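(* Let $\Lambda$ be an Artin algebra and let $\mathcal X$ be a resolving and contravariantly finite subcategory of $\mathrm{mod}\text{-}\Lambda$. The functor $\Psi_{\mathcal X}$ induces an equivalence between the stable categories of exact categories $$\underline{\mathcal S^{\rm scw}_{\mathcal X}(\Lambda)}\simeq\underline{\mathrm{mod}\text{-}\underline{\mathcal X}}.$$ Consequently, there is an equivalence of categories $$\mathcal S_{\mathcal X}(\Lambda)/\mathcal V\simeq\underline{\mathrm{mod}\text{-}\underline{\mathcal X}},$$ where $\mathcal V$ is the ideal generated by the objects of the form $(X\xrightarrow{1}X)$, $(0\to X)$ and $(\Omega_\Lambda(X)\hookrightarrow P_X)$ for $X$ in $\mathcal X$.
   Context: $\Lambda$ is an Artin algebra over a commutative artinian ring; $\mathrm{mod}\text{-}\Lambda$ is the category of finitely generated right $\Lambda$-modules and $\mathrm{prj}\text{-}\Lambda$ its subcategory of projectives. Subcategories are full and closed under isomorphism. $\mathcal X$ is resolving if it contains $\mathrm{prj}\text{-}\Lambda$ and is closed under finite direct sums, direct summands, extensions and kernels of epimorphisms; it is contravariantly finite if every module $M$ admits a morphism $f:X\to M$ with $X\in\mathcal X$ through which every morphism from an object of $\mathcal X$ to $M$ factors. $P_X\to X$ is the projective cover and $\Omega_\Lambda(X)$ its kernel. $\mathrm H(\Lambda)$ is the (abelian) morphism category of $\mathrm{mod}\text{-}\Lambda$ (objects are morphisms $(A\xrightarrow{f}B)$, morphisms are commutative squares). $\mathcal S_{\mathcal X}(\Lambda)$ is the full subcategory of $\mathrm H(\Lambda)$ of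 all monomorphisms $(A\xrightarrow{f}B)$ with $A,B,\mathrm{Cok}\,f\in\mathcal X$. $\mathcal S^{\rm scw}_{\mathcal X}(\Lambda)$ is $\mathcal S_{\mathcal X}(\Lambda)$ with the exact structure of all short exact sequences $0\to(X_1\xrightarrow{f}X_2)\to(Z_1\xrightarrow{h}Z_2)\to(Y_1\xrightarrow{g}Y_2)\to0$ of $\mathrm H(\Lambda)$ with terms in $\mathcal S_{\mathcal X}(\Lambda)$ such that $0\to X_i\to Z_i\to Y_i\to0$ ($i=1,2$) and $0\to\mathrm{Cok}\,f\to\mathrm{Cok}\,h\to\mathrm{Cok}\,g\to0$ are all split. The stable category $\underline{\mathcal C}$ of an exact (e.g. abelian) category $\mathcal C$ has the same objects, and morphisms modulo those factoring through a projective object. The ideal generated by a class of objects consists of the morphisms factoring through finite direct sums of objects in that class, and $\mathcal C/\mathcal I$ denotes the additive factor category by an ideal $\mathcal I$. $\underline{\mathcal X}$ is the category with the objects of $\mathcal X$ and morphisms modulo those factoring through a projective module. $\mathrm{mod}\text{-}\mathcal X$, $\mathrm{mod}\text{-}\underline{\mathcal X}$ are the categories of finitely presented contravariant additive functors to abelian groups; both are abelian here, and $\mathrm{mod}\text{-}\underline{\mathcal X}$ is identified with the functors in $\mathrm{mod}\text{-}\mathcal X$ vanishing on $\mathrm{prj}\text{-}\Lambda$. Write $(-,X)=\mathrm{Hom}_\Lambda(-,X)|_{\mathcal X}$. The functor $\Psi_{\mathcal X}:\mathcal S_{\mathcal X}(\Lambda)\to\mathrm{mod}\text{-}\underline{\mathcal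 X}$ sends $(A\xrightarrow{f}B)$ to the functor $F$ in the exact sequence $0\to(-,A)\to(-,B)\to(-,\mathrm{Cok}\,f)\to F\to0$ in $\mathrm{mod}\text{-}\mathcal X$, and a morphism to the induced map of cokernels. *)

theory Defs
  imports "HOL-Algebra.Module" "HOL-Algebra.Ideal"
begin

text \<open>
  Hom-sets are abelian groups, represented by the library's \<^type>\<open>monoid\<close> records; the group
  operation, although written additively in mathematics, is therefore \<^const>\<open>mult\<close>, and the zero
  morphism is \<^const>\<open>one\<close>.  Hom-sets of different pairs of objects need not be disjoint, so
  \<open>Comp C A B D g f\<close>, the composite of \<open>f : A \<rightarrow> B\<close> and \<open>g : B \<rightarrow> D\<close>, takes the objects as arguments.
\<close>

record ('o, 'a) precat =
  Obj :: "'o set"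
  Hom :: "'o \<Rightarrow> 'o \<Rightarrow> 'a monoid"
  Comp :: "'o \<Rightarrow> 'o \<Rightarrow> 'o \<Rightarrow> 'a \<Rightarrow> 'a \<Rightarrow> 'a"
  Ident :: "'o \<Rightarrow> 'a"

abbreviation Arr :: "('o, 'a) precat \<Rightarrow> 'o \<Rightarrow> 'o \<Rightarrow> 'a set"
  where "Arr C A B \<equiv> carrier (Hom C A B)"

abbreviation Zero :: "('o, 'a) precat \<Rightarrow> 'o \<Rightarrow> 'o \<Rightarrow> 'a"
  where "Zero C A B \<equiv> one (Hom C A B)"

locale preadditive_category =
  fixes C :: "('o, 'a) precat"
  assumes Hom_comm_group: "A \<in> Obj C \<Longrightarrow> B \<in> Obj C \<Longrightarrow> comm_group (Hom C A B)"
    and Ident_closed: "A \<in> Obj C \<Longrightarrow> Ident C A \<in> Arr C A A"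
    and Comp_closed: "\<lbrakk>A \<in> Obj C; B \<in> Obj C; D \<in> Obj C; f \<in> Arr C A B; g \<in> Arr C B D\<rbrakk>
      \<Longrightarrow> Comp C A B D g f \<in> Arr C A D"
    and Comp_assoc: "\<lbrakk>A \<in> Obj C; B \<in> Obj C; D \<in> Obj C; E \<in> Obj C;
        f \<in> Arr C A B; g \<in> Arr C B D; h \<in> Arr C D E\<rbrakk>
      \<Longrightarrow> Comp C A D E h (Comp C A B D g f) = Comp C A B E (Comp C B D E h g) f"
    and Comp_Ident_left: "\<lbrakk>A \<in> Obj C; B \<in> Obj C; f \<in> Arr C A B\<rbrakk>
      \<Longrightarrow> Comp C A B B (Ident C B) f = f"
    and Comp_Ident_right: "\<lbrakk>A \<in> Obj C; B \<in> Obj C; f \<in> Arr C A B\<rbrakk>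
      \<Longrightarrow> Comp C A A B f (Ident C A) = f"
    and Comp_add_left: "\<lbrakk>A \<in> Obj C; B \<in> Obj C; D \<in> Obj C;
        f \<in> Arr C A B; g \<in> Arr C B D; g' \<in> Arr C B D\<rbrakk>
      \<Longrightarrow> Comp C A B D (g \<otimes>\<^bsub>Hom C B D\<^esub> g') f
          = Comp C A B D g f \<otimes>\<^bsub>Hom C A D\<^esub> Comp C A B D g' f"
    and Comp_add_right: "\<lbrakk>A \<in> Obj C; B \<in> Obj C; D \<in> Obj C;
        f \<in> Arr C A B; f' \<in> Arr C A B; g \<in> Arr C B D\<rbrakk>
      \<Longrightarrow> Comp C A B D g (f \<otimes>\<^bsub>Hom C A B\<^esub> f')
          = Comp C A B D g f \<otimes>\<^bsub>Hom C A D\<^esub> Comp C A B D g f'"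

definition op_cat :: "('o, 'a) precat \<Rightarrow> ('o, 'a) precat" where
  "op_cat C = \<lparr>Obj = Obj C, Hom = (\<lambda>A B. Hom C B A),
    Comp = (\<lambda>A B D g f. Comp C D B A f g), Ident = Ident C\<rparr>"

definition full_subcat :: "('o, 'a) precat \<Rightarrow> 'o set \<Rightarrow> ('o, 'a) precat" where
  "full_subcat C S = C\<lparr>Obj := Obj C \<inter> S\<rparr>"

definition monic :: "('o, 'a) precat \<Rightarrow> 'o \<Rightarrow> 'a \<Rightarrow> 'o \<Rightarrow> bool" where
  "monic C A f B \<longleftrightarrow> A \<in> Obj C \<and> B \<in> Obj C \<and> f \<in> Arr C A B \<and>
    (\<forall>T\<in>Obj C. \<forall>s\<in>Arr C T A. \<forall>t\<in>Arr C T A. Comp C T A B f s = Comp C T A B f t \<longrightarrow> s = t)"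

definition epi :: "('o, 'a) precat \<Rightarrow> 'o \<Rightarrow> 'a \<Rightarrow> 'o \<Rightarrow> bool" where
  "epi C A f B \<longleftrightarrow> A \<in> Obj C \<and> B \<in> Obj C \<and> f \<in> Arr C A B \<and>
    (\<forall>T\<in>Obj C. \<forall>s\<in>Arr C B T. \<forall>t\<in>Arr C B T. Comp C A B T s f = Comp C A B T t f \<longrightarrow> s = t)"

definition iso_arr :: "('o, 'a) precat \<Rightarrow> 'o \<Rightarrow> 'a \<Rightarrow> 'o \<Rightarrow> bool" where
  "iso_arr C A f B \<longleftrightarrow> A \<in> Obj C \<and> B \<in> Obj C \<and> f \<in> Arr C A B \<and>
    (\<exists>g\<in>Arr C B A. Comp C A B A g f = Ident C A \<and> Comp C B A B f g = Ident C B)"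

definition zero_object :: "('o, 'a) precat \<Rightarrow> 'o \<Rightarrow> bool" where
  "zero_object C Z \<longleftrightarrow> Z \<in> Obj C \<and>
    (\<forall>A\<in>Obj C. Arr C Z A = {Zero C Z A} \<and> Arr C A Z = {Zero C A Z})"

text \<open>\<open>is_kernel C K i A f B\<close>: the morphism \<open>i : K \<rightarrow> A\<close> is a kernel of \<open>f : A \<rightarrow> B\<close>.\<close>

definition is_kernel :: "('o, 'a) precat \<Rightarrow> 'o \<Rightarrow> 'a \<Rightarrow> 'o \<Rightarrow> 'a \<Rightarrow> 'o \<Rightarrow> bool" where
  "is_kernel C K i A f B \<longleftrightarrow> K \<in> Obj C \<and> A \<in> Obj C \<and> B \<in> Obj C \<and>
    i \<in> Arr C K A \<and> f \<in> Arr C A B \<and> Comp C K A B f i = Zero C K B \<and>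
    (\<forall>T\<in>Obj C. \<forall>t\<in>Arr C T A. Comp C T A B f t = Zero C T B \<longrightarrow>
      (\<exists>!s. s \<in> Arr C T K \<and> Comp C T K A i s = t))"

text \<open>\<open>is_cokernel C A f B p D\<close>: the morphism \<open>p : B \<rightarrow> D\<close> is a cokernel of \<open>f : A \<rightarrow> B\<close>.\<close>

definition is_cokernel :: "('o, 'a) precat \<Rightarrow> 'o \<Rightarrow> 'a \<Rightarrow> 'o \<Rightarrow> 'a \<Rightarrow> 'o \<Rightarrow> bool" where
  "is_cokernel C A f B p D \<longleftrightarrow> A \<in> Obj C \<and> B \<in> Obj C \<and> D \<in> Obj C \<and>
    f \<in> Arr C A B \<and> p \<in> Arr C B D \<and> Comp C A B D p f = Zero C A D \<and>
    (\<forall>T\<in>Obj C. \<forall>t\<in>Arr C B T. Comp C A B T t f = Zero C A T \<longrightarrow>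
      (\<exists>!s. s \<in> Arr C D T \<and> Comp C B D T s p = t))"

text \<open>A fixed choice of cokernel, for constructions like \<open>Cok f\<close>; the value is arbitrary if there is none.\<close>

definition cok :: "('o, 'a) precat \<Rightarrow> 'o \<times> 'o \<times> 'a \<Rightarrow> 'o \<times> 'a" where
  "cok C = (\<lambda>(A, B, f). SOME (D, p). is_cokernel C A f B p D)"

abbreviation cok_obj :: "('o, 'a) precat \<Rightarrow> 'o \<times> 'o \<times> 'a \<Rightarrow> 'o"
  where "cok_obj C x \<equiv> fst (cok C x)"

abbreviation cok_map :: "('o, 'a) precat \<Rightarrow> 'o \<times> 'o \<times> 'a \<Rightarrow> 'a"
  where "cok_map C x \<equiv> snd (cok C x)"

definition short_exact :: "('o, 'a) precat \<Rightarrow> 'o \<Rightarrow> 'a \<Rightarrow> 'o \<Rightarrow> 'a \<Rightarrow> 'o \<Rightarrow> bool" where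
  "short_exact C A i B p D \<longleftrightarrow> is_kernel C A i B p D \<and> is_cokernel C A i B p D"

definition split_exact :: "('o, 'a) precat \<Rightarrow> 'o \<Rightarrow> 'a \<Rightarrow> 'o \<Rightarrow> 'a \<Rightarrow> 'o \<Rightarrow> bool" where
  "split_exact C A i B p D \<longleftrightarrow> short_exact C A i B p D \<and>
    (\<exists>s\<in>Arr C D B. Comp C D B D p s = Ident C D)"

text \<open>\<open>B\<close> is a direct sum of \<open>A 0, \<dots>, A (n - 1)\<close>; for \<open>n = 0\<close> this says that \<open>B\<close> is a zero object.
  The \<^const>\<open>finprod\<close> is the sum of the idempotents \<open>i k \<circ> p k\<close> in the endomorphism group of \<open>B\<close>.\<close>

definition is_direct_sum :: "('o, 'a) precat \<Rightarrow> nat \<Rightarrow> (nat \<Rightarrow> 'o) \<Rightarrow> 'o \<Rightarrow> bool" where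
  "is_direct_sum C n A B \<longleftrightarrow> (\<forall>k<n. A k \<in> Obj C) \<and> B \<in> Obj C \<and>
    (\<exists>i p. (\<forall>k<n. i k \<in> Arr C (A k) B \<and> p k \<in> Arr C B (A k)) \<and>
      (\<forall>k<n. \<forall>l<n. Comp C (A k) B (A l) (p l) (i k)
          = (if k = l then Ident C (A k) else Zero C (A k) (A l))) \<and>
      finprod (Hom C B B) (\<lambda>k. Comp C B (A k) B (i k) (p k)) {..<n} = Ident C B)"

record ('o, 'a, 'p, 'b) afunctor =
  FObj :: "'o \<Rightarrow> 'p"
  FArr :: "'o \<Rightarrow> 'o \<Rightarrow> 'a \<Rightarrow> 'b"

locale additive_functor =
  source: preadditive_category C + target: preadditive_category D
  for C :: "('o, 'a) precat" and D :: "('p, 'b) precat" +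
  fixes F :: "('o, 'a, 'p, 'b) afunctor"
  assumes FObj_closed: "A \<in> Obj C \<Longrightarrow> FObj F A \<in> Obj D"
    and FArr_hom: "A \<in> Obj C \<Longrightarrow> B \<in> Obj C \<Longrightarrow>
      FArr F A B \<in> hom (Hom C A B) (Hom D (FObj F A) (FObj F B))"
    and FArr_Ident: "A \<in> Obj C \<Longrightarrow> FArr F A A (Ident C A) = Ident D (FObj F A)"
    and FArr_Comp: "\<lbrakk>A \<in> Obj C; B \<in> Obj C; E \<in> Obj C; f \<in> Arr C A B; g \<in> Arr C B E\<rbrakk>
      \<Longrightarrow> FArr F A E (Comp C A B E g f)
          = Comp D (FObj F A) (FObj F B) (FObj F E) (FArr F B E g) (FArr F A B f)"

definition id_functor :: "('o, 'a, 'o, 'a) afunctor" where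
  "id_functor = \<lparr>FObj = (\<lambda>A. A), FArr = (\<lambda>A B f. f)\<rparr>"

definition comp_functor ::
  "('p, 'b, 'q, 'c) afunctor \<Rightarrow> ('o, 'a, 'p, 'b) afunctor \<Rightarrow> ('o, 'a, 'q, 'c) afunctor" where
  "comp_functor G F = \<lparr>FObj = (\<lambda>A. FObj G (FObj F A)),
    FArr = (\<lambda>A B f. FArr G (FObj F A) (FObj F B) (FArr F A B f))\<rparr>"

definition naturally_isomorphic :: "('o, 'a) precat \<Rightarrow> ('p, 'b) precat \<Rightarrow>
    ('o, 'a, 'p, 'b) afunctor \<Rightarrow> ('o, 'a, 'p, 'b) afunctor \<Rightarrow> bool" where
  "naturally_isomorphic C D F G \<longleftrightarrow>
    (\<exists>\<eta>. (\<forall>A\<in>Obj C. iso_arr D (FObj F A) (\<eta> A) (FObj G A)) \<and>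
      (\<forall>A\<in>Obj C. \<forall>B\<in>Obj C. \<forall>f\<in>Arr C A B.
        Comp D (FObj F A) (FObj F B) (FObj G B) (\<eta> B) (FArr F A B f)
        = Comp D (FObj F A) (FObj G A) (FObj G B) (FArr G A B f) (\<eta> A)))"

definition equivalence_of_categories ::
  "('o, 'a) precat \<Rightarrow> ('p, 'b) precat \<Rightarrow> ('o, 'a, 'p, 'b) afunctor \<Rightarrow> bool" where
  "equivalence_of_categories C D F \<longleftrightarrow> additive_functor C D F \<and>
    (\<exists>G. additive_functor D C G \<and>
      naturally_isomorphic C C id_functor (comp_functor G F) \<and>
      naturally_isomorphic D D (comp_functor F G) id_functor)"

definition factoring_through ::
  "('o, 'a) precat \<Rightarrow> 'o set \<Rightarrow> 'o \<Rightarrow> 'o \<Rightarrow> 'a set" where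
  "factoring_through C S A B =
    {h. \<exists>P\<in>S \<inter> Obj C. \<exists>f\<in>Arr C A P. \<exists>g\<in>Arr C P B. h = Comp C A P B g f}"

definition generated_ideal ::
  "('o, 'a) precat \<Rightarrow> 'o set \<Rightarrow> 'o \<Rightarrow> 'o \<Rightarrow> 'a set" where
  "generated_ideal C S =
    factoring_through C {P. \<exists>n A. (\<forall>k<n. A k \<in> S) \<and> is_direct_sum C n A P}"

text \<open>Morphisms of the factor category are cosets.  In \<open>Comp\<close> all the cosets in the union
  coincide when \<open>I\<close> is an ideal.\<close>

definition factor_cat ::
  "('o, 'a) precat \<Rightarrow> ('o \<Rightarrow> 'o \<Rightarrow> 'a set) \<Rightarrow> ('o, 'a set) precat" where
  "factor_cat C I = \<lparr>Obj = Obj C, Hom = (\<lambda>A B. Hom C A B Mod I A B),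
    Comp = (\<lambda>A B D V U. \<Union>v\<in>V. \<Union>u\<in>U. I A D #>\<^bsub>Hom C A D\<^esub> Comp C A B D v u),
    Ident = (\<lambda>A. I A A #>\<^bsub>Hom C A A\<^esub> Ident C A)\<rparr>"

text \<open>An exact structure is given by its class of conflations
  \<open>0 \<rightarrow> A \<rightarrow>\<^sub>i B \<rightarrow>\<^sub>p D \<rightarrow> 0\<close>; for an abelian category \<open>C\<close> it is \<open>short_exact C\<close>.\<close>

type_synonym ('o, 'a) exact_structure = "'o \<Rightarrow> 'a \<Rightarrow> 'o \<Rightarrow> 'a \<Rightarrow> 'o \<Rightarrow> bool"

definition projective ::
  "('o, 'a) precat \<Rightarrow> ('o, 'a) exact_structure \<Rightarrow> 'o \<Rightarrow> bool" where
  "projective C E P \<longleftrightarrow> P \<in> Obj C \<and>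
    (\<forall>A\<in>Obj C. \<forall>B\<in>Obj C. \<forall>D\<in>Obj C. \<forall>i\<in>Arr C A B. \<forall>p\<in>Arr C B D. E A i B p D \<longrightarrow>
      (\<forall>t\<in>Arr C P D. \<exists>s\<in>Arr C P B. Comp C P B D p s = t))"

definition stable_ideal ::
  "('o, 'a) precat \<Rightarrow> ('o, 'a) exact_structure \<Rightarrow> 'o \<Rightarrow> 'o \<Rightarrow> 'a set" where
  "stable_ideal C E = factoring_through C {P. projective C E P}"

definition stable_cat ::
  "('o, 'a) precat \<Rightarrow> ('o, 'a) exact_structure \<Rightarrow> ('o, 'a set) precat" where
  "stable_cat C E = factor_cat C (stable_ideal C E)"

definition ab_cat :: "('g monoid, 'g \<Rightarrow> 'g) precat" where
  "ab_cat = \<lparr>Obj = {G. comm_group G},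
    Hom = (\<lambda>G H. \<lparr>carrier = hom G H \<inter> extensional (carrier G),
      mult = (\<lambda>f g. \<lambda>x\<in>carrier G. f x \<otimes>\<^bsub>H\<^esub> g x), one = (\<lambda>x\<in>carrier G. \<one>\<^bsub>H\<^esub>)\<rparr>),
    Comp = (\<lambda>G H K g f. compose (carrier G) g f),
    Ident = (\<lambda>G. \<lambda>x\<in>carrier G. x)\<rparr>"

type_synonym ('o, 'a, 'g) contravariant = "('o, 'a, 'g monoid, 'g \<Rightarrow> 'g) afunctor"

text \<open>\<open>F\<close> is a contravariant additive functor with an exact sequence
  \<open>(-, A) \<rightarrow> (-, B) \<rightarrow> F \<rightarrow> 0\<close>, the first map being composition with some \<open>f : A \<rightarrow> B\<close> (Yoneda).\<close>

definition finitely_presented :: "('o, 'a) precat \<Rightarrow> ('o, 'a, 'g) contravariant \<Rightarrow> bool" where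
  "finitely_presented C F \<longleftrightarrow> additive_functor (op_cat C) ab_cat F \<and>
    (\<exists>A\<in>Obj C. \<exists>B\<in>Obj C. \<exists>f\<in>Arr C A B. \<exists>\<pi>.
      (\<forall>T\<in>Obj C. \<pi> T \<in> hom (Hom C T B) (FObj F T) \<and>
        \<pi> T ` Arr C T B = carrier (FObj F T) \<and>
        kernel (Hom C T B) (FObj F T) (\<pi> T) = (\<lambda>s. Comp C T A B f s) ` Arr C T A) \<and>
      (\<forall>T\<in>Obj C. \<forall>T'\<in>Obj C. \<forall>u\<in>Arr C T' T. \<forall>s\<in>Arr C T B.
        \<pi> T' (Comp C T' T B s u) = FArr F T T' u (\<pi> T s)))"

text \<open>The category \<open>mod-C\<close>; a morphism is a natural transformation, extended by
  \<^const>\<open>undefined\<close> outside the objects of \<open>C\<close>.\<close>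

definition fp_cat ::
  "('o, 'a) precat \<Rightarrow> (('o, 'a, 'g) contravariant, 'o \<Rightarrow> 'g \<Rightarrow> 'g) precat" where
  "fp_cat C = \<lparr>Obj = {F. finitely_presented C F},
    Hom = (\<lambda>F G. \<lparr>carrier = {\<eta> \<in> extensional (Obj C).
        (\<forall>T\<in>Obj C. \<eta> T \<in> Arr ab_cat (FObj F T) (FObj G T)) \<and>
        (\<forall>T\<in>Obj C. \<forall>T'\<in>Obj C. \<forall>u\<in>Arr C T' T.
          Comp ab_cat (FObj F T) (FObj F T') (FObj G T') (\<eta> T') (FArr F T T' u)
          = Comp ab_cat (FObj F T) (FObj G T) (FObj G T') (FArr G T T' u) (\<eta> T))},
      mult = (\<lambda>\<eta> \<theta>. \<lambda>T\<in>Obj C. \<eta> T \<otimes>\<^bsub>Hom ab_cat (FObj F T) (FObj G T)\<^esub> \<theta> T),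
      one = (\<lambda>T\<in>Obj C. Zero ab_cat (FObj F T) (FObj G T))\<rparr>),
    Comp = (\<lambda>F G H \<theta> \<eta>. \<lambda>T\<in>Obj C.
      Comp ab_cat (FObj F T) (FObj G T) (FObj H T) (\<theta> T) (\<eta> T)),
    Ident = (\<lambda>F. \<lambda>T\<in>Obj C. Ident ab_cat (FObj F T))\<rparr>"

text \<open>A functor on \<open>C\<close> that kills an ideal, regarded as a functor on the factor category
  (whose morphisms are cosets).\<close>

definition descend :: "('o, 'a, 'p, 'b) afunctor \<Rightarrow> ('o, 'a set, 'p, 'b) afunctor" where
  "descend F = \<lparr>FObj = FObj F, FArr = (\<lambda>A B U. FArr F A B (SOME u. u \<in> U))\<rparr>"

locale artin_algebra = cring R + L: ring \<Lambda>
  for R :: "('k, 'c) ring_scheme" and \<Lambda> :: "('r, 'd) ring_scheme" +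
  fixes \<phi> :: "'k \<Rightarrow> 'r"
  assumes artinian: "\<And>I :: nat \<Rightarrow> 'k set. \<lbrakk>\<And>n. ideal (I n) R; \<And>n. I (Suc n) \<subseteq> I n\<rbrakk>
      \<Longrightarrow> \<exists>N. \<forall>n\<ge>N. I n = I N"
    and structure_map: "\<phi> \<in> ring_hom R \<Lambda>"
    and central: "\<lbrakk>r \<in> carrier R; x \<in> carrier \<Lambda>\<rbrakk> \<Longrightarrow> \<phi> r \<otimes>\<^bsub>\<Lambda>\<^esub> x = x \<otimes>\<^bsub>\<Lambda>\<^esub> \<phi> r"
    and module_finite: "\<exists>S. finite S \<and> S \<subseteq> carrier \<Lambda> \<and>
      (\<forall>x\<in>carrier \<Lambda>. \<exists>c\<in>S \<rightarrow> carrier R. x = finsum \<Lambda> (\<lambda>s. \<phi> (c s) \<otimes>\<^bsub>\<Lambda>\<^esub> s) S)"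

text \<open>Right modules use the library's \<^type>\<open>module\<close> records; \<open>r \<odot>\<^bsub>M\<^esub> x\<close> stands for \<open>x r\<close>.
  The fields \<^const>\<open>mult\<close> and \<^const>\<open>one\<close> of such a record are irrelevant for \<open>M\<close>.\<close>

locale right_module = L: ring \<Lambda> + abelian_group M
  for \<Lambda> :: "('r, 'd) ring_scheme" and M :: "('r, 'u, 'e) module_scheme" +
  assumes smult_closed: "\<lbrakk>r \<in> carrier \<Lambda>; x \<in> carrier M\<rbrakk> \<Longrightarrow> r \<odot>\<^bsub>M\<^esub> x \<in> carrier M"
    and smult_l_distr: "\<lbrakk>r \<in> carrier \<Lambda>; s \<in> carrier \<Lambda>; x \<in> carrier M\<rbrakk>
      \<Longrightarrow> (r \<oplus>\<^bsub>\<Lambda>\<^esub> s) \<odot>\<^bsub>M\<^esub> x = r \<odot>\<^bsub>M\<^esub> x \<oplus>\<^bsub>M\<^esub> s \<odot>\<^bsub>M\<^esub> x"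
    and smult_r_distr: "\<lbrakk>r \<in> carrier \<Lambda>; x \<in> carrier M; y \<in> carrier M\<rbrakk>
      \<Longrightarrow> r \<odot>\<^bsub>M\<^esub> (x \<oplus>\<^bsub>M\<^esub> y) = r \<odot>\<^bsub>M\<^esub> x \<oplus>\<^bsub>M\<^esub> r \<odot>\<^bsub>M\<^esub> y"
    and smult_assoc: "\<lbrakk>r \<in> carrier \<Lambda>; s \<in> carrier \<Lambda>; x \<in> carrier M\<rbrakk>
      \<Longrightarrow> (r \<otimes>\<^bsub>\<Lambda>\<^esub> s) \<odot>\<^bsub>M\<^esub> x = s \<odot>\<^bsub>M\<^esub> (r \<odot>\<^bsub>M\<^esub> x)"
    and smult_one: "x \<in> carrier M \<Longrightarrow> \<one>\<^bsub>\<Lambda>\<^esub> \<odot>\<^bsub>M\<^esub> x = x"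

definition fg_right_module ::
  "('r, 'd) ring_scheme \<Rightarrow> ('r, 'u, 'e) module_scheme \<Rightarrow> bool" where
  "fg_right_module \<Lambda> M \<longleftrightarrow> right_module \<Lambda> M \<and>
    (\<exists>S. finite S \<and> S \<subseteq> carrier M \<and>
      (\<forall>x\<in>carrier M. \<exists>c\<in>S \<rightarrow> carrier \<Lambda>. x = finsum M (\<lambda>s. c s \<odot>\<^bsub>M\<^esub> s) S))"

text \<open>The elements of the modules under consideration are drawn from the type
  \<open>(nat \<Rightarrow> 'r) set\<close>.  It is large enough: every finitely generated module is isomorphic to a
  quotient \<open>\<Lambda>\<^sup>n / K\<close>, whose elements are sets of \<open>n\<close>-tuples.\<close>

type_synonym 'r elt = "(nat \<Rightarrow> 'r) set"
type_synonym 'r fmod = "('r, 'r elt) module"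
type_synonym 'r fmap = "'r elt \<Rightarrow> 'r elt"

definition mod_cat :: "('r, 'd) ring_scheme \<Rightarrow> ('r fmod, 'r fmap) precat" where
  "mod_cat \<Lambda> = \<lparr>Obj = {M. fg_right_module \<Lambda> M},
    Hom = (\<lambda>M N. \<lparr>carrier = {f \<in> carrier M \<rightarrow>\<^sub>E carrier N.
        (\<forall>x\<in>carrier M. \<forall>y\<in>carrier M. f (x \<oplus>\<^bsub>M\<^esub> y) = f x \<oplus>\<^bsub>N\<^esub> f y) \<and>
        (\<forall>r\<in>carrier \<Lambda>. \<forall>x\<in>carrier M. f (r \<odot>\<^bsub>M\<^esub> x) = r \<odot>\<^bsub>N\<^esub> f x)},
      mult = (\<lambda>f g. \<lambda>x\<in>carrier M. f x \<oplus>\<^bsub>N\<^esub> g x), one = (\<lambda>x\<in>carrier M. \<zero>\<^bsub>N\<^esub>)\<rparr>),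
    Comp = (\<lambda>M N K g f. compose (carrier M) g f),
    Ident = (\<lambda>M. \<lambda>x\<in>carrier M. x)\<rparr>"

definition prj :: "('r, 'd) ring_scheme \<Rightarrow> 'r fmod set" where
  "prj \<Lambda> = {P. projective (mod_cat \<Lambda>) (short_exact (mod_cat \<Lambda>)) P}"

definition projective_cover ::
  "('r, 'd) ring_scheme \<Rightarrow> 'r fmod \<Rightarrow> 'r fmap \<Rightarrow> 'r fmod \<Rightarrow> bool" where
  "projective_cover \<Lambda> P p M \<longleftrightarrow> P \<in> prj \<Lambda> \<and> epi (mod_cat \<Lambda>) P p M \<and>
    (\<forall>T\<in>Obj (mod_cat \<Lambda>). \<forall>t\<in>Arr (mod_cat \<Lambda>) T P.
      epi (mod_cat \<Lambda>) T (Comp (mod_cat \<Lambda>) T P M p t) M \<longrightarrow> epi (mod_cat \<Lambda>) T t P)"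

definition subcategory :: "('r, 'd) ring_scheme \<Rightarrow> 'r fmod set \<Rightarrow> bool" where
  "subcategory \<Lambda> \<XX> \<longleftrightarrow> \<XX> \<subseteq> Obj (mod_cat \<Lambda>) \<and>
    (\<forall>M\<in>\<XX>. \<forall>N f. iso_arr (mod_cat \<Lambda>) M f N \<longrightarrow> N \<in> \<XX>)"

definition resolving :: "('r, 'd) ring_scheme \<Rightarrow> 'r fmod set \<Rightarrow> bool" where
  "resolving \<Lambda> \<XX> \<longleftrightarrow> subcategory \<Lambda> \<XX> \<and> prj \<Lambda> \<subseteq> \<XX> \<and>
    (\<forall>n A B. is_direct_sum (mod_cat \<Lambda>) n A B \<longrightarrow> (\<forall>k<n. A k \<in> \<XX>) \<longrightarrow> B \<in> \<XX>) \<and>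
    (\<forall>n A B. is_direct_sum (mod_cat \<Lambda>) n A B \<longrightarrow> B \<in> \<XX> \<longrightarrow> (\<forall>k<n. A k \<in> \<XX>)) \<and>
    (\<forall>A i B p D. short_exact (mod_cat \<Lambda>) A i B p D \<longrightarrow> A \<in> \<XX> \<longrightarrow> D \<in> \<XX> \<longrightarrow> B \<in> \<XX>) \<and>
    (\<forall>K i B p D. epi (mod_cat \<Lambda>) B p D \<longrightarrow> is_kernel (mod_cat \<Lambda>) K i B p D \<longrightarrow>
      B \<in> \<XX> \<longrightarrow> D \<in> \<XX> \<longrightarrow> K \<in> \<XX>)"

definition contravariantly_finite :: "('r, 'd) ring_scheme \<Rightarrow> 'r fmod set \<Rightarrow> bool" where
  "contravariantly_finite \<Lambda> \<XX> \<longleftrightarrow> subcategory \<Lambda> \<XX> \<and>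
    (\<forall>M\<in>Obj (mod_cat \<Lambda>). \<exists>X\<in>\<XX>. \<exists>f\<in>Arr (mod_cat \<Lambda>) X M.
      \<forall>Y\<in>\<XX>. \<forall>g\<in>Arr (mod_cat \<Lambda>) Y M. \<exists>h\<in>Arr (mod_cat \<Lambda>) Y X.
        g = Comp (mod_cat \<Lambda>) Y X M f h)"

definition arrow_cat :: "('o, 'a) precat \<Rightarrow> ('o \<times> 'o \<times> 'a, 'a \<times> 'a) precat" where
  "arrow_cat C = \<lparr>Obj = {(A, B, f). A \<in> Obj C \<and> B \<in> Obj C \<and> f \<in> Arr C A B},
    Hom = (\<lambda>(A, B, f) (A', B', f'). (Hom C A A' \<times>\<times> Hom C B B')
      \<lparr>carrier := {(a, b). a \<in> Arr C A A' \<and> b \<in> Arr C B B' \<and>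
        Comp C A A' B' f' a = Comp C A B B' b f}\<rparr>),
    Comp = (\<lambda>(A, B, f) (A', B', f') (A'', B'', f'') (a', b') (a, b).
      (Comp C A A' A'' a' a, Comp C B B' B'' b' b)),
    Ident = (\<lambda>(A, B, f). (Ident C A, Ident C B))\<rparr>"

type_synonym 'r hobj = "'r fmod \<times> 'r fmod \<times> 'r fmap"
type_synonym 'r harr = "'r fmap \<times> 'r fmap"

definition S_cat ::
  "('r, 'd) ring_scheme \<Rightarrow> 'r fmod set \<Rightarrow> ('r hobj, 'r harr) precat" where
  "S_cat \<Lambda> \<XX> = full_subcat (arrow_cat (mod_cat \<Lambda>))
    {(A, B, f). monic (mod_cat \<Lambda>) A f B \<and> A \<in> \<XX> \<and> B \<in> \<XX> \<and> cok_obj (mod_cat \<Lambda>) (A, B, f) \<in> \<XX>}"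

text \<open>In a conflation \<open>0 \<rightarrow> X \<rightarrow> Z \<rightarrow> Y \<rightarrow> 0\<close>, the maps \<open>c\<close> and \<open>d\<close> are the ones induced on the cokernels.\<close>

definition scw :: "('r, 'd) ring_scheme \<Rightarrow> 'r fmod set \<Rightarrow> ('r hobj, 'r harr) exact_structure" where
  "scw \<Lambda> \<XX> = (\<lambda>(X1, X2, f) (i1, i2) (Z1, Z2, h) (p1, p2) (Y1, Y2, g).
    (let M = mod_cat \<Lambda>; X = (X1, X2, f); Z = (Z1, Z2, h); Y = (Y1, Y2, g) in
      X \<in> Obj (S_cat \<Lambda> \<XX>) \<and> Z \<in> Obj (S_cat \<Lambda> \<XX>) \<and> Y \<in> Obj (S_cat \<Lambda> \<XX>) \<and>
      short_exact (arrow_cat M) X (i1, i2) Z (p1, p2) Y \<and>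
      split_exact M X1 i1 Z1 p1 Y1 \<and>
      split_exact M X2 i2 Z2 p2 Y2 \<and>
      (\<exists>c\<in>Arr M (cok_obj M X) (cok_obj M Z). \<exists>d\<in>Arr M (cok_obj M Z) (cok_obj M Y).
        Comp M X2 (cok_obj M X) (cok_obj M Z) c (cok_map M X)
          = Comp M X2 Z2 (cok_obj M Z) (cok_map M Z) i2 \<and>
        Comp M Z2 (cok_obj M Z) (cok_obj M Y) d (cok_map M Z)
          = Comp M Z2 Y2 (cok_obj M Y) (cok_map M Y) p2 \<and>
        split_exact M (cok_obj M X) c (cok_obj M Z) d (cok_obj M Y))))"

text \<open>The objects \<open>(X = X)\<close>, \<open>(0 \<rightarrow> X)\<close> and \<open>(\<Omega> X \<rightarrow> P\<^sub>X)\<close> for \<open>X\<close> in \<open>\<XX>\<close>, for every choice of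
  the zero module, the projective cover and its kernel.\<close>

definition V_objects :: "('r, 'd) ring_scheme \<Rightarrow> 'r fmod set \<Rightarrow> 'r hobj set" where
  "V_objects \<Lambda> \<XX> =
    {(X, X, Ident (mod_cat \<Lambda>) X) | X. X \<in> \<XX>} \<union>
    {(Z, X, Zero (mod_cat \<Lambda>) Z X) | Z X. zero_object (mod_cat \<Lambda>) Z \<and> X \<in> \<XX>} \<union>
    {(K, P, i) | K P i. \<exists>X\<in>\<XX>. \<exists>p. projective_cover \<Lambda> P p X \<and> is_kernel (mod_cat \<Lambda>) K i P p X}"

definition X_cat :: "('r, 'd) ring_scheme \<Rightarrow> 'r fmod set \<Rightarrow> ('r fmod, 'r fmap) precat" where
  "X_cat \<Lambda> \<XX> = full_subcat (mod_cat \<Lambda>) \<XX>"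

definition stable_X_cat ::
  "('r, 'd) ring_scheme \<Rightarrow> 'r fmod set \<Rightarrow> ('r fmod, 'r fmap set) precat" where
  "stable_X_cat \<Lambda> \<XX> = factor_cat (X_cat \<Lambda> \<XX>) (factoring_through (mod_cat \<Lambda>) (prj \<Lambda>))"

text \<open>The values of the functors are groups with elements in \<open>'r fmap set\<close>; this is no loss, since
  up to isomorphism \<open>F(T)\<close> is a quotient of a group of module homomorphisms.\<close>

type_synonym 'r sfun = "('r fmod, 'r fmap set, 'r fmap set) contravariant"
type_synonym 'r snat = "'r fmod \<Rightarrow> 'r fmap set \<Rightarrow> 'r fmap set"

definition mod_stable_X ::
  "('r, 'd) ring_scheme \<Rightarrow> 'r fmod set \<Rightarrow> ('r sfun, 'r snat) precat" where
  "mod_stable_X \<Lambda> \<XX> = fp_cat (stable_X_cat \<Lambda> \<XX>)"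

text \<open>For \<open>x = (A \<rightarrow> B)\<close>, the image of \<open>(T, B) \<rightarrow> (T, Cok f)\<close>, and the cokernel \<open>F\<close> of
  \<open>(-, B) \<rightarrow> (-, Cok f)\<close> as a functor on \<open>\<XX>\<close>.\<close>

definition psi_image :: "('r, 'd) ring_scheme \<Rightarrow> 'r hobj \<Rightarrow> 'r fmod \<Rightarrow> 'r fmap set" where
  "psi_image \<Lambda> x T = (let M = mod_cat \<Lambda>; B = fst (snd x) in
    (\<lambda>s. Comp M T B (cok_obj M x) (cok_map M x) s) ` Arr M T B)"

definition psi_group :: "('r, 'd) ring_scheme \<Rightarrow> 'r hobj \<Rightarrow> 'r fmod \<Rightarrow> 'r fmap set monoid" where
  "psi_group \<Lambda> x T = Hom (mod_cat \<Lambda>) T (cok_obj (mod_cat \<Lambda>) x) Mod psi_image \<Lambda> x T"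

definition psi_obj ::
  "('r, 'd) ring_scheme \<Rightarrow> 'r hobj \<Rightarrow> ('r fmod, 'r fmap, 'r fmap set) contravariant" where
  "psi_obj \<Lambda> x = (let M = mod_cat \<Lambda>; D = cok_obj M x in
    \<lparr>FObj = psi_group \<Lambda> x,
     FArr = (\<lambda>T T' u. \<lambda>c\<in>carrier (psi_group \<Lambda> x T).
       \<Union>s\<in>c. psi_image \<Lambda> x T' #>\<^bsub>Hom M T' D\<^esub> Comp M T' T D s u)\<rparr>)"

definition induced_cok_map ::
  "('r, 'd) ring_scheme \<Rightarrow> 'r hobj \<Rightarrow> 'r hobj \<Rightarrow> 'r harr \<Rightarrow> 'r fmap" where
  "induced_cok_map \<Lambda> x y ab = (let M = mod_cat \<Lambda>; B = fst (snd x); B' = fst (snd y) in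
    THE c. c \<in> Arr M (cok_obj M x) (cok_obj M y) \<and>
      Comp M B (cok_obj M x) (cok_obj M y) c (cok_map M x)
      = Comp M B B' (cok_obj M y) (cok_map M y) (snd ab))"

definition Psi ::
  "('r, 'd) ring_scheme \<Rightarrow> 'r fmod set \<Rightarrow> ('r hobj, 'r harr, 'r sfun, 'r snat) afunctor" where
  "Psi \<Lambda> \<XX> = (let M = mod_cat \<Lambda> in
    \<lparr>FObj = (\<lambda>x. descend (psi_obj \<Lambda> x)),
     FArr = (\<lambda>x y ab. \<lambda>T\<in>Obj (X_cat \<Lambda> \<XX>). \<lambda>c\<in>carrier (psi_group \<Lambda> x T).
       \<Union>s\<in>c. psi_image \<Lambda> y T #>\<^bsub>Hom M T (cok_obj M y)\<^esub>
         Comp M T (cok_obj M x) (cok_obj M y) (induced_cok_map \<Lambda> x y ab) s)\<rparr>)"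

definition induces_on_factors :: "('o, 'a) precat \<Rightarrow> ('o \<Rightarrow> 'o \<Rightarrow> 'a set) \<Rightarrow>
    ('p, 'b) precat \<Rightarrow> ('p \<Rightarrow> 'p \<Rightarrow> 'b set) \<Rightarrow>
    ('o, 'a, 'p, 'b) afunctor \<Rightarrow> ('o, 'a set, 'p, 'b set) afunctor \<Rightarrow> bool" where
  "induces_on_factors C I D J F G \<longleftrightarrow>
    (\<forall>A\<in>Obj C. FObj G A = FObj F A) \<and>
    (\<forall>A\<in>Obj C. \<forall>B\<in>Obj C. \<forall>f\<in>Arr C A B.
      FArr G A B (I A B #>\<^bsub>Hom C A B\<^esub> f)
      = J (FObj F A) (FObj F B) #>\<^bsub>Hom D (FObj F A) (FObj F B)\<^esub> FArr F A B f)"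

end

theory Submission imports Defs begin

text \<open>The functor \<open>\<Psi>\<close> sees only the map of cokernels that a morphism \<open>x \<rightarrow> y\<close> induces.  By Yoneda, a morphism
  \<open>\<Psi> x \<rightarrow> \<Psi> y\<close> is given by a map \<open>c : Cok x \<rightarrow> Cok y\<close> that lifts to the targets of the monomorphisms, and two such
  maps give the same morphism iff they differ by a map through \<open>q y\<close>, where \<open>q y\<close> is the cokernel map of \<open>y\<close>
  (\<open>psi_map_full\<close>, \<open>psi_map_eq_iff\<close>).  Hence \<open>\<Psi>\<close> is full.  It is dense: a presentation of a functor by
  \<open>A \<rightarrow> B\<close> becomes one by an epimorphism if a projective cover of \<open>B\<close> is added to \<open>A\<close>, which changes nothing
  stably, and the kernel of this epimorphism belongs to \<open>\<XX>\<close> (\<open>Fun_dense\<close>).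

  A full and dense functor induces an equivalence after factoring out an ideal \<open>J\<close> of the target and its
  preimage in the source (\<open>full_dense_factor_equivalence\<close>).  With \<open>J\<close> the morphisms that factor through projective
  functors, both claims reduce to the assertion that the preimage of \<open>J\<close> is the ideal of morphisms through projective
  objects of the exact structure, and also the ideal generated by \<open>V_objects\<close>.

  The preimage is computed as follows.  If the target of the monomorphism \<open>w\<close> is a projective module, then \<open>\<Psi> w\<close> is projective
  (\<open>Fun_projective\<close>), and every \<open>\<Psi> x\<close> is a quotient of such a functor: take for \<open>w\<close> the inclusion of the kernel of a
  projective cover of \<open>Cok x\<close>; the kernel of \<open>\<Psi> w \<rightarrow> \<Psi> x\<close> comes from a pullback (\<open>Fun_cover_exact\<close>).  So the morphism given by \<open>c\<close> lies
  in \<open>J\<close> iff \<open>c \<circ> q x\<close> factors through a projective module, up to a change of \<open>c\<close> by a map through \<open>q y\<close>; this is the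
  ideal \<open>stably_trivial\<close>.

  The three ideals are then compared (\<open>ideals_agree\<close>).  The objects \<open>(X = X)\<close>, \<open>(0 \<rightarrow> X)\<close> and \<open>(\<Omega> X \<rightarrow> P)\<close> are projective for the
  exact structure, and every \<open>x = (A \<rightarrow> B)\<close> is the target of a deflation from
  \<open>(A = A) \<oplus> (0 \<rightarrow> B) \<oplus> (\<Omega> (Cok x) \<rightarrow> P)\<close>, so that the projective objects are the direct summands of finite sums of objects of this kind
  (\<open>projective_Ident_generated\<close>).  Their identities are stably trivial, and conversely a stably trivial morphism
  is an explicit sum of three morphisms through such objects (\<open>stably_trivial_decomposition\<close>).

  The module theory underneath is that finitely generated modules over an Artin algebra are artinian and
  noetherian, which gives kernels of finitely generated modules and projective covers.\<close>

section \<open>Preadditive categories\<close>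

lemma (in comm_group) coset_eq_iff:
  assumes "subgroup H G" "x \<in> carrier G" "y \<in> carrier G"
  shows "H #> x = H #> y \<longleftrightarrow> (\<exists>h\<in>H. x = y \<otimes> h)"
proof
  assume "H #> x = H #> y"
  with rcos_self[OF assms(2,1)] obtain h where "h \<in> H" "x = h \<otimes> y" by (auto simp: r_coset_def)
  then show "\<exists>h\<in>H. x = y \<otimes> h"
    using assms by (metis m_comm subgroup.mem_carrier)
next
  assume "\<exists>h\<in>H. x = y \<otimes> h"
  then obtain h where h: "h \<in> H" "x = y \<otimes> h" by auto
  then have "x \<in> H #> y"
    using assms by (auto simp: r_coset_def m_comm[of y h] subgroup.mem_carrier)
  then show "H #> x = H #> y" using repr_independence[OF _ assms(3,1)] by auto
qed

lemma (in comm_group) coset_mem_iff: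
  assumes "subgroup H G" "x \<in> carrier G" "y \<in> H #> x"
  shows "y \<in> carrier G" "H #> y = H #> x"
  using assms by (meson r_coset_subset_G subgroup.subset subsetD, metis repr_independence)

lemma (in comm_group) coset_zero:
  assumes "subgroup H G" "x \<in> carrier G"
  shows "H #> x = H \<longleftrightarrow> x \<in> H"
  using assms by (metis rcos_self coset_join2)

lemma (in comm_group) Mod_mult:
  assumes "subgroup H G" "x \<in> carrier G" "y \<in> carrier G"
  shows "(H #> x) \<otimes>\<^bsub>G Mod H\<^esub> (H #> y) = H #> (x \<otimes> y)"
  using normal.rcos_sum[OF subgroup_imp_normal[OF assms(1)] assms(2,3)] by (simp add: FactGroup_def)

lemma carrier_Mod: "carrier (G Mod H) = (\<lambda>x. H #>\<^bsub>G\<^esub> x) ` carrier G"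
  by (auto simp: FactGroup_def RCOSETS_def)

lemma (in comm_group) abelian_Mod: "subgroup H G \<Longrightarrow> comm_group (G Mod H)"
  by (simp add: abelian_FactGroup)

context preadditive_category
begin

lemma hom_group: "A \<in> Obj C \<Longrightarrow> B \<in> Obj C \<Longrightarrow> group (Hom C A B)"
  using Hom_comm_group comm_group.axioms(2) by blast

lemma add_closed [simp]:
  "\<lbrakk>A \<in> Obj C; B \<in> Obj C; f \<in> Arr C A B; g \<in> Arr C A B\<rbrakk> \<Longrightarrow> f \<otimes>\<^bsub>Hom C A B\<^esub> g \<in> Arr C A B"
  using hom_group by (simp add: group.is_monoid monoid.m_closed)

lemma zero_closed [simp]: "\<lbrakk>A \<in> Obj C; B \<in> Obj C\<rbrakk> \<Longrightarrow> Zero C A B \<in> Arr C A B"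
  using hom_group by (simp add: group.is_monoid monoid.one_closed)

lemma neg_closed [simp]:
  "\<lbrakk>A \<in> Obj C; B \<in> Obj C; f \<in> Arr C A B\<rbrakk> \<Longrightarrow> inv\<^bsub>Hom C A B\<^esub> f \<in> Arr C A B"
  using hom_group by (simp add: group.inv_closed)

lemma add_assoc:
  "\<lbrakk>A \<in> Obj C; B \<in> Obj C; f \<in> Arr C A B; g \<in> Arr C A B; h \<in> Arr C A B\<rbrakk>
    \<Longrightarrow> f \<otimes>\<^bsub>Hom C A B\<^esub> g \<otimes>\<^bsub>Hom C A B\<^esub> h = f \<otimes>\<^bsub>Hom C A B\<^esub> (g \<otimes>\<^bsub>Hom C A B\<^esub> h)"
  using hom_group by (simp add: group.is_monoid monoid.m_assoc)

lemma add_comm: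
  "\<lbrakk>A \<in> Obj C; B \<in> Obj C; f \<in> Arr C A B; g \<in> Arr C A B\<rbrakk>
    \<Longrightarrow> f \<otimes>\<^bsub>Hom C A B\<^esub> g = g \<otimes>\<^bsub>Hom C A B\<^esub> f"
  using Hom_comm_group by (simp add: comm_group_def comm_monoid.m_comm)

lemma zero_add [simp]:
  "\<lbrakk>A \<in> Obj C; B \<in> Obj C; f \<in> Arr C A B\<rbrakk> \<Longrightarrow> Zero C A B \<otimes>\<^bsub>Hom C A B\<^esub> f = f"
  using hom_group by (simp add: group.is_monoid monoid.l_one)

lemma add_zero [simp]:
  "\<lbrakk>A \<in> Obj C; B \<in> Obj C; f \<in> Arr C A B\<rbrakk> \<Longrightarrow> f \<otimes>\<^bsub>Hom C A B\<^esub> Zero C A B = f"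
  using hom_group by (simp add: group.is_monoid monoid.r_one)

lemma add_neg [simp]:
  "\<lbrakk>A \<in> Obj C; B \<in> Obj C; f \<in> Arr C A B\<rbrakk> \<Longrightarrow> f \<otimes>\<^bsub>Hom C A B\<^esub> inv\<^bsub>Hom C A B\<^esub> f = Zero C A B"
  using hom_group by (simp add: group.r_inv)

lemma neg_add [simp]:
  "\<lbrakk>A \<in> Obj C; B \<in> Obj C; f \<in> Arr C A B\<rbrakk> \<Longrightarrow> inv\<^bsub>Hom C A B\<^esub> f \<otimes>\<^bsub>Hom C A B\<^esub> f = Zero C A B"
  using hom_group by (simp add: group.l_inv)

lemma add_left_cancel [simp]:
  "\<lbrakk>A \<in> Obj C; B \<in> Obj C; f \<in> Arr C A B; g \<in> Arr C A B; h \<in> Arr C A B\<rbrakk>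
    \<Longrightarrow> f \<otimes>\<^bsub>Hom C A B\<^esub> g = f \<otimes>\<^bsub>Hom C A B\<^esub> h \<longleftrightarrow> g = h"
  using monoid.Units_l_cancel[OF group.is_monoid[OF hom_group]] by (simp add: group.Units_eq hom_group)

lemma add_eq_self:
  "\<lbrakk>A \<in> Obj C; B \<in> Obj C; f \<in> Arr C A B; g \<in> Arr C A B; f \<otimes>\<^bsub>Hom C A B\<^esub> g = f\<rbrakk>
    \<Longrightarrow> g = Zero C A B"
  by (metis add_left_cancel add_zero zero_closed)

lemma difference:
  assumes "A \<in> Obj C" "B \<in> Obj C" "f \<in> Arr C A B" "g \<in> Arr C A B"
  obtains h where "h \<in> Arr C A B" "f = g \<otimes>\<^bsub>Hom C A B\<^esub> h"
proof
  show "inv\<^bsub>Hom C A B\<^esub> g \<otimes>\<^bsub>Hom C A B\<^esub> f \<in> Arr C A B" using assms by simp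
  show "f = g \<otimes>\<^bsub>Hom C A B\<^esub> (inv\<^bsub>Hom C A B\<^esub> g \<otimes>\<^bsub>Hom C A B\<^esub> f)"
    using assms by (simp flip: add_assoc)
qed

lemmas Comp_assoc' = Comp_assoc [symmetric]

lemma Comp_zero_right [simp]:
  assumes "A \<in> Obj C" "B \<in> Obj C" "D \<in> Obj C" "g \<in> Arr C B D"
  shows "Comp C A B D g (Zero C A B) = Zero C A D"
proof (rule add_eq_self[of A D "Comp C A B D g (Zero C A B)"])
  show "Comp C A B D g (Zero C A B) \<otimes>\<^bsub>Hom C A D\<^esub> Comp C A B D g (Zero C A B) = Comp C A B D g (Zero C A B)"
    using assms by (simp flip: Comp_add_right)
qed (use assms in \<open>auto intro: Comp_closed\<close>)

lemma Comp_zero_left [simp]: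
  assumes "A \<in> Obj C" "B \<in> Obj C" "D \<in> Obj C" "f \<in> Arr C A B"
  shows "Comp C A B D (Zero C B D) f = Zero C A D"
proof (rule add_eq_self[of A D "Comp C A B D (Zero C B D) f"])
  show "Comp C A B D (Zero C B D) f \<otimes>\<^bsub>Hom C A D\<^esub> Comp C A B D (Zero C B D) f = Comp C A B D (Zero C B D) f"
    using assms by (simp flip: Comp_add_left)
qed (use assms in \<open>auto intro: Comp_closed\<close>)

declare Ident_closed [simp] Comp_closed [simp] Comp_Ident_left [simp] Comp_Ident_right [simp]

lemma neg_unique:
  assumes "A \<in> Obj C" "B \<in> Obj C" "f \<in> Arr C A B" "g \<in> Arr C A B" "f \<otimes>\<^bsub>Hom C A B\<^esub> g = Zero C A B"
  shows "inv\<^bsub>Hom C A B\<^esub> f = g"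
  using assms by (metis add_left_cancel add_neg neg_closed)

lemma Comp_neg_right:
  assumes "A \<in> Obj C" "B \<in> Obj C" "D \<in> Obj C" "g \<in> Arr C B D" "f \<in> Arr C A B"
  shows "Comp C A B D g (inv\<^bsub>Hom C A B\<^esub> f) = inv\<^bsub>Hom C A D\<^esub> (Comp C A B D g f)"
proof (rule neg_unique[symmetric])
  show "Comp C A B D g f \<otimes>\<^bsub>Hom C A D\<^esub> Comp C A B D g (inv\<^bsub>Hom C A B\<^esub> f) = Zero C A D"
    using assms by (simp flip: Comp_add_right)
qed (use assms in auto)

lemma Comp_neg_left:
  assumes "A \<in> Obj C" "B \<in> Obj C" "D \<in> Obj C" "g \<in> Arr C B D" "f \<in> Arr C A B"
  shows "Comp C A B D (inv\<^bsub>Hom C B D\<^esub> g) f = inv\<^bsub>Hom C A D\<^esub> (Comp C A B D g f)"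
proof (rule neg_unique[symmetric])
  show "Comp C A B D g f \<otimes>\<^bsub>Hom C A D\<^esub> Comp C A B D (inv\<^bsub>Hom C B D\<^esub> g) f = Zero C A D"
    using assms by (simp flip: Comp_add_left)
qed (use assms in auto)

lemma Comp_hom_right:
  "\<lbrakk>A \<in> Obj C; B \<in> Obj C; D \<in> Obj C; g \<in> Arr C B D\<rbrakk> \<Longrightarrow> Comp C A B D g \<in> hom (Hom C A B) (Hom C A D)"
  by (auto simp: hom_def Comp_add_right)

lemma Comp_hom_left:
  "\<lbrakk>A \<in> Obj C; B \<in> Obj C; D \<in> Obj C; f \<in> Arr C A B\<rbrakk>
    \<Longrightarrow> (\<lambda>g. Comp C A B D g f) \<in> hom (Hom C B D) (Hom C A D)"
  by (auto simp: hom_def Comp_add_left)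

lemma Hom_comm_monoid: "A \<in> Obj C \<Longrightarrow> B \<in> Obj C \<Longrightarrow> comm_monoid (Hom C A B)"
  using Hom_comm_group by (simp add: comm_group_def)

lemma finprod_Arr:
  fixes n :: nat
  assumes "A \<in> Obj C" "B \<in> Obj C" "\<And>k. k < n \<Longrightarrow> f k \<in> Arr C A B"
  shows "finprod (Hom C A B) f {..<n} \<in> Arr C A B"
  using assms by (auto intro!: comm_monoid.finprod_closed[OF Hom_comm_monoid])

lemma finprod_Arr_Suc:
  assumes "A \<in> Obj C" "B \<in> Obj C" "\<And>k. k < Suc n \<Longrightarrow> f k \<in> Arr C A B"
  shows "finprod (Hom C A B) f {..<Suc n} = finprod (Hom C A B) f {..<n} \<otimes>\<^bsub>Hom C A B\<^esub> f n"
proof -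
  interpret comm_monoid "Hom C A B" using assms Hom_comm_monoid by blast
  have "{..<Suc n} = insert n {..<n}" by auto
  then show ?thesis
    using assms by (simp add: m_comm finprod_Arr Pi_def)
qed

lemma Comp_finprod_right:
  fixes n :: nat
  assumes "A \<in> Obj C" "B \<in> Obj C" "D \<in> Obj C" "g \<in> Arr C B D" "\<And>k. k < n \<Longrightarrow> f k \<in> Arr C A B"
  shows "Comp C A B D g (finprod (Hom C A B) f {..<n}) = finprod (Hom C A D) (\<lambda>k. Comp C A B D g (f k)) {..<n}"
  using assms(5)
proof (induction n)
  case 0
  then show ?case using assms by (simp add: comm_monoid.finprod_empty[OF Hom_comm_monoid])
next
  case (Suc n)
  then show ?case using assms by (simp add: finprod_Arr_Suc Comp_add_right finprod_Arr)
qed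

lemma Comp_finprod_left:
  fixes n :: nat
  assumes "A \<in> Obj C" "B \<in> Obj C" "D \<in> Obj C" "f \<in> Arr C A B" "\<And>k. k < n \<Longrightarrow> g k \<in> Arr C B D"
  shows "Comp C A B D (finprod (Hom C B D) g {..<n}) f = finprod (Hom C A D) (\<lambda>k. Comp C A B D (g k) f) {..<n}"
  using assms(5)
proof (induction n)
  case 0
  then show ?case using assms by (simp add: comm_monoid.finprod_empty[OF Hom_comm_monoid])
next
  case (Suc n)
  then show ?case using assms by (simp add: finprod_Arr_Suc Comp_add_left finprod_Arr)
qed

lemma finprod_Arr_cong:
  fixes n :: nat
  assumes "A \<in> Obj C" "B \<in> Obj C" "\<And>k. k < n \<Longrightarrow> g k \<in> Arr C A B" "\<And>k. k < n \<Longrightarrow> f k = g k"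
  shows "finprod (Hom C A B) f {..<n} = finprod (Hom C A B) g {..<n}"
  using assms by (intro comm_monoid.finprod_cong'[OF Hom_comm_monoid]) auto

lemma finprod_delta:
  fixes n :: nat
  assumes "A \<in> Obj C" "B \<in> Obj C" "l < n" "\<And>k. k < n \<Longrightarrow> k \<noteq> l \<Longrightarrow> f k = Zero C A B" "f l \<in> Arr C A B"
  shows "finprod (Hom C A B) f {..<n} = f l"
  using assms(3,4)
proof (induction n)
  case (Suc n)
  have cl: "f k \<in> Arr C A B" if "k < Suc n" for k
    using Suc.prems(2)[OF that] assms by (cases "k = l") auto
  have z: "finprod (Hom C A B) f {..<m} = Zero C A B" if "\<And>k. k < m \<Longrightarrow> f k = Zero C A B" for m :: nat
    using that
  proof (induction m)
    case 0
    then show ?case by (simp add: assms comm_monoid.finprod_empty[OF Hom_comm_monoid])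
  next
    case (Suc m)
    then show ?case using assms by (simp add: finprod_Arr_Suc)
  qed
  show ?case
  proof (cases "l = n")
    case True
    then have "finprod (Hom C A B) f {..<n} = Zero C A B" using Suc.prems by (intro z) auto
    then show ?thesis using True assms cl by (simp add: finprod_Arr_Suc)
  next
    case False
    then have "finprod (Hom C A B) f {..<n} = f l" using Suc.prems by (intro Suc.IH) auto
    moreover have "f n = Zero C A B" using Suc.prems False by auto
    ultimately show ?thesis using assms cl by (simp add: finprod_Arr_Suc)
  qed
qed simp

end

section \<open>Direct sums\<close>

text \<open>Direct sums of two objects with named structure maps; these are easier to calculate with than
  families over \<open>{..<2}\<close>.\<close>

definition biproduct :: "('o, 'a) precat \<Rightarrow> 'o \<Rightarrow> 'o \<Rightarrow> 'o \<Rightarrow> 'a \<Rightarrow> 'a \<Rightarrow> 'a \<Rightarrow> 'a \<Rightarrow> bool" where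
  "biproduct C A B S i j p q \<longleftrightarrow> A \<in> Obj C \<and> B \<in> Obj C \<and> S \<in> Obj C \<and>
    i \<in> Arr C A S \<and> j \<in> Arr C B S \<and> p \<in> Arr C S A \<and> q \<in> Arr C S B \<and>
    Comp C A S A p i = Ident C A \<and> Comp C B S B q j = Ident C B \<and>
    Comp C B S A p j = Zero C B A \<and> Comp C A S B q i = Zero C A B \<and>
    Comp C S A S i p \<otimes>\<^bsub>Hom C S S\<^esub> Comp C S B S j q = Ident C S"

context preadditive_category
begin

text \<open>By induction on \<open>n\<close>, adding one summand at a time.  The class \<open>Y\<close> records that the direct sum stays
  inside every subcategory with a zero object and biproducts.\<close>

lemma direct_sum_data_exists:
  assumes "zero_object C Z" "Z \<in> Y" "Y \<subseteq> Obj C"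
    and bi: "\<And>A B. A \<in> Y \<Longrightarrow> B \<in> Y \<Longrightarrow> \<exists>S\<in>Y. \<exists>i j p q. biproduct C A B S i j p q"
    and A: "\<And>k. k < n \<Longrightarrow> A k \<in> Y"
  shows "\<exists>B\<in>Y. is_direct_sum C n A B"
  using A
proof (induction n)
  case 0
  have "Zero C Z Z = Ident C Z" using assms(1) Ident_closed[of Z] by (auto simp: zero_object_def)
  then show ?case using assms(1,2,3)
    by (intro bexI[of _ Z]) (auto simp: is_direct_sum_def comm_monoid.finprod_empty[OF Hom_comm_monoid])
next
  case (Suc n)
  then obtain B where B: "B \<in> Y" "is_direct_sum C n A B" by auto
  obtain i p where ip: "\<And>k. k < n \<Longrightarrow> i k \<in> Arr C (A k) B" "\<And>k. k < n \<Longrightarrow> p k \<in> Arr C B (A k)"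
    "\<And>k l. k < n \<Longrightarrow> l < n \<Longrightarrow> Comp C (A k) B (A l) (p l) (i k)
          = (if k = l then Ident C (A k) else Zero C (A k) (A l))"
    "finprod (Hom C B B) (\<lambda>k. Comp C B (A k) B (i k) (p k)) {..<n} = Ident C B"
    using B(2) unfolding is_direct_sum_def by blast
  have An: "A n \<in> Y" using Suc.prems by simp
  obtain S i' j' p' q' where S: "S \<in> Y" and b: "biproduct C B (A n) S i' j' p' q'"
    using bi[OF B(1) An] by blast
  note b' = b[unfolded biproduct_def]
  have AO: "A k \<in> Obj C" if "k < n" for k using Suc.prems[of k] that assms(3) by auto
  have O: "B \<in> Obj C" "A n \<in> Obj C" "S \<in> Obj C" using b' by auto
  define i2 where "i2 k = (if k < n then Comp C (A k) B S i' (i k) else j')" for k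
  define p2 where "p2 k = (if k < n then Comp C S B (A k) (p k) p' else q')" for k
  have less: "k < Suc n \<longleftrightarrow> k < n \<or> k = n" for k by auto
  have 1: "\<forall>k<Suc n. i2 k \<in> Arr C (A k) S \<and> p2 k \<in> Arr C S (A k)"
    using b' ip AO by (auto simp: i2_def p2_def less)
  have 2: "Comp C (A k) S (A l) (p2 l) (i2 k) = (if k = l then Ident C (A k) else Zero C (A k) (A l))"
    if kl: "k < Suc n" "l < Suc n" for k l
  proof -
    have e1: "Comp C (A k) S (A l) (Comp C S B (A l) (p l) p') (Comp C (A k) B S i' (i k))
        = Comp C (A k) B (A l) (p l) (i k)" if "k < n" "l < n"
    proof -
      have "Comp C (A k) S B p' (Comp C (A k) B S i' (i k)) = i k"
        using that AO ip O b' by (simp add: Comp_assoc)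
      then show ?thesis using that AO ip O b' by (simp add: Comp_assoc')
    qed
    have e2: "Comp C (A n) S (A l) (Comp C S B (A l) (p l) p') j' = Zero C (A n) (A l)" if "l < n"
      using that AO ip O b' by (simp add: Comp_assoc')
    have e3: "Comp C (A k) S (A n) q' (Comp C (A k) B S i' (i k)) = Zero C (A k) (A n)" if "k < n"
      using that AO ip O b' by (simp add: Comp_assoc)
    show ?thesis using kl e1 e2 e3 b' ip(3) by (auto simp: i2_def p2_def less)
  qed
  have "finprod (Hom C S S) (\<lambda>k. Comp C S (A k) S (i2 k) (p2 k)) {..<n}
      = finprod (Hom C S S) (\<lambda>k. Comp C S B S i' (Comp C S B B (Comp C B (A k) B (i k) (p k)) p')) {..<n}"
    using AO ip O b' by (intro finprod_Arr_cong) (auto simp: i2_def p2_def Comp_assoc)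
  also have "\<dots> = Comp C S B S i' (Comp C S B B (finprod (Hom C B B) (\<lambda>k. Comp C B (A k) B (i k) (p k)) {..<n}) p')"
    using AO ip O b' by (subst Comp_finprod_left; simp add: Comp_finprod_right)
  also have "\<dots> = Comp C S B S i' p'" using ip O b' by simp
  finally have 3: "finprod (Hom C S S) (\<lambda>k. Comp C S (A k) S (i2 k) (p2 k)) {..<Suc n} = Ident C S"
    using b' 1 AO O by (subst finprod_Arr_Suc) (auto simp: i2_def p2_def less)
  show ?case
    unfolding is_direct_sum_def using S 1 2 3 O AO by (intro bexI[OF _ S] conjI exI[of _ i2] exI[of _ p2]) (auto simp: less)
qed

lemma biproduct_of_direct_sum:
  assumes "is_direct_sum C 2 (\<lambda>k. if k = 0 then A else B) S"
  shows "\<exists>i j p q. biproduct C A B S i j p q"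
proof -
  define A' where "A' = (\<lambda>k::nat. if k = 0 then A else B)"
  obtain i p where ip: "\<And>k. k < 2 \<Longrightarrow> i k \<in> Arr C (A' k) S" "\<And>k. k < 2 \<Longrightarrow> p k \<in> Arr C S (A' k)"
    "\<And>k l. k < 2 \<Longrightarrow> l < 2 \<Longrightarrow> Comp C (A' k) S (A' l) (p l) (i k)
          = (if k = l then Ident C (A' k) else Zero C (A' k) (A' l))"
    "finprod (Hom C S S) (\<lambda>k. Comp C S (A' k) S (i k) (p k)) {..<2} = Ident C S"
    and O: "\<And>k. k < 2 \<Longrightarrow> A' k \<in> Obj C" "S \<in> Obj C"
    using assms[folded A'_def] unfolding is_direct_sum_def by blast
  have s: "(2::nat) = Suc (Suc 0)" by simp
  have cl: "Comp C S (A' k) S (i k) (p k) \<in> Arr C S S" if "k < Suc (Suc 0)" for k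
    using ip(1,2) O that by (simp only: flip: s) simp
  have "finprod (Hom C S S) (\<lambda>k. Comp C S (A' k) S (i k) (p k)) {..<2}
     = Comp C S (A' 0) S (i 0) (p 0) \<otimes>\<^bsub>Hom C S S\<^esub> Comp C S (A' 1) S (i 1) (p 1)"
    unfolding s using cl O
    by (simp add: finprod_Arr_Suc comm_monoid.finprod_empty[OF Hom_comm_monoid])
  then show ?thesis
    using ip(1)[of 0] ip(1)[of 1] ip(2)[of 0] ip(2)[of 1] O(1)[of 0] O(1)[of 1] O(2)
      ip(3)[of 0 0] ip(3)[of 0 1] ip(3)[of 1 0] ip(3)[of 1 1] ip(4)
    unfolding biproduct_def A'_def by (intro exI[of _ "i 0"] exI[of _ "i 1"] exI[of _ "p 0"] exI[of _ "p 1"]) simp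
qed

lemma projective_direct_sum:
  assumes "is_direct_sum C n A B" and "\<And>k. k < n \<Longrightarrow> projective C E (A k)"
  shows "projective C E B"
  unfolding projective_def
proof (intro conjI ballI impI)
  obtain i p where ip: "\<And>k. k < n \<Longrightarrow> i k \<in> Arr C (A k) B" "\<And>k. k < n \<Longrightarrow> p k \<in> Arr C B (A k)"
    "finprod (Hom C B B) (\<lambda>k. Comp C B (A k) B (i k) (p k)) {..<n} = Ident C B"
    and O: "\<And>k. k < n \<Longrightarrow> A k \<in> Obj C" "B \<in> Obj C"
    using assms(1) unfolding is_direct_sum_def by blast
  show "B \<in> Obj C" by fact
  fix X Y D j q t assume H: "X \<in> Obj C" "Y \<in> Obj C" "D \<in> Obj C" "j \<in> Arr C X Y" "q \<in> Arr C Y D"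
    "E X j Y q D" "t \<in> Arr C B D"
  have "\<exists>s\<in>Arr C (A k) Y. Comp C (A k) Y D q s = Comp C (A k) B D t (i k)" if "k < n" for k
    using assms(2)[OF that] H ip(1)[OF that] O that unfolding projective_def by auto
  then obtain s where s: "\<And>k. k < n \<Longrightarrow> s k \<in> Arr C (A k) Y"
     "\<And>k. k < n \<Longrightarrow> Comp C (A k) Y D q (s k) = Comp C (A k) B D t (i k)" by metis
  show "\<exists>s\<in>Arr C B Y. Comp C B Y D q s = t"
  proof
    show "finprod (Hom C B Y) (\<lambda>k. Comp C B (A k) Y (s k) (p k)) {..<n} \<in> Arr C B Y"
      using O H s ip by (intro finprod_Arr) auto
    have "Comp C B Y D q (finprod (Hom C B Y) (\<lambda>k. Comp C B (A k) Y (s k) (p k)) {..<n})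
       = finprod (Hom C B D) (\<lambda>k. Comp C B B D t (Comp C B (A k) B (i k) (p k))) {..<n}"
      using O H s ip by (subst Comp_finprod_right) (auto intro!: finprod_Arr_cong simp: Comp_assoc)
    also have "\<dots> = Comp C B B D t (Ident C B)"
      unfolding ip(3)[symmetric] using O H ip by (subst Comp_finprod_right) auto
    finally show "Comp C B Y D q (finprod (Hom C B Y) (\<lambda>k. Comp C B (A k) Y (s k) (p k)) {..<n}) = t"
      using O H by simp
  qed
qed

text \<open>The pairing of the \<open>f k\<close> followed by the copairing of the \<open>g k\<close>: the mixed terms of this composite
  vanish because the injections and projections of a direct sum are orthogonal.\<close>

lemma sum_factors_through_direct_sum:
  assumes "is_direct_sum C n V P" "A \<in> Obj C" "B \<in> Obj C"
    "\<And>k. k < n \<Longrightarrow> f k \<in> Arr C A (V k)" "\<And>k. k < n \<Longrightarrow> g k \<in> Arr C (V k) B"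
  shows "\<exists>u\<in>Arr C A P. \<exists>v\<in>Arr C P B.
    finprod (Hom C A B) (\<lambda>k. Comp C A (V k) B (g k) (f k)) {..<n} = Comp C A P B v u"
proof -
  obtain i p where ip: "\<And>k. k < n \<Longrightarrow> i k \<in> Arr C (V k) P" "\<And>k. k < n \<Longrightarrow> p k \<in> Arr C P (V k)"
    "\<And>k l. k < n \<Longrightarrow> l < n \<Longrightarrow> Comp C (V k) P (V l) (p l) (i k)
          = (if k = l then Ident C (V k) else Zero C (V k) (V l))"
    and O: "\<And>k. k < n \<Longrightarrow> V k \<in> Obj C" "P \<in> Obj C"
    using assms(1) unfolding is_direct_sum_def by blast
  define u where "u = finprod (Hom C A P) (\<lambda>k. Comp C A (V k) P (i k) (f k)) {..<n}"
  define v where "v = finprod (Hom C P B) (\<lambda>k. Comp C P (V k) B (g k) (p k)) {..<n}"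
  have u: "u \<in> Arr C A P" and v: "v \<in> Arr C P B"
    unfolding u_def v_def using assms O ip by (auto intro!: finprod_Arr)
  have pu: "Comp C A P (V l) (p l) u = f l" if "l < n" for l
  proof -
    have *: "Comp C A P (V l) (p l) (Comp C A (V k) P (i k) (f k)) = (if k = l then f k else Zero C A (V l))"
      if "k < n" for k
    proof -
      have "Comp C A P (V l) (p l) (Comp C A (V k) P (i k) (f k))
          = Comp C A (V k) (V l) (Comp C (V k) P (V l) (p l) (i k)) (f k)"
        using O assms ip that \<open>l < n\<close> by (simp add: Comp_assoc)
      then show ?thesis using O assms ip(3)[OF that \<open>l < n\<close>] that \<open>l < n\<close> by (auto split: if_splits)
    qed
    have "Comp C A P (V l) (p l) u
        = finprod (Hom C A (V l)) (\<lambda>k. Comp C A P (V l) (p l) (Comp C A (V k) P (i k) (f k))) {..<n}"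
      unfolding u_def using that assms O ip by (subst Comp_finprod_right) auto
    also have "\<dots> = f l" using that assms O ip * by (subst finprod_delta[where l=l]) auto
    finally show ?thesis .
  qed
  have "Comp C A P B v u = finprod (Hom C A B) (\<lambda>k. Comp C A P B (Comp C P (V k) B (g k) (p k)) u) {..<n}"
    unfolding v_def using u assms O ip by (subst Comp_finprod_left) auto
  also have "\<dots> = finprod (Hom C A B) (\<lambda>k. Comp C A (V k) B (g k) (f k)) {..<n}"
    using u assms O ip pu by (intro finprod_Arr_cong) (auto simp: Comp_assoc')
  finally show ?thesis using u v by metis
qed

end

section \<open>Constructions of preadditive categories\<close>

lemma op_cat_simps [simp]:
  "Obj (op_cat C) = Obj C" "Hom (op_cat C) A B = Hom C B A"
  "Comp (op_cat C) A B D g f = Comp C D B A f g" "Ident (op_cat C) = Ident C"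
  by (simp_all add: op_cat_def)

lemma (in preadditive_category) op_cat_preadditive: "preadditive_category (op_cat C)"
  by (rule preadditive_category.intro) (auto simp: Hom_comm_group Comp_add_left Comp_add_right Comp_assoc)

lemma full_subcat_simps [simp]:
  "Obj (full_subcat C S) = Obj C \<inter> S" "Hom (full_subcat C S) = Hom C"
  "Comp (full_subcat C S) = Comp C" "Ident (full_subcat C S) = Ident C"
  by (simp_all add: full_subcat_def)

lemma (in preadditive_category) full_subcat_preadditive: "preadditive_category (full_subcat C S)"
  by (rule preadditive_category.intro) (auto simp: Hom_comm_group Comp_add_left Comp_add_right Comp_assoc)

lemma ab_cat_simps [simp]:
  "Obj ab_cat = {G. comm_group G}"
  "Arr ab_cat G H = hom G H \<inter> extensional (carrier G)"
  "Zero ab_cat G H = (\<lambda>x\<in>carrier G. \<one>\<^bsub>H\<^esub>)"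
  "f \<otimes>\<^bsub>Hom ab_cat G H\<^esub> g = (\<lambda>x\<in>carrier G. f x \<otimes>\<^bsub>H\<^esub> g x)"
  "Comp ab_cat G H K g' f' = compose (carrier G) g' f'"
  "Ident ab_cat G = (\<lambda>x\<in>carrier G. x)"
  by (simp_all add: ab_cat_def)

lemma ab_cat_preadditive: "preadditive_category ab_cat"
proof (rule preadditive_category.intro)
  fix A B :: "'g monoid" assume "A \<in> Obj ab_cat" "B \<in> Obj ab_cat"
  then interpret A: comm_group A + B: comm_group B by auto
  show "comm_group (Hom ab_cat A B)"
  proof (rule comm_groupI)
    fix f assume f: "f \<in> Arr ab_cat A B"
    have [simp]: "f x \<in> carrier B" if "x \<in> carrier A" for x using f that by (auto simp: hom_def)
    show "\<exists>g\<in>Arr ab_cat A B. g \<otimes>\<^bsub>Hom ab_cat A B\<^esub> f = Zero ab_cat A B"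
    proof
      show "(\<lambda>x\<in>carrier A. inv\<^bsub>B\<^esub> f x) \<otimes>\<^bsub>Hom ab_cat A B\<^esub> f = Zero ab_cat A B"
        by (auto intro!: restrict_ext simp: hom_def)
      show "(\<lambda>x\<in>carrier A. inv\<^bsub>B\<^esub> f x) \<in> Arr ab_cat A B"
        using f by (auto simp: hom_def B.inv_mult)
    qed
  qed (auto simp: hom_def extensional_def restrict_def fun_eq_iff Pi_def B.m_ac)
qed (auto simp: hom_def compose_def extensional_def restrict_def fun_eq_iff Pi_def
      comm_group_def comm_monoid_def monoid.m_closed)

lemma fp_cat_simps [simp]:
  "Obj (fp_cat C) = {F. finitely_presented C F}"
  "Zero (fp_cat C) F G = (\<lambda>T\<in>Obj C. Zero ab_cat (FObj F T) (FObj G T))"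
  "\<eta> \<otimes>\<^bsub>Hom (fp_cat C) F G\<^esub> \<theta> = (\<lambda>T\<in>Obj C. \<eta> T \<otimes>\<^bsub>Hom ab_cat (FObj F T) (FObj G T)\<^esub> \<theta> T)"
  "Comp (fp_cat C) F G H \<theta> \<eta> = (\<lambda>T\<in>Obj C. Comp ab_cat (FObj F T) (FObj G T) (FObj H T) (\<theta> T) (\<eta> T))"
  "Ident (fp_cat C) F = (\<lambda>T\<in>Obj C. Ident ab_cat (FObj F T))"
  by (simp_all add: fp_cat_def)

lemma fp_cat_Arr:
  "Arr (fp_cat C) F G = {\<eta> \<in> extensional (Obj C).
        (\<forall>T\<in>Obj C. \<eta> T \<in> Arr ab_cat (FObj F T) (FObj G T)) \<and>
        (\<forall>T\<in>Obj C. \<forall>T'\<in>Obj C. \<forall>u\<in>Arr C T' T.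
          Comp ab_cat (FObj F T) (FObj F T') (FObj G T') (\<eta> T') (FArr F T T' u)
          = Comp ab_cat (FObj F T) (FObj G T) (FObj G T') (FArr G T T' u) (\<eta> T))}"
  by (simp add: fp_cat_def)

lemma finitely_presented_functor: "finitely_presented C F \<Longrightarrow> additive_functor (op_cat C) ab_cat F"
  by (simp add: finitely_presented_def)

lemma fp_cat_preadditive: "preadditive_category (fp_cat C :: (('o,'a,'g) contravariant, _) precat)"
proof -
  interpret ab: preadditive_category "ab_cat :: ('g monoid, _) precat" by (rule ab_cat_preadditive)
  note [simp del] = ab_cat_simps
  have O: "FObj F T \<in> Obj ab_cat" if "finitely_presented C F" "T \<in> Obj C" for F :: "('o,'a,'g) contravariant" and T
    using additive_functor.FObj_closed[OF finitely_presented_functor[OF that(1)]] that(2) by simp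
  have H: "FArr F T T' u \<in> Arr ab_cat (FObj F T) (FObj F T')"
    if "finitely_presented C F" "T \<in> Obj C" "T' \<in> Obj C" "u \<in> Arr C T' T" for F :: "('o,'a,'g) contravariant" and T T' u
    using additive_functor.FArr_hom[OF finitely_presented_functor[OF that(1)], of T T'] that
    by (auto simp: hom_def)
  show ?thesis
  proof (rule preadditive_category.intro)
    fix F G :: "('o,'a,'g) contravariant" assume "F \<in> Obj (fp_cat C)" "G \<in> Obj (fp_cat C)"
    then have FG: "finitely_presented C F" "finitely_presented C G" by simp_all
    show "comm_group (Hom (fp_cat C) F G)"
    proof (rule comm_groupI)
      fix \<eta> assume e: "\<eta> \<in> Arr (fp_cat C) F G"
      let ?m = "\<lambda>T\<in>Obj C. inv\<^bsub>Hom ab_cat (FObj F T) (FObj G T)\<^esub> \<eta> T"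
      show "\<exists>\<theta>\<in>Arr (fp_cat C) F G. \<theta> \<otimes>\<^bsub>Hom (fp_cat C) F G\<^esub> \<eta> = Zero (fp_cat C) F G"
      proof
        show "?m \<otimes>\<^bsub>Hom (fp_cat C) F G\<^esub> \<eta> = Zero (fp_cat C) F G"
          using e FG by (auto intro!: restrict_ext simp: fp_cat_Arr O)
        show "?m \<in> Arr (fp_cat C) F G"
          using e FG by (auto simp: fp_cat_Arr O H ab.Comp_neg_left ab.Comp_neg_right)
      qed
    next
      show "\<eta> \<otimes>\<^bsub>Hom (fp_cat C) F G\<^esub> \<theta> \<in> Arr (fp_cat C) F G"
        if "\<eta> \<in> Arr (fp_cat C) F G" "\<theta> \<in> Arr (fp_cat C) F G" for \<eta> \<theta>
        using that FG by (auto simp: fp_cat_Arr O H ab.Comp_add_left ab.Comp_add_right)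
      show "Zero (fp_cat C) F G \<in> Arr (fp_cat C) F G" using FG by (auto simp: fp_cat_Arr O H)
      show "\<one>\<^bsub>Hom (fp_cat C) F G\<^esub> \<otimes>\<^bsub>Hom (fp_cat C) F G\<^esub> \<eta> = \<eta>" if "\<eta> \<in> Arr (fp_cat C) F G" for \<eta>
        using that FG by (auto intro!: extensionalityI[of _ "Obj C"] simp: fp_cat_Arr O)
      show "\<eta> \<otimes>\<^bsub>Hom (fp_cat C) F G\<^esub> \<theta> = \<theta> \<otimes>\<^bsub>Hom (fp_cat C) F G\<^esub> \<eta>"
        if "\<eta> \<in> Arr (fp_cat C) F G" "\<theta> \<in> Arr (fp_cat C) F G" for \<eta> \<theta>
        using that FG by (auto intro!: restrict_ext ab.add_comm simp: fp_cat_Arr O)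
      show "\<eta> \<otimes>\<^bsub>Hom (fp_cat C) F G\<^esub> \<theta> \<otimes>\<^bsub>Hom (fp_cat C) F G\<^esub> \<zeta> = \<eta> \<otimes>\<^bsub>Hom (fp_cat C) F G\<^esub> (\<theta> \<otimes>\<^bsub>Hom (fp_cat C) F G\<^esub> \<zeta>)"
        if "\<eta> \<in> Arr (fp_cat C) F G" "\<theta> \<in> Arr (fp_cat C) F G" "\<zeta> \<in> Arr (fp_cat C) F G" for \<eta> \<theta> \<zeta>
        using that FG by (auto intro!: restrict_ext ab.add_assoc simp: fp_cat_Arr O)
    qed
  next
    fix F :: "('o,'a,'g) contravariant" assume "F \<in> Obj (fp_cat C)"
    then show "Ident (fp_cat C) F \<in> Arr (fp_cat C) F F"
      by (auto simp: fp_cat_Arr O H)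
  next
    fix F G K :: "('o,'a,'g) contravariant" and \<eta> \<theta>
    assume a: "F \<in> Obj (fp_cat C)" "G \<in> Obj (fp_cat C)" "K \<in> Obj (fp_cat C)"
      "\<eta> \<in> Arr (fp_cat C) F G" "\<theta> \<in> Arr (fp_cat C) G K"
    then have FG: "finitely_presented C F" "finitely_presented C G" "finitely_presented C K" by simp_all
    have "Comp ab_cat (FObj F T) (FObj F T') (FObj K T') (Comp ab_cat (FObj F T') (FObj G T') (FObj K T') (\<theta> T') (\<eta> T')) (FArr F T T' u)
       = Comp ab_cat (FObj F T) (FObj K T) (FObj K T') (FArr K T T' u) (Comp ab_cat (FObj F T) (FObj G T) (FObj K T) (\<theta> T) (\<eta> T))"
      if t: "T \<in> Obj C" "T' \<in> Obj C" "u \<in> Arr C T' T" for T T' u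
    proof -
      have 1: "\<eta> T \<in> Arr ab_cat (FObj F T) (FObj G T)" "\<theta> T \<in> Arr ab_cat (FObj G T) (FObj K T)" if "T \<in> Obj C" for T
        using a that by (auto simp: fp_cat_Arr)
      have "Comp ab_cat (FObj F T) (FObj F T') (FObj G T') (\<eta> T') (FArr F T T' u)
          = Comp ab_cat (FObj F T) (FObj G T) (FObj G T') (FArr G T T' u) (\<eta> T)"
        "Comp ab_cat (FObj G T) (FObj G T') (FObj K T') (\<theta> T') (FArr G T T' u)
          = Comp ab_cat (FObj G T) (FObj K T) (FObj K T') (FArr K T T' u) (\<theta> T)"
        using a t by (auto simp: fp_cat_Arr)
      note 2 = this
      have "Comp ab_cat (FObj F T) (FObj F T') (FObj K T') (Comp ab_cat (FObj F T') (FObj G T') (FObj K T') (\<theta> T') (\<eta> T')) (FArr F T T' u)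
        = Comp ab_cat (FObj F T) (FObj G T') (FObj K T') (\<theta> T') (Comp ab_cat (FObj F T) (FObj G T) (FObj G T') (FArr G T T' u) (\<eta> T))"
        using FG t 1 by (simp add: O H ab.Comp_assoc' flip: 2(1))
      also have "\<dots> = Comp ab_cat (FObj F T) (FObj G T) (FObj K T') (Comp ab_cat (FObj G T) (FObj K T) (FObj K T') (FArr K T T' u) (\<theta> T)) (\<eta> T)"
        using FG t 1 by (simp add: O H ab.Comp_assoc flip: 2(2))
      finally show ?thesis using FG t 1 by (simp add: O H ab.Comp_assoc)
    qed
    then show "Comp (fp_cat C) F G K \<theta> \<eta> \<in> Arr (fp_cat C) F K"
      using a FG by (auto simp: fp_cat_Arr O H)
    fix L \<zeta> assume "L \<in> Obj (fp_cat C)" "\<zeta> \<in> Arr (fp_cat C) K L"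
    then show "Comp (fp_cat C) F K L \<zeta> (Comp (fp_cat C) F G K \<theta> \<eta>)
        = Comp (fp_cat C) F G L (Comp (fp_cat C) G K L \<zeta> \<theta>) \<eta>"
      using a by (auto intro!: restrict_ext simp: fp_cat_Arr O ab.Comp_assoc)
  next
    fix F G :: "('o,'a,'g) contravariant" and \<eta> assume "F \<in> Obj (fp_cat C)" "G \<in> Obj (fp_cat C)" "\<eta> \<in> Arr (fp_cat C) F G"
    then show "Comp (fp_cat C) F G G (Ident (fp_cat C) G) \<eta> = \<eta>" "Comp (fp_cat C) F F G \<eta> (Ident (fp_cat C) F) = \<eta>"
      by (auto intro!: extensionalityI[of _ "Obj C"] simp: fp_cat_Arr O)
  next
    fix F G K :: "('o,'a,'g) contravariant" and \<eta> \<theta> \<theta>'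
    assume "F \<in> Obj (fp_cat C)" "G \<in> Obj (fp_cat C)" "K \<in> Obj (fp_cat C)"
      "\<eta> \<in> Arr (fp_cat C) F G" "\<theta> \<in> Arr (fp_cat C) G K" "\<theta>' \<in> Arr (fp_cat C) G K"
    then show "Comp (fp_cat C) F G K (\<theta> \<otimes>\<^bsub>Hom (fp_cat C) G K\<^esub> \<theta>') \<eta>
       = Comp (fp_cat C) F G K \<theta> \<eta> \<otimes>\<^bsub>Hom (fp_cat C) F K\<^esub> Comp (fp_cat C) F G K \<theta>' \<eta>"
      by (auto intro!: restrict_ext simp: fp_cat_Arr O ab.Comp_add_left)
  next
    fix F G K :: "('o,'a,'g) contravariant" and \<eta> \<theta> \<theta>'
    assume "F \<in> Obj (fp_cat C)" "G \<in> Obj (fp_cat C)" "K \<in> Obj (fp_cat C)"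
      "\<theta> \<in> Arr (fp_cat C) F G" "\<theta>' \<in> Arr (fp_cat C) F G" "\<eta> \<in> Arr (fp_cat C) G K"
    then show "Comp (fp_cat C) F G K \<eta> (\<theta> \<otimes>\<^bsub>Hom (fp_cat C) F G\<^esub> \<theta>')
       = Comp (fp_cat C) F G K \<eta> \<theta> \<otimes>\<^bsub>Hom (fp_cat C) F K\<^esub> Comp (fp_cat C) F G K \<eta> \<theta>'"
      by (auto intro!: restrict_ext simp: fp_cat_Arr O ab.Comp_add_right)
  qed
qed

lemma arrow_cat_simps [simp]:
  "(A, B, f) \<in> Obj (arrow_cat C) \<longleftrightarrow> A \<in> Obj C \<and> B \<in> Obj C \<and> f \<in> Arr C A B"
  "(a, b) \<in> Arr (arrow_cat C) (A, B, f) (A', B', f') \<longleftrightarrow> a \<in> Arr C A A' \<and> b \<in> Arr C B B' \<and>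
        Comp C A A' B' f' a = Comp C A B B' b f"
  "Zero (arrow_cat C) (A, B, f) (A', B', f') = (Zero C A A', Zero C B B')"
  "(a1, b1) \<otimes>\<^bsub>Hom (arrow_cat C) (A, B, f) (A', B', f')\<^esub> (a2, b2)
    = (a1 \<otimes>\<^bsub>Hom C A A'\<^esub> a2, b1 \<otimes>\<^bsub>Hom C B B'\<^esub> b2)"
  "Comp (arrow_cat C) (A, B, f) (A', B', f') (A'', B'', f'') (a', b') (a, b)
    = (Comp C A A' A'' a' a, Comp C B B' B'' b' b)"
  "Ident (arrow_cat C) (A, B, f) = (Ident C A, Ident C B)"
  by (simp_all add: arrow_cat_def DirProd_def)

lemma (in preadditive_category) arrow_cat_preadditive: "preadditive_category (arrow_cat C)"
proof (rule preadditive_category.intro)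
  fix x y assume "x \<in> Obj (arrow_cat C)" "y \<in> Obj (arrow_cat C)"
  moreover obtain A B f A' B' f' where "x = (A, B, f)" "y = (A', B', f')" by (metis prod_cases3)
  ultimately have xy: "x = (A, B, f)" "y = (A', B', f')" "A \<in> Obj C" "B \<in> Obj C" "f \<in> Arr C A B"
    "A' \<in> Obj C" "B' \<in> Obj C" "f' \<in> Arr C A' B'" by auto
  show "comm_group (Hom (arrow_cat C) x y)"
  proof (rule comm_groupI)
    fix u assume "u \<in> Arr (arrow_cat C) x y"
    then obtain a b where u: "u = (a, b)" "(a, b) \<in> Arr (arrow_cat C) x y" by (cases u) auto
    show "\<exists>v\<in>Arr (arrow_cat C) x y. v \<otimes>\<^bsub>Hom (arrow_cat C) x y\<^esub> u = Zero (arrow_cat C) x y"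
      using u xy by (intro bexI[of _ "(inv\<^bsub>Hom C A A'\<^esub> a, inv\<^bsub>Hom C B B'\<^esub> b)"])
        (auto simp: Comp_neg_left Comp_neg_right)
  qed (use xy in \<open>auto simp: Comp_add_left Comp_add_right intro: add_comm add_assoc\<close>)
next
  fix x y z u v assume "x \<in> Obj (arrow_cat C)" "y \<in> Obj (arrow_cat C)" "z \<in> Obj (arrow_cat C)"
    "u \<in> Arr (arrow_cat C) x y" "v \<in> Arr (arrow_cat C) y z"
  then show "Comp (arrow_cat C) x y z v u \<in> Arr (arrow_cat C) x z"
    by (cases x; cases y; cases z; cases u; cases v) (auto simp: Comp_assoc, metis Comp_assoc)
qed (auto simp: Comp_add_left Comp_add_right Comp_assoc)

section \<open>Kernels, cokernels and isomorphisms\<close>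

context preadditive_category
begin

lemma kernel_cancel:
  assumes "is_kernel C K i A f B" "T \<in> Obj C" "s \<in> Arr C T K" "t \<in> Arr C T K"
    "Comp C T K A i s = Comp C T K A i t"
  shows "s = t"
proof -
  have k: "K \<in> Obj C" "A \<in> Obj C" "B \<in> Obj C" "i \<in> Arr C K A" "f \<in> Arr C A B" "Comp C K A B f i = Zero C K B"
    using assms(1) by (auto simp: is_kernel_def)
  have "Comp C T A B f (Comp C T K A i s) = Zero C T B"
    using k assms(2,3) by (simp add: Comp_assoc)
  then have "\<exists>!r. r \<in> Arr C T K \<and> Comp C T K A i r = Comp C T K A i s"
    using assms(1,2,3) k unfolding is_kernel_def by simp
  then show ?thesis using assms by metis
qed

lemma kernel_lift:
  assumes "is_kernel C K i A f B" "T \<in> Obj C" "t \<in> Arr C T A" "Comp C T A B f t = Zero C T B"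
  obtains s where "s \<in> Arr C T K" "Comp C T K A i s = t"
  using assms unfolding is_kernel_def by metis

lemma kernel_monic:
  assumes "is_kernel C K i A f B" shows "monic C K i A"
  using kernel_cancel[OF assms] assms by (simp add: monic_def is_kernel_def)

lemma cokernel_cancel:
  assumes "is_cokernel C A f B p D" "T \<in> Obj C" "s \<in> Arr C D T" "t \<in> Arr C D T"
    "Comp C B D T s p = Comp C B D T t p"
  shows "s = t"
proof -
  have k: "D \<in> Obj C" "A \<in> Obj C" "B \<in> Obj C" "p \<in> Arr C B D" "f \<in> Arr C A B" "Comp C A B D p f = Zero C A D"
    using assms(1) by (auto simp: is_cokernel_def)
  have "Comp C A B T (Comp C B D T s p) f = Zero C A T"
    using k assms(2,3) by (simp add: Comp_assoc')
  then have "\<exists>!r. r \<in> Arr C D T \<and> Comp C B D T r p = Comp C B D T s p"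
    using assms(1,2,3) k unfolding is_cokernel_def by simp
  then show ?thesis using assms by metis
qed

lemma cokernel_lift:
  assumes "is_cokernel C A f B p D" "T \<in> Obj C" "t \<in> Arr C B T" "Comp C A B T t f = Zero C A T"
  obtains s where "s \<in> Arr C D T" "Comp C B D T s p = t"
  using assms unfolding is_cokernel_def by metis

lemma cokernel_epi:
  assumes "is_cokernel C A f B p D" shows "epi C B p D"
  using cokernel_cancel[OF assms] assms by (simp add: epi_def is_cokernel_def)

lemma epi_comp:
  assumes "epi C A f B" "epi C B g D"
  shows "epi C A (Comp C A B D g f) D"
proof -
  have O: "A \<in> Obj C" "B \<in> Obj C" "D \<in> Obj C" "f \<in> Arr C A B" "g \<in> Arr C B D"
    using assms by (auto simp: epi_def)
  show ?thesis unfolding epi_def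
  proof (intro conjI ballI impI)
    fix T s t assume T: "T \<in> Obj C" "s \<in> Arr C D T" "t \<in> Arr C D T"
      "Comp C A D T s (Comp C A B D g f) = Comp C A D T t (Comp C A B D g f)"
    then have "Comp C A B T (Comp C B D T s g) f = Comp C A B T (Comp C B D T t g) f"
      using O by (simp add: Comp_assoc)
    then have "Comp C B D T s g = Comp C B D T t g" using assms(1) T O unfolding epi_def by simp
    then show "s = t" using assms(2) T unfolding epi_def by blast
  qed (use O in auto)
qed

lemma epi_factor:
  assumes "epi C A (Comp C A B D g f) D" "f \<in> Arr C A B" "g \<in> Arr C B D" "B \<in> Obj C"
  shows "epi C B g D"
proof -
  have O: "A \<in> Obj C" "D \<in> Obj C" using assms by (auto simp: epi_def)
  show ?thesis unfolding epi_def
  proof (intro conjI ballI impI)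
    fix T s t assume T: "T \<in> Obj C" "s \<in> Arr C D T" "t \<in> Arr C D T" "Comp C B D T s g = Comp C B D T t g"
    then have "Comp C A D T s (Comp C A B D g f) = Comp C A D T t (Comp C A B D g f)"
      using O assms by (simp add: Comp_assoc)
    then show "s = t" using assms(1) T unfolding epi_def by blast
  qed (use O assms in auto)
qed

lemma iso_sym:
  assumes "iso_arr C A f B"
  obtains g where "iso_arr C B g A" "Comp C A B A g f = Ident C A" "Comp C B A B f g = Ident C B" "g \<in> Arr C B A"
  using assms that unfolding iso_arr_def by auto

lemma iso_Ident: "A \<in> Obj C \<Longrightarrow> iso_arr C A (Ident C A) A"
  unfolding iso_arr_def by (auto intro!: bexI[of _ "Ident C A"])

lemma iso_epi:
  assumes "iso_arr C A f B" shows "epi C A f B"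
proof -
  obtain g where g: "Comp C B A B f g = Ident C B" "g \<in> Arr C B A" using iso_sym[OF assms] by metis
  show ?thesis unfolding epi_def using assms
  proof (auto simp: iso_arr_def)
    fix T s t assume H: "A \<in> Obj C" "B \<in> Obj C" "f \<in> Arr C A B" "T \<in> Obj C" "s \<in> Arr C B T" "t \<in> Arr C B T"
      "Comp C A B T s f = Comp C A B T t f"
    then have "Comp C B A T (Comp C A B T s f) g = Comp C B A T (Comp C A B T t f) g" by simp
    then show "s = t" using H(1-6) g by (simp add: Comp_assoc')
  qed
qed

lemma cokernel_unique:
  assumes "is_cokernel C A f B p D" "is_cokernel C A f B p' D'"
  obtains k where "iso_arr C D k D'" "Comp C B D D' k p = p'" "k \<in> Arr C D D'"
proof -
  have O: "A \<in> Obj C" "B \<in> Obj C" "D \<in> Obj C" "D' \<in> Obj C" "p \<in> Arr C B D" "p' \<in> Arr C B D'"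
    using assms by (auto simp: is_cokernel_def)
  obtain k where k: "k \<in> Arr C D D'" "Comp C B D D' k p = p'"
    using cokernel_lift[OF assms(1), of D' p'] assms(2) O by (auto simp: is_cokernel_def)
  obtain l where l: "l \<in> Arr C D' D" "Comp C B D' D l p' = p"
    using cokernel_lift[OF assms(2), of D p] assms(1) O by (auto simp: is_cokernel_def)
  have "Comp C D D' D l k = Ident C D"
    by (rule cokernel_cancel[OF assms(1), of D]) (use O k l in \<open>auto simp: Comp_assoc'\<close>)
  moreover have "Comp C D' D D' k l = Ident C D'"
    by (rule cokernel_cancel[OF assms(2), of D']) (use O k l in \<open>auto simp: Comp_assoc'\<close>)
  ultimately show ?thesis using that k l O by (auto simp: iso_arr_def)
qed

lemma cok_is_cokernel:
  assumes "is_cokernel C A f B p D"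
  shows "is_cokernel C A f B (cok_map C (A, B, f)) (cok_obj C (A, B, f))"
proof -
  have "case (SOME (D, p). is_cokernel C A f B p D) of (D, p) \<Rightarrow> is_cokernel C A f B p D"
    by (rule someI[of _ "(D, p)"]) (use assms in simp)
  then show ?thesis by (simp add: cok_def split: prod.splits)
qed

end

section \<open>Ideals and factor categories\<close>

locale category_ideal = preadditive_category C for C :: "('o, 'a) precat" +
  fixes I :: "'o \<Rightarrow> 'o \<Rightarrow> 'a set"
  assumes I_subgroup: "\<lbrakk>A \<in> Obj C; B \<in> Obj C\<rbrakk> \<Longrightarrow> subgroup (I A B) (Hom C A B)"
    and I_Comp_left: "\<lbrakk>A \<in> Obj C; B \<in> Obj C; D \<in> Obj C; f \<in> I A B; g \<in> Arr C B D\<rbrakk> \<Longrightarrow> Comp C A B D g f \<in> I A D"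
    and I_Comp_right: "\<lbrakk>A \<in> Obj C; B \<in> Obj C; D \<in> Obj C; f \<in> Arr C A B; g \<in> I B D\<rbrakk> \<Longrightarrow> Comp C A B D g f \<in> I A D"
begin

abbreviation cls where "cls A B f \<equiv> I A B #>\<^bsub>Hom C A B\<^esub> f"

lemma I_Arr: "\<lbrakk>A \<in> Obj C; B \<in> Obj C; f \<in> I A B\<rbrakk> \<Longrightarrow> f \<in> Arr C A B"
  by (rule subgroup.mem_carrier[OF I_subgroup])

lemma I_zero: "\<lbrakk>A \<in> Obj C; B \<in> Obj C\<rbrakk> \<Longrightarrow> Zero C A B \<in> I A B"
  by (rule subgroup.one_closed[OF I_subgroup])

lemma I_add: "\<lbrakk>A \<in> Obj C; B \<in> Obj C; f \<in> I A B; g \<in> I A B\<rbrakk> \<Longrightarrow> f \<otimes>\<^bsub>Hom C A B\<^esub> g \<in> I A B"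
  by (rule subgroup.m_closed[OF I_subgroup])

lemma cls_eq_iff:
  "\<lbrakk>A \<in> Obj C; B \<in> Obj C; f \<in> Arr C A B; g \<in> Arr C A B\<rbrakk>
    \<Longrightarrow> cls A B f = cls A B g \<longleftrightarrow> (\<exists>i\<in>I A B. f = g \<otimes>\<^bsub>Hom C A B\<^esub> i)"
  using comm_group.coset_eq_iff[OF Hom_comm_group I_subgroup] by simp

lemma cls_memD:
  assumes "A \<in> Obj C" "B \<in> Obj C" "f \<in> Arr C A B" "g \<in> cls A B f"
  shows "g \<in> Arr C A B" "cls A B g = cls A B f"
  using comm_group.coset_mem_iff[OF Hom_comm_group[OF assms(1,2)] I_subgroup[OF assms(1,2)] assms(3,4)]
  by simp_all

lemma cls_self: "\<lbrakk>A \<in> Obj C; B \<in> Obj C; f \<in> Arr C A B\<rbrakk> \<Longrightarrow> f \<in> cls A B f"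
  using group.rcos_self[OF hom_group _ I_subgroup] by simp

lemma cls_some: "\<lbrakk>A \<in> Obj C; B \<in> Obj C; f \<in> Arr C A B\<rbrakk>
    \<Longrightarrow> (SOME g. g \<in> cls A B f) \<in> Arr C A B \<and> cls A B (SOME g. g \<in> cls A B f) = cls A B f"
  using cls_memD[OF _ _ _ someI[of "\<lambda>g. g \<in> cls A B f", OF cls_self]] by simp

lemma factor_simps [simp]:
  "Obj (factor_cat C I) = Obj C"
  "Arr (factor_cat C I) A B = cls A B ` Arr C A B"
  "Zero (factor_cat C I) A B = I A B"
  "Ident (factor_cat C I) A = cls A A (Ident C A)"
  by (simp_all add: factor_cat_def carrier_Mod)

lemma factor_mult [simp]:
  "\<lbrakk>A \<in> Obj C; B \<in> Obj C; f \<in> Arr C A B; g \<in> Arr C A B\<rbrakk>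
    \<Longrightarrow> cls A B f \<otimes>\<^bsub>Hom (factor_cat C I) A B\<^esub> cls A B g = cls A B (f \<otimes>\<^bsub>Hom C A B\<^esub> g)"
  using comm_group.Mod_mult[OF Hom_comm_group I_subgroup] by (simp add: factor_cat_def)

text \<open>This is why all the cosets in the union that defines the composition of a factor category coincide.\<close>

lemma cls_Comp:
  assumes "A \<in> Obj C" "B \<in> Obj C" "D \<in> Obj C" "f \<in> Arr C A B" "g \<in> Arr C B D"
    "f' \<in> Arr C A B" "g' \<in> Arr C B D" "cls A B f = cls A B f'" "cls B D g = cls B D g'"
  shows "cls A D (Comp C A B D g f) = cls A D (Comp C A B D g' f')"
proof -
  obtain i where i: "i \<in> I A B" "f = f' \<otimes>\<^bsub>Hom C A B\<^esub> i" using assms cls_eq_iff by auto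
  obtain j where j: "j \<in> I B D" "g = g' \<otimes>\<^bsub>Hom C B D\<^esub> j" using assms cls_eq_iff by auto
  have ij: "i \<in> Arr C A B" "j \<in> Arr C B D" using assms i j I_Arr by auto
  have "Comp C A B D g f = Comp C A B D g' f' \<otimes>\<^bsub>Hom C A D\<^esub> (Comp C A B D g' i \<otimes>\<^bsub>Hom C A D\<^esub> Comp C A B D j f)"
  proof -
    have "Comp C A B D g f = Comp C A B D g' f \<otimes>\<^bsub>Hom C A D\<^esub> Comp C A B D j f"
      unfolding j(2) using assms ij by (simp add: Comp_add_left)
    moreover have "Comp C A B D g' f = Comp C A B D g' f' \<otimes>\<^bsub>Hom C A D\<^esub> Comp C A B D g' i"
      unfolding i(2) using assms ij by (simp add: Comp_add_right)
    ultimately show ?thesis using assms(1-7) ij by (simp add: add_assoc)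
  qed
  moreover have "Comp C A B D g' i \<otimes>\<^bsub>Hom C A D\<^esub> Comp C A B D j f \<in> I A D"
    using assms i j by (intro I_add I_Comp_left I_Comp_right) auto
  ultimately have "\<exists>i\<in>I A D. Comp C A B D g f = Comp C A B D g' f' \<otimes>\<^bsub>Hom C A D\<^esub> i" by blast
  then show ?thesis
    using cls_eq_iff[of A D "Comp C A B D g f" "Comp C A B D g' f'"] assms(1-7) by simp
qed

lemma factor_Comp [simp]:
  assumes "A \<in> Obj C" "B \<in> Obj C" "D \<in> Obj C" "f \<in> Arr C A B" "g \<in> Arr C B D"
  shows "Comp (factor_cat C I) A B D (cls B D g) (cls A B f) = cls A D (Comp C A B D g f)"
proof -
  have *: "cls A D (Comp C A B D v u) = cls A D (Comp C A B D g f)" if "v \<in> cls B D g" "u \<in> cls A B f" for u v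
    using cls_Comp[OF assms(1-3) cls_memD(1)[OF assms(1,2,4) that(2)] cls_memD(1)[OF assms(2,3,5) that(1)] assms(4,5)]
      cls_memD(2)[OF assms(1,2,4) that(2)] cls_memD(2)[OF assms(2,3,5) that(1)] by simp
  have ne: "cls A B f \<noteq> {}" "cls B D g \<noteq> {}" using assms cls_self by blast+
  have "(\<Union>v\<in>cls B D g. \<Union>u\<in>cls A B f. cls A D (Comp C A B D v u))
     = (\<Union>v\<in>cls B D g. \<Union>u\<in>cls A B f. cls A D (Comp C A B D g f))"
    by (rule SUP_cong[OF refl], rule SUP_cong[OF refl], rule *)
  also have "\<dots> = cls A D (Comp C A B D g f)" using ne by simp
  finally have "(\<Union>v\<in>cls B D g. \<Union>u\<in>cls A B f. cls A D (Comp C A B D v u)) = cls A D (Comp C A B D g f)" .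
  then show ?thesis by (simp add: factor_cat_def)
qed

lemma factor_preadditive: "preadditive_category (factor_cat C I)"
proof (rule preadditive_category.intro)
  fix A B assume "A \<in> Obj (factor_cat C I)" "B \<in> Obj (factor_cat C I)"
  then have "comm_group (Hom C A B Mod I A B)"
    by (intro comm_group.abelian_Mod) (auto simp: Hom_comm_group I_subgroup)
  then show "comm_group (Hom (factor_cat C I) A B)" by (simp add: factor_cat_def)
qed (auto simp: Comp_assoc Comp_add_left Comp_add_right)

end

context preadditive_category
begin

lemma factoring_throughI:
  "\<lbrakk>P \<in> S; P \<in> Obj C; f \<in> Arr C A P; g \<in> Arr C P B\<rbrakk> \<Longrightarrow> Comp C A P B g f \<in> factoring_through C S A B"
  unfolding factoring_through_def by auto

lemma factoring_throughE:
  assumes "h \<in> factoring_through C S A B"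
  obtains P f g where "P \<in> S" "P \<in> Obj C" "f \<in> Arr C A P" "g \<in> Arr C P B" "h = Comp C A P B g f"
  using assms unfolding factoring_through_def by auto

lemma factoring_through_Arr:
  "\<lbrakk>A \<in> Obj C; B \<in> Obj C; h \<in> factoring_through C S A B\<rbrakk> \<Longrightarrow> h \<in> Arr C A B"
  by (auto elim!: factoring_throughE)

lemma factoring_through_left:
  assumes "A \<in> Obj C" "B \<in> Obj C" "D \<in> Obj C" "f \<in> factoring_through C S A B" "g \<in> Arr C B D"
  shows "Comp C A B D g f \<in> factoring_through C S A D"
  using assms(4)
proof (rule factoring_throughE)
  fix P u v assume "P \<in> S" "P \<in> Obj C" "u \<in> Arr C A P" "v \<in> Arr C P B" "f = Comp C A P B v u"
  then show ?thesis using assms factoring_throughI[of P S u A "Comp C P B D g v" D]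
    by (simp add: Comp_assoc)
qed

lemma factoring_through_right:
  assumes "A \<in> Obj C" "B \<in> Obj C" "D \<in> Obj C" "f \<in> Arr C A B" "g \<in> factoring_through C S B D"
  shows "Comp C A B D g f \<in> factoring_through C S A D"
  using assms(5)
proof (rule factoring_throughE)
  fix P u v assume "P \<in> S" "P \<in> Obj C" "u \<in> Arr C B P" "v \<in> Arr C P D" "g = Comp C B P D v u"
  then show ?thesis using assms factoring_throughI[of P S "Comp C A B P u f" A v D]
    by (simp add: Comp_assoc)
qed

lemma factoring_through_ideal:
  assumes ne: "S \<inter> Obj C \<noteq> {}"
    and add: "\<And>A B f g. \<lbrakk>A \<in> Obj C; B \<in> Obj C; f \<in> factoring_through C S A B; g \<in> factoring_through C S A B\<rbrakk>
      \<Longrightarrow> f \<otimes>\<^bsub>Hom C A B\<^esub> g \<in> factoring_through C S A B"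
  shows "category_ideal C (factoring_through C S)"
proof (intro category_ideal.intro category_ideal_axioms.intro preadditive_category_axioms)
  fix A B assume AB: "A \<in> Obj C" "B \<in> Obj C"
  interpret comm_group "Hom C A B" using AB Hom_comm_group by simp
  obtain P where P: "P \<in> S" "P \<in> Obj C" using ne by auto
  have "Comp C A P B (Zero C P B) (Zero C A P) \<in> factoring_through C S A B"
    using P AB by (intro factoring_throughI) auto
  then have "factoring_through C S A B \<noteq> {}" by auto
  moreover have "inv\<^bsub>Hom C A B\<^esub> f \<in> factoring_through C S A B" if f: "f \<in> factoring_through C S A B" for f
  proof -
    have "Comp C A B B (inv\<^bsub>Hom C B B\<^esub> Ident C B) f \<in> factoring_through C S A B"
      using AB f by (intro factoring_through_left) auto
    then show ?thesis using AB factoring_through_Arr[OF AB f] by (simp add: Comp_neg_left)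
  qed
  ultimately show "subgroup (factoring_through C S A B) (Hom C A B)"
    using add[OF AB] factoring_through_Arr[OF AB] by (intro subgroupI) auto
next
  show "Comp C A B D g f \<in> factoring_through C S A D"
    if "A \<in> Obj C" "B \<in> Obj C" "D \<in> Obj C" "f \<in> factoring_through C S A B" "g \<in> Arr C B D" for A B D f g
    using that by (rule factoring_through_left)
  show "Comp C A B D g f \<in> factoring_through C S A D"
    if "A \<in> Obj C" "B \<in> Obj C" "D \<in> Obj C" "f \<in> Arr C A B" "g \<in> factoring_through C S B D" for A B D f g
    using that by (rule factoring_through_right)
qed

lemma biproduct_factor:
  assumes "biproduct C P Q S i j p q" "A \<in> Obj C" "B \<in> Obj C" "f \<in> Arr C A P" "g \<in> Arr C P B"
    "f' \<in> Arr C A Q" "g' \<in> Arr C Q B"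
  shows "Comp C A P B g f \<otimes>\<^bsub>Hom C A B\<^esub> Comp C A Q B g' f' =
    Comp C A S B (Comp C S P B g p \<otimes>\<^bsub>Hom C S B\<^esub> Comp C S Q B g' q)
      (Comp C A P S i f \<otimes>\<^bsub>Hom C A S\<^esub> Comp C A Q S j f')"
proof -
  note b = assms(1)[unfolded biproduct_def]
  have "Comp C A S P p (Comp C A P S i f) = f" "Comp C A S Q q (Comp C A P S i f) = Zero C A Q"
     "Comp C A S P p (Comp C A Q S j f') = Zero C A P" "Comp C A S Q q (Comp C A Q S j f') = f'"
    using b assms by (simp_all add: Comp_assoc)
  then show ?thesis using b assms by (simp add: Comp_add_left Comp_add_right Comp_assoc')
qed

text \<open>A morphism through \<open>P\<close> plus a morphism through \<open>Q\<close> is a morphism through the biproduct of \<open>P\<close> and \<open>Q\<close>.\<close>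

lemma factoring_through_add:
  assumes "A \<in> Obj C" "B \<in> Obj C" "f \<in> factoring_through C S A B" "g \<in> factoring_through C S A B"
    and bi: "\<And>P Q. P \<in> S \<inter> Obj C \<Longrightarrow> Q \<in> S \<inter> Obj C \<Longrightarrow> \<exists>B\<in>S. \<exists>i j p q. biproduct C P Q B i j p q"
  shows "f \<otimes>\<^bsub>Hom C A B\<^esub> g \<in> factoring_through C S A B"
proof -
  obtain P a b where P: "P \<in> S" "P \<in> Obj C" "a \<in> Arr C A P" "b \<in> Arr C P B" "f = Comp C A P B b a"
    using assms(3) by (rule factoring_throughE)
  obtain Q a' b' where Q: "Q \<in> S" "Q \<in> Obj C" "a' \<in> Arr C A Q" "b' \<in> Arr C Q B" "g = Comp C A Q B b' a'"
    using assms(4) by (rule factoring_throughE)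
  obtain D i j p q where D: "D \<in> S" "biproduct C P Q D i j p q" using bi P Q by blast
  have "Comp C A D B (Comp C D P B b p \<otimes>\<^bsub>Hom C D B\<^esub> Comp C D Q B b' q)
      (Comp C A P D i a \<otimes>\<^bsub>Hom C A D\<^esub> Comp C A Q D j a') \<in> factoring_through C S A B"
    using D P Q assms(1,2) by (intro factoring_throughI) (auto simp: biproduct_def)
  then show ?thesis unfolding P(5) Q(5) using D P Q assms(1,2) by (subst biproduct_factor) auto
qed

end

section \<open>Equivalences of additive categories\<close>

lemma (in additive_functor) FArr_closed [simp]:
  "\<lbrakk>A \<in> Obj C; B \<in> Obj C; f \<in> Arr C A B\<rbrakk> \<Longrightarrow> FArr F A B f \<in> Arr D (FObj F A) (FObj F B)"
  using FArr_hom by (auto simp: hom_def)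

lemma (in additive_functor) FArr_add:
  "\<lbrakk>A \<in> Obj C; B \<in> Obj C; f \<in> Arr C A B; g \<in> Arr C A B\<rbrakk>
   \<Longrightarrow> FArr F A B (f \<otimes>\<^bsub>Hom C A B\<^esub> g) = FArr F A B f \<otimes>\<^bsub>Hom D (FObj F A) (FObj F B)\<^esub> FArr F A B g"
  using FArr_hom by (auto simp: hom_def)

lemma (in additive_functor) FArr_zero:
  assumes "A \<in> Obj C" "B \<in> Obj C"
  shows "FArr F A B (Zero C A B) = Zero D (FObj F A) (FObj F B)"
  using FArr_add[of A B "Zero C A B" "Zero C A B"] assms
  by (auto intro!: target.add_eq_self[of _ _ "FArr F A B (Zero C A B)"] simp: FObj_closed)

text \<open>The usual construction of a quasi-inverse: choose a preimage \<open>g Y\<close> of each object \<open>Y\<close>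
  together with an isomorphism \<open>e Y : F (g Y) \<rightarrow> Y\<close>, and transport morphisms along \<open>e\<close>.\<close>

lemma fully_faithful_dense_equivalence:
  assumes "additive_functor C D F"
    and bij: "\<And>A B. \<lbrakk>A \<in> Obj C; B \<in> Obj C\<rbrakk>
      \<Longrightarrow> bij_betw (FArr F A B) (Arr C A B) (Arr D (FObj F A) (FObj F B))"
    and dense: "\<And>Y. Y \<in> Obj D \<Longrightarrow> \<exists>A\<in>Obj C. \<exists>f. iso_arr D (FObj F A) f Y"
  shows "equivalence_of_categories C D F"
proof -
  interpret F: additive_functor C D F by fact
  note [simp] = F.FObj_closed F.FArr_Ident
  have "\<forall>Y\<in>Obj D. \<exists>A f f'. A \<in> Obj C \<and> f \<in> Arr D (FObj F A) Y \<and> f' \<in> Arr D Y (FObj F A) \<and>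
     Comp D (FObj F A) Y (FObj F A) f' f = Ident D (FObj F A) \<and> Comp D Y (FObj F A) Y f f' = Ident D Y"
    using dense unfolding iso_arr_def by metis
  then obtain g e e' where ge: "\<And>Y. Y \<in> Obj D \<Longrightarrow> g Y \<in> Obj C" "\<And>Y. Y \<in> Obj D \<Longrightarrow> e Y \<in> Arr D (FObj F (g Y)) Y"
    "\<And>Y. Y \<in> Obj D \<Longrightarrow> e' Y \<in> Arr D Y (FObj F (g Y))"
    "\<And>Y. Y \<in> Obj D \<Longrightarrow> Comp D (FObj F (g Y)) Y (FObj F (g Y)) (e' Y) (e Y) = Ident D (FObj F (g Y))"
    "\<And>Y. Y \<in> Obj D \<Longrightarrow> Comp D Y (FObj F (g Y)) Y (e Y) (e' Y) = Ident D Y"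
    by metis
  define m where "m A B v = inv_into (Arr C A B) (FArr F A B) v" for A B v
  have m: "m A B v \<in> Arr C A B" "FArr F A B (m A B v) = v"
    if "A \<in> Obj C" "B \<in> Obj C" "v \<in> Arr D (FObj F A) (FObj F B)" for A B v
    using bij[OF that(1,2)] that(3) unfolding m_def bij_betw_def
    by (auto intro: inv_into_into f_inv_into_f)
  have inj: "f = f'" if "A \<in> Obj C" "B \<in> Obj C" "f \<in> Arr C A B" "f' \<in> Arr C A B" "FArr F A B f = FArr F A B f'" for A B f f'
    using bij[OF that(1,2)] that(3-) by (auto simp: bij_betw_def dest: inj_onD)
  define t where "t Y Y' v = Comp D (FObj F (g Y)) Y' (FObj F (g Y')) (e' Y') (Comp D (FObj F (g Y)) Y Y' v (e Y))" for Y Y' v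
  have t: "t Y Y' v \<in> Arr D (FObj F (g Y)) (FObj F (g Y'))" if "Y \<in> Obj D" "Y' \<in> Obj D" "v \<in> Arr D Y Y'" for Y Y' v
    using that ge by (simp add: t_def)
  define G where "G = \<lparr>FObj = g, FArr = (\<lambda>Y Y' v. m (g Y) (g Y') (t Y Y' v))\<rparr>"
  have G: "FObj G = g" "FArr G Y Y' v = m (g Y) (g Y') (t Y Y' v)" for Y Y' v by (simp_all add: G_def)
  have tcomp: "t Y Y'' (Comp D Y Y' Y'' w v) = Comp D (FObj F (g Y)) (FObj F (g Y')) (FObj F (g Y'')) (t Y' Y'' w) (t Y Y' v)"
    if Y: "Y \<in> Obj D" "Y' \<in> Obj D" "Y'' \<in> Obj D" "v \<in> Arr D Y Y'" "w \<in> Arr D Y' Y''" for Y Y' Y'' v w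
  proof -
    have "Comp D (FObj F (g Y)) (FObj F (g Y')) Y' (e Y') (t Y Y' v) = Comp D (FObj F (g Y)) Y Y' v (e Y)"
      unfolding t_def using Y ge by (simp add: F.target.Comp_assoc)
    then show ?thesis using Y ge t[of Y Y' v] unfolding t_def[of Y' Y''] t_def[of Y Y'']
      by (simp add: F.target.Comp_assoc')
  qed
  have Gf: "additive_functor D C G"
  proof (intro additive_functor.intro additive_functor_axioms.intro F.source.preadditive_category_axioms
      F.target.preadditive_category_axioms)
    fix Y Y' assume Y: "Y \<in> Obj D" "Y' \<in> Obj D"
    show "FArr G Y Y' \<in> hom (Hom D Y Y') (Hom C (FObj G Y) (FObj G Y'))"
    proof (rule homI)
      fix v w assume vw: "v \<in> Arr D Y Y'" "w \<in> Arr D Y Y'"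
      show "FArr G Y Y' (v \<otimes>\<^bsub>Hom D Y Y'\<^esub> w) = FArr G Y Y' v \<otimes>\<^bsub>Hom C (FObj G Y) (FObj G Y')\<^esub> FArr G Y Y' w"
        unfolding G using Y vw t m ge
        by (intro inj[of "g Y" "g Y'"]) (simp_all add: F.FArr_add t_def F.target.Comp_add_left F.target.Comp_add_right)
    qed (use Y t m ge in \<open>simp add: G\<close>)
  next
    fix Y assume Y: "Y \<in> Obj D"
    show "FArr G Y Y (Ident D Y) = Ident C (FObj G Y)"
      unfolding G using Y t m ge by (intro inj[of "g Y" "g Y"]) (simp_all add: t_def)
  next
    fix Y Y' Y'' v w assume Y: "Y \<in> Obj D" "Y' \<in> Obj D" "Y'' \<in> Obj D" "v \<in> Arr D Y Y'" "w \<in> Arr D Y' Y''"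
    show "FArr G Y Y'' (Comp D Y Y' Y'' w v) = Comp C (FObj G Y) (FObj G Y') (FObj G Y'') (FArr G Y' Y'' w) (FArr G Y Y' v)"
      unfolding G using Y t m ge tcomp by (intro inj[of "g Y" "g Y''"]) (simp_all add: F.FArr_Comp)
  qed (use ge in \<open>simp add: G\<close>)
  have 1: "naturally_isomorphic D D (comp_functor F G) id_functor"
    unfolding naturally_isomorphic_def
  proof (intro exI[of _ e] conjI ballI)
    fix Y assume Y: "Y \<in> Obj D"
    show "iso_arr D (FObj (comp_functor F G) Y) (e Y) (FObj id_functor Y)"
      using Y ge unfolding iso_arr_def by (auto simp: comp_functor_def id_functor_def G intro!: bexI[of _ "e' Y"])
    fix Y' v assume Y': "Y' \<in> Obj D" "v \<in> Arr D Y Y'"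
    have "Comp D (FObj F (g Y)) (FObj F (g Y')) Y' (e Y') (t Y Y' v) = Comp D (FObj F (g Y)) Y Y' v (e Y)"
      unfolding t_def using Y Y' ge by (simp add: F.target.Comp_assoc)
    then show "Comp D (FObj (comp_functor F G) Y) (FObj (comp_functor F G) Y') (FObj id_functor Y') (e Y') (FArr (comp_functor F G) Y Y' v)
      = Comp D (FObj (comp_functor F G) Y) (FObj id_functor Y) (FObj id_functor Y') (FArr id_functor Y Y' v) (e Y)"
      using Y Y' ge t m by (simp add: comp_functor_def id_functor_def G)
  qed
  define \<eta> where "\<eta> A = m A (g (FObj F A)) (e' (FObj F A))" for A
  have 2: "naturally_isomorphic C C id_functor (comp_functor G F)"
    unfolding naturally_isomorphic_def
  proof (intro exI[of _ \<eta>] conjI ballI)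
    have \<eta>: "\<eta> A \<in> Arr C A (g (FObj F A))" "FArr F A (g (FObj F A)) (\<eta> A) = e' (FObj F A)" if "A \<in> Obj C" for A
      using that ge m unfolding \<eta>_def by auto
    fix A assume A: "A \<in> Obj C"
    let ?\<theta> = "m (g (FObj F A)) A (e (FObj F A))"
    have \<theta>: "?\<theta> \<in> Arr C (g (FObj F A)) A" "FArr F (g (FObj F A)) A ?\<theta> = e (FObj F A)"
      using A ge m by auto
    have "Comp C A (g (FObj F A)) A ?\<theta> (\<eta> A) = Ident C A"
      using A ge \<eta> \<theta> by (intro inj[of A A]) (auto simp: F.FArr_Comp)
    moreover have "Comp C (g (FObj F A)) A (g (FObj F A)) (\<eta> A) ?\<theta> = Ident C (g (FObj F A))"
      using A ge \<eta> \<theta> by (intro inj[of "g (FObj F A)" "g (FObj F A)"]) (auto simp: F.FArr_Comp)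
    ultimately show "iso_arr C (FObj id_functor A) (\<eta> A) (FObj (comp_functor G F) A)"
      using A ge \<eta> \<theta> by (auto simp: iso_arr_def comp_functor_def id_functor_def G)
    fix B f assume B: "B \<in> Obj C" "f \<in> Arr C A B"
    have "Comp D (FObj F A) (FObj F (g (FObj F A))) (FObj F (g (FObj F B))) (t (FObj F A) (FObj F B) (FArr F A B f)) (e' (FObj F A))
       = Comp D (FObj F A) (FObj F B) (FObj F (g (FObj F B))) (e' (FObj F B)) (FArr F A B f)"
      unfolding t_def using A B ge by (simp add: F.target.Comp_assoc')
    then show "Comp C (FObj id_functor A) (FObj id_functor B) (FObj (comp_functor G F) B) (\<eta> B) (FArr id_functor A B f)
       = Comp C (FObj id_functor A) (FObj (comp_functor G F) A) (FObj (comp_functor G F) B) (FArr (comp_functor G F) A B f) (\<eta> A)"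
      using A B ge t m \<eta> unfolding comp_functor_def id_functor_def G afunctor.simps
      by (intro inj[of A "g (FObj F B)"]) (auto simp: F.FArr_Comp)
  qed
  show ?thesis unfolding equivalence_of_categories_def using Gf 1 2 assms(1) by auto
qed

lemma preimage_ideal:
  assumes "additive_functor C D F" and J: "category_ideal D J"
    and I: "\<And>A B. \<lbrakk>A \<in> Obj C; B \<in> Obj C\<rbrakk> \<Longrightarrow> I A B = {f \<in> Arr C A B. FArr F A B f \<in> J (FObj F A) (FObj F B)}"
  shows "category_ideal C I"
proof -
  interpret F: additive_functor C D F by fact
  interpret J: category_ideal D J by fact
  note [simp] = F.FObj_closed F.FArr_Ident
  show ?thesis
  proof (intro category_ideal.intro category_ideal_axioms.intro F.source.preadditive_category_axioms)
    fix A B assume AB: "A \<in> Obj C" "B \<in> Obj C"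
    interpret g: group "Hom C A B" using AB F.source.hom_group by simp
    interpret j: subgroup "J (FObj F A) (FObj F B)" "Hom D (FObj F A) (FObj F B)" using AB J.I_subgroup by simp
    have "FArr F A B (inv\<^bsub>Hom C A B\<^esub> f) = inv\<^bsub>Hom D (FObj F A) (FObj F B)\<^esub> FArr F A B f" if "f \<in> Arr C A B" for f
      using AB that F.FArr_add[of A B f "inv\<^bsub>Hom C A B\<^esub> f"]
      by (intro F.target.neg_unique[symmetric]) (auto simp: F.FArr_zero)
    moreover have "Zero C A B \<in> I A B" using AB by (auto simp: I F.FArr_zero)
    ultimately show "subgroup (I A B) (Hom C A B)"
      using AB by (intro g.subgroupI) (auto simp: I F.FArr_add j.m_inv_closed F.target.hom_group)
  qed (auto simp: I F.FArr_Comp J.I_Comp_left J.I_Comp_right)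
qed

text \<open>Fullness and density pass to the factor categories.  Dividing out exactly the morphisms that \<open>F\<close> sends
  into \<open>J\<close> makes the induced functor faithful: if \<open>F f\<close> and \<open>F g\<close> agree modulo \<open>J\<close>, then \<open>f\<close> and \<open>g\<close> differ by
  a morphism with image in \<open>J\<close>.\<close>

lemma full_dense_factor_equivalence:
  assumes "additive_functor C D F"
    and full: "\<And>A B. \<lbrakk>A \<in> Obj C; B \<in> Obj C\<rbrakk> \<Longrightarrow> FArr F A B ` Arr C A B = Arr D (FObj F A) (FObj F B)"
    and dense: "\<And>Y. Y \<in> Obj D \<Longrightarrow> \<exists>A\<in>Obj C. \<exists>f. iso_arr D (FObj F A) f Y"
    and J: "category_ideal D J"
    and I: "\<And>A B. \<lbrakk>A \<in> Obj C; B \<in> Obj C\<rbrakk> \<Longrightarrow> I A B = {f \<in> Arr C A B. FArr F A B f \<in> J (FObj F A) (FObj F B)}"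
  shows "\<exists>G. induces_on_factors C I D J F G \<and> equivalence_of_categories (factor_cat C I) (factor_cat D J) G"
proof -
  interpret F: additive_functor C D F by fact
  interpret J: category_ideal D J by fact
  note [simp] = F.FObj_closed F.FArr_Ident
  interpret I: category_ideal C I by (rule preimage_ideal[OF assms(1) J I])
  define G where "G = \<lparr>FObj = FObj F, FArr = (\<lambda>A B U. J.cls (FObj F A) (FObj F B) (FArr F A B (SOME u. u \<in> U)))\<rparr>"
  have eq: "J.cls (FObj F A) (FObj F B) (FArr F A B f) = J.cls (FObj F A) (FObj F B) (FArr F A B g) \<longleftrightarrow> I.cls A B f = I.cls A B g"
    if fg: "A \<in> Obj C" "B \<in> Obj C" "f \<in> Arr C A B" "g \<in> Arr C A B" for A B f g
  proof -
    obtain h where h: "h \<in> Arr C A B" "f = g \<otimes>\<^bsub>Hom C A B\<^esub> h" using F.source.difference[OF fg] .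
    have "I.cls A B f = I.cls A B g \<longleftrightarrow> h \<in> I A B"
    proof -
      have "(\<exists>i\<in>I A B. f = g \<otimes>\<^bsub>Hom C A B\<^esub> i) \<longleftrightarrow> h \<in> I A B"
        using fg h I.I_Arr by (metis F.source.add_left_cancel)
      then show ?thesis using fg I.cls_eq_iff by simp
    qed
    moreover have "J.cls (FObj F A) (FObj F B) (FArr F A B f) = J.cls (FObj F A) (FObj F B) (FArr F A B g)
       \<longleftrightarrow> FArr F A B h \<in> J (FObj F A) (FObj F B)"
    proof -
      have "(\<exists>i\<in>J (FObj F A) (FObj F B). FArr F A B f = FArr F A B g \<otimes>\<^bsub>Hom D (FObj F A) (FObj F B)\<^esub> i)
         \<longleftrightarrow> FArr F A B h \<in> J (FObj F A) (FObj F B)"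
        using fg h J.I_Arr by (auto simp: F.FArr_add)
      then show ?thesis using fg J.cls_eq_iff by simp
    qed
    ultimately show ?thesis using fg h I by auto
  qed
  have Gcls: "FArr G A B (I.cls A B f) = J.cls (FObj F A) (FObj F B) (FArr F A B f)"
    if "A \<in> Obj C" "B \<in> Obj C" "f \<in> Arr C A B" for A B f
    using that eq[of A B "SOME u. u \<in> I.cls A B f" f] I.cls_some[of A B f] by (simp add: G_def)
  have GO: "FObj G = FObj F" by (simp add: G_def)
  have "additive_functor (factor_cat C I) (factor_cat D J) G"
  proof (intro additive_functor.intro additive_functor_axioms.intro I.factor_preadditive J.factor_preadditive)
    fix A B assume "A \<in> Obj (factor_cat C I)" "B \<in> Obj (factor_cat C I)"
    then show "FArr G A B \<in> hom (Hom (factor_cat C I) A B) (Hom (factor_cat D J) (FObj G A) (FObj G B))"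
      by (auto simp: hom_def Gcls GO F.FArr_add)
  qed (auto simp: GO Gcls F.FArr_Comp)
  moreover have "bij_betw (FArr G A B) (Arr (factor_cat C I) A B) (Arr (factor_cat D J) (FObj G A) (FObj G B))"
    if "A \<in> Obj (factor_cat C I)" "B \<in> Obj (factor_cat C I)" for A B
    using that unfolding bij_betw_def
  proof (intro conjI inj_onI)
    have "FArr G A B ` Arr (factor_cat C I) A B = J.cls (FObj F A) (FObj F B) ` FArr F A B ` Arr C A B"
      using that Gcls by (force simp: image_image)
    then show "FArr G A B ` Arr (factor_cat C I) A B = Arr (factor_cat D J) (FObj G A) (FObj G B)"
      using that full by (simp add: GO)
  qed (auto simp: Gcls eq)
  moreover have "\<exists>A\<in>Obj (factor_cat C I). \<exists>f. iso_arr (factor_cat D J) (FObj G A) f Y" if Y: "Y \<in> Obj (factor_cat D J)" for Y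
  proof -
    obtain A f where A: "A \<in> Obj C" "iso_arr D (FObj F A) f Y" using dense[of Y] Y by auto
    then have "iso_arr (factor_cat D J) (FObj F A) (J.cls (FObj F A) Y f) Y"
      unfolding iso_arr_def by (auto intro!: rev_bexI)
    then show ?thesis using A by (auto simp: GO)
  qed
  ultimately have "equivalence_of_categories (factor_cat C I) (factor_cat D J) G"
    by (rule fully_faithful_dense_equivalence)
  moreover have "induces_on_factors C I D J F G"
    unfolding induces_on_factors_def using Gcls by (simp add: GO)
  ultimately show ?thesis by blast
qed

section \<open>Chain conditions\<close>

text \<open>Ideals of a commutative ring and submodules of a module are both subgroups of an abelian group that
  are stable under certain endomorphisms.  Arguing with a set \<open>\<Phi>\<close> of operators treats their chain
  conditions together.\<close>

locale operator_group = abelian_group G for G :: "('a, 'b) ring_scheme" (structure) +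
  fixes \<Phi> :: "('a \<Rightarrow> 'a) set"
  assumes \<Phi>_closed: "\<lbrakk>f \<in> \<Phi>; x \<in> carrier G\<rbrakk> \<Longrightarrow> f x \<in> carrier G"
    and \<Phi>_add: "\<lbrakk>f \<in> \<Phi>; x \<in> carrier G; y \<in> carrier G\<rbrakk> \<Longrightarrow> f (x \<oplus> y) = f x \<oplus> f y"

definition opsub :: "('a, 'b) ring_scheme \<Rightarrow> ('a \<Rightarrow> 'a) set \<Rightarrow> 'a set \<Rightarrow> bool" where
  "opsub G \<Phi> N \<longleftrightarrow> N \<subseteq> carrier G \<and> \<zero>\<^bsub>G\<^esub> \<in> N \<and> (\<forall>x\<in>N. \<forall>y\<in>N. x \<oplus>\<^bsub>G\<^esub> y \<in> N) \<and>
    (\<forall>x\<in>N. \<ominus>\<^bsub>G\<^esub> x \<in> N) \<and> (\<forall>f\<in>\<Phi>. \<forall>x\<in>N. f x \<in> N)"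

text \<open>\<open>chain_condition G \<Phi> ord K L\<close>: chains of submodules between \<open>K\<close> and \<open>L\<close> become stationary;
  \<open>ord\<close> is \<open>(\<subseteq>)\<close> for ascending and \<open>(\<supseteq>)\<close> for descending chains.  Speaking of intervals
  instead of subquotients avoids the formation of quotient modules.\<close>

definition chain_condition ::
  "('a, 'b) ring_scheme \<Rightarrow> ('a \<Rightarrow> 'a) set \<Rightarrow> ('a set \<Rightarrow> 'a set \<Rightarrow> bool) \<Rightarrow> 'a set \<Rightarrow> 'a set \<Rightarrow> bool" where
  "chain_condition G \<Phi> ord K L \<longleftrightarrow> (\<forall>C :: nat \<Rightarrow> 'a set.
    (\<forall>n. opsub G \<Phi> (C n) \<and> K \<subseteq> C n \<and> C n \<subseteq> L) \<longrightarrow> (\<forall>n. ord (C n) (C (Suc n))) \<longrightarrow>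
      (\<exists>N. \<forall>n\<ge>N. C n = C N))"

lemma chain_le:
  assumes "ord = (\<subseteq>) \<or> ord = (\<supseteq>)" "\<And>n. ord (C n) (C (Suc n))" "(m::nat) \<le> n"
  shows "ord (C m) (C n)"
  using assms(1)
proof
  assume "ord = (\<subseteq>)" then show ?thesis using assms(2,3) lift_Suc_mono_le[of C] by auto
next
  assume "ord = (\<supseteq>)" then show ?thesis using assms(2,3) lift_Suc_antimono_le[of C] by auto
qed

text \<open>Otherwise one could choose a strictly monotone chain inside the family.\<close>

lemma chain_condition_extremal:
  assumes cc: "chain_condition G \<Phi> ord K L" and ne: "U \<in> F"
    and F: "\<And>U. U \<in> F \<Longrightarrow> opsub G \<Phi> U \<and> K \<subseteq> U \<and> U \<subseteq> L"
  obtains U where "U \<in> F" "\<And>V. V \<in> F \<Longrightarrow> ord U V \<Longrightarrow> V = U"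
proof (rule ccontr)
  assume "\<not> thesis"
  then have "\<forall>U\<in>F. \<exists>V. V \<in> F \<and> ord U V \<and> V \<noteq> U" using that by blast
  then obtain s where s: "\<And>U. U \<in> F \<Longrightarrow> s U \<in> F \<and> ord U (s U) \<and> s U \<noteq> U" by metis
  define C where "C n = (s ^^ n) U" for n
  have C: "C n \<in> F" for n by (induction n) (auto simp: C_def ne s)
  have "ord (C n) (C (Suc n))" "C (Suc n) \<noteq> C n" for n using s[OF C[of n]] by (auto simp: C_def)
  moreover have "\<exists>N. \<forall>n\<ge>N. C n = C N"
    using cc calculation(1) F[OF C] unfolding chain_condition_def by blast
  ultimately show False by (metis le_Suc_eq order_refl)
qed

context operator_group
begin

lemma opsub_zero: "opsub G \<Phi> {\<zero>}"
proof -
  have "f \<zero> = \<zero>" if "f \<in> \<Phi>" for f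
    using \<Phi>_add[OF that, of \<zero> \<zero>] \<Phi>_closed[OF that, of \<zero>] by (simp add: local.add.l_cancel_one)
  then show ?thesis by (auto simp: opsub_def)
qed

lemma opsub_carrier: "opsub G \<Phi> (carrier G)"
  by (auto simp: opsub_def \<Phi>_closed)

lemma opsub_Int: "\<lbrakk>opsub G \<Phi> K; opsub G \<Phi> L\<rbrakk> \<Longrightarrow> opsub G \<Phi> (K \<inter> L)"
  by (auto simp: opsub_def)

lemma opsub_sum:
  assumes K: "opsub G \<Phi> K" and L: "opsub G \<Phi> L"
  shows "opsub G \<Phi> {x \<oplus> y | x y. x \<in> K \<and> y \<in> L}"
proof -
  have c: "x \<in> carrier G" if "x \<in> K \<or> x \<in> L" for x using that K L by (auto simp: opsub_def)
  show ?thesis unfolding opsub_def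
  proof (intro conjI ballI subsetI)
    show "\<zero> \<in> {x \<oplus> y | x y. x \<in> K \<and> y \<in> L}" using K L
      by (intro CollectI exI[of _ \<zero>]) (auto simp: opsub_def)
    fix a assume "a \<in> {x \<oplus> y | x y. x \<in> K \<and> y \<in> L}"
    then obtain x y where a: "a = x \<oplus> y" "x \<in> K" "y \<in> L" by auto
    show "a \<in> carrier G" using a c by auto
    show "\<ominus> a \<in> {x \<oplus> y | x y. x \<in> K \<and> y \<in> L}"
      using a K L c by (intro CollectI exI[of _ "\<ominus> x"] exI[of _ "\<ominus> y"]) (auto simp: opsub_def minus_add)
    show "f a \<in> {x \<oplus> y | x y. x \<in> K \<and> y \<in> L}" if "f \<in> \<Phi>" for f
      using a K L c that by (intro CollectI exI[of _ "f x"] exI[of _ "f y"]) (auto simp: opsub_def \<Phi>_add)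
    fix b assume "b \<in> {x \<oplus> y | x y. x \<in> K \<and> y \<in> L}"
    then obtain x' y' where b: "b = x' \<oplus> y'" "x' \<in> K" "y' \<in> L" by auto
    have "a \<oplus> b = (x \<oplus> x') \<oplus> (y \<oplus> y')" using a b c by (simp add: a_ac)
    then show "a \<oplus> b \<in> {x \<oplus> y | x y. x \<in> K \<and> y \<in> L}" using a b K L
      by (intro CollectI exI[of _ "x \<oplus> x'"] exI[of _ "y \<oplus> y'"]) (auto simp: opsub_def)
  qed
qed

text \<open>A form of the modular law: an operator subgroup is determined, among those comparable with it, by its
  intersection and its sum with \<open>L\<close>.\<close>

lemma modular_cancel:
  assumes "opsub G \<Phi> U" "opsub G \<Phi> V" "opsub G \<Phi> L" "U \<subseteq> V" "V \<inter> L \<subseteq> U"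
    "V \<subseteq> {x \<oplus> y | x y. x \<in> U \<and> y \<in> L}"
  shows "V = U"
proof
  show "V \<subseteq> U"
  proof
    fix v assume v: "v \<in> V"
    then obtain u l where ul: "v = u \<oplus> l" "u \<in> U" "l \<in> L" using assms by auto
    have c: "u \<in> carrier G" "l \<in> carrier G" "v \<in> carrier G" using ul v assms by (auto simp: opsub_def)
    then have "l = \<ominus> u \<oplus> v" using ul by (simp add: a_assoc[symmetric] l_neg)
    then have "l \<in> V" using ul v assms unfolding opsub_def by (metis subsetD)
    then show "v \<in> U" using ul assms by (auto simp: opsub_def)
  qed
qed (use assms in auto)

text \<open>Both the intersections and the sums of the members of a chain with \<open>L\<close> become stationary, so by
  the modular law the chain does, too.\<close>

lemma chain_condition_trans:
  assumes ord: "ord = (\<subseteq>) \<or> ord = (\<supseteq>)" and L: "opsub G \<Phi> L" "K \<subseteq> L" "L \<subseteq> M" and M: "opsub G \<Phi> M"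
    and 1: "chain_condition G \<Phi> ord K L" and 2: "chain_condition G \<Phi> ord L M"
  shows "chain_condition G \<Phi> ord K M"
  unfolding chain_condition_def
proof (intro allI impI)
  fix C :: "nat \<Rightarrow> _" assume C: "\<forall>n. opsub G \<Phi> (C n) \<and> K \<subseteq> C n \<and> C n \<subseteq> M" "\<forall>n. ord (C n) (C (Suc n))"
  define S where "S n = {x \<oplus> y | x y. x \<in> C n \<and> y \<in> L}" for n
  have Cc: "C n \<subseteq> carrier G" "\<zero> \<in> C n" for n using C(1) by (auto simp: opsub_def)
  have Lc: "L \<subseteq> carrier G" "\<zero> \<in> L" using L by (auto simp: opsub_def)
  have CS: "C n \<subseteq> S n" for n
  proof
    fix x assume "x \<in> C n"
    then show "x \<in> S n" using Cc(1)[of n] Lc unfolding S_def by (intro CollectI exI[of _ x] exI[of _ \<zero>]) auto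
  qed
  have LS: "L \<subseteq> S n" for n
  proof
    fix x assume "x \<in> L"
    then show "x \<in> S n" using Cc(2)[of n] Lc unfolding S_def by (intro CollectI exI[of _ \<zero>] exI[of _ x]) auto
  qed
  have SM: "S n \<subseteq> M" for n
  proof
    fix z assume "z \<in> S n"
    then obtain x y where "z = x \<oplus> y" "x \<in> C n" "y \<in> L" by (auto simp: S_def)
    moreover have "x \<in> M" "y \<in> M" using calculation C(1) L by auto
    ultimately show "z \<in> M" using M by (auto simp: opsub_def)
  qed
  have leS: "ord (S n) (S (Suc n))" for n using ord C(2) unfolding S_def by blast
  have leI: "ord (C n \<inter> L) (C (Suc n) \<inter> L)" for n using ord C(2) by blast
  obtain N1 where N1: "\<And>n. n \<ge> N1 \<Longrightarrow> C n \<inter> L = C N1 \<inter> L"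
    using 1[unfolded chain_condition_def, rule_format, of "\<lambda>n. C n \<inter> L"] leI C(1) L opsub_Int by auto
  obtain N2 where N2: "\<And>n. n \<ge> N2 \<Longrightarrow> S n = S N2"
    using 2[unfolded chain_condition_def, rule_format, of S] leS SM LS C(1) L opsub_sum[of "C _" L]
    unfolding S_def by meson
  define N where "N = max N1 N2"
  have "C n = C N" if n: "n \<ge> N" for n
  proof -
    have e: "C n \<inter> L = C N \<inter> L" "S n = S N" using N1[of n] N1[of N] N2[of n] N2[of N] n by (auto simp: N_def)
    have "ord (C N) (C n)" using chain_le[OF ord _ n, of C] C(2) by simp
    then have "C N \<subseteq> C n \<or> C n \<subseteq> C N" using ord by auto
    then show ?thesis
    proof
      assume "C N \<subseteq> C n"
      moreover have "C n \<inter> L \<subseteq> C N" "C n \<subseteq> S N" using e CS[of n] by auto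
      ultimately show ?thesis using C(1) L(1) by (intro modular_cancel[of "C N" "C n" L]) (simp_all add: S_def)
    next
      assume "C n \<subseteq> C N"
      moreover have "C N \<inter> L \<subseteq> C n" "C N \<subseteq> S n" using e CS[of N] by auto
      ultimately have "C N = C n" using C(1) L(1)
        by (intro modular_cancel[of "C n" "C N" L]) (simp_all add: S_def)
      then show ?thesis by simp
    qed
  qed
  then show "\<exists>N. \<forall>n\<ge>N. C n = C N" by blast
qed

lemma chain_condition_refl:
  assumes "K = L" shows "chain_condition G \<Phi> ord K L"
  unfolding chain_condition_def using assms by (metis subset_antisym)

end

section \<open>Commutative artinian rings are noetherian\<close>

context cring
begin

abbreviation mults :: "('a \<Rightarrow> 'a) set" where "mults \<equiv> {(\<lambda>x. r \<otimes> x) | r. r \<in> carrier R}"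

lemma operator_group_mults: "operator_group R mults"
  by unfold_locales (auto simp: r_distr)

lemma opsub_iff_ideal: "opsub R mults I \<longleftrightarrow> ideal I R"
proof
  assume I: "opsub R mults I"
  then have c: "I \<subseteq> carrier R" by (simp add: opsub_def)
  show "ideal I R"
  proof (rule idealI)
    show "subgroup I (add_monoid R)"
      using I unfolding opsub_def by (auto intro!: add.subgroupI simp: a_inv_def)
    show "x \<otimes> a \<in> I" if "a \<in> I" "x \<in> carrier R" for a x using that I by (auto simp: opsub_def)
    then show "a \<otimes> x \<in> I" if "a \<in> I" "x \<in> carrier R" for a x using that c m_comm[of a x] by auto
  qed (rule ring_axioms)
next
  assume "ideal I R"
  then interpret ideal I R .
  show "opsub R mults I"
    unfolding opsub_def using a_subset zero_closed a_closed a_inv_closed I_l_closed by auto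
qed

text \<open>Let \<open>I\<^sub>0\<close> be minimal among the ideals with noetherian quotient, and suppose
  \<open>I\<^sub>0 \<noteq> 0\<close>.  Choose an ideal \<open>K\<close> minimal with \<open>K I\<^sub>0 \<noteq> 0\<close>; it is principal, \<open>K = (x)\<close>, and the
  annihilator of \<open>x I\<^sub>0\<close> is a maximal ideal.  So \<open>I\<^sub>0 / (I\<^sub>0 \<inter> (0 : x)) \<cong> x I\<^sub>0\<close> is a nonzero vector space
  and has a hyperplane \<open>I\<^sub>1\<close>, whose quotient is noetherian as well; this contradicts the choice of \<open>I\<^sub>0\<close>.\<close>

theorem artinian_imp_noetherian:
  assumes dcc: "chain_condition R mults (\<supseteq>) {\<zero>} (carrier R)"
  shows "chain_condition R mults (\<subseteq>) {\<zero>} (carrier R)"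
proof -
  interpret O: operator_group R mults by (rule operator_group_mults)
  let ?acc = "\<lambda>I. chain_condition R mults (\<subseteq>) I (carrier R)"
  let ?ideal = "opsub R mults"
  have sub: "I \<subseteq> carrier R" "\<zero> \<in> I" if "?ideal I" for I using that by (auto simp: opsub_def)
  have mI: "r \<otimes> x \<in> I" if "?ideal I" "r \<in> carrier R" "x \<in> I" for I r x using that by (auto simp: opsub_def)
  have pI: "x \<oplus> y \<in> I" if "?ideal I" "x \<in> I" "y \<in> I" for I y x using that by (auto simp: opsub_def)
  have nI: "\<ominus> x \<in> I" if "?ideal I" "x \<in> I" for I x using that by (auto simp: opsub_def)
  have "carrier R \<in> {I. ?ideal I \<and> ?acc I}" using O.opsub_carrier O.chain_condition_refl by auto
  then obtain I0 where I0: "I0 \<in> {I. ?ideal I \<and> ?acc I}"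
    and min: "\<And>V. V \<in> {I. ?ideal I \<and> ?acc I} \<Longrightarrow> V \<subseteq> I0 \<Longrightarrow> V = I0"
    by (rule chain_condition_extremal[OF dcc]) (auto simp: sub)
  then have I0': "?ideal I0" "?acc I0" by auto
  have "I0 = {\<zero>}"
  proof (rule ccontr)
    assume ne: "I0 \<noteq> {\<zero>}"
    let ?F = "{K. ?ideal K \<and> (\<exists>k\<in>K. \<exists>i\<in>I0. k \<otimes> i \<noteq> \<zero>)}"
    obtain i0 where "i0 \<in> I0" "i0 \<noteq> \<zero>" using ne sub[OF I0'(1)] by auto
    then have "carrier R \<in> ?F" using O.opsub_carrier sub[OF I0'(1)]
      by (intro CollectI conjI bexI[of _ \<one>] bexI[of _ i0]) auto
    then obtain K where K: "K \<in> ?F" and Kmin: "\<And>V. V \<in> ?F \<Longrightarrow> V \<subseteq> K \<Longrightarrow> V = K"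
      by (rule chain_condition_extremal[OF dcc]) (auto simp: sub)
    then obtain x w where xw: "x \<in> K" "w \<in> I0" "x \<otimes> w \<noteq> \<zero>" by auto
    have xc: "x \<in> carrier R" "w \<in> carrier R" using xw K sub I0' by auto
    have principal: "?ideal ((\<lambda>r. r \<otimes> a) ` carrier R)" if "a \<in> carrier R" for a
    proof -
      have "\<zero> \<in> (\<lambda>r. r \<otimes> a) ` carrier R" using that by (intro image_eqI[of _ _ \<zero>]) auto
      then show ?thesis unfolding opsub_def using that
        by (auto simp: l_distr[symmetric] l_minus[symmetric] m_assoc[symmetric])
    qed
    \<comment> \<open>the maximality of the annihilator of \<open>x I\<^sub>0\<close>: an \<open>r\<close> outside it is invertible modulo it, since \<open>(r x) = K\<close>\<close>
    have invertible: "\<exists>s\<in>carrier R. x = s \<otimes> (r \<otimes> x)"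
      if r: "r \<in> carrier R" "i \<in> I0" "x \<otimes> (r \<otimes> i) \<noteq> \<zero>" for r i
    proof -
      have ic: "i \<in> carrier R" using r sub I0' by auto
      have rx: "(\<one> \<otimes> (r \<otimes> x)) \<otimes> i \<noteq> \<zero>" using r ic xc by (simp add: m_ac)
      have "(\<lambda>s. s \<otimes> (r \<otimes> x)) ` carrier R \<in> ?F"
      proof (intro CollectI conjI bexI)
        show "?ideal ((\<lambda>s. s \<otimes> (r \<otimes> x)) ` carrier R)" using principal[of "r \<otimes> x"] r xc by simp
        show "(\<one> \<otimes> (r \<otimes> x)) \<otimes> i \<noteq> \<zero>" by fact
        show "\<one> \<otimes> (r \<otimes> x) \<in> (\<lambda>s. s \<otimes> (r \<otimes> x)) ` carrier R" by (rule imageI) simp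
      qed fact
      moreover have "(\<lambda>s. s \<otimes> (r \<otimes> x)) ` carrier R \<subseteq> K"
        using K xw r mI by auto
      ultimately have "(\<lambda>s. s \<otimes> (r \<otimes> x)) ` carrier R = K" by (rule Kmin)
      then show ?thesis using xw by auto
    qed
    let ?Z = "{i \<in> I0. x \<otimes> i = \<zero>}"
    have Z: "?ideal ?Z"
      unfolding opsub_def using xc sub[OF I0'(1)] pI[OF I0'(1)] nI[OF I0'(1)] mI[OF I0'(1)]
      by (auto simp: r_distr r_minus m_lcomm subset_iff)
    \<comment> \<open>Zorn's lemma yields the hyperplane as an ideal that is maximal without \<open>w\<close>\<close>
    let ?A = "{U. ?ideal U \<and> ?Z \<subseteq> U \<and> U \<subseteq> I0 \<and> w \<notin> U}"
    have "?Z \<in> ?A" using Z xw by auto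
    then have nonempty: "?A \<noteq> {}" by blast
    have union: "\<Union> \<C> \<in> ?A" if chain: "\<C> \<noteq> {}" "subset.chain ?A \<C>" for \<C>
    proof -
      have el: "U \<in> ?A" if "U \<in> \<C>" for U using that chain(2) by (auto simp: subset.chain_def)
      have tot: "\<exists>W\<in>\<C>. a \<in> W \<and> b \<in> W" if ab: "a \<in> \<Union>\<C>" "b \<in> \<Union>\<C>" for a b
      proof -
        obtain U V where "U \<in> \<C>" "V \<in> \<C>" "a \<in> U" "b \<in> V" using ab by auto
        moreover have "U \<subseteq> V \<or> V \<subseteq> U" using chain(2) calculation(1,2) by (auto simp: subset.chain_def)
        ultimately show ?thesis by blast
      qed
      have "?ideal (\<Union>\<C>)"
        unfolding opsub_def
      proof (intro conjI ballI)
        show "\<Union>\<C> \<subseteq> carrier R" using el sub by blast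
        show "\<zero> \<in> \<Union>\<C>" using el sub chain(1) by blast
        show "a \<oplus> b \<in> \<Union>\<C>" if "a \<in> \<Union>\<C>" "b \<in> \<Union>\<C>" for a b
          using tot[OF that] el pI by blast
        show "\<ominus> a \<in> \<Union>\<C>" if "a \<in> \<Union>\<C>" for a using that el nI by blast
        show "f a \<in> \<Union>\<C>" if "f \<in> mults" "a \<in> \<Union>\<C>" for f a
          using that el unfolding opsub_def by blast
      qed
      then show ?thesis using el chain(1) by blast
    qed
    have "\<exists>I1\<in>?A. \<forall>X\<in>?A. I1 \<subseteq> X \<longrightarrow> X = I1"
      by (rule subset_Zorn_nonempty[OF nonempty union])
    then obtain I1 where I1: "?ideal I1" "?Z \<subseteq> I1" "I1 \<subseteq> I0" "w \<notin> I1"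
      and max: "\<And>X. \<lbrakk>?ideal X; ?Z \<subseteq> X; X \<subseteq> I0; w \<notin> X; I1 \<subseteq> X\<rbrakk> \<Longrightarrow> X = I1" by auto
    have simple: "U = I0" if U: "?ideal U" "I1 \<subseteq> U" "U \<subseteq> I0" "U \<noteq> I1" for U
    proof
      show "I0 \<subseteq> U"
      proof
        fix v assume v: "v \<in> I0"
        have wU: "w \<in> U" using max[OF U(1)] U I1 by blast
        show "v \<in> U"
        proof (cases "v \<in> I1")
          case False
          have vc: "v \<in> carrier R" using v sub I0' by auto
          let ?W = "{a \<oplus> b | a b. a \<in> I1 \<and> b \<in> (\<lambda>r. r \<otimes> v) ` carrier R}"
          have W: "?ideal ?W" using O.opsub_sum[OF I1(1) principal[OF vc]] .
          have "I1 \<subseteq> ?W"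
          proof
            fix a assume "a \<in> I1"
            then show "a \<in> ?W" using sub[OF I1(1)] vc
              by (intro CollectI exI[of _ a] exI[of _ \<zero>]) (auto simp: image_iff intro!: bexI[of _ \<zero>])
          qed
          moreover have "?W \<subseteq> I0" using I1 v pI[OF I0'(1)] mI[OF I0'(1)] by auto
          moreover have "v \<in> ?W" using sub[OF I1(1)] vc
            by (intro CollectI exI[of _ \<zero>] exI[of _ v]) (auto simp: image_iff intro!: bexI[of _ \<one>])
          ultimately have "w \<in> ?W" using max[OF W] I1 False by blast
          then obtain j r where jr: "w = j \<oplus> r \<otimes> v" "j \<in> I1" "r \<in> carrier R" by auto
          have jc: "j \<in> carrier R" using jr sub I1 by auto
          have "x \<otimes> (r \<otimes> v) \<noteq> \<zero>"
          proof
            assume "x \<otimes> (r \<otimes> v) = \<zero>"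
            then have "r \<otimes> v \<in> I1" using I1(2) mI[OF I0'(1) jr(3) v] by auto
            then show False using jr pI[OF I1(1)] I1(4) by auto
          qed
          then obtain s where s: "s \<in> carrier R" "x = s \<otimes> (r \<otimes> x)" using invertible[OF jr(3) v] by auto
          have rv: "r \<otimes> v = w \<ominus> j" using jr jc xc vc
            by (simp add: minus_eq a_comm[of j "r \<otimes> v"] a_assoc r_neg)
          have "x \<otimes> (v \<ominus> s \<otimes> (r \<otimes> v)) = x \<otimes> v \<ominus> (s \<otimes> (r \<otimes> x)) \<otimes> v"
            using s(1) jr vc xc by (simp add: minus_eq r_distr r_minus m_ac)
          also have "\<dots> = \<zero>" using s(2)[symmetric] vc xc by (simp add: minus_eq r_neg)
          finally have "x \<otimes> (v \<ominus> s \<otimes> (r \<otimes> v)) = \<zero>" .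
          moreover have "v \<ominus> s \<otimes> (r \<otimes> v) \<in> I0"
            unfolding minus_eq using v s jr mI[OF I0'(1)] pI[OF I0'(1)] nI[OF I0'(1)] by auto
          ultimately have 1: "v \<ominus> s \<otimes> (r \<otimes> v) \<in> U" using I1(2) U(2) by auto
          have 2: "s \<otimes> (r \<otimes> v) \<in> U" unfolding rv minus_eq
            using jr(2) U wU s(1) by (intro mI[OF U(1)] pI[OF U(1)] nI[OF U(1)]) auto
          have "v = (v \<ominus> s \<otimes> (r \<otimes> v)) \<oplus> s \<otimes> (r \<otimes> v)"
            using vc s(1) jr by (simp add: minus_eq a_assoc l_neg)
          then show ?thesis using pI[OF U(1) 1 2] by simp
        qed (use U in auto)
      qed
    qed (use U in auto)
    have "chain_condition R mults (\<subseteq>) I1 I0"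
      unfolding chain_condition_def
    proof (intro allI impI)
      fix C :: "nat \<Rightarrow> 'a set"
      assume C: "\<forall>n. ?ideal (C n) \<and> I1 \<subseteq> C n \<and> C n \<subseteq> I0" "\<forall>n. C n \<subseteq> C (Suc n)"
      then have two: "C n = I1 \<or> C n = I0" for n using simple by blast
      show "\<exists>N. \<forall>n\<ge>N. C n = C N"
      proof (cases "\<exists>N. C N = I0")
        case True
        then obtain N where N: "C N = I0" by auto
        have "C n = C N" if "n \<ge> N" for n
          using lift_Suc_mono_le[of C N n] C that N by blast
        then show ?thesis by blast
      qed (use two in metis)
    qed
    then have "?acc I1"
      using O.chain_condition_trans[of "(\<subseteq>)" I0 I1 "carrier R"] I0' I1 O.opsub_carrier sub by auto
    then have "I1 = I0" using min I1 by blast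
    then show False using I1 xw by blast
  qed
  then show ?thesis using I0' by simp
qed

end

section \<open>Finitely generated modules\<close>

lemma (in operator_group) opsub_finsum:
  assumes "opsub G \<Phi> N" "finite S" "\<And>s. s \<in> S \<Longrightarrow> f s \<in> N"
  shows "finsum G f S \<in> N"
  using assms(2,3)
proof (induction S rule: finite_induct)
  case (insert s S)
  have "f t \<in> carrier G" if "t \<in> insert s S" for t using insert.prems[OF that] assms(1) by (auto simp: opsub_def)
  then show ?case using insert assms(1) by (subst finsum_insert) (auto simp: opsub_def)
qed (use assms in \<open>simp add: opsub_def\<close>)

abbreviation actions :: "('r, 'd) ring_scheme \<Rightarrow> ('r, 'u, 'e) module_scheme \<Rightarrow> ('u \<Rightarrow> 'u) set" where
  "actions \<Lambda> M \<equiv> {(\<lambda>x. r \<odot>\<^bsub>M\<^esub> x) | r. r \<in> carrier \<Lambda>}"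

abbreviation rsub :: "('r, 'd) ring_scheme \<Rightarrow> ('r, 'u, 'e) module_scheme \<Rightarrow> 'u set \<Rightarrow> bool" where
  "rsub \<Lambda> M N \<equiv> opsub M (actions \<Lambda> M) N"

context right_module
begin

lemma operator_group_actions: "operator_group M (actions \<Lambda> M)"
  by unfold_locales (auto simp: smult_closed smult_r_distr)

lemma smult_zero [simp]: "r \<in> carrier \<Lambda> \<Longrightarrow> r \<odot>\<^bsub>M\<^esub> \<zero>\<^bsub>M\<^esub> = \<zero>\<^bsub>M\<^esub>"
  using smult_r_distr[of r "\<zero>\<^bsub>M\<^esub>" "\<zero>\<^bsub>M\<^esub>"] smult_closed[of r "\<zero>\<^bsub>M\<^esub>"] by (simp add: local.add.l_cancel_one)

lemma zero_smult [simp]: "x \<in> carrier M \<Longrightarrow> \<zero>\<^bsub>\<Lambda>\<^esub> \<odot>\<^bsub>M\<^esub> x = \<zero>\<^bsub>M\<^esub>"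
  using smult_l_distr[of "\<zero>\<^bsub>\<Lambda>\<^esub>" "\<zero>\<^bsub>\<Lambda>\<^esub>" x] smult_closed[of "\<zero>\<^bsub>\<Lambda>\<^esub>" x] by (simp add: local.add.l_cancel_one)

lemma neg_one_smult: 
  assumes "x \<in> carrier M" shows "(\<ominus>\<^bsub>\<Lambda>\<^esub> \<one>\<^bsub>\<Lambda>\<^esub>) \<odot>\<^bsub>M\<^esub> x = \<ominus>\<^bsub>M\<^esub> x"
proof -
  have "(\<ominus>\<^bsub>\<Lambda>\<^esub> \<one>\<^bsub>\<Lambda>\<^esub>) \<odot>\<^bsub>M\<^esub> x \<oplus>\<^bsub>M\<^esub> x = (\<ominus>\<^bsub>\<Lambda>\<^esub> \<one>\<^bsub>\<Lambda>\<^esub> \<oplus>\<^bsub>\<Lambda>\<^esub> \<one>\<^bsub>\<Lambda>\<^esub>) \<odot>\<^bsub>M\<^esub> x"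
    using assms by (simp add: smult_l_distr smult_one)
  then have "(\<ominus>\<^bsub>\<Lambda>\<^esub> \<one>\<^bsub>\<Lambda>\<^esub>) \<odot>\<^bsub>M\<^esub> x \<oplus>\<^bsub>M\<^esub> x = \<zero>\<^bsub>M\<^esub>" using assms by (simp add: L.l_neg)
  then show ?thesis using assms by (metis minus_equality smult_closed L.add.inv_closed L.one_closed)
qed

lemma smult_neg:
  assumes "r \<in> carrier \<Lambda>" "x \<in> carrier M" shows "r \<odot>\<^bsub>M\<^esub> (\<ominus>\<^bsub>M\<^esub> x) = \<ominus>\<^bsub>M\<^esub> (r \<odot>\<^bsub>M\<^esub> x)"
proof -
  have "r \<odot>\<^bsub>M\<^esub> (\<ominus>\<^bsub>M\<^esub> x) \<oplus>\<^bsub>M\<^esub> r \<odot>\<^bsub>M\<^esub> x = \<zero>\<^bsub>M\<^esub>"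
    using assms by (simp flip: smult_r_distr add: l_neg)
  then show ?thesis using assms by (metis minus_equality smult_closed a_inv_closed)
qed

lemma rsubI:
  assumes "N \<subseteq> carrier M" "\<zero>\<^bsub>M\<^esub> \<in> N" "\<And>x y. x \<in> N \<Longrightarrow> y \<in> N \<Longrightarrow> x \<oplus>\<^bsub>M\<^esub> y \<in> N"
    "\<And>r x. r \<in> carrier \<Lambda> \<Longrightarrow> x \<in> N \<Longrightarrow> r \<odot>\<^bsub>M\<^esub> x \<in> N"
  shows "rsub \<Lambda> M N"
proof -
  have "\<ominus>\<^bsub>M\<^esub> x \<in> N" if "x \<in> N" for x
    using assms(1,4) that neg_one_smult[of x] L.add.inv_closed[OF L.one_closed] by (metis a_inv_def subsetD)
  then show ?thesis using assms by (auto simp: opsub_def)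
qed

lemma rsubD:
  assumes "rsub \<Lambda> M N"
  shows "N \<subseteq> carrier M" "\<zero>\<^bsub>M\<^esub> \<in> N" "\<And>x y. x \<in> N \<Longrightarrow> y \<in> N \<Longrightarrow> x \<oplus>\<^bsub>M\<^esub> y \<in> N"
    "\<And>r x. r \<in> carrier \<Lambda> \<Longrightarrow> x \<in> N \<Longrightarrow> r \<odot>\<^bsub>M\<^esub> x \<in> N" "\<And>x. x \<in> N \<Longrightarrow> \<ominus>\<^bsub>M\<^esub> x \<in> N"
  using assms unfolding opsub_def by auto

lemma smult_finsum:
  assumes "finite S" "f \<in> S \<rightarrow> carrier M" "r \<in> carrier \<Lambda>"
  shows "r \<odot>\<^bsub>M\<^esub> finsum M f S = finsum M (\<lambda>s. r \<odot>\<^bsub>M\<^esub> f s) S"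
  using assms(1,2)
proof (induction S rule: finite_induct)
  case (insert s S)
  then show ?case using assms(3) by (simp add: smult_r_distr smult_closed finsum_insert Pi_def)
qed (use assms in simp)

definition span :: "'u set \<Rightarrow> 'u set" where
  "span S = {finsum M (\<lambda>s. c s \<odot>\<^bsub>M\<^esub> s) S | c. c \<in> S \<rightarrow> carrier \<Lambda>}"

lemma span:
  assumes S: "finite S" "S \<subseteq> carrier M"
  shows "rsub \<Lambda> M (span S)" "S \<subseteq> span S" "rsub \<Lambda> M N \<Longrightarrow> S \<subseteq> N \<Longrightarrow> span S \<subseteq> N"
proof -
  have cl: "c s \<odot>\<^bsub>M\<^esub> s \<in> carrier M" if "c \<in> S \<rightarrow> carrier \<Lambda>" "s \<in> S" for c s
    using that S by (auto intro: smult_closed)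
  show "rsub \<Lambda> M (span S)"
  proof (rule rsubI)
    show "span S \<subseteq> carrier M" using cl by (auto simp: span_def)
    have "finsum M (\<lambda>s. \<zero>\<^bsub>\<Lambda>\<^esub> \<odot>\<^bsub>M\<^esub> s) S = finsum M (\<lambda>s. \<zero>\<^bsub>M\<^esub>) S"
      using S by (intro finsum_cong') auto
    then have "finsum M (\<lambda>s. (\<lambda>s. \<zero>\<^bsub>\<Lambda>\<^esub>) s \<odot>\<^bsub>M\<^esub> s) S = \<zero>\<^bsub>M\<^esub>" by simp
    then show "\<zero>\<^bsub>M\<^esub> \<in> span S" unfolding span_def by (intro CollectI exI[of _ "\<lambda>_. \<zero>\<^bsub>\<Lambda>\<^esub>"]) auto
    fix x assume "x \<in> span S"
    then obtain c where c: "x = finsum M (\<lambda>s. c s \<odot>\<^bsub>M\<^esub> s) S" "c \<in> S \<rightarrow> carrier \<Lambda>" by (auto simp: span_def)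
    {
      fix y assume "y \<in> span S"
      then obtain d where d: "y = finsum M (\<lambda>s. d s \<odot>\<^bsub>M\<^esub> s) S" "d \<in> S \<rightarrow> carrier \<Lambda>" by (auto simp: span_def)
      have "x \<oplus>\<^bsub>M\<^esub> y = finsum M (\<lambda>s. c s \<odot>\<^bsub>M\<^esub> s \<oplus>\<^bsub>M\<^esub> d s \<odot>\<^bsub>M\<^esub> s) S"
        unfolding c(1) d(1) using cl c(2) d(2) by (intro finsum_addf[symmetric]) auto
      also have "\<dots> = finsum M (\<lambda>s. (c s \<oplus>\<^bsub>\<Lambda>\<^esub> d s) \<odot>\<^bsub>M\<^esub> s) S"
        using c(2) d(2) S by (intro finsum_cong') (auto simp: smult_l_distr smult_closed Pi_iff subset_iff)
      finally show "x \<oplus>\<^bsub>M\<^esub> y \<in> span S"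
        unfolding span_def using c(2) d(2) by (intro CollectI exI[of _ "\<lambda>s. c s \<oplus>\<^bsub>\<Lambda>\<^esub> d s"]) auto
    }
    fix r assume r: "r \<in> carrier \<Lambda>"
    have "r \<odot>\<^bsub>M\<^esub> x = finsum M (\<lambda>s. r \<odot>\<^bsub>M\<^esub> (c s \<odot>\<^bsub>M\<^esub> s)) S"
      unfolding c(1) using S cl c r by (intro smult_finsum) auto
    also have "\<dots> = finsum M (\<lambda>s. (c s \<otimes>\<^bsub>\<Lambda>\<^esub> r) \<odot>\<^bsub>M\<^esub> s) S"
      using c(2) r S by (intro finsum_cong') (auto simp: smult_assoc smult_closed Pi_iff subset_iff)
    finally show "r \<odot>\<^bsub>M\<^esub> x \<in> span S"
      unfolding span_def using c(2) r by (intro CollectI exI[of _ "\<lambda>s. c s \<otimes>\<^bsub>\<Lambda>\<^esub> r"]) auto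
  qed
  show "S \<subseteq> span S"
  proof
    fix s assume s: "s \<in> S"
    have "finsum M (\<lambda>t. (if t = s then \<one>\<^bsub>\<Lambda>\<^esub> else \<zero>\<^bsub>\<Lambda>\<^esub>) \<odot>\<^bsub>M\<^esub> t) S = finsum M (\<lambda>t. if s = t then t else \<zero>\<^bsub>M\<^esub>) S"
      using S by (intro finsum_cong') (auto simp: smult_one)
    also have "\<dots> = s" using S s by (subst add.finprod_singleton) auto
    finally show "s \<in> span S"
      unfolding span_def by (intro CollectI exI[of _ "\<lambda>t. if t = s then \<one>\<^bsub>\<Lambda>\<^esub> else \<zero>\<^bsub>\<Lambda>\<^esub>"]) auto
  qed
  show "span S \<subseteq> N" if "rsub \<Lambda> M N" "S \<subseteq> N"
  proof -
    interpret operator_group M "actions \<Lambda> M" by (rule operator_group_actions)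
    show ?thesis using that S(1) by (auto simp: span_def subset_iff Pi_iff intro!: opsub_finsum rsubD(4))
  qed
qed

text \<open>Phrased with submodules instead of linear combinations, finite generation passes to
  images.\<close>

lemma fg_iff:
  "fg_right_module \<Lambda> M \<longleftrightarrow>
    (\<exists>S. finite S \<and> S \<subseteq> carrier M \<and> (\<forall>N. rsub \<Lambda> M N \<and> S \<subseteq> N \<longrightarrow> N = carrier M))" (is "_ \<longleftrightarrow> ?R")
proof
  assume "fg_right_module \<Lambda> M"
  then obtain S where S: "finite S" "S \<subseteq> carrier M"
    "\<forall>x\<in>carrier M. \<exists>c\<in>S \<rightarrow> carrier \<Lambda>. x = finsum M (\<lambda>s. c s \<odot>\<^bsub>M\<^esub> s) S"
    unfolding fg_right_module_def by blast
  have "carrier M \<subseteq> span S" using S(3) unfolding span_def by blast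
  then have "N = carrier M" if "rsub \<Lambda> M N" "S \<subseteq> N" for N
    using span(3)[OF S(1,2) that] rsubD(1)[OF that(1)] by auto
  then show ?R using S by blast
next
  assume ?R
  then obtain S where S: "finite S" "S \<subseteq> carrier M" "\<And>N. rsub \<Lambda> M N \<Longrightarrow> S \<subseteq> N \<Longrightarrow> N = carrier M" by auto
  then have "span S = carrier M" using span[of S] by blast
  then have "\<forall>x\<in>carrier M. \<exists>c\<in>S \<rightarrow> carrier \<Lambda>. x = finsum M (\<lambda>s. c s \<odot>\<^bsub>M\<^esub> s) S"
    unfolding span_def by blast
  then show "fg_right_module \<Lambda> M"
    unfolding fg_right_module_def using S(1,2) right_module_axioms by blast
qed

text \<open>As \<open>\<Lambda>\<close> is finite over \<open>R\<close>, the module is finitely generated over \<open>R\<close>.  Chains of \<open>R\<close>-submodules between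
  \<open>N\<close> and \<open>N + R x\<close> correspond to chains of ideals of \<open>R\<close>; so both chain conditions carry over from \<open>R\<close>,
  one generator \<open>x\<close> at a time.\<close>

lemma fg_chain_condition:
  assumes art: "artin_algebra R \<Lambda> \<phi>" and fg: "fg_right_module \<Lambda> M"
    and ord: "ord = (\<subseteq>) \<or> ord = (\<supseteq>)"
  shows "chain_condition M (actions \<Lambda> M) ord {\<zero>\<^bsub>M\<^esub>} (carrier M)"
proof -
  interpret A: artin_algebra R \<Lambda> \<phi> by fact
  define \<Phi> where "\<Phi> = {(\<lambda>x. \<phi> r \<odot>\<^bsub>M\<^esub> x) | r. r \<in> carrier R}"
  have \<phi>: "\<phi> r \<in> carrier \<Lambda>" if "r \<in> carrier R" for r using A.structure_map that by (auto simp: ring_hom_def)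
  have \<phi>add: "\<phi> (r \<oplus>\<^bsub>R\<^esub> s) = \<phi> r \<oplus>\<^bsub>\<Lambda>\<^esub> \<phi> s" "\<phi> (r \<otimes>\<^bsub>R\<^esub> s) = \<phi> r \<otimes>\<^bsub>\<Lambda>\<^esub> \<phi> s"
    if "r \<in> carrier R" "s \<in> carrier R" for r s using A.structure_map that by (auto simp: ring_hom_def)
  have \<phi>1: "\<phi> \<one>\<^bsub>R\<^esub> = \<one>\<^bsub>\<Lambda>\<^esub>" using A.structure_map by (auto simp: ring_hom_def)
  have \<phi>0: "\<phi> \<zero>\<^bsub>R\<^esub> = \<zero>\<^bsub>\<Lambda>\<^esub>"
    using \<phi>add(1)[of "\<zero>\<^bsub>R\<^esub>" "\<zero>\<^bsub>R\<^esub>"] \<phi>[of "\<zero>\<^bsub>R\<^esub>"] by (simp add: L.add.l_cancel_one)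
  have "\<phi> (\<ominus>\<^bsub>R\<^esub> r) \<oplus>\<^bsub>\<Lambda>\<^esub> \<phi> r = \<zero>\<^bsub>\<Lambda>\<^esub>" if "r \<in> carrier R" for r
    using that \<phi>0 by (simp flip: \<phi>add add: A.l_neg)
  then have \<phi>neg: "\<phi> (\<ominus>\<^bsub>R\<^esub> r) = \<ominus>\<^bsub>\<Lambda>\<^esub> \<phi> r" if "r \<in> carrier R" for r
    using that \<phi> by (metis L.minus_equality A.a_inv_closed)
  interpret O: operator_group M \<Phi>
    by unfold_locales (auto simp: \<Phi>_def smult_closed smult_r_distr \<phi>)
  let ?rs = "opsub M \<Phi>"
  have rsI: "?rs N" if "rsub \<Lambda> M N" for N
    using rsubD[OF that] \<phi> unfolding opsub_def by (auto simp: \<Phi>_def)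
  have rsD: "N \<subseteq> carrier M" "\<zero>\<^bsub>M\<^esub> \<in> N" "\<And>x y. x \<in> N \<Longrightarrow> y \<in> N \<Longrightarrow> x \<oplus>\<^bsub>M\<^esub> y \<in> N"
    "\<And>r x. r \<in> carrier R \<Longrightarrow> x \<in> N \<Longrightarrow> \<phi> r \<odot>\<^bsub>M\<^esub> x \<in> N" "\<And>x. x \<in> N \<Longrightarrow> \<ominus>\<^bsub>M\<^esub> x \<in> N" if "?rs N" for N
    using that unfolding opsub_def \<Phi>_def by auto
  have dccR: "chain_condition R A.mults (\<supseteq>) {\<zero>\<^bsub>R\<^esub>} (carrier R)"
    unfolding chain_condition_def A.opsub_iff_ideal
  proof (intro allI impI)
    fix C :: "nat \<Rightarrow> _"
    assume C: "\<forall>n. ideal (C n) R \<and> {\<zero>\<^bsub>R\<^esub>} \<subseteq> C n \<and> C n \<subseteq> carrier R" "\<forall>n. C (Suc n) \<subseteq> C n"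
    show "\<exists>N. \<forall>n\<ge>N. C n = C N" by (rule A.artinian) (use C in auto)
  qed
  then have accR: "chain_condition R A.mults (\<subseteq>) {\<zero>\<^bsub>R\<^esub>} (carrier R)"
    by (rule A.artinian_imp_noetherian)
  have neg: "(\<ominus>\<^bsub>\<Lambda>\<^esub> a) \<odot>\<^bsub>M\<^esub> x = \<ominus>\<^bsub>M\<^esub> (a \<odot>\<^bsub>M\<^esub> x)" if "a \<in> carrier \<Lambda>" "x \<in> carrier M" for a x
  proof -
    have "(\<ominus>\<^bsub>\<Lambda>\<^esub> a) \<odot>\<^bsub>M\<^esub> x \<oplus>\<^bsub>M\<^esub> a \<odot>\<^bsub>M\<^esub> x = \<zero>\<^bsub>M\<^esub>"
      using that by (simp flip: smult_l_distr add: L.l_neg)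
    then show ?thesis using that by (metis minus_equality smult_closed L.a_inv_closed)
  qed
  have step: "\<exists>N'. ?rs N' \<and> N \<subseteq> N' \<and> x \<in> N' \<and> chain_condition M \<Phi> ord N N'"
    if N: "?rs N" and x: "x \<in> carrier M" for N x
  proof -
    define Rx where "Rx = (\<lambda>r. \<phi> r \<odot>\<^bsub>M\<^esub> x) ` carrier R"
    have Rx: "?rs Rx" unfolding opsub_def
    proof (intro conjI ballI)
      show "Rx \<subseteq> carrier M" using x \<phi> by (auto simp: Rx_def smult_closed)
      show "\<zero>\<^bsub>M\<^esub> \<in> Rx" unfolding Rx_def using x \<phi>0 by (intro image_eqI[of _ _ "\<zero>\<^bsub>R\<^esub>"]) auto
      show "a \<oplus>\<^bsub>M\<^esub> b \<in> Rx" if "a \<in> Rx" "b \<in> Rx" for a b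
        using that x unfolding Rx_def by (auto simp flip: smult_l_distr \<phi>add simp: \<phi>)
      show "\<ominus>\<^bsub>M\<^esub> a \<in> Rx" if "a \<in> Rx" for a
        using that x unfolding Rx_def by (auto simp flip: neg \<phi>neg simp: \<phi>)
      show "f a \<in> Rx" if f: "f \<in> \<Phi>" "a \<in> Rx" for f a
      proof -
        obtain r s where "f = (\<lambda>x. \<phi> r \<odot>\<^bsub>M\<^esub> x)" "a = \<phi> s \<odot>\<^bsub>M\<^esub> x" "r \<in> carrier R" "s \<in> carrier R"
          using f by (auto simp: \<Phi>_def Rx_def)
        moreover from this have "\<phi> r \<odot>\<^bsub>M\<^esub> (\<phi> s \<odot>\<^bsub>M\<^esub> x) = \<phi> (s \<otimes>\<^bsub>R\<^esub> r) \<odot>\<^bsub>M\<^esub> x"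
          using x \<phi> by (simp add: \<phi>add smult_assoc)
        ultimately show ?thesis unfolding Rx_def by auto
      qed
    qed
    let ?N' = "{a \<oplus>\<^bsub>M\<^esub> b | a b. a \<in> N \<and> b \<in> Rx}"
    have N': "?rs ?N'" by (rule O.opsub_sum[OF N Rx])
    have "N \<subseteq> ?N'"
    proof
      fix a assume "a \<in> N" then show "a \<in> ?N'" using rsD(1)[OF N] rsD(2)[OF Rx]
        by (intro CollectI exI[of _ a] exI[of _ "\<zero>\<^bsub>M\<^esub>"]) auto
    qed
    moreover have "x \<in> ?N'"
      using rsD(2)[OF N] x \<phi>1 by (intro CollectI exI[of _ "\<zero>\<^bsub>M\<^esub>"] exI[of _ x])
        (auto simp: Rx_def smult_one intro!: image_eqI[of _ _ "\<one>\<^bsub>R\<^esub>"])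
    moreover have "chain_condition M \<Phi> ord N ?N'"
      unfolding chain_condition_def
    proof (intro allI impI)
      fix C :: "nat \<Rightarrow> _" assume C: "\<forall>n. ?rs (C n) \<and> N \<subseteq> C n \<and> C n \<subseteq> ?N'" "\<forall>n. ord (C n) (C (Suc n))"
      define J where "J n = {r \<in> carrier R. \<phi> r \<odot>\<^bsub>M\<^esub> x \<in> C n}" for n
      have "opsub R A.mults (J n)" for n
      proof -
        have Cn: "?rs (C n)" using C by simp
        show ?thesis unfolding opsub_def J_def
          using rsD(2,3,5)[OF Cn] x by (auto simp: \<phi>0 \<phi>add \<phi>neg smult_l_distr neg \<phi> rsD(4)[OF Cn] smult_assoc A.m_comm
             simp flip: smult_assoc)
            (metis A.central Cn \<phi> rsD(4) smult_assoc)
      qed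
      moreover have "(\<forall>n. J n \<subseteq> J (Suc n)) \<or> (\<forall>n. J n \<supseteq> J (Suc n))"
        using ord C(2) unfolding J_def by blast
      moreover have "{\<zero>\<^bsub>R\<^esub>} \<subseteq> J n" for n using C(1) rsD(2) x by (auto simp: J_def \<phi>0)
      moreover have "J n \<subseteq> carrier R" for n by (auto simp: J_def)
      ultimately obtain K where K: "\<And>n. n \<ge> K \<Longrightarrow> J n = J K"
        using dccR accR unfolding chain_condition_def by meson
      have rec: "C n = {a \<oplus>\<^bsub>M\<^esub> \<phi> r \<odot>\<^bsub>M\<^esub> x | a r. a \<in> N \<and> r \<in> J n}" for n
      proof -
        have Cn: "?rs (C n)" "N \<subseteq> C n" "C n \<subseteq> ?N'" using C by auto
        show ?thesis
        proof (intro equalityI subsetI)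
          fix z assume z: "z \<in> C n"
          then obtain a r where ar: "z = a \<oplus>\<^bsub>M\<^esub> \<phi> r \<odot>\<^bsub>M\<^esub> x" "a \<in> N" "r \<in> carrier R" using Cn(3) by (auto simp: Rx_def)
          have c: "a \<in> carrier M" "\<phi> r \<odot>\<^bsub>M\<^esub> x \<in> carrier M" using ar rsD(1)[OF N] x \<phi> by (auto simp: smult_closed)
          then have "\<phi> r \<odot>\<^bsub>M\<^esub> x = \<ominus>\<^bsub>M\<^esub> a \<oplus>\<^bsub>M\<^esub> z" unfolding ar(1) by (simp add: a_assoc[symmetric] l_neg)
          moreover have "\<ominus>\<^bsub>M\<^esub> a \<oplus>\<^bsub>M\<^esub> z \<in> C n" using rsD(3)[OF Cn(1) rsD(5)[OF Cn(1)] z] ar(2) Cn(2) by auto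
          ultimately have "r \<in> J n" unfolding J_def using ar(3) by simp
          then show "z \<in> {a \<oplus>\<^bsub>M\<^esub> \<phi> r \<odot>\<^bsub>M\<^esub> x | a r. a \<in> N \<and> r \<in> J n}" using ar by blast
        qed (use rsD(3)[OF Cn(1)] Cn(2) in \<open>auto simp: J_def\<close>)
      qed
      have "C n = C K" if "n \<ge> K" for n unfolding rec K[OF that] ..
      then show "\<exists>K. \<forall>n\<ge>K. C n = C K" by blast
    qed
    ultimately show ?thesis using N' by blast
  qed
  have gen: "\<exists>N. ?rs N \<and> S \<subseteq> N \<and> chain_condition M \<Phi> ord {\<zero>\<^bsub>M\<^esub>} N" if "finite S" "S \<subseteq> carrier M" for S
    using that
  proof (induction S rule: finite_induct)
    case empty
    show ?case using O.opsub_zero O.chain_condition_refl by blast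
  next
    case (insert x S)
    then obtain N where N: "?rs N" "S \<subseteq> N" "chain_condition M \<Phi> ord {\<zero>\<^bsub>M\<^esub>} N" by auto
    obtain N' where N': "?rs N'" "N \<subseteq> N'" "x \<in> N'" "chain_condition M \<Phi> ord N N'"
      using step[OF N(1), of x] insert by auto
    have "chain_condition M \<Phi> ord {\<zero>\<^bsub>M\<^esub>} N'"
      using O.chain_condition_trans[OF ord N(1) _ N'(2) N'(1) N(3) N'(4)] rsD(2)[OF N(1)] by simp
    then show ?case using N N' by blast
  qed
  obtain T where T: "finite T" "T \<subseteq> carrier M" "\<And>N. rsub \<Lambda> M N \<Longrightarrow> T \<subseteq> N \<Longrightarrow> N = carrier M"
    using fg[unfolded fg_iff] by auto
  obtain S where S: "finite S" "S \<subseteq> carrier \<Lambda>"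
    "\<And>x. x \<in> carrier \<Lambda> \<Longrightarrow> \<exists>c\<in>S \<rightarrow> carrier R. x = finsum \<Lambda> (\<lambda>s. \<phi> (c s) \<otimes>\<^bsub>\<Lambda>\<^esub> s) S"
    using A.module_finite by auto
  define G where "G = (\<lambda>(s, t). s \<odot>\<^bsub>M\<^esub> t) ` (S \<times> T)"
  have "finite G" "G \<subseteq> carrier M" using S T by (auto simp: G_def intro!: smult_closed)
  then obtain N where N: "?rs N" "G \<subseteq> N" "chain_condition M \<Phi> ord {\<zero>\<^bsub>M\<^esub>} N" using gen[of G] by blast
  have LT: "l \<odot>\<^bsub>M\<^esub> t \<in> N" if l: "l \<in> carrier \<Lambda>" and t: "t \<in> T" for l t
  proof -
    obtain c where c: "c \<in> S \<rightarrow> carrier R" "l = finsum \<Lambda> (\<lambda>s. \<phi> (c s) \<otimes>\<^bsub>\<Lambda>\<^esub> s) S" using S(3)[OF l] by auto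
    have tc: "t \<in> carrier M" using t T by auto
    have "finsum \<Lambda> (\<lambda>s. \<phi> (c s) \<otimes>\<^bsub>\<Lambda>\<^esub> s) S' \<odot>\<^bsub>M\<^esub> t \<in> N" if "S' \<subseteq> S" for S'
      using finite_subset[OF that S(1)] that
    proof (induction S' rule: finite_induct)
      case empty
      then show ?case using tc rsD(2)[OF N(1)] by simp
    next
      case (insert s S')
      have s: "s \<in> carrier \<Lambda>" "c s \<in> carrier R" "s \<in> S" using insert S(2) c(1) by auto
      have cl: "\<phi> (c s) \<otimes>\<^bsub>\<Lambda>\<^esub> s \<in> carrier \<Lambda>" if "s \<in> S" for s using that S(2) c(1) \<phi> by auto
      have "s \<odot>\<^bsub>M\<^esub> t \<in> N" using s t N(2) by (auto simp: G_def)
      then have "(\<phi> (c s) \<otimes>\<^bsub>\<Lambda>\<^esub> s) \<odot>\<^bsub>M\<^esub> t \<in> N"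
        using s tc \<phi> rsD(4)[OF N(1)] A.central by (metis smult_assoc)
      moreover have "finsum \<Lambda> (\<lambda>s. \<phi> (c s) \<otimes>\<^bsub>\<Lambda>\<^esub> s) S' \<in> carrier \<Lambda>"
        using cl insert by (intro L.finsum_closed) auto
      ultimately show ?case using insert cl tc rsD(3)[OF N(1)] s
        by (subst L.finsum_insert) (auto simp: smult_l_distr)
    qed
    then show ?thesis using c by auto
  qed
  have "span T \<subseteq> N" using T(2) LT O.opsub_finsum[OF N(1) T(1)]
    unfolding span_def by (auto simp: Pi_iff)
  moreover have "span T = carrier M" using T span[OF T(1,2)] by blast
  ultimately have "N = carrier M" using rsD(1)[OF N(1)] by auto
  then have cc: "chain_condition M \<Phi> ord {\<zero>\<^bsub>M\<^esub>} (carrier M)" using N by simp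
  show ?thesis unfolding chain_condition_def
  proof (intro allI impI)
    fix C :: "nat \<Rightarrow> _"
    assume C: "\<forall>n. rsub \<Lambda> M (C n) \<and> {\<zero>\<^bsub>M\<^esub>} \<subseteq> C n \<and> C n \<subseteq> carrier M" "\<forall>n. ord (C n) (C (Suc n))"
    then have "\<forall>n. ?rs (C n) \<and> {\<zero>\<^bsub>M\<^esub>} \<subseteq> C n \<and> C n \<subseteq> carrier M" using rsI by simp
    then show "\<exists>K. \<forall>n\<ge>K. C n = C K" using cc C(2) unfolding chain_condition_def by simp
  qed
qed

text \<open>A maximal member among the submodules of \<open>N\<close> that are spanned by finite sets has to be \<open>N\<close> itself.\<close>

lemma noetherian_submodule:
  assumes art: "artin_algebra R \<Lambda> \<phi>" and fg: "fg_right_module \<Lambda> M" and N: "rsub \<Lambda> M N"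
  shows "\<exists>S. finite S \<and> S \<subseteq> N \<and> (\<forall>N'. rsub \<Lambda> M N' \<and> S \<subseteq> N' \<longrightarrow> N \<subseteq> N')"
proof -
  let ?F = "{span S | S. finite S \<and> S \<subseteq> N}"
  have Nc: "N \<subseteq> carrier M" using rsubD(1)[OF N] .
  have cc: "chain_condition M (actions \<Lambda> M) (\<subseteq>) {\<zero>\<^bsub>M\<^esub>} (carrier M)"
    by (rule fg_chain_condition[OF art fg]) simp
  have e: "span {} \<in> ?F" by blast
  have F: "rsub \<Lambda> M V \<and> {\<zero>\<^bsub>M\<^esub>} \<subseteq> V \<and> V \<subseteq> carrier M" if "V \<in> ?F" for V
  proof -
    from that
    obtain S where S: "V = span S" "finite S" "S \<subseteq> carrier M" using Nc by auto
    then show "rsub \<Lambda> M V \<and> {\<zero>\<^bsub>M\<^esub>} \<subseteq> V \<and> V \<subseteq> carrier M"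
      using span(1)[OF S(2,3)] rsubD(1,2) by blast
  qed
  obtain U where U: "U \<in> ?F" and max: "\<forall>V\<in>?F. U \<subseteq> V \<longrightarrow> V = U"
    by (rule chain_condition_extremal[OF cc e F]) auto
  obtain S where S: "U = span S" "finite S" "S \<subseteq> N" using U by auto
  have "x \<in> U" if x: "x \<in> N" for x
  proof -
    have 1: "finite (insert x S)" "insert x S \<subseteq> carrier M" using S x Nc by auto
    have "span S \<subseteq> span (insert x S)" using span(3)[OF _ _ span(1)[OF 1]] span(2)[OF 1] S 1 by auto
    then have "span (insert x S) = U" using bspec[OF max, of "span (insert x S)"] S x by auto
    then show ?thesis using span(2)[OF 1] by auto
  qed
  then have "N \<subseteq> N'" if "rsub \<Lambda> M N'" "S \<subseteq> N'" for N'
    using span(3)[OF S(2) _ that] S Nc by auto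
  then show ?thesis using S by blast
qed

end

section \<open>The category of finitely generated modules\<close>

context preadditive_category
begin

lemma direct_sum_copair:
  assumes "is_direct_sum C n A P" "B \<in> Obj C" "\<And>k. k < n \<Longrightarrow> g k \<in> Arr C (A k) B"
  obtains i v where "\<And>k. k < n \<Longrightarrow> i k \<in> Arr C (A k) P" "v \<in> Arr C P B"
    "\<And>k. k < n \<Longrightarrow> Comp C (A k) P B v (i k) = g k"
proof -
  obtain i p where ip: "\<And>k. k < n \<Longrightarrow> i k \<in> Arr C (A k) P" "\<And>k. k < n \<Longrightarrow> p k \<in> Arr C P (A k)"
    "\<And>k l. k < n \<Longrightarrow> l < n \<Longrightarrow> Comp C (A k) P (A l) (p l) (i k)
          = (if k = l then Ident C (A k) else Zero C (A k) (A l))"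
    and O: "\<And>k. k < n \<Longrightarrow> A k \<in> Obj C" "P \<in> Obj C"
    using assms(1) unfolding is_direct_sum_def by blast
  define v where "v = finprod (Hom C P B) (\<lambda>k. Comp C P (A k) B (g k) (p k)) {..<n}"
  have "Comp C (A l) P B v (i l) = g l" if l: "l < n" for l
  proof -
    have *: "Comp C (A l) P B (Comp C P (A k) B (g k) (p k)) (i l) = (if k = l then g l else Zero C (A l) B)"
      if "k < n" for k
      using O assms ip(1,2) ip(3)[OF l that] that l by (simp add: Comp_assoc')
    have "Comp C (A l) P B v (i l)
        = finprod (Hom C (A l) B) (\<lambda>k. Comp C (A l) P B (Comp C P (A k) B (g k) (p k)) (i l)) {..<n}"
      unfolding v_def using l assms O ip by (subst Comp_finprod_left) auto
    also have "\<dots> = g l" using l assms O ip * by (subst finprod_delta[where l=l]) auto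
    finally show ?thesis .
  qed
  moreover have "v \<in> Arr C P B" unfolding v_def using assms O ip by (auto intro!: finprod_Arr)
  ultimately show ?thesis using that ip(1) by blast
qed

lemma projective_retract:
  assumes "projective C E P" "Q \<in> Obj C" "s \<in> Arr C P Q" "j \<in> Arr C Q P" "Comp C Q P Q s j = Ident C Q"
  shows "projective C E Q"
  unfolding projective_def
proof (intro conjI ballI impI)
  have PO: "P \<in> Obj C" using assms(1) by (simp add: projective_def)
  fix A B D i p t assume H: "A \<in> Obj C" "B \<in> Obj C" "D \<in> Obj C" "i \<in> Arr C A B" "p \<in> Arr C B D"
    "E A i B p D" "t \<in> Arr C Q D"
  then obtain u where u: "u \<in> Arr C P B" "Comp C P B D p u = Comp C P Q D t s"
    using assms PO unfolding projective_def by (meson Comp_closed)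
  have "Comp C Q B D p (Comp C Q P B u j) = Comp C Q P D (Comp C P Q D t s) j"
    using u H assms PO by (simp add: Comp_assoc)
  also have "\<dots> = t" using H assms PO by (simp add: Comp_assoc')
  finally show "\<exists>s\<in>Arr C Q B. Comp C Q B D p s = t" using u H assms PO by (intro bexI[of _ "Comp C Q P B u j"]) auto
qed fact

end

definition linear_on ::
  "('r, 'd) ring_scheme \<Rightarrow> ('r, 'u, 'e) module_scheme \<Rightarrow> ('r, 'v, 'g) module_scheme \<Rightarrow> ('u \<Rightarrow> 'v) \<Rightarrow> bool" where
  "linear_on \<Lambda> A B h \<longleftrightarrow> (\<forall>x\<in>carrier A. h x \<in> carrier B) \<and>
    (\<forall>x\<in>carrier A. \<forall>y\<in>carrier A. h (x \<oplus>\<^bsub>A\<^esub> y) = h x \<oplus>\<^bsub>B\<^esub> h y) \<and>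
    (\<forall>r\<in>carrier \<Lambda>. \<forall>x\<in>carrier A. h (r \<odot>\<^bsub>A\<^esub> x) = r \<odot>\<^bsub>B\<^esub> h x)"

locale linear_map = A: right_module \<Lambda> A + B: right_module \<Lambda> B
  for \<Lambda> :: "('r, 'd) ring_scheme" and A :: "('r, 'u, 'e) module_scheme" and B :: "('r, 'v, 'g) module_scheme" +
  fixes h
  assumes linear: "linear_on \<Lambda> A B h"
begin

lemma closed [simp]: "x \<in> carrier A \<Longrightarrow> h x \<in> carrier B"
  and add: "\<lbrakk>x \<in> carrier A; y \<in> carrier A\<rbrakk> \<Longrightarrow> h (x \<oplus>\<^bsub>A\<^esub> y) = h x \<oplus>\<^bsub>B\<^esub> h y"
  and smult: "\<lbrakk>r \<in> carrier \<Lambda>; x \<in> carrier A\<rbrakk> \<Longrightarrow> h (r \<odot>\<^bsub>A\<^esub> x) = r \<odot>\<^bsub>B\<^esub> h x"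
  using linear by (auto simp: linear_on_def)

lemma zero [simp]: "h \<zero>\<^bsub>A\<^esub> = \<zero>\<^bsub>B\<^esub>"
  using add[of "\<zero>\<^bsub>A\<^esub>" "\<zero>\<^bsub>A\<^esub>"] closed[of "\<zero>\<^bsub>A\<^esub>"] by (simp add: B.add.l_cancel_one)

lemma neg: "x \<in> carrier A \<Longrightarrow> h (\<ominus>\<^bsub>A\<^esub> x) = \<ominus>\<^bsub>B\<^esub> h x"
  by (metis A.l_neg A.a_inv_closed B.minus_equality add closed zero)

lemma vimage_rsub: "rsub \<Lambda> B N \<Longrightarrow> rsub \<Lambda> A {x \<in> carrier A. h x \<in> N}"
  by (rule A.rsubI) (auto simp: add smult B.rsubD A.smult_closed)

lemma image_rsub:
  assumes "rsub \<Lambda> A N" shows "rsub \<Lambda> B (h ` N)"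
proof (rule B.rsubI)
  note N = A.rsubD[OF assms]
  show "h ` N \<subseteq> carrier B" using N(1) by auto
  show "\<zero>\<^bsub>B\<^esub> \<in> h ` N" using N(2) zero by (metis imageI)
  show "x \<oplus>\<^bsub>B\<^esub> y \<in> h ` N" if xy: "x \<in> h ` N" "y \<in> h ` N" for x y
  proof -
    obtain a b where "x = h a" "y = h b" "a \<in> N" "b \<in> N" using xy by auto
    then show ?thesis using N(1,3) add[of a b] by (metis imageI subsetD)
  qed
  show "r \<odot>\<^bsub>B\<^esub> x \<in> h ` N" if x: "r \<in> carrier \<Lambda>" "x \<in> h ` N" for r x
  proof -
    obtain a where "x = h a" "a \<in> N" using x by auto
    then show ?thesis using N(1,4) smult[of r a] x(1) by (metis imageI subsetD)
  qed
qed

lemma fg_image: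
  assumes "fg_right_module \<Lambda> A" "h ` carrier A = carrier B"
  shows "fg_right_module \<Lambda> B"
proof -
  obtain S where S: "finite S" "S \<subseteq> carrier A" "\<And>N. rsub \<Lambda> A N \<Longrightarrow> S \<subseteq> N \<Longrightarrow> N = carrier A"
    using assms(1)[unfolded A.fg_iff] by auto
  have "N = carrier B" if N: "rsub \<Lambda> B N" "h ` S \<subseteq> N" for N
  proof -
    have "{x \<in> carrier A. h x \<in> N} = carrier A" using S(2) N by (intro S(3) vimage_rsub) auto
    then have "h ` carrier A \<subseteq> N" by blast
    then show ?thesis using assms(2) B.rsubD(1)[OF N(1)] by auto
  qed
  then show ?thesis unfolding B.fg_iff using S by (intro exI[of _ "h ` S"]) auto
qed

end

locale module_category = L: ring \<Lambda> for \<Lambda> :: "('r, 'd) ring_scheme"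
begin

text \<open>Constructions like quotients and products leave the type that carries the modules of
  \<open>mod_cat \<Lambda>\<close>; their results are copied back along an injection.\<close>

lemma transported_module:
  fixes N :: "('r, 'u, 'e) module_scheme" and e :: "'u \<Rightarrow> 'v"
  assumes "right_module \<Lambda> N" and e: "inj_on e (carrier N)"
  defines "d \<equiv> inv_into (carrier N) e"
  defines "T \<equiv> \<lparr>carrier = e ` carrier N, mult = undefined, one = undefined, zero = e \<zero>\<^bsub>N\<^esub>,
    add = (\<lambda>x y. e (d x \<oplus>\<^bsub>N\<^esub> d y)), smult = (\<lambda>r x. e (r \<odot>\<^bsub>N\<^esub> d x))\<rparr>"
  shows "right_module \<Lambda> T" "linear_on \<Lambda> N T e" "bij_betw e (carrier N) (carrier T)"
proof -
  interpret N: right_module \<Lambda> N by fact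
  have d [simp]: "d (e x) = x" if "x \<in> carrier N" for x using that e by (simp add: d_def)
  show "right_module \<Lambda> T"
  proof (intro right_module.intro right_module_axioms.intro L.ring_axioms abelian_groupI)
    fix x assume "x \<in> carrier T"
    then obtain a where "x = e a" "a \<in> carrier N" by (auto simp: T_def)
    then show "\<exists>y\<in>carrier T. y \<oplus>\<^bsub>T\<^esub> x = \<zero>\<^bsub>T\<^esub>"
      by (intro bexI[of _ "e (\<ominus>\<^bsub>N\<^esub> a)"]) (auto simp: T_def N.l_neg)
  qed (auto simp: T_def N.a_ac N.smult_closed N.smult_l_distr N.smult_r_distr N.smult_assoc N.smult_one)
  show "linear_on \<Lambda> N T e" by (auto simp: linear_on_def T_def)
  show "bij_betw e (carrier N) (carrier T)" using e by (simp add: T_def bij_betw_def)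
qed

lemma mod_cat_simps [simp]:
  "M \<in> Obj (mod_cat \<Lambda>) \<longleftrightarrow> fg_right_module \<Lambda> M"
  "Zero (mod_cat \<Lambda>) M N = (\<lambda>x\<in>carrier M. \<zero>\<^bsub>N\<^esub>)"
  "f \<otimes>\<^bsub>Hom (mod_cat \<Lambda>) M N\<^esub> g = (\<lambda>x\<in>carrier M. f x \<oplus>\<^bsub>N\<^esub> g x)"
  "Comp (mod_cat \<Lambda>) M N K g' f' = compose (carrier M) g' f'"
  "Ident (mod_cat \<Lambda>) M = (\<lambda>x\<in>carrier M. x)"
  by (simp_all add: mod_cat_def)

lemma mod_cat_Arr: "f \<in> Arr (mod_cat \<Lambda>) A B \<longleftrightarrow> f \<in> extensional (carrier A) \<and> linear_on \<Lambda> A B f"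
  by (auto simp: mod_cat_def linear_on_def PiE_def)

lemma fg_module: "fg_right_module \<Lambda> M \<Longrightarrow> right_module \<Lambda> M"
  by (simp add: fg_right_module_def)

lemma mod_cat_linear:
  assumes "fg_right_module \<Lambda> A" "fg_right_module \<Lambda> B" "f \<in> Arr (mod_cat \<Lambda>) A B"
  shows "linear_map \<Lambda> A B f"
  using assms by (simp add: fg_module linear_map_def linear_map_axioms_def mod_cat_Arr)

lemma mod_cat_ext:
  assumes "f \<in> Arr (mod_cat \<Lambda>) A B" "g \<in> Arr (mod_cat \<Lambda>) A B'" "\<And>x. x \<in> carrier A \<Longrightarrow> f x = g x"
  shows "f = g"
  using assms by (auto simp: mod_cat_Arr intro: extensionalityI)

lemma mod_cat_preadditive: "preadditive_category (mod_cat \<Lambda>)"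
proof (rule preadditive_category.intro)
  fix A B assume "A \<in> Obj (mod_cat \<Lambda>)" "B \<in> Obj (mod_cat \<Lambda>)"
  then interpret A: right_module \<Lambda> A + B: right_module \<Lambda> B by (simp_all add: fg_module)
  show "comm_group (Hom (mod_cat \<Lambda>) A B)"
  proof (rule comm_groupI)
    fix f assume f: "f \<in> Arr (mod_cat \<Lambda>) A B"
    then interpret f: linear_map \<Lambda> A B f
      by unfold_locales (simp add: mod_cat_Arr)
    show "\<exists>g\<in>Arr (mod_cat \<Lambda>) A B. g \<otimes>\<^bsub>Hom (mod_cat \<Lambda>) A B\<^esub> f = Zero (mod_cat \<Lambda>) A B"
      by (intro bexI[of _ "\<lambda>x\<in>carrier A. \<ominus>\<^bsub>B\<^esub> f x"])
        (auto intro!: restrict_ext simp: B.l_neg mod_cat_Arr linear_on_def f.add f.smult B.minus_add B.smult_neg A.smult_closed)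
  next
    show "\<And>x. x \<in> Arr (mod_cat \<Lambda>) A B \<Longrightarrow> \<one>\<^bsub>Hom (mod_cat \<Lambda>) A B\<^esub> \<otimes>\<^bsub>Hom (mod_cat \<Lambda>) A B\<^esub> x = x"
      by (auto simp: mod_cat_Arr linear_on_def intro!: extensionalityI[of _ "carrier A"])
  qed (auto simp: mod_cat_Arr linear_on_def B.a_ac B.smult_r_distr A.smult_closed B.smult_closed intro!: restrict_ext)
next
  fix A B and f g g' D assume "A \<in> Obj (mod_cat \<Lambda>)" "B \<in> Obj (mod_cat \<Lambda>)" "f \<in> Arr (mod_cat \<Lambda>) A B"
    "g \<in> Arr (mod_cat \<Lambda>) B D" "g' \<in> Arr (mod_cat \<Lambda>) B D"
  then show "Comp (mod_cat \<Lambda>) A B D (g \<otimes>\<^bsub>Hom (mod_cat \<Lambda>) B D\<^esub> g') f =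
       Comp (mod_cat \<Lambda>) A B D g f \<otimes>\<^bsub>Hom (mod_cat \<Lambda>) A D\<^esub> Comp (mod_cat \<Lambda>) A B D g' f"
    by (auto simp: mod_cat_Arr linear_on_def compose_def intro!: restrict_ext)
next
  fix A B and f f' g D assume "A \<in> Obj (mod_cat \<Lambda>)" "B \<in> Obj (mod_cat \<Lambda>)" "f \<in> Arr (mod_cat \<Lambda>) A B"
    "f' \<in> Arr (mod_cat \<Lambda>) A B" "g \<in> Arr (mod_cat \<Lambda>) B D"
  then show "Comp (mod_cat \<Lambda>) A B D g (f \<otimes>\<^bsub>Hom (mod_cat \<Lambda>) A B\<^esub> f') =
       Comp (mod_cat \<Lambda>) A B D g f \<otimes>\<^bsub>Hom (mod_cat \<Lambda>) A D\<^esub> Comp (mod_cat \<Lambda>) A B D g f'"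
    by (auto simp: mod_cat_Arr linear_on_def compose_def intro!: restrict_ext)
next
  fix A B and f assume "f \<in> Arr (mod_cat \<Lambda>) A B"
  then show "Comp (mod_cat \<Lambda>) A B B (Ident (mod_cat \<Lambda>) B) f = f" "Comp (mod_cat \<Lambda>) A A B f (Ident (mod_cat \<Lambda>) A) = f"
    by (auto simp: mod_cat_Arr linear_on_def compose_def intro!: extensionalityI[of _ "carrier A"])
next
  fix A assume "A \<in> Obj (mod_cat \<Lambda>)"
  then interpret A: right_module \<Lambda> A by (simp add: fg_module)
  show "Ident (mod_cat \<Lambda>) A \<in> Arr (mod_cat \<Lambda>) A A" by (auto simp: mod_cat_Arr linear_on_def A.smult_closed)
next
  fix A B D f g assume *: "A \<in> Obj (mod_cat \<Lambda>)" "f \<in> Arr (mod_cat \<Lambda>) A B" "g \<in> Arr (mod_cat \<Lambda>) B D"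
  then interpret A: right_module \<Lambda> A by (simp add: fg_module)
  show "Comp (mod_cat \<Lambda>) A B D g f \<in> Arr (mod_cat \<Lambda>) A D"
    using * by (auto simp: mod_cat_Arr linear_on_def compose_def A.smult_closed)
next
  fix A B D E f g h assume "f \<in> Arr (mod_cat \<Lambda>) A B"
  then show "Comp (mod_cat \<Lambda>) A D E h (Comp (mod_cat \<Lambda>) A B D g f) = Comp (mod_cat \<Lambda>) A B E (Comp (mod_cat \<Lambda>) B D E h g) f"
    by (auto simp: mod_cat_Arr linear_on_def compose_def intro!: restrict_ext)
qed

text \<open>If \<open>g 0, \<dots>, g (n - 1)\<close> generate the module, then an element is determined by the set of its
  coordinate tuples, which belongs to \<^typ>\<open>'r elt\<close>.\<close>

lemma encode:
  fixes N :: "('r, 'u, 'e) module_scheme"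
  assumes "fg_right_module \<Lambda> N"
  obtains T :: "'r fmod" and e where "fg_right_module \<Lambda> T" "linear_on \<Lambda> N T e" "bij_betw e (carrier N) (carrier T)"
proof -
  interpret N: right_module \<Lambda> N using assms by (simp add: fg_right_module_def)
  obtain S where S: "finite S" "S \<subseteq> carrier N"
    "\<forall>x\<in>carrier N. \<exists>c\<in>S \<rightarrow> carrier \<Lambda>. x = finsum N (\<lambda>s. c s \<odot>\<^bsub>N\<^esub> s) S"
    using assms unfolding fg_right_module_def by blast
  obtain g where g: "bij_betw g {0..<card S} S" using ex_bij_betw_nat_finite[OF S(1)] by auto
  define e :: "'u \<Rightarrow> 'r elt" where "e x = {c. c \<in> {0..<card S} \<rightarrow> carrier \<Lambda> \<and>
    finsum N (\<lambda>i. c i \<odot>\<^bsub>N\<^esub> g i) {0..<card S} = x}" for x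
  have ne: "e x \<noteq> {}" if x: "x \<in> carrier N" for x
  proof -
    obtain c where c: "c \<in> S \<rightarrow> carrier \<Lambda>" "x = finsum N (\<lambda>s. c s \<odot>\<^bsub>N\<^esub> s) S" using S(3) x by auto
    have im: "g ` {0..<card S} = S" "inj_on g {0..<card S}" using g by (auto simp: bij_betw_def)
    have "x = finsum N (\<lambda>i. c (g i) \<odot>\<^bsub>N\<^esub> g i) {0..<card S}"
      unfolding c(2) using N.finsum_reindex[of "\<lambda>s. c s \<odot>\<^bsub>N\<^esub> s" g "{0..<card S}"] im c(1) S(2)
      by (auto simp: Pi_iff subset_iff N.smult_closed)
    then have "(\<lambda>i. c (g i)) \<in> e x" using c(1) im unfolding e_def by auto
    then show ?thesis by auto
  qed
  have inj: "inj_on e (carrier N)"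
  proof (rule inj_onI)
    fix x y assume "x \<in> carrier N" "y \<in> carrier N" "e x = e y"
    then show "x = y" using ne[of x] by (auto simp: e_def)
  qed
  note T = transported_module[OF N.right_module_axioms inj]
  then have "fg_right_module \<Lambda> \<lparr>carrier = e ` carrier N, mult = undefined, one = undefined, zero = e \<zero>\<^bsub>N\<^esub>,
    add = (\<lambda>x y. e (inv_into (carrier N) e x \<oplus>\<^bsub>N\<^esub> inv_into (carrier N) e y)),
    smult = (\<lambda>r x. e (r \<odot>\<^bsub>N\<^esub> inv_into (carrier N) e x))\<rparr>"
    using assms by (intro linear_map.fg_image[of \<Lambda> N _ e])
      (auto simp: linear_map_def linear_map_axioms_def N.right_module_axioms)
  then show ?thesis using that T(2,3) by blast
qed

lemma inverse_linear:
  assumes "linear_on \<Lambda> A B e" "bij_betw e (carrier A) (carrier B)" "right_module \<Lambda> A"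
  defines "d \<equiv> inv_into (carrier A) e"
  shows "linear_on \<Lambda> B A d" "\<And>x. x \<in> carrier A \<Longrightarrow> d (e x) = x" "\<And>y. y \<in> carrier B \<Longrightarrow> e (d y) = y"
proof -
  interpret A: right_module \<Lambda> A by fact
  show 1: "d (e x) = x" if "x \<in> carrier A" for x using assms(2) that by (simp add: d_def bij_betw_def)
  show 2: "e (d y) = y" if "y \<in> carrier B" for y
    using assms(2) that by (simp add: d_def bij_betw_def f_inv_into_f)
  have dc: "d y \<in> carrier A" if "y \<in> carrier B" for y
    using assms(2) that by (auto simp: d_def bij_betw_def intro: inv_into_into)
  show "linear_on \<Lambda> B A d"
    unfolding linear_on_def
  proof (intro conjI ballI)
    fix x y assume "x \<in> carrier B" "y \<in> carrier B"
    then have "x \<oplus>\<^bsub>B\<^esub> y = e (d x \<oplus>\<^bsub>A\<^esub> d y)" using assms(1) 2 dc by (simp add: linear_on_def)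
    then show "d (x \<oplus>\<^bsub>B\<^esub> y) = d x \<oplus>\<^bsub>A\<^esub> d y" using 1 dc \<open>x \<in> _\<close> \<open>y \<in> _\<close> by simp
  next
    fix r x assume "r \<in> carrier \<Lambda>" "x \<in> carrier B"
    then have "r \<odot>\<^bsub>B\<^esub> x = e (r \<odot>\<^bsub>A\<^esub> d x)" using assms(1) 2 dc by (simp add: linear_on_def)
    then show "d (r \<odot>\<^bsub>B\<^esub> x) = r \<odot>\<^bsub>A\<^esub> d x" using 1 dc A.smult_closed \<open>r \<in> _\<close> \<open>x \<in> _\<close> by simp
  qed (use dc in auto)
qed

text \<open>The regular module, with \<open>u\<close> corresponding to \<open>1\<close>: it represents the underlying set of a module.\<close>

lemma free_module_exists:
  obtains U :: "'r fmod" and u where "U \<in> Obj (mod_cat \<Lambda>)" "u \<in> carrier U"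
    "\<And>M m. M \<in> Obj (mod_cat \<Lambda>) \<Longrightarrow> m \<in> carrier M \<Longrightarrow> \<exists>f\<in>Arr (mod_cat \<Lambda>) U M. f u = m"
    "\<And>x. x \<in> carrier U \<Longrightarrow> \<exists>r\<in>carrier \<Lambda>. x = r \<odot>\<^bsub>U\<^esub> u"
proof -
  define N :: "('r, 'r) module" where "N = \<lparr>carrier = carrier \<Lambda>, mult = undefined, one = undefined,
    zero = \<zero>\<^bsub>\<Lambda>\<^esub>, add = add \<Lambda>, smult = (\<lambda>r x. x \<otimes>\<^bsub>\<Lambda>\<^esub> r)\<rparr>"
  have N: "right_module \<Lambda> N"
  proof (intro right_module.intro right_module_axioms.intro L.ring_axioms abelian_groupI)
    fix x assume "x \<in> carrier N"
    then show "\<exists>y\<in>carrier N. y \<oplus>\<^bsub>N\<^esub> x = \<zero>\<^bsub>N\<^esub>"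
      by (intro bexI[of _ "\<ominus>\<^bsub>\<Lambda>\<^esub> x"]) (auto simp: N_def L.l_neg)
  qed (auto simp: N_def L.a_ac L.l_distr L.r_distr L.m_assoc)
  then interpret N: right_module \<Lambda> N .
  have "K = carrier N" if K: "rsub \<Lambda> N K" "{\<one>\<^bsub>\<Lambda>\<^esub>} \<subseteq> K" for K
    using N.rsubD(1)[OF K(1)] N.rsubD(4)[OF K(1), of _ "\<one>\<^bsub>\<Lambda>\<^esub>"] K(2) by (auto simp: N_def)
  then have "fg_right_module \<Lambda> N" unfolding N.fg_iff by (intro exI[of _ "{\<one>\<^bsub>\<Lambda>\<^esub>}"]) (auto simp: N_def)
  then obtain U :: "'r fmod" and e where U: "fg_right_module \<Lambda> U" "linear_on \<Lambda> N U e" "bij_betw e (carrier N) (carrier U)"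
    by (rule encode)
  define d where "d = inv_into (carrier N) e"
  have d: "linear_on \<Lambda> U N d" "\<And>x. x \<in> carrier N \<Longrightarrow> d (e x) = x" "\<And>y. y \<in> carrier U \<Longrightarrow> e (d y) = y"
    using inverse_linear[OF U(2,3) N] by (auto simp: d_def)
  interpret e: linear_map \<Lambda> N U e using U N by (simp add: fg_module linear_map_def linear_map_axioms_def)
  interpret d: linear_map \<Lambda> U N d using U N d by (simp add: fg_module linear_map_def linear_map_axioms_def)
  have 1: "\<one>\<^bsub>\<Lambda>\<^esub> \<in> carrier N" by (simp add: N_def)
  show ?thesis
  proof (rule that)
    show "U \<in> Obj (mod_cat \<Lambda>)" using U by simp
    show "e \<one>\<^bsub>\<Lambda>\<^esub> \<in> carrier U" using 1 by simp
    show "\<exists>f\<in>Arr (mod_cat \<Lambda>) U M. f (e \<one>\<^bsub>\<Lambda>\<^esub>) = m" if "M \<in> Obj (mod_cat \<Lambda>)" "m \<in> carrier M" for M m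
    proof -
      interpret M: right_module \<Lambda> M using that by (simp add: fg_module)
      have dl: "d x \<in> carrier \<Lambda>" if "x \<in> carrier U" for x using d.closed[OF that] by (simp add: N_def)
      have "(\<lambda>x\<in>carrier U. d x \<odot>\<^bsub>M\<^esub> m) \<in> Arr (mod_cat \<Lambda>) U M"
        using that dl by (auto simp: mod_cat_Arr linear_on_def M.smult_closed d.add d.smult e.B.smult_closed)
          (auto simp: N_def M.smult_l_distr M.smult_assoc)
      then show ?thesis using that 1 d(2)[OF 1] by (intro bexI) (auto simp: M.smult_one)
    qed
    show "\<exists>r\<in>carrier \<Lambda>. x = r \<odot>\<^bsub>U\<^esub> e \<one>\<^bsub>\<Lambda>\<^esub>" if x: "x \<in> carrier U" for x
    proof -
      have dx: "d x \<in> carrier \<Lambda>" using d.closed[OF x] by (simp add: N_def)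
      have "d x \<odot>\<^bsub>U\<^esub> e \<one>\<^bsub>\<Lambda>\<^esub> = e (d x \<odot>\<^bsub>N\<^esub> \<one>\<^bsub>\<Lambda>\<^esub>)" using e.smult[OF dx 1] by simp
      also have "\<dots> = x" using dx d(3)[OF x] by (simp add: N_def)
      finally show ?thesis using dx by metis
    qed
  qed
qed

lemma quotient_exists:
  assumes B: "B \<in> Obj (mod_cat \<Lambda>)" and N: "rsub \<Lambda> B N"
  obtains D p where "D \<in> Obj (mod_cat \<Lambda>)" "p \<in> Arr (mod_cat \<Lambda>) B D" "p ` carrier B = carrier D"
    "{x \<in> carrier B. p x = \<zero>\<^bsub>D\<^esub>} = N"
proof -
  interpret B: right_module \<Lambda> B using B by (simp add: fg_module)
  note N' = B.rsubD[OF N]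
  \<comment> \<open>the quotient is realised on a system of representatives\<close>
  define rep where "rep x = (SOME y. y \<in> carrier B \<and> y \<ominus>\<^bsub>B\<^esub> x \<in> N)" for x
  have rep: "rep x \<in> carrier B" "rep x \<ominus>\<^bsub>B\<^esub> x \<in> N" if "x \<in> carrier B" for x
  proof -
    have "x \<in> carrier B \<and> x \<ominus>\<^bsub>B\<^esub> x \<in> N" using that N' by (simp add: B.minus_eq B.r_neg)
    from someI[of "\<lambda>y. y \<in> carrier B \<and> y \<ominus>\<^bsub>B\<^esub> x \<in> N", OF this]
    show "rep x \<in> carrier B" "rep x \<ominus>\<^bsub>B\<^esub> x \<in> N" by (simp_all add: rep_def)
  qed
  have tr: "x \<ominus>\<^bsub>B\<^esub> z \<in> N" if "x \<in> carrier B" "y \<in> carrier B" "z \<in> carrier B" "x \<ominus>\<^bsub>B\<^esub> y \<in> N" "y \<ominus>\<^bsub>B\<^esub> z \<in> N" for x y z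
  proof -
    have "x \<ominus>\<^bsub>B\<^esub> z = (x \<ominus>\<^bsub>B\<^esub> y) \<oplus>\<^bsub>B\<^esub> (y \<ominus>\<^bsub>B\<^esub> z)"
      using that by (simp add: B.minus_eq B.a_assoc) (simp add: B.a_assoc[symmetric] B.l_neg)
    then show ?thesis using that N' by simp
  qed
  have sy: "y \<ominus>\<^bsub>B\<^esub> x \<in> N" if "x \<in> carrier B" "y \<in> carrier B" "x \<ominus>\<^bsub>B\<^esub> y \<in> N" for x y
  proof -
    have "y \<ominus>\<^bsub>B\<^esub> x = \<ominus>\<^bsub>B\<^esub> (x \<ominus>\<^bsub>B\<^esub> y)" using that by (simp add: B.minus_eq B.minus_add B.a_comm)
    then show ?thesis using that N' by simp
  qed
  have eq: "rep x = rep y \<longleftrightarrow> x \<ominus>\<^bsub>B\<^esub> y \<in> N" if xy: "x \<in> carrier B" "y \<in> carrier B" for x y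
  proof
    assume "rep x = rep y"
    then show "x \<ominus>\<^bsub>B\<^esub> y \<in> N" using rep[OF xy(1)] rep[OF xy(2)] tr[of x "rep x" y] sy[of "rep x" x] xy by simp
  next
    assume *: "x \<ominus>\<^bsub>B\<^esub> y \<in> N"
    have "(z \<in> carrier B \<and> z \<ominus>\<^bsub>B\<^esub> x \<in> N) = (z \<in> carrier B \<and> z \<ominus>\<^bsub>B\<^esub> y \<in> N)" for z
      using * xy tr[of z x y] tr[of z y x] sy[of x y] by blast
    then show "rep x = rep y" by (simp add: rep_def)
  qed
  have rr: "rep (rep x) = rep x" if "x \<in> carrier B" for x using eq rep that by simp
  have ra: "rep (rep x \<oplus>\<^bsub>B\<^esub> y) = rep (x \<oplus>\<^bsub>B\<^esub> y)" if xy: "x \<in> carrier B" "y \<in> carrier B" for x y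
  proof -
    have "rep x \<oplus>\<^bsub>B\<^esub> y \<ominus>\<^bsub>B\<^esub> (x \<oplus>\<^bsub>B\<^esub> y) = rep x \<ominus>\<^bsub>B\<^esub> x"
    proof -
      have "rep x \<oplus>\<^bsub>B\<^esub> y \<ominus>\<^bsub>B\<^esub> (x \<oplus>\<^bsub>B\<^esub> y) = (rep x \<ominus>\<^bsub>B\<^esub> x) \<oplus>\<^bsub>B\<^esub> (y \<oplus>\<^bsub>B\<^esub> \<ominus>\<^bsub>B\<^esub> y)"
        using xy rep(1)[OF xy(1)] by (simp only: B.minus_eq B.minus_add B.a_ac B.a_closed B.a_inv_closed)
      then show ?thesis using xy rep(1)[OF xy(1)] by (simp add: B.r_neg)
    qed
    then show ?thesis using eq rep xy by simp
  qed
  have ra': "rep (y \<oplus>\<^bsub>B\<^esub> rep x) = rep (y \<oplus>\<^bsub>B\<^esub> x)" if xy: "x \<in> carrier B" "y \<in> carrier B" for x y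
    using ra[OF xy] rep xy by (simp add: B.a_comm)
  have rs: "rep (r \<odot>\<^bsub>B\<^esub> rep x) = rep (r \<odot>\<^bsub>B\<^esub> x)" if rx: "r \<in> carrier \<Lambda>" "x \<in> carrier B" for r x
  proof -
    have "r \<odot>\<^bsub>B\<^esub> rep x \<ominus>\<^bsub>B\<^esub> r \<odot>\<^bsub>B\<^esub> x = r \<odot>\<^bsub>B\<^esub> (rep x \<ominus>\<^bsub>B\<^esub> x)"
      using rx rep by (simp add: B.minus_eq B.smult_r_distr B.smult_neg)
    then show ?thesis using eq rep rx N' B.smult_closed by simp
  qed
  define D :: "'r fmod" where "D = \<lparr>carrier = rep ` carrier B, mult = undefined, one = undefined,
    zero = rep \<zero>\<^bsub>B\<^esub>, add = (\<lambda>x y. rep (x \<oplus>\<^bsub>B\<^esub> y)), smult = (\<lambda>r x. rep (r \<odot>\<^bsub>B\<^esub> x))\<rparr>"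
  have D: "right_module \<Lambda> D"
  proof (intro right_module.intro right_module_axioms.intro L.ring_axioms abelian_groupI)
    fix x assume "x \<in> carrier D"
    then obtain a where "x = rep a" "a \<in> carrier B" by (auto simp: D_def)
    then show "\<exists>y\<in>carrier D. y \<oplus>\<^bsub>D\<^esub> x = \<zero>\<^bsub>D\<^esub>"
      by (intro bexI[of _ "rep (\<ominus>\<^bsub>B\<^esub> a)"]) (auto simp: D_def ra ra' rep B.l_neg)
  qed (auto simp: D_def ra ra' rs rr rep B.a_assoc B.smult_closed B.smult_one,
      simp_all add: B.a_comm B.smult_l_distr B.smult_r_distr B.smult_assoc B.smult_closed)
  have lin: "linear_on \<Lambda> B D rep"
    by (auto simp: linear_on_def D_def ra ra' rs rep B.smult_closed)
  have im: "rep ` carrier B = carrier D" by (simp add: D_def)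
  have kernel: "{x \<in> carrier B. rep x = \<zero>\<^bsub>D\<^esub>} = N"
  proof -
    have "rep x = rep \<zero>\<^bsub>B\<^esub> \<longleftrightarrow> x \<in> N" if x: "x \<in> carrier B" for x
      using eq[OF x B.zero_closed] x B.minus_equality[OF B.r_zero[OF B.zero_closed] B.zero_closed B.zero_closed]
      by (simp add: B.minus_eq)
    then show ?thesis using N'(1) by (auto simp only: D_def partial_object.simps monoid.simps ring.simps)
  qed
  interpret rep: linear_map \<Lambda> B D rep
    by (intro linear_map.intro linear_map_axioms.intro D lin B.right_module_axioms)

  have fgB: "fg_right_module \<Lambda> B" using B by simp
  have fg: "fg_right_module \<Lambda> D" by (rule rep.fg_image[OF fgB im])
  show ?thesis
  proof (rule that)
    show "D \<in> Obj (mod_cat \<Lambda>)" using fg by simp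
    show "(\<lambda>x\<in>carrier B. rep x) \<in> Arr (mod_cat \<Lambda>) B D"
      using lin by (auto simp: mod_cat_Arr linear_on_def B.smult_closed)
    show "(\<lambda>x\<in>carrier B. rep x) ` carrier B = carrier D" using im by simp
    show "{x \<in> carrier B. (\<lambda>x\<in>carrier B. rep x) x = \<zero>\<^bsub>D\<^esub>} = N"
      using kernel by (simp cong: conj_cong)
  qed
qed

end

lemma epi_cancel:
  assumes "epi C A f B" "T \<in> Obj C" "s \<in> Arr C B T" "t \<in> Arr C B T" "Comp C A B T s f = Comp C A B T t f"
  shows "s = t"
  using assms by (simp add: epi_def)

lemma monic_cancel:
  assumes "monic C A f B" "T \<in> Obj C" "s \<in> Arr C T A" "t \<in> Arr C T A" "Comp C T A B f s = Comp C T A B f t"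
  shows "s = t"
  using assms by (simp add: monic_def)

sublocale module_category \<subseteq> C: preadditive_category "mod_cat \<Lambda>"
  by (rule mod_cat_preadditive)

context module_category
begin

abbreviation "M \<equiv> mod_cat \<Lambda>"

lemma free_module:
  "\<exists>(U :: 'r fmod) u. U \<in> Obj M \<and> u \<in> carrier U \<and> (\<forall>M'\<in>Obj M. \<forall>m\<in>carrier M'. \<exists>f\<in>Arr M U M'. f u = m) \<and>
    (\<forall>x\<in>carrier U. \<exists>r\<in>carrier \<Lambda>. x = r \<odot>\<^bsub>U\<^esub> u)"
proof (rule free_module_exists)
  fix U :: "'r fmod" and u
  assume U: "U \<in> Obj M" "u \<in> carrier U"
    and 3: "\<And>M' m. M' \<in> Obj M \<Longrightarrow> m \<in> carrier M' \<Longrightarrow> \<exists>f\<in>Arr M U M'. f u = m"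
    and 4: "\<And>x. x \<in> carrier U \<Longrightarrow> \<exists>r\<in>carrier \<Lambda>. x = r \<odot>\<^bsub>U\<^esub> u"
  show ?thesis by (rule exI[of _ U], rule exI[of _ u]) (use U 3 4 in simp)
qed

lemma quotient:
  assumes "B \<in> Obj M" "rsub \<Lambda> B N"
  shows "\<exists>D p. D \<in> Obj M \<and> p \<in> Arr M B D \<and> p ` carrier B = carrier D \<and> {x \<in> carrier B. p x = \<zero>\<^bsub>D\<^esub>} = N"
  by (rule quotient_exists[OF assms]) (intro exI conjI, assumption+)

lemma zero_module_exists: "\<exists>Z. zero_object M Z"
proof -
  define Z :: "'r fmod" where "Z = \<lparr>carrier = {{}}, mult = undefined, one = undefined, zero = {},
    add = (\<lambda>x y. {}), smult = (\<lambda>r x. {})\<rparr>"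
  have "right_module \<Lambda> Z"
    by (intro right_module.intro right_module_axioms.intro L.ring_axioms abelian_groupI) (auto simp: Z_def)
  then interpret Z: right_module \<Lambda> Z .
  have Zc: "carrier Z = {\<zero>\<^bsub>Z\<^esub>}" by (simp add: Z_def)
  have "N = carrier Z" if "rsub \<Lambda> Z N" for N
    using Z.rsubD(1,2)[OF that] Zc by auto
  then have ZO: "Z \<in> Obj M" unfolding mod_cat_simps Z.fg_iff
    by (intro exI[of _ "{}"]) simp
  have "Arr M Z A = {Zero M Z A} \<and> Arr M A Z = {Zero M A Z}" if A: "A \<in> Obj M" for A
  proof -
    have "f = Zero M Z A" if f: "f \<in> Arr M Z A" for f
    proof (rule mod_cat_ext[OF f C.zero_closed[OF ZO A]])
      interpret f: linear_map \<Lambda> Z A f using ZO A f by (simp add: mod_cat_linear)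
      show "f x = Zero M Z A x" if "x \<in> carrier Z" for x using that Zc by auto
    qed
    moreover have "f = Zero M A Z" if f: "f \<in> Arr M A Z" for f
    proof (rule mod_cat_ext[OF f C.zero_closed[OF A ZO]])
      interpret f: linear_map \<Lambda> A Z f using ZO A f by (simp add: mod_cat_linear)
      show "f x = Zero M A Z x" if "x \<in> carrier A" for x using that Zc f.closed[OF that] by auto
    qed
    ultimately show ?thesis using C.zero_closed[OF ZO A] C.zero_closed[OF A ZO] by blast
  qed
  then show ?thesis using ZO unfolding zero_object_def by blast
qed

lemma biproduct_exists:
  assumes AB: "A \<in> Obj M" "B \<in> Obj M"
  shows "\<exists>S\<in>Obj M. \<exists>i j p q. biproduct M A B S i j p q"
proof -
  interpret A: right_module \<Lambda> A + B: right_module \<Lambda> B using AB by (simp_all add: fg_module)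
  define P :: "('r, 'r elt \<times> 'r elt) module" where "P = \<lparr>carrier = carrier A \<times> carrier B, mult = undefined, one = undefined,
    zero = (\<zero>\<^bsub>A\<^esub>, \<zero>\<^bsub>B\<^esub>), add = (\<lambda>x y. (fst x \<oplus>\<^bsub>A\<^esub> fst y, snd x \<oplus>\<^bsub>B\<^esub> snd y)),
    smult = (\<lambda>r x. (r \<odot>\<^bsub>A\<^esub> fst x, r \<odot>\<^bsub>B\<^esub> snd x))\<rparr>"
  have P: "right_module \<Lambda> P"
  proof (intro right_module.intro right_module_axioms.intro L.ring_axioms abelian_groupI)
    fix x assume "x \<in> carrier P"
    then show "\<exists>y\<in>carrier P. y \<oplus>\<^bsub>P\<^esub> x = \<zero>\<^bsub>P\<^esub>"
      by (intro bexI[of _ "(\<ominus>\<^bsub>A\<^esub> fst x, \<ominus>\<^bsub>B\<^esub> snd x)"]) (auto simp: P_def A.l_neg B.l_neg)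
  qed (auto simp: P_def A.a_ac B.a_ac A.smult_closed A.smult_l_distr A.smult_r_distr A.smult_assoc A.smult_one
      B.smult_closed B.smult_l_distr B.smult_r_distr B.smult_assoc B.smult_one)
  then interpret P: right_module \<Lambda> P .
  obtain S where S: "finite S" "S \<subseteq> carrier A" "\<And>N. rsub \<Lambda> A N \<Longrightarrow> S \<subseteq> N \<Longrightarrow> N = carrier A"
    using AB(1)[unfolded mod_cat_simps A.fg_iff] by auto
  obtain T where T: "finite T" "T \<subseteq> carrier B" "\<And>N. rsub \<Lambda> B N \<Longrightarrow> T \<subseteq> N \<Longrightarrow> N = carrier B"
    using AB(2)[unfolded mod_cat_simps B.fg_iff] by auto
  have iA: "linear_map \<Lambda> A P (\<lambda>x. (x, \<zero>\<^bsub>B\<^esub>))"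
    by (intro linear_map.intro linear_map_axioms.intro P A.right_module_axioms) (auto simp: linear_on_def P_def)
  have iB: "linear_map \<Lambda> B P (\<lambda>x. (\<zero>\<^bsub>A\<^esub>, x))"
    by (intro linear_map.intro linear_map_axioms.intro P B.right_module_axioms) (auto simp: linear_on_def P_def)
  have "fg_right_module \<Lambda> P" unfolding P.fg_iff
  proof (intro exI[of _ "(\<lambda>x. (x, \<zero>\<^bsub>B\<^esub>)) ` S \<union> (\<lambda>x. (\<zero>\<^bsub>A\<^esub>, x)) ` T"] conjI allI impI)
    show "(\<lambda>x. (x, \<zero>\<^bsub>B\<^esub>)) ` S \<union> (\<lambda>x. (\<zero>\<^bsub>A\<^esub>, x)) ` T \<subseteq> carrier P" using S T by (auto simp: P_def)
    fix N assume N: "rsub \<Lambda> P N \<and> (\<lambda>x. (x, \<zero>\<^bsub>B\<^esub>)) ` S \<union> (\<lambda>x. (\<zero>\<^bsub>A\<^esub>, x)) ` T \<subseteq> N"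
    have "{x \<in> carrier A. (x, \<zero>\<^bsub>B\<^esub>) \<in> N} = carrier A"
      using S N linear_map.vimage_rsub[OF iA] by (intro S(3)) auto
    then have 1: "(x, \<zero>\<^bsub>B\<^esub>) \<in> N" if "x \<in> carrier A" for x using that by blast
    have "{x \<in> carrier B. (\<zero>\<^bsub>A\<^esub>, x) \<in> N} = carrier B"
      using T N linear_map.vimage_rsub[OF iB] by (intro T(3)) auto
    then have 2: "(\<zero>\<^bsub>A\<^esub>, x) \<in> N" if "x \<in> carrier B" for x using that by blast
    have "(x, y) \<in> N" if "x \<in> carrier A" "y \<in> carrier B" for x y
      using P.rsubD(3)[OF conjunct1[OF N] 1[OF that(1)] 2[OF that(2)]] that by (simp add: P_def)
    then show "N = carrier P" using P.rsubD(1)[of N] N by (auto simp: P_def)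
  qed (use S T in auto)
  then obtain W :: "'r fmod" and e where W: "fg_right_module \<Lambda> W" "linear_on \<Lambda> P W e" "bij_betw e (carrier P) (carrier W)"
    by (rule encode)
  define d where "d = inv_into (carrier P) e"
  have d: "linear_on \<Lambda> W P d" "\<And>x. x \<in> carrier P \<Longrightarrow> d (e x) = x" "\<And>y. y \<in> carrier W \<Longrightarrow> e (d y) = y"
    using inverse_linear[OF W(2,3) P] by (auto simp: d_def)
  interpret W: right_module \<Lambda> W using W by (simp add: fg_module)
  have Pc: "(x, y) \<in> carrier P \<longleftrightarrow> x \<in> carrier A \<and> y \<in> carrier B" for x y by (simp add: P_def)
  have Pa: "(x, y) \<oplus>\<^bsub>P\<^esub> (x', y') = (x \<oplus>\<^bsub>A\<^esub> x', y \<oplus>\<^bsub>B\<^esub> y')" "r \<odot>\<^bsub>P\<^esub> (x, y) = (r \<odot>\<^bsub>A\<^esub> x, r \<odot>\<^bsub>B\<^esub> y)"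
    for x y x' y' r by (simp_all add: P_def)
  have Ps: "fst (a \<oplus>\<^bsub>P\<^esub> b) = fst a \<oplus>\<^bsub>A\<^esub> fst b" "snd (a \<oplus>\<^bsub>P\<^esub> b) = snd a \<oplus>\<^bsub>B\<^esub> snd b"
    "fst (r \<odot>\<^bsub>P\<^esub> a) = r \<odot>\<^bsub>A\<^esub> fst a" "snd (r \<odot>\<^bsub>P\<^esub> a) = r \<odot>\<^bsub>B\<^esub> snd a" for a b r
    by (simp_all add: P_def)
  have el: "e x \<in> carrier W" "e (x \<oplus>\<^bsub>P\<^esub> y) = e x \<oplus>\<^bsub>W\<^esub> e y" "e (r \<odot>\<^bsub>P\<^esub> x) = r \<odot>\<^bsub>W\<^esub> e x"
    if "x \<in> carrier P" "y \<in> carrier P" "r \<in> carrier \<Lambda>" for x y r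
    using W(2) that by (auto simp: linear_on_def)
  have dl: "fst (d x) \<in> carrier A" "snd (d x) \<in> carrier B" "d (x \<oplus>\<^bsub>W\<^esub> y) = d x \<oplus>\<^bsub>P\<^esub> d y" "d (r \<odot>\<^bsub>W\<^esub> x) = r \<odot>\<^bsub>P\<^esub> d x"
    if "x \<in> carrier W" "y \<in> carrier W" "r \<in> carrier \<Lambda>" for x y r
    using d(1) that Pc[of "fst (d x)" "snd (d x)"] by (auto simp: linear_on_def)
  have e1: "e (x, y) \<in> carrier W" and d2: "d (e (x, y)) = (x, y)" if "x \<in> carrier A" "y \<in> carrier B" for x y
    using el(1)[of "(x, y)" "(x, y)" "\<zero>\<^bsub>\<Lambda>\<^esub>"] d(2)[of "(x, y)"] that by (simp_all add: Pc)
  have d3: "d (x \<oplus>\<^bsub>W\<^esub> y) = d x \<oplus>\<^bsub>P\<^esub> d y" if "x \<in> carrier W" "y \<in> carrier W" for x y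
    using dl(3)[OF that, of "\<zero>\<^bsub>\<Lambda>\<^esub>"] by simp
  have d4: "d (r \<odot>\<^bsub>W\<^esub> x) = r \<odot>\<^bsub>P\<^esub> d x" if "x \<in> carrier W" "r \<in> carrier \<Lambda>" for x r
    using dl(4)[OF that(1,1,2)] .
  have d5: "fst (d x) \<in> carrier A" "snd (d x) \<in> carrier B" if "x \<in> carrier W" for x
    using dl(1,2)[OF that that, of "\<zero>\<^bsub>\<Lambda>\<^esub>"] by simp_all
  have e2: "e (x \<oplus>\<^bsub>A\<^esub> x', y \<oplus>\<^bsub>B\<^esub> y') = e (x, y) \<oplus>\<^bsub>W\<^esub> e (x', y')"
    if "x \<in> carrier A" "y \<in> carrier B" "x' \<in> carrier A" "y' \<in> carrier B" for x x' y y'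
    using el(2)[of "(x, y)" "(x', y')" "\<zero>\<^bsub>\<Lambda>\<^esub>"] that by (simp add: Pc Pa)
  have e3: "e (r \<odot>\<^bsub>A\<^esub> x, r \<odot>\<^bsub>B\<^esub> y) = r \<odot>\<^bsub>W\<^esub> e (x, y)"
    if "x \<in> carrier A" "y \<in> carrier B" "r \<in> carrier \<Lambda>" for x y r
    using el(3)[of "(x, y)" "(x, y)" r] that by (simp add: Pc Pa)
  let ?i = "\<lambda>x\<in>carrier A. e (x, \<zero>\<^bsub>B\<^esub>)" and ?j = "\<lambda>x\<in>carrier B. e (\<zero>\<^bsub>A\<^esub>, x)"
  let ?p = "\<lambda>x\<in>carrier W. fst (d x)" and ?q = "\<lambda>x\<in>carrier W. snd (d x)"
  have z: "\<zero>\<^bsub>\<Lambda>\<^esub> \<in> carrier \<Lambda>" by simp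
  have i: "?i \<in> Arr M A W" unfolding mod_cat_Arr linear_on_def
    by (auto simp: e1 A.smult_closed simp flip: e2 e3)
  have j: "?j \<in> Arr M B W" unfolding mod_cat_Arr linear_on_def
    by (auto simp: e1 B.smult_closed simp flip: e2 e3)
  have p: "?p \<in> Arr M W A" unfolding mod_cat_Arr linear_on_def
    by (auto simp: W.smult_closed Ps d3 d4 d5)
  have q: "?q \<in> Arr M W B" unfolding mod_cat_Arr linear_on_def
    by (auto simp: W.smult_closed Ps d3 d4 d5)
  have "biproduct M A B W ?i ?j ?p ?q"
    unfolding biproduct_def
  proof (intro conjI AB i j p q)
    show "W \<in> Obj M" using W by simp
    show "Comp M W A W ?i ?p \<otimes>\<^bsub>Hom M W W\<^esub> Comp M W B W ?j ?q = Ident M W"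
    proof (rule mod_cat_ext[of _ W W _ W])
      fix x assume x: "x \<in> carrier W"
      have "e (fst (d x), \<zero>\<^bsub>B\<^esub>) \<oplus>\<^bsub>W\<^esub> e (\<zero>\<^bsub>A\<^esub>, snd (d x)) = e ((fst (d x), \<zero>\<^bsub>B\<^esub>) \<oplus>\<^bsub>P\<^esub> (\<zero>\<^bsub>A\<^esub>, snd (d x)))"
        using dl[OF x x z] z by (intro el(2)[symmetric]) (auto simp: Pc)
      also have "\<dots> = x" using dl[OF x x z] d(3)[OF x] by (simp add: Pa)
      finally show "(Comp M W A W ?i ?p \<otimes>\<^bsub>Hom M W W\<^esub> Comp M W B W ?j ?q) x = Ident M W x"
        using x dl[OF x x z] by (simp add: compose_def)
    qed (use W i j p q AB in \<open>auto simp del: mod_cat_simps(2-) simp: C.add_closed C.Comp_closed C.Ident_closed\<close>)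
  qed (use e1 d2 in \<open>auto simp: compose_def cong: restrict_cong\<close>)
  then show ?thesis using W(1) by (intro bexI[of _ W] exI) simp_all
qed

lemma epi_iff_surj:
  assumes f: "f \<in> Arr M A B" and AB: "A \<in> Obj M" "B \<in> Obj M"
  shows "epi M A f B \<longleftrightarrow> f ` carrier A = carrier B"
proof
  interpret f: linear_map \<Lambda> A B f using f AB by (simp add: mod_cat_linear)
  {
    assume *: "f ` carrier A = carrier B"
    show "epi M A f B" unfolding epi_def
    proof (intro conjI ballI impI AB f)
      fix T s t assume "T \<in> Obj M" and st: "s \<in> Arr M B T" "t \<in> Arr M B T" "Comp M A B T s f = Comp M A B T t f"
      have "s (f x) = t (f x)" if "x \<in> carrier A" for x
        using fun_cong[OF st(3), of x] that by (simp add: compose_def)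
      moreover have "\<exists>x\<in>carrier A. y = f x" if "y \<in> carrier B" for y using that unfolding *[symmetric] by blast
      ultimately have "s y = t y" if "y \<in> carrier B" for y using that by metis
      then show "s = t" by (rule mod_cat_ext[OF st(1,2)])
    qed
  next
    assume e: "epi M A f B"
    have im: "rsub \<Lambda> B (f ` carrier A)"
      by (intro f.image_rsub operator_group.opsub_carrier f.A.operator_group_actions)
    obtain D p where D: "D \<in> Obj M" "p \<in> Arr M B D" "p ` carrier B = carrier D"
      "{x \<in> carrier B. p x = \<zero>\<^bsub>D\<^esub>} = f ` carrier A"
      using quotient[OF AB(2) im] by (elim exE conjE)
    have "p (f x) = \<zero>\<^bsub>D\<^esub>" if "x \<in> carrier A" for x using D(4) that by blast
    then have "Comp M A B D p f = Comp M A B D (Zero M B D) f"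
      by (auto simp: compose_def intro!: restrict_ext)
    then have "p = Zero M B D" using epi_cancel[OF e D(1,2) C.zero_closed[OF AB(2) D(1)]] by simp
    then have "{x \<in> carrier B. p x = \<zero>\<^bsub>D\<^esub>} = carrier B" by auto
    then show "f ` carrier A = carrier B" using D(4) by simp
  }
qed

text \<open>Elements of the kernel are images of the generator under morphisms from the free module of rank one,
  to which the definition of a monomorphism applies.\<close>

lemma monic_imp_inj:
  assumes "monic M A f B" "x \<in> carrier A" "f x = \<zero>\<^bsub>B\<^esub>"
  shows "x = \<zero>\<^bsub>A\<^esub>"
proof -
  have AB: "A \<in> Obj M" "B \<in> Obj M" "f \<in> Arr M A B" using assms(1) by (auto simp: monic_def)
  interpret f: linear_map \<Lambda> A B f using AB by (simp add: mod_cat_linear)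
  obtain U u where U: "U \<in> Obj M" "u \<in> carrier U"
    "\<forall>M'\<in>Obj M. \<forall>m\<in>carrier M'. \<exists>f\<in>Arr M U M'. f u = m"
    "\<forall>x\<in>carrier U. \<exists>r\<in>carrier \<Lambda>. x = r \<odot>\<^bsub>U\<^esub> u" using free_module by metis
  obtain g where g: "g \<in> Arr M U A" "g u = x" using U(3) AB(1) assms(2) by blast
  interpret g: linear_map \<Lambda> U A g using AB U g by (simp add: mod_cat_linear)
  have "f (g y) = f \<zero>\<^bsub>A\<^esub>" if y: "y \<in> carrier U" for y
  proof -
    obtain r where "r \<in> carrier \<Lambda>" "y = r \<odot>\<^bsub>U\<^esub> u" using U(4) y by blast
    then show ?thesis using g assms(2,3) U(2) by (simp add: g.smult f.smult)
  qed
  then have "Comp M U A B f g = Comp M U A B f (Zero M U A)"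
    by (auto simp: compose_def intro!: restrict_ext)
  then have "g = Zero M U A" using monic_cancel[OF assms(1) U(1) g(1) C.zero_closed[OF U(1) AB(1)]] by simp
  then show ?thesis using g U by simp
qed

lemma is_kernel_char:
  assumes "is_kernel M K i A f B" "x \<in> carrier A"
  shows "f x = \<zero>\<^bsub>B\<^esub> \<longleftrightarrow> x \<in> i ` carrier K"
proof
  have O: "A \<in> Obj M" "B \<in> Obj M" "K \<in> Obj M" "f \<in> Arr M A B" "i \<in> Arr M K A" "Comp M K A B f i = Zero M K B"
    using assms(1) by (auto simp: is_kernel_def)
  interpret f: linear_map \<Lambda> A B f using O by (simp add: mod_cat_linear)
  show "f x = \<zero>\<^bsub>B\<^esub>" if xi: "x \<in> i ` carrier K"
  proof -
    obtain y where y: "y \<in> carrier K" "x = i y" using xi by blast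
    show ?thesis using fun_cong[OF O(6), of y] y by (simp add: compose_def)
  qed
  assume fx: "f x = \<zero>\<^bsub>B\<^esub>"
  obtain U u where U: "U \<in> Obj M" "u \<in> carrier U"
    "\<forall>M'\<in>Obj M. \<forall>m\<in>carrier M'. \<exists>f\<in>Arr M U M'. f u = m"
    "\<forall>x\<in>carrier U. \<exists>r\<in>carrier \<Lambda>. x = r \<odot>\<^bsub>U\<^esub> u" using free_module by metis
  obtain g where g: "g \<in> Arr M U A" "g u = x" using U(3) O(1) assms(2) by blast
  interpret g: linear_map \<Lambda> U A g using O U g by (simp add: mod_cat_linear)
  have "f (g y) = \<zero>\<^bsub>B\<^esub>" if y: "y \<in> carrier U" for y
  proof -
    obtain r where "r \<in> carrier \<Lambda>" "y = r \<odot>\<^bsub>U\<^esub> u" using U(4) y by blast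
    then show ?thesis using g assms(2) fx U(2) by (simp add: g.smult f.smult)
  qed
  then have "Comp M U A B f g = Zero M U B" by (auto simp: compose_def intro!: restrict_ext)
  then obtain h where h: "h \<in> Arr M U K" "Comp M U K A i h = g"
    using C.kernel_lift[OF assms(1) U(1) g(1)] by metis
  interpret h: linear_map \<Lambda> U K h using O U h by (simp add: mod_cat_linear)
  have "x = i (h u)" using fun_cong[OF h(2), of u] U(2) g by (simp add: compose_def)
  then show "x \<in> i ` carrier K" using U(2) by simp
qed

text \<open>A map that vanishes on the kernel of a surjection \<open>p\<close> is constant on the fibres of \<open>p\<close>.\<close>

lemma surj_cokernel:
  assumes O: "A \<in> Obj M" "B \<in> Obj M" "D \<in> Obj M" "f \<in> Arr M A B" "p \<in> Arr M B D"
    and surj: "p ` carrier B = carrier D" and ker: "\<And>x. x \<in> carrier B \<Longrightarrow> p x = \<zero>\<^bsub>D\<^esub> \<longleftrightarrow> x \<in> f ` carrier A"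
  shows "is_cokernel M A f B p D"
  unfolding is_cokernel_def
proof (intro conjI O ballI impI)
  interpret f: linear_map \<Lambda> A B f using O by (simp add: mod_cat_linear)
  interpret p: linear_map \<Lambda> B D p using O by (simp add: mod_cat_linear)
  have "p (f x) = \<zero>\<^bsub>D\<^esub>" if "x \<in> carrier A" for x using that ker by simp
  then show "Comp M A B D p f = Zero M A D" by (auto simp: compose_def intro!: restrict_ext)
  fix T t assume T: "T \<in> Obj M" "t \<in> Arr M B T" "Comp M A B T t f = Zero M A T"
  interpret t: linear_map \<Lambda> B T t using O T by (simp add: mod_cat_linear)
  have tf: "t (f x) = \<zero>\<^bsub>T\<^esub>" if "x \<in> carrier A" for x
    using fun_cong[OF T(3), of x] that by (simp add: compose_def)
  define g where "g y = (SOME x. x \<in> carrier B \<and> p x = y)" for y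
  have g: "g y \<in> carrier B" "p (g y) = y" if "y \<in> carrier D" for y
  proof -
    have "\<exists>x. x \<in> carrier B \<and> p x = y" using that unfolding surj[symmetric] by blast
    from someI_ex[OF this] show "g y \<in> carrier B" "p (g y) = y" by (simp_all add: g_def)
  qed
  have tg: "t (g (p x)) = t x" if x: "x \<in> carrier B" for x
  proof -
    have gc: "g (p x) \<in> carrier B" "p (g (p x)) = p x" using g x by auto
    have "p (g (p x) \<oplus>\<^bsub>B\<^esub> \<ominus>\<^bsub>B\<^esub> x) = \<zero>\<^bsub>D\<^esub>" using gc x by (simp add: p.add p.neg p.B.r_neg)
    then obtain a where a: "a \<in> carrier A" "g (p x) \<oplus>\<^bsub>B\<^esub> \<ominus>\<^bsub>B\<^esub> x = f a" using ker gc x by auto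
    have "t (g (p x)) \<oplus>\<^bsub>T\<^esub> \<ominus>\<^bsub>T\<^esub> t x = \<zero>\<^bsub>T\<^esub>"
      using tf[OF a(1)] gc x unfolding a(2)[symmetric] by (simp add: t.add t.neg)
    then show ?thesis using gc x by (metis t.B.r_neg t.B.add.inv_solve_right' t.B.l_zero t.B.zero_closed t.closed a_inv_def)
  qed
  have s: "(\<lambda>y\<in>carrier D. t (g y)) \<in> Arr M D T"
    unfolding mod_cat_Arr linear_on_def
  proof (intro conjI ballI)
    fix x y assume xy: "x \<in> carrier D" "y \<in> carrier D"
    have "t (g (x \<oplus>\<^bsub>D\<^esub> y)) = t (g (p (g x \<oplus>\<^bsub>B\<^esub> g y)))" using xy g by (simp add: p.add)
    also have "\<dots> = t (g x) \<oplus>\<^bsub>T\<^esub> t (g y)" using xy g tg by (simp add: t.add)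
    finally show "(\<lambda>y\<in>carrier D. t (g y)) (x \<oplus>\<^bsub>D\<^esub> y) = (\<lambda>y\<in>carrier D. t (g y)) x \<oplus>\<^bsub>T\<^esub> (\<lambda>y\<in>carrier D. t (g y)) y"
      using xy by simp
  next
    fix r x assume xy: "r \<in> carrier \<Lambda>" "x \<in> carrier D"
    have "t (g (r \<odot>\<^bsub>D\<^esub> x)) = t (g (p (r \<odot>\<^bsub>B\<^esub> g x)))" using xy g by (simp add: p.smult)
    also have "\<dots> = r \<odot>\<^bsub>T\<^esub> t (g x)" using xy g tg f.B.smult_closed by (simp add: t.smult)
    finally show "(\<lambda>y\<in>carrier D. t (g y)) (r \<odot>\<^bsub>D\<^esub> x) = r \<odot>\<^bsub>T\<^esub> (\<lambda>y\<in>carrier D. t (g y)) x"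
      using xy by (simp add: p.B.smult_closed)
  qed (use g in auto)
  show "\<exists>!s. s \<in> Arr M D T \<and> Comp M B D T s p = t"
  proof (rule ex1I)
    have "Comp M B D T (\<lambda>y\<in>carrier D. t (g y)) p = t"
      using tg by (intro mod_cat_ext[OF C.Comp_closed[OF O(2,3) T(1) O(5) s] T(2)]) (simp add: compose_def)
    then show "(\<lambda>y\<in>carrier D. t (g y)) \<in> Arr M D T \<and> Comp M B D T (\<lambda>y\<in>carrier D. t (g y)) p = t" using s by simp
    fix r assume r: "r \<in> Arr M D T \<and> Comp M B D T r p = t"
    show "r = (\<lambda>y\<in>carrier D. t (g y))"
    proof (rule mod_cat_ext[OF conjunct1[OF r] s])
      fix y assume y: "y \<in> carrier D"
      have "r (p (g y)) = t (g y)" using fun_cong[OF conjunct2[OF r], of "g y"] g[OF y] by (simp add: compose_def)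
      then show "r y = (\<lambda>y\<in>carrier D. t (g y)) y" using g y by simp
    qed
  qed
qed

lemma epi_kernel_short_exact:
  assumes "epi M B p D" "is_kernel M K i B p D"
  shows "short_exact M K i B p D"
  unfolding short_exact_def
proof
  show "is_cokernel M K i B p D"
    using assms epi_iff_surj[of p B D] is_kernel_char[OF assms(2)]
    by (intro surj_cokernel) (auto simp: is_kernel_def simp del: mod_cat_simps)
qed fact

lemma cokernel_exists:
  assumes O: "A \<in> Obj M" "B \<in> Obj M" "f \<in> Arr M A B"
  obtains D p where "is_cokernel M A f B p D" "\<forall>x\<in>carrier B. p x = \<zero>\<^bsub>D\<^esub> \<longleftrightarrow> x \<in> f ` carrier A"
proof -
  interpret f: linear_map \<Lambda> A B f using O by (simp add: mod_cat_linear)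
  have im: "rsub \<Lambda> B (f ` carrier A)"
    by (intro f.image_rsub operator_group.opsub_carrier f.A.operator_group_actions)
  obtain D p where D: "D \<in> Obj M" "p \<in> Arr M B D" "p ` carrier B = carrier D"
    "{x \<in> carrier B. p x = \<zero>\<^bsub>D\<^esub>} = f ` carrier A"
    using quotient[OF O(2) im] by (elim exE conjE)
  have *: "\<And>x. x \<in> carrier B \<Longrightarrow> p x = \<zero>\<^bsub>D\<^esub> \<longleftrightarrow> x \<in> f ` carrier A" using D(4) by blast
  show ?thesis using that[OF surj_cokernel[OF O(1,2) D(1) O(3) D(2,3) *]] * by simp
qed

lemma monic_cokernel_short_exact:
  assumes m: "monic M A f B" and c: "is_cokernel M A f B p D"
  shows "short_exact M A f B p D"
  unfolding short_exact_def
proof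
  have O: "A \<in> Obj M" "B \<in> Obj M" "D \<in> Obj M" "f \<in> Arr M A B" "p \<in> Arr M B D" "Comp M A B D p f = Zero M A D"
    using c by (auto simp: is_cokernel_def)
  interpret f: linear_map \<Lambda> A B f using O by (simp add: mod_cat_linear)
  interpret p: linear_map \<Lambda> B D p using O by (simp add: mod_cat_linear)
  obtain D' p' where D': "is_cokernel M A f B p' D'" "\<forall>x\<in>carrier B. p' x = \<zero>\<^bsub>D'\<^esub> \<longleftrightarrow> x \<in> f ` carrier A"
    using cokernel_exists[OF O(1,2,4)] .
  obtain k where k: "k \<in> Arr M D D'" "Comp M B D D' k p = p'" using C.cokernel_unique[OF c D'(1)] by metis
  have D'O: "D' \<in> Obj M" using D' by (simp add: is_cokernel_def)
  interpret k: linear_map \<Lambda> D D' k using O D'O k by (simp add: mod_cat_linear)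
  have inj: "x = y" if xy: "x \<in> carrier A" "y \<in> carrier A" "f x = f y" for x y
  proof -
    have "f (x \<oplus>\<^bsub>A\<^esub> \<ominus>\<^bsub>A\<^esub> y) = \<zero>\<^bsub>B\<^esub>" using xy by (simp add: f.add f.neg f.B.r_neg)
    then have "x \<oplus>\<^bsub>A\<^esub> \<ominus>\<^bsub>A\<^esub> y = \<zero>\<^bsub>A\<^esub>" using monic_imp_inj[OF m] xy by simp
    then show ?thesis using xy by (metis f.A.r_neg f.A.add.inv_solve_right' f.A.l_zero f.A.zero_closed a_inv_def)
  qed
  have im: "x \<in> f ` carrier A" if x: "x \<in> carrier B" "p x = \<zero>\<^bsub>D\<^esub>" for x
    using fun_cong[OF k(2), of x] x D'(2) by (auto simp: compose_def)
  show "is_kernel M A f B p D"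
    unfolding is_kernel_def
  proof (intro conjI O ballI impI)
    fix T t assume T: "T \<in> Obj M" "t \<in> Arr M T B" "Comp M T B D p t = Zero M T D"
    interpret t: linear_map \<Lambda> T B t using O T by (simp add: mod_cat_linear)
    have "\<exists>a\<in>carrier A. f a = t x" if "x \<in> carrier T" for x
      using im[of "t x"] fun_cong[OF T(3), of x] that by (auto simp: compose_def)
    then obtain s where s: "\<And>x. x \<in> carrier T \<Longrightarrow> s x \<in> carrier A" "\<And>x. x \<in> carrier T \<Longrightarrow> f (s x) = t x" by metis
    have s_add: "s (x \<oplus>\<^bsub>T\<^esub> y) = s x \<oplus>\<^bsub>A\<^esub> s y" if "x \<in> carrier T" "y \<in> carrier T" for x y
      by (rule inj) (use s that in \<open>simp_all add: f.add t.add\<close>)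
    have s_smult: "s (r \<odot>\<^bsub>T\<^esub> x) = r \<odot>\<^bsub>A\<^esub> s x" if "r \<in> carrier \<Lambda>" "x \<in> carrier T" for r x
      by (rule inj) (use s that in \<open>simp_all add: f.smult t.smult t.A.smult_closed f.A.smult_closed\<close>)
    have sA: "(\<lambda>x\<in>carrier T. s x) \<in> Arr M T A"
      unfolding mod_cat_Arr linear_on_def using s(1) by (simp add: t.A.smult_closed s_add s_smult)
    show "\<exists>!s. s \<in> Arr M T A \<and> Comp M T A B f s = t"
    proof (rule ex1I)
      have "Comp M T A B f (\<lambda>x\<in>carrier T. s x) = t"
        using s by (intro mod_cat_ext[OF C.Comp_closed[OF T(1) O(1,2) sA O(4)] T(2)]) (simp add: compose_def)
      then show "(\<lambda>x\<in>carrier T. s x) \<in> Arr M T A \<and> Comp M T A B f (\<lambda>x\<in>carrier T. s x) = t" using sA by simp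
      fix r assume r: "r \<in> Arr M T A \<and> Comp M T A B f r = t"
      interpret r: linear_map \<Lambda> T A r using O T r by (simp add: mod_cat_linear)
      show "r = (\<lambda>x\<in>carrier T. s x)"
      proof (rule mod_cat_ext[OF conjunct1[OF r] sA])
        fix y assume y: "y \<in> carrier T"
        have "f (r y) = t y" using fun_cong[OF conjunct2[OF r], of y] y by (simp add: compose_def)
        then show "r y = (\<lambda>x\<in>carrier T. s x) y" using s y by (simp add: inj)
      qed
    qed
  qed
qed fact

lemma projective_lift_surj:
  assumes "projective M (short_exact M) P" "short_exact M K i B p D" "t \<in> Arr M P D"
  shows "\<exists>s\<in>Arr M P B. Comp M P B D p s = t"
proof -
  have "K \<in> Obj M" "B \<in> Obj M" "D \<in> Obj M" "i \<in> Arr M K B" "p \<in> Arr M B D"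
    using assms(2) by (auto simp: short_exact_def is_kernel_def)
  then show ?thesis using assms unfolding projective_def by blast
qed

text \<open>The free module of rank one is projective since the image of its generator lifts along surjections;
  the direct sum of one copy for each generator of \<open>X\<close> maps onto \<open>X\<close>.\<close>

lemma enough_projectives:
  assumes X: "X \<in> Obj M"
  shows "\<exists>P p. projective M (short_exact M) P \<and> epi M P p X"
proof -
  interpret X: right_module \<Lambda> X using X by (simp add: fg_module)
  obtain U u where U: "U \<in> Obj M" "u \<in> carrier U"
    "\<forall>M'\<in>Obj M. \<forall>m\<in>carrier M'. \<exists>f\<in>Arr M U M'. f u = m"
    "\<forall>x\<in>carrier U. \<exists>r\<in>carrier \<Lambda>. x = r \<odot>\<^bsub>U\<^esub> u" using free_module by metis
  have projU: "projective M (short_exact M) U"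
    unfolding projective_def
  proof (intro conjI ballI impI U)
    fix A B D i p t assume H: "A \<in> Obj M" "B \<in> Obj M" "D \<in> Obj M" "i \<in> Arr M A B" "p \<in> Arr M B D"
      "short_exact M A i B p D" "t \<in> Arr M U D"
    interpret t: linear_map \<Lambda> U D t using H U by (simp add: mod_cat_linear)
    interpret p: linear_map \<Lambda> B D p using H U by (simp add: mod_cat_linear)
    have "epi M B p D" using H(6) C.cokernel_epi by (auto simp: short_exact_def)
    then have "p ` carrier B = carrier D" using epi_iff_surj H by simp
    then obtain b where b: "b \<in> carrier B" "p b = t u" using t.closed[OF U(2)] by (metis imageE)
    obtain s where s: "s \<in> Arr M U B" "s u = b" using U(3) H(2) b(1) by blast
    interpret s: linear_map \<Lambda> U B s using H U s by (simp add: mod_cat_linear)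
    have "Comp M U B D p s = t"
    proof (rule mod_cat_ext[OF C.Comp_closed[OF U(1) H(2,3) s(1) H(5)] H(7)])
      fix x assume x: "x \<in> carrier U"
      then obtain r where r: "r \<in> carrier \<Lambda>" "x = r \<odot>\<^bsub>U\<^esub> u" using U(4) by blast
      show "Comp M U B D p s x = t x" using r x b s U(2) by (simp add: compose_def s.smult t.smult p.smult)
    qed
    then show "\<exists>s\<in>Arr M U B. Comp M U B D p s = t" using s by auto
  qed
  obtain S where S: "finite S" "S \<subseteq> carrier X" "\<And>N. rsub \<Lambda> X N \<Longrightarrow> S \<subseteq> N \<Longrightarrow> N = carrier X"
    using X[unfolded mod_cat_simps X.fg_iff] by auto
  obtain x where x: "bij_betw x {0..<card S} S" using ex_bij_betw_nat_finite[OF S(1)] by auto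
  have xS: "x k \<in> carrier X" if "k < card S" for k using x S that by (auto simp: bij_betw_def)
  have "\<forall>k. \<exists>f. k < card S \<longrightarrow> f \<in> Arr M U X \<and> f u = x k" using U(3) X xS by blast
  then obtain g where g: "\<And>k. k < card S \<Longrightarrow> g k \<in> Arr M U X" "\<And>k. k < card S \<Longrightarrow> g k u = x k" by metis
  obtain Z where Z: "zero_object M Z" using zero_module_exists by auto
  then have ZO: "Z \<in> Obj M" by (simp add: zero_object_def)
  obtain P where P: "P \<in> Obj M" "is_direct_sum M (card S) (\<lambda>_. U) P"
    using C.direct_sum_data_exists[OF Z ZO subset_refl, of "card S" "\<lambda>_. U"] biproduct_exists U(1) by blast
  obtain i v where v: "\<And>k. k < card S \<Longrightarrow> i k \<in> Arr M U P" "v \<in> Arr M P X"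
    "\<And>k. k < card S \<Longrightarrow> Comp M U P X v (i k) = g k"
    using C.direct_sum_copair[OF P(2) X, of g] g(1) by blast
  interpret v: linear_map \<Lambda> P X v using P X v by (simp add: mod_cat_linear)
  have im: "rsub \<Lambda> X (v ` carrier P)"
    by (intro v.image_rsub operator_group.opsub_carrier v.A.operator_group_actions)
  have "x k \<in> v ` carrier P" if k: "k < card S" for k
  proof -
    interpret i: linear_map \<Lambda> U P "i k" using P U v(1)[OF k] by (simp add: mod_cat_linear)
    have "x k = v (i k u)" using fun_cong[OF v(3)[OF k], of u] g(2)[OF k] U(2) by (simp add: compose_def)
    then show ?thesis using U(2) by simp
  qed
  then have "x ` {0..<card S} \<subseteq> v ` carrier P" by (intro image_subsetI) simp
  then have "S \<subseteq> v ` carrier P" using x by (simp add: bij_betw_def)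
  then have "epi M P v X" using S(3)[OF im] epi_iff_surj[OF v(2) P(1) X] by simp
  moreover have "projective M (short_exact M) P"
    using C.projective_direct_sum[OF P(2)] projU by simp
  ultimately show ?thesis by blast
qed

end

locale artin_module_category = module_category \<Lambda> for \<Lambda> :: "('r, 'd) ring_scheme" +
  fixes R :: "('k, 'c) ring_scheme" and \<phi> :: "'k \<Rightarrow> 'r"
  assumes artin: "artin_algebra R \<Lambda> \<phi>"
begin

lemma submodule_object:
  assumes A: "A \<in> Obj M" and N: "rsub \<Lambda> A N"
  shows "A\<lparr>carrier := N\<rparr> \<in> Obj M" "(\<lambda>x\<in>N. x) \<in> Arr M (A\<lparr>carrier := N\<rparr>) A"
proof -
  interpret A: right_module \<Lambda> A using A by (simp add: fg_module)
  note N' = A.rsubD[OF N]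
  have c: "x \<in> carrier A" if "x \<in> N" for x using that N' by auto
  have "right_module \<Lambda> (A\<lparr>carrier := N\<rparr>)"
  proof (intro right_module.intro right_module_axioms.intro L.ring_axioms abelian_groupI)
    fix x assume "x \<in> carrier (A\<lparr>carrier := N\<rparr>)"
    then show "\<exists>y\<in>carrier (A\<lparr>carrier := N\<rparr>). y \<oplus>\<^bsub>A\<lparr>carrier := N\<rparr>\<^esub> x = \<zero>\<^bsub>A\<lparr>carrier := N\<rparr>\<^esub>"
      using N' c by (intro bexI[of _ "\<ominus>\<^bsub>A\<^esub> x"]) (auto simp: A.l_neg)
  qed (use N' c in \<open>auto simp: A.a_ac A.smult_l_distr A.smult_r_distr A.smult_assoc A.smult_one\<close>)
  then interpret S: right_module \<Lambda> "A\<lparr>carrier := N\<rparr>" .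
  have fg: "fg_right_module \<Lambda> A" using A by simp
  obtain G where G: "finite G" "G \<subseteq> N" "\<And>N'. rsub \<Lambda> A N' \<Longrightarrow> G \<subseteq> N' \<Longrightarrow> N \<subseteq> N'"
    using A.noetherian_submodule[OF artin fg N] by auto
  have "K = N" if K: "rsub \<Lambda> (A\<lparr>carrier := N\<rparr>) K" "G \<subseteq> K" for K
  proof
    show "K \<subseteq> N" using S.rsubD(1)[OF K(1)] by simp
    have "rsub \<Lambda> A K" using S.rsubD[OF K(1)] c by (intro A.rsubI) auto
    then show "N \<subseteq> K" using G(3) K(2) by simp
  qed
  then show "A\<lparr>carrier := N\<rparr> \<in> Obj M" unfolding mod_cat_simps S.fg_iff using G by auto
  show "(\<lambda>x\<in>N. x) \<in> Arr M (A\<lparr>carrier := N\<rparr>) A"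
    using c N' by (auto simp: mod_cat_Arr linear_on_def)
qed

lemma kernel_exists:
  assumes O: "A \<in> Obj M" "B \<in> Obj M" "f \<in> Arr M A B"
  shows "\<exists>K i. is_kernel M K i A f B"
proof -
  interpret f: linear_map \<Lambda> A B f using O by (simp add: mod_cat_linear)
  let ?N = "{x \<in> carrier A. f x \<in> {\<zero>\<^bsub>B\<^esub>}}"
  have N: "rsub \<Lambda> A ?N"
    by (intro f.vimage_rsub operator_group.opsub_zero f.B.operator_group_actions)
  let ?K = "A\<lparr>carrier := ?N\<rparr>" and ?i = "\<lambda>x\<in>?N. x"
  note K = submodule_object[OF O(1) N]
  have "is_kernel M ?K ?i A f B"
    unfolding is_kernel_def
  proof (intro conjI ballI impI)
    show "?K \<in> Obj M" "?i \<in> Arr M ?K A" by (rule K)+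
    show "A \<in> Obj M" "B \<in> Obj M" "f \<in> Arr M A B" by (rule O)+
    show "Comp M ?K A B f ?i = Zero M ?K B" by (simp add: compose_def cong: restrict_cong)
    fix T t assume T: "T \<in> Obj M" "t \<in> Arr M T A" "Comp M T A B f t = Zero M T B"
    interpret t: linear_map \<Lambda> T A t using O T by (simp add: mod_cat_linear)
    have tN: "t x \<in> ?N" if "x \<in> carrier T" for x
      using fun_cong[OF T(3), of x] that by (simp add: compose_def)
    show "\<exists>!s. s \<in> Arr M T ?K \<and> Comp M T ?K A ?i s = t"
    proof (rule ex1I)
      have tK: "t \<in> Arr M T ?K" using T(2) tN unfolding mod_cat_Arr linear_on_def by auto
      moreover have "Comp M T ?K A ?i t = t"
        using tN by (intro mod_cat_ext[OF C.Comp_closed[OF T(1) K(1) O(1) tK K(2)] T(2)]) (simp add: compose_def)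
      ultimately show "t \<in> Arr M T ?K \<and> Comp M T ?K A ?i t = t" by simp
      fix r assume r: "r \<in> Arr M T ?K \<and> Comp M T ?K A ?i r = t"
      interpret r: linear_map \<Lambda> T ?K r using K(1) T r by (simp add: mod_cat_linear)
      show "r = t"
      proof (rule mod_cat_ext[OF conjunct1[OF r] T(2)])
        fix y assume y: "y \<in> carrier T"
        have "r y \<in> ?N" using r.closed[OF y] by simp
        then show "r y = t y" using fun_cong[OF conjunct2[OF r], of y] y by (simp add: compose_def)
      qed
    qed
  qed
  then show ?thesis by blast
qed

lemma projective_lift:
  assumes "projective M (short_exact M) P" "epi M B p D" "t \<in> Arr M P D"
  shows "\<exists>s\<in>Arr M P B. Comp M P B D p s = t"
proof -
  obtain K i where "is_kernel M K i B p D" using kernel_exists assms(2) unfolding epi_def by blast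
  then show ?thesis using projective_lift_surj assms epi_kernel_short_exact by blast
qed

text \<open>Choose an epimorphism \<open>p : P \<rightarrow> X\<close> with \<open>P\<close> projective, and a submodule \<open>N\<close> of \<open>P\<close> minimal
  with \<open>p(N) = X\<close>.  Then \<open>N \<rightarrow> X\<close> is essential by minimality.  Lifting \<open>p\<close> along \<open>N \<rightarrow> X\<close> gives
  \<open>s : P \<rightarrow> N\<close>, which maps \<open>N\<close> onto \<open>N\<close>; as \<open>N\<close> is noetherian, \<open>s\<close> is bijective on \<open>N\<close>, so that
  \<open>N\<close> is a retract of \<open>P\<close>.\<close>

theorem projective_cover_exists:
  assumes X: "X \<in> Obj M"
  shows "\<exists>P p. projective_cover \<Lambda> P p X"
proof -
  obtain P p where P: "projective M (short_exact M) P" "epi M P p X" using enough_projectives[OF X] by auto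
  then have PO: "P \<in> Obj M" "p \<in> Arr M P X" by (auto simp: epi_def simp del: mod_cat_simps)
  interpret p: linear_map \<Lambda> P X p using PO X by (simp add: mod_cat_linear)
  have surj: "p ` carrier P = carrier X" using P epi_iff_surj[OF PO(2,1) X] by simp
  have fgP: "fg_right_module \<Lambda> P" using PO by simp
  let ?F = "{N. rsub \<Lambda> P N \<and> p ` N = carrier X}"
  have dcc: "chain_condition P (actions \<Lambda> P) (\<supseteq>) {\<zero>\<^bsub>P\<^esub>} (carrier P)"
    by (rule p.A.fg_chain_condition[OF artin fgP]) simp
  have "carrier P \<in> ?F" using surj operator_group.opsub_carrier[OF p.A.operator_group_actions] by simp
  then obtain N where N: "N \<in> ?F" and min: "\<forall>V\<in>?F. V \<subseteq> N \<longrightarrow> V = N"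
    by (rule chain_condition_extremal[OF dcc]) (auto dest: p.A.rsubD(1,2))
  have Nr: "rsub \<Lambda> P N" "p ` N = carrier X" using N by auto
  note N' = p.A.rsubD[OF Nr(1)]
  let ?P0 = "P\<lparr>carrier := N\<rparr>" and ?i = "\<lambda>x\<in>N. x" and ?p0 = "\<lambda>x\<in>N. p x"
  note P0 = submodule_object[OF PO(1) Nr(1)]
  have Nc: "x \<in> carrier P" if "x \<in> N" for x using that N'(1) by auto
  have p0: "?p0 \<in> Arr M ?P0 X"
    using Nc N' by (auto simp: mod_cat_Arr linear_on_def p.add p.smult)
  have p0epi: "epi M ?P0 ?p0 X" using epi_iff_surj[OF p0 P0(1) X] Nr(2) by simp
  obtain s where s: "s \<in> Arr M P ?P0" "Comp M P ?P0 X ?p0 s = p" using projective_lift[OF P(1) p0epi PO(2)] by auto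
  interpret s: linear_map \<Lambda> P ?P0 s using PO P0 s by (simp add: mod_cat_linear)
  have sN: "s x \<in> N" if "x \<in> carrier P" for x using s.closed[OF that] by simp
  have ps: "p (s x) = p x" if "x \<in> carrier P" for x
    using fun_cong[OF s(2), of x] that sN by (simp add: compose_def)
  have subP: "rsub \<Lambda> P V" if "rsub \<Lambda> ?P0 V" for V
    using s.B.rsubD[OF that] Nc by (intro p.A.rsubI) auto
  have "rsub \<Lambda> P (s ` N)" by (intro subP s.image_rsub Nr)
  moreover have "p ` s ` N = carrier X" using ps Nc Nr(2) by (auto simp: image_image)
  moreover have "s ` N \<subseteq> N" using sN Nc by auto
  ultimately have ontoN: "s ` N = N" using min by blast
  \<comment> \<open>the kernels of the powers of \<open>s\<close> on \<open>N\<close> form an ascending chain, and a surjective \<open>s\<close> is injective as soon as this chain stops\<close>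
  have pow: "(s ^^ n) x \<in> N" if "x \<in> N" for n x using that by (induction n) (auto simp: sN Nc)
  have pow0: "(s ^^ n) \<zero>\<^bsub>P\<^esub> = \<zero>\<^bsub>P\<^esub>" for n using s.zero by (induction n) auto
  have powlin: "linear_on \<Lambda> ?P0 ?P0 (s ^^ n)" for n
  proof (induction n)
    case (Suc n)
    then show ?case using s.add s.smult sN Nc unfolding linear_on_def by auto
  qed (simp add: linear_on_def N')
  have acc: "chain_condition P (actions \<Lambda> P) (\<subseteq>) {\<zero>\<^bsub>P\<^esub>} (carrier P)"
    by (rule p.A.fg_chain_condition[OF artin fgP]) simp
  define K where "K n = {x \<in> N. (s ^^ n) x = \<zero>\<^bsub>P\<^esub>}" for n
  have Kr: "rsub \<Lambda> P (K n)" for n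
  proof (rule subP)
    interpret l: linear_map \<Lambda> ?P0 ?P0 "s ^^ n"
      by (intro linear_map.intro linear_map_axioms.intro powlin s.B.right_module_axioms)
    show "rsub \<Lambda> ?P0 (K n)"
      using l.vimage_rsub[OF operator_group.opsub_zero[OF s.B.operator_group_actions]] by (simp add: K_def)
  qed
  have s0: "s \<zero>\<^bsub>P\<^esub> = \<zero>\<^bsub>P\<^esub>" using pow0[of 1] by simp
  have Kmono: "K n \<subseteq> K (Suc n)" for n
  proof
    fix x assume "x \<in> K n"
    then have "x \<in> N" "(s ^^ n) x = \<zero>\<^bsub>P\<^esub>" by (simp_all add: K_def)
    then show "x \<in> K (Suc n)" using s0 by (simp add: K_def)
  qed
  have "\<exists>n. \<forall>m\<ge>n. K m = K n"
    using acc[unfolded chain_condition_def, rule_format, of K] Kr Kmono p.A.rsubD(1,2)[OF Kr] by simp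
  then obtain n where n: "\<And>m. m \<ge> n \<Longrightarrow> K m = K n" by auto
  have pown: "\<exists>y\<in>N. (s ^^ m) y = x" if "x \<in> N" for x m
    using that
  proof (induction m arbitrary: x)
    case (Suc m)
    have "x \<in> s ` N" using Suc.prems ontoN by simp
    then obtain z where z: "z \<in> N" "s z = x" by (metis imageE)
    obtain y where "y \<in> N" "(s ^^ m) y = z" using Suc.IH[OF z(1)] by auto
    then show ?case using z by (intro bexI[of _ y]) simp_all
  qed simp
  have ker0: "x = \<zero>\<^bsub>P\<^esub>" if x: "x \<in> N" "s x = \<zero>\<^bsub>P\<^esub>" for x
  proof -
    obtain y where y: "y \<in> N" "(s ^^ n) y = x" using pown[OF x(1)] by auto
    then have "y \<in> K (Suc n)" using x by (simp add: K_def)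
    then have "y \<in> K n" using n[of "Suc n"] by simp
    then show ?thesis using y by (simp add: K_def)
  qed
  have injN: "inj_on s N"
  proof (rule inj_onI)
    fix x y assume xy: "x \<in> N" "y \<in> N" "s x = s y"
    have "s (x \<oplus>\<^bsub>P\<^esub> \<ominus>\<^bsub>P\<^esub> y) = s \<zero>\<^bsub>P\<^esub>"
    proof -
      have "s (x \<oplus>\<^bsub>P\<^esub> \<ominus>\<^bsub>P\<^esub> y) = s (y \<oplus>\<^bsub>P\<^esub> \<ominus>\<^bsub>P\<^esub> y)" using xy Nc by (simp only: s.add p.A.a_inv_closed)
      then show ?thesis using xy Nc by (simp add: p.A.r_neg)
    qed
    then have "x \<oplus>\<^bsub>P\<^esub> \<ominus>\<^bsub>P\<^esub> y = \<zero>\<^bsub>P\<^esub>" using xy(1,2) N'(3,5) s0 ker0[of "x \<oplus>\<^bsub>P\<^esub> \<ominus>\<^bsub>P\<^esub> y"] by simp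
    then show "x = y" using xy Nc by (metis p.A.r_neg p.A.add.inv_solve_right' p.A.l_zero p.A.zero_closed a_inv_def)
  qed
  define j where "j = inv_into N s"
  have bij: "bij_betw s (carrier ?P0) (carrier ?P0)" using injN ontoN by (simp add: bij_betw_def)
  have lin: "linear_on \<Lambda> ?P0 ?P0 s" using powlin[of 1] by simp
  have jl: "linear_on \<Lambda> ?P0 ?P0 j" "\<And>x. x \<in> N \<Longrightarrow> s (j x) = x"
    using inverse_linear[OF lin bij s.B.right_module_axioms] by (simp_all add: j_def)
  have jA: "(\<lambda>x\<in>N. j x) \<in> Arr M ?P0 P"
    using jl(1) Nc N' by (auto simp: mod_cat_Arr linear_on_def)
  have "Comp M ?P0 P ?P0 s (\<lambda>x\<in>N. j x) = Ident M ?P0"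
    using jl(2) by (auto simp: compose_def intro!: restrict_ext)
  then have "projective M (short_exact M) ?P0"
    using C.projective_retract[OF P(1) P0(1) s(1) jA] by simp
  then have prj: "?P0 \<in> prj \<Lambda>" by (simp add: prj_def)
  have "epi M T t ?P0" if T: "T \<in> Obj M" "t \<in> Arr M T ?P0" "epi M T (Comp M T ?P0 X ?p0 t) X" for T t
  proof -
    interpret t: linear_map \<Lambda> T ?P0 t using T P0 by (simp add: mod_cat_linear)
    have tN: "t x \<in> N" if "x \<in> carrier T" for x using t.closed[OF that] by simp
    have "Comp M T ?P0 X ?p0 t ` carrier T = carrier X"
      using epi_iff_surj[OF C.Comp_closed[OF T(1) P0(1) X T(2) p0] T(1) X] T(3) by simp
    then have "p ` t ` carrier T = carrier X" using tN by (auto simp: compose_def image_image cong: image_cong_simp)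
    moreover have "rsub \<Lambda> P (t ` carrier T)"
      by (intro subP t.image_rsub operator_group.opsub_carrier t.A.operator_group_actions)
    moreover have "t ` carrier T \<subseteq> N" using tN by auto
    ultimately have "t ` carrier T = N" using min by blast
    then show ?thesis using epi_iff_surj[OF T(2,1) P0(1)] by simp
  qed
  then show ?thesis unfolding projective_cover_def using prj p0epi by blast
qed

end

section \<open>Short exact sequences\<close>

context preadditive_category
begin

lemma short_exactD:
  assumes "short_exact C A f B p D"
  shows "A \<in> Obj C" "B \<in> Obj C" "D \<in> Obj C" "f \<in> Arr C A B" "p \<in> Arr C B D" "Comp C A B D p f = Zero C A D"
  using assms by (simp_all add: short_exact_def is_kernel_def)

lemma se_lift:
  assumes "short_exact C A f B p D" "T \<in> Obj C" "t \<in> Arr C T B" "Comp C T B D p t = Zero C T D"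
  shows "\<exists>s. s \<in> Arr C T A \<and> Comp C T A B f s = t"
  using assms kernel_lift[of A f B p D T t] by (auto simp: short_exact_def)

lemma se_colift:
  assumes "short_exact C A f B p D" "T \<in> Obj C" "t \<in> Arr C B T" "Comp C A B T t f = Zero C A T"
  shows "\<exists>s. s \<in> Arr C D T \<and> Comp C B D T s p = t"
  using assms cokernel_lift[of A f B p D T t] by (auto simp: short_exact_def)

lemma se_mono:
  assumes "short_exact C A f B p D" "T \<in> Obj C" "s \<in> Arr C T A" "t \<in> Arr C T A" "Comp C T A B f s = Comp C T A B f t"
  shows "s = t"
  using assms kernel_cancel[of A f B p D T s t] by (simp add: short_exact_def)

lemma se_epi:
  assumes "short_exact C A f B p D" "T \<in> Obj C" "s \<in> Arr C D T" "t \<in> Arr C D T" "Comp C B D T s p = Comp C B D T t p"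
  shows "s = t"
  using assms cokernel_cancel[of A f B p D T s t] by (simp add: short_exact_def)

lemma se_is_epi: "short_exact C A f B p D \<Longrightarrow> epi C B p D"
  by (auto simp: short_exact_def intro: cokernel_epi)

lemma se_is_monic: "short_exact C A f B p D \<Longrightarrow> monic C A f B"
  by (auto simp: short_exact_def intro: kernel_monic)

lemma split_epi:
  assumes "B \<in> Obj C" "D \<in> Obj C" "p \<in> Arr C B D" "s \<in> Arr C D B" "Comp C D B D p s = Ident C D"
  shows "epi C B p D"
  unfolding epi_def
proof (intro conjI ballI impI)
  fix T u v assume T: "T \<in> Obj C" "u \<in> Arr C D T" "v \<in> Arr C D T" "Comp C B D T u p = Comp C B D T v p"
  have "Comp C D B T (Comp C B D T u p) s = Comp C D B T (Comp C B D T v p) s" using T by simp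
  then show "u = v" using T(1-3) assms by (simp add: Comp_assoc')
qed (use assms in auto)

lemma short_exact_iso_left:
  assumes se: "short_exact C K i B p D" and k: "iso_arr C K' k K"
  shows "short_exact C K' (Comp C K' K B i k) B p D"
proof -
  note O = short_exactD[OF se]
  have O': "K' \<in> Obj C" "k \<in> Arr C K' K" using k by (simp_all add: iso_arr_def)
  obtain l where l: "l \<in> Arr C K K'" "Comp C K' K K' l k = Ident C K'" "Comp C K K' K k l = Ident C K"
    using k by (auto simp: iso_arr_def)
  have undo: "Comp C K K' B (Comp C K' K B i k) l = i" using O O' l by (simp add: Comp_assoc')
  have zero: "Comp C K' B D p (Comp C K' K B i k) = Zero C K' D" using O O' by (simp add: Comp_assoc)
  have "is_kernel C K' (Comp C K' K B i k) B p D"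
    unfolding is_kernel_def
  proof (intro conjI ballI impI)
    fix T t assume T: "T \<in> Obj C" "t \<in> Arr C T B" "Comp C T B D p t = Zero C T D"
    obtain s where s: "s \<in> Arr C T K" "Comp C T K B i s = t" using se_lift[OF se T] by auto
    show "\<exists>!s. s \<in> Arr C T K' \<and> Comp C T K' B (Comp C K' K B i k) s = t"
    proof (rule ex1I)
      show "Comp C T K K' l s \<in> Arr C T K' \<and> Comp C T K' B (Comp C K' K B i k) (Comp C T K K' l s) = t"
        using O O' l(1) s T(1) undo by (simp add: Comp_assoc)
      fix r assume r: "r \<in> Arr C T K' \<and> Comp C T K' B (Comp C K' K B i k) r = t"
      have "Comp C T K' K k r = s"
        by (rule se_mono[OF se T(1)]) (use O O' r s T in \<open>simp_all add: Comp_assoc\<close>)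
      then have "Comp C T K K' l s = Comp C T K K' l (Comp C T K' K k r)" by simp
      also have "\<dots> = r" using O O' l r T by (simp add: Comp_assoc)
      finally show "r = Comp C T K K' l s" by simp
    qed
  qed (use O O' zero in simp_all)
  moreover have "is_cokernel C K' (Comp C K' K B i k) B p D"
    unfolding is_cokernel_def
  proof (intro conjI ballI impI)
    fix T t assume T: "T \<in> Obj C" "t \<in> Arr C B T" "Comp C K' B T t (Comp C K' K B i k) = Zero C K' T"
    have "Comp C K B T t i = Comp C K K' T (Comp C K' B T t (Comp C K' K B i k)) l"
      using O O' l T(1,2) undo by (simp add: Comp_assoc')
    then have "Comp C K B T t i = Zero C K T" using T O O' l by simp
    then show "\<exists>!s. s \<in> Arr C D T \<and> Comp C B D T s p = t"
      using se T(1,2) by (simp add: short_exact_def is_cokernel_def)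
  qed (use O O' zero in simp_all)
  ultimately show ?thesis by (simp add: short_exact_def)
qed

lemma projective_biproduct:
  assumes b: "biproduct C P Q S i j p q" and "projective C E P" "projective C E Q"
  shows "projective C E S"
  unfolding projective_def
proof (intro conjI ballI impI)
  note b' = b[unfolded biproduct_def]
  show "S \<in> Obj C" using b' by simp
  have types: "P \<in> Obj C" "Q \<in> Obj C" "S \<in> Obj C" "i \<in> Arr C P S" "j \<in> Arr C Q S" "p \<in> Arr C S P" "q \<in> Arr C S Q"
    using b' by simp_all
  fix A B D a u t assume H: "A \<in> Obj C" "B \<in> Obj C" "D \<in> Obj C" "a \<in> Arr C A B" "u \<in> Arr C B D"
    "E A a B u D" "t \<in> Arr C S D"
  have "Comp C P S D t i \<in> Arr C P D" "Comp C Q S D t j \<in> Arr C Q D" using b' H by simp_all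
  then obtain v w where v: "v \<in> Arr C P B" "Comp C P B D u v = Comp C P S D t i"
    and w: "w \<in> Arr C Q B" "Comp C Q B D u w = Comp C Q S D t j"
    using assms(2,3) H unfolding projective_def by meson
  have "Comp C S B D u (Comp C S P B v p \<otimes>\<^bsub>Hom C S B\<^esub> Comp C S Q B w q)
     = Comp C S P D (Comp C P B D u v) p \<otimes>\<^bsub>Hom C S D\<^esub> Comp C S Q D (Comp C Q B D u w) q"
    using b' H v(1) w(1) by (simp add: Comp_add_right Comp_assoc)
  also have "\<dots> = Comp C S S D t (Comp C S P S i p \<otimes>\<^bsub>Hom C S S\<^esub> Comp C S Q S j q)"
    unfolding v(2) w(2) using types H by (simp add: Comp_add_right Comp_assoc)
  also have "\<dots> = t" using b' H by simp
  finally show "\<exists>s\<in>Arr C S B. Comp C S B D u s = t"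
    using b' H v(1) w(1) by (intro bexI[of _ "Comp C S P B v p \<otimes>\<^bsub>Hom C S B\<^esub> Comp C S Q B w q"]) simp_all
qed

text \<open>A morphism of the morphism category is lifted or factored componentwise; the square of the two components
  commutes because the maps involved are monic or epic.\<close>

lemma arrow_short_exact:
  assumes 1: "short_exact C X1 i1 Z1 p1 Y1" and 2: "short_exact C X2 i2 Z2 p2 Y2"
    and f: "f \<in> Arr C X1 X2" and h: "h \<in> Arr C Z1 Z2" and g: "g \<in> Arr C Y1 Y2"
    and hi: "Comp C X1 Z1 Z2 h i1 = Comp C X1 X2 Z2 i2 f" and gp: "Comp C Z1 Y1 Y2 g p1 = Comp C Z1 Z2 Y2 p2 h"
  shows "short_exact (arrow_cat C) (X1, X2, f) (i1, i2) (Z1, Z2, h) (p1, p2) (Y1, Y2, g)"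
proof -
  note O1 = short_exactD[OF 1] and O2 = short_exactD[OF 2]
  have k: "\<exists>!s. s \<in> Arr (arrow_cat C) T (X1, X2, f) \<and> Comp (arrow_cat C) T (X1, X2, f) (Z1, Z2, h) (i1, i2) s = t"
    if "T \<in> Obj (arrow_cat C)" "t \<in> Arr (arrow_cat C) T (Z1, Z2, h)"
      "Comp (arrow_cat C) T (Z1, Z2, h) (Y1, Y2, g) (p1, p2) t = Zero (arrow_cat C) T (Y1, Y2, g)" for T t
  proof -
    obtain T1 T2 u where T: "T = (T1, T2, u)" by (metis prod_cases3)
    obtain t1 t2 where t: "t = (t1, t2)" by (metis surj_pair)
    have H: "T1 \<in> Obj C" "T2 \<in> Obj C" "u \<in> Arr C T1 T2" "t1 \<in> Arr C T1 Z1" "t2 \<in> Arr C T2 Z2"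
      "Comp C T1 Z1 Z2 h t1 = Comp C T1 T2 Z2 t2 u" "Comp C T1 Z1 Y1 p1 t1 = Zero C T1 Y1" "Comp C T2 Z2 Y2 p2 t2 = Zero C T2 Y2"
      using that by (simp_all add: T t)
    obtain s1 where s1: "s1 \<in> Arr C T1 X1" "Comp C T1 X1 Z1 i1 s1 = t1" using se_lift[OF 1 H(1,4,7)] by auto
    obtain s2 where s2: "s2 \<in> Arr C T2 X2" "Comp C T2 X2 Z2 i2 s2 = t2" using se_lift[OF 2 H(2,5,8)] by auto
    have "Comp C T1 X1 X2 f s1 = Comp C T1 T2 X2 s2 u"
    proof (rule se_mono[OF 2 H(1)])
      have "Comp C T1 X2 Z2 i2 (Comp C T1 X1 X2 f s1) = Comp C T1 X1 Z2 (Comp C X1 X2 Z2 i2 f) s1"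
        using O1 O2 H s1(1) f by (simp add: Comp_assoc)
      also have "\<dots> = Comp C T1 Z1 Z2 h t1"
        unfolding hi[symmetric] s1(2)[symmetric] using O1 O2 H(1-5) s1(1) h by (simp add: Comp_assoc)
      also have "\<dots> = Comp C T1 X2 Z2 i2 (Comp C T1 T2 X2 s2 u)"
        unfolding H(6) s2(2)[symmetric] using O1 O2 H(1-5) s2(1) by (simp add: Comp_assoc)
      finally show "Comp C T1 X2 Z2 i2 (Comp C T1 X1 X2 f s1) = Comp C T1 X2 Z2 i2 (Comp C T1 T2 X2 s2 u)" .
    qed (use O1 O2 H s1 s2 f in simp_all)
    then have ex: "(s1, s2) \<in> Arr (arrow_cat C) T (X1, X2, f) \<and> Comp (arrow_cat C) T (X1, X2, f) (Z1, Z2, h) (i1, i2) (s1, s2) = t"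
      using s1 s2 by (simp add: T t)
    show ?thesis
    proof (rule ex1I[of _ "(s1, s2)"], rule ex)
      fix r assume r: "r \<in> Arr (arrow_cat C) T (X1, X2, f) \<and> Comp (arrow_cat C) T (X1, X2, f) (Z1, Z2, h) (i1, i2) r = t"
      obtain r1 r2 where rr: "r = (r1, r2)" by (metis surj_pair)
      have R: "r1 \<in> Arr C T1 X1" "r2 \<in> Arr C T2 X2" "Comp C T1 X1 Z1 i1 r1 = t1" "Comp C T2 X2 Z2 i2 r2 = t2"
        using r by (simp_all add: T t rr)
      have "r1 = s1" by (rule se_mono[OF 1 H(1)]) (use R s1 in simp_all)
      moreover have "r2 = s2" by (rule se_mono[OF 2 H(2)]) (use R s2 in simp_all)
      ultimately show "r = (s1, s2)" by (simp add: rr)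
    qed
  qed
  have c: "\<exists>!s. s \<in> Arr (arrow_cat C) (Y1, Y2, g) T \<and> Comp (arrow_cat C) (Z1, Z2, h) (Y1, Y2, g) T s (p1, p2) = t"
    if "T \<in> Obj (arrow_cat C)" "t \<in> Arr (arrow_cat C) (Z1, Z2, h) T"
      "Comp (arrow_cat C) (X1, X2, f) (Z1, Z2, h) T t (i1, i2) = Zero (arrow_cat C) (X1, X2, f) T" for T t
  proof -
    obtain T1 T2 u where T: "T = (T1, T2, u)" by (metis prod_cases3)
    obtain t1 t2 where t: "t = (t1, t2)" by (metis surj_pair)
    have H: "T1 \<in> Obj C" "T2 \<in> Obj C" "u \<in> Arr C T1 T2" "t1 \<in> Arr C Z1 T1" "t2 \<in> Arr C Z2 T2"
      "Comp C Z1 T1 T2 u t1 = Comp C Z1 Z2 T2 t2 h" "Comp C X1 Z1 T1 t1 i1 = Zero C X1 T1" "Comp C X2 Z2 T2 t2 i2 = Zero C X2 T2"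
      using that by (simp_all add: T t)
    obtain s1 where s1: "s1 \<in> Arr C Y1 T1" "Comp C Z1 Y1 T1 s1 p1 = t1" using se_colift[OF 1 H(1,4,7)] by auto
    obtain s2 where s2: "s2 \<in> Arr C Y2 T2" "Comp C Z2 Y2 T2 s2 p2 = t2" using se_colift[OF 2 H(2,5,8)] by auto
    have "Comp C Y1 T1 T2 u s1 = Comp C Y1 Y2 T2 s2 g"
    proof (rule se_epi[OF 1 H(2)])
      have "Comp C Z1 Y1 T2 (Comp C Y1 Y2 T2 s2 g) p1 = Comp C Z1 Y2 T2 s2 (Comp C Z1 Y1 Y2 g p1)"
        using O1 O2 H s2(1) g by (simp add: Comp_assoc)
      also have "\<dots> = Comp C Z1 Z2 T2 t2 h"
        unfolding gp s2(2)[symmetric] using O1 O2 H(1-5) s2(1) h by (simp add: Comp_assoc)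
      also have "\<dots> = Comp C Z1 Y1 T2 (Comp C Y1 T1 T2 u s1) p1"
        unfolding H(6)[symmetric] s1(2)[symmetric] using O1 O2 H(1-5) s1(1) by (simp add: Comp_assoc)
      finally show "Comp C Z1 Y1 T2 (Comp C Y1 T1 T2 u s1) p1 = Comp C Z1 Y1 T2 (Comp C Y1 Y2 T2 s2 g) p1" by simp
    qed (use O1 O2 H s1 s2 g in simp_all)
    then have ex: "(s1, s2) \<in> Arr (arrow_cat C) (Y1, Y2, g) T \<and> Comp (arrow_cat C) (Z1, Z2, h) (Y1, Y2, g) T (s1, s2) (p1, p2) = t"
      using s1 s2 by (simp add: T t)
    show ?thesis
    proof (rule ex1I[of _ "(s1, s2)"], rule ex)
      fix r assume r: "r \<in> Arr (arrow_cat C) (Y1, Y2, g) T \<and> Comp (arrow_cat C) (Z1, Z2, h) (Y1, Y2, g) T r (p1, p2) = t"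
      obtain r1 r2 where rr: "r = (r1, r2)" by (metis surj_pair)
      have R: "r1 \<in> Arr C Y1 T1" "r2 \<in> Arr C Y2 T2" "Comp C Z1 Y1 T1 r1 p1 = t1" "Comp C Z2 Y2 T2 r2 p2 = t2"
        using r by (simp_all add: T t rr)
      have "r1 = s1" by (rule se_epi[OF 1 H(1)]) (use R s1 in simp_all)
      moreover have "r2 = s2" by (rule se_epi[OF 2 H(2)]) (use R s2 in simp_all)
      ultimately show "r = (s1, s2)" by (simp add: rr)
    qed
  qed
  have "(X1, X2, f) \<in> Obj (arrow_cat C)" "(Z1, Z2, h) \<in> Obj (arrow_cat C)" "(Y1, Y2, g) \<in> Obj (arrow_cat C)"
    "(i1, i2) \<in> Arr (arrow_cat C) (X1, X2, f) (Z1, Z2, h)" "(p1, p2) \<in> Arr (arrow_cat C) (Z1, Z2, h) (Y1, Y2, g)"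
    "Comp (arrow_cat C) (X1, X2, f) (Z1, Z2, h) (Y1, Y2, g) (p1, p2) (i1, i2) = Zero (arrow_cat C) (X1, X2, f) (Y1, Y2, g)"
    using O1 O2 f g h hi gp by simp_all
  then show ?thesis
    unfolding short_exact_def is_kernel_def is_cokernel_def using k c by blast
qed

end

section \<open>The category of monomorphisms\<close>

text \<open>What the arguments about monomorphisms need to know about \<open>\<Lambda>\<close> and \<open>\<XX>\<close>; elements of modules do not occur
  from here on.\<close>

locale resolving_setting =
  fixes \<Lambda> :: "('r, 'd) ring_scheme" and \<XX> :: "'r fmod set"
  assumes mod_preadditive: "preadditive_category (mod_cat \<Lambda>)"
    and X_Obj: "A \<in> \<XX> \<Longrightarrow> A \<in> Obj (mod_cat \<Lambda>)"
    and X_iso: "A \<in> \<XX> \<Longrightarrow> iso_arr (mod_cat \<Lambda>) A f B \<Longrightarrow> B \<in> \<XX>"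
    and zero_exists: "\<exists>Z. zero_object (mod_cat \<Lambda>) Z"
    and X_zero: "zero_object (mod_cat \<Lambda>) Z \<Longrightarrow> Z \<in> \<XX>"
    and X_biproduct: "A \<in> \<XX> \<Longrightarrow> B \<in> \<XX> \<Longrightarrow> \<exists>S\<in>\<XX>. \<exists>i j p q. biproduct (mod_cat \<Lambda>) A B S i j p q"
    and X_kernel: "epi (mod_cat \<Lambda>) B p D \<Longrightarrow> B \<in> \<XX> \<Longrightarrow> D \<in> \<XX> \<Longrightarrow> \<exists>K\<in>\<XX>. \<exists>i. short_exact (mod_cat \<Lambda>) K i B p D"
    and kernel_epi: "epi (mod_cat \<Lambda>) B p D \<Longrightarrow> is_kernel (mod_cat \<Lambda>) K i B p D \<Longrightarrow> short_exact (mod_cat \<Lambda>) K i B p D"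
    and cok_short_exact: "monic (mod_cat \<Lambda>) A f B \<Longrightarrow>
      short_exact (mod_cat \<Lambda>) A f B (cok_map (mod_cat \<Lambda>) (A, B, f)) (cok_obj (mod_cat \<Lambda>) (A, B, f))"
    and cover: "D \<in> \<XX> \<Longrightarrow> \<exists>P p. projective_cover \<Lambda> P p D"
    and prj_X: "P \<in> prj \<Lambda> \<Longrightarrow> P \<in> \<XX>"
    and prj_lift: "P \<in> prj \<Lambda> \<Longrightarrow> epi (mod_cat \<Lambda>) B p D \<Longrightarrow> t \<in> Arr (mod_cat \<Lambda>) P D \<Longrightarrow>
      \<exists>s. s \<in> Arr (mod_cat \<Lambda>) P B \<and> Comp (mod_cat \<Lambda>) P B D p s = t"

sublocale resolving_setting \<subseteq> C: preadditive_category "mod_cat \<Lambda>"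
  by (rule mod_preadditive)

context resolving_setting
begin

text \<open>For an object \<open>x = (A, B, f)\<close> of \<open>S\<close>, the cokernel of \<open>f\<close> is \<open>q x : B \<rightarrow> Cok x\<close>.  Composition and addition of module
  maps are written \<open>cp\<close> and \<open>ad\<close>.\<close>

abbreviation M where "M \<equiv> mod_cat \<Lambda>"
abbreviation S where "S \<equiv> S_cat \<Lambda> \<XX>"
abbreviation scw_structure ("\<E>") where "\<E> \<equiv> scw \<Lambda> \<XX>"
abbreviation V_set ("\<V>") where "\<V> \<equiv> V_objects \<Lambda> \<XX>"
abbreviation Psi_fun ("\<Psi>") where "\<Psi> \<equiv> Psi \<Lambda> \<XX>"
abbreviation ind where "ind \<equiv> induced_cok_map \<Lambda>"
abbreviation pg where "pg \<equiv> psi_group \<Lambda>"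
abbreviation Cok where "Cok x \<equiv> cok_obj (mod_cat \<Lambda>) x"
abbreviation q where "q x \<equiv> cok_map (mod_cat \<Lambda>) x"
abbreviation cp where "cp \<equiv> Comp (mod_cat \<Lambda>)"
abbreviation ad where "ad A B f g \<equiv> f \<otimes>\<^bsub>Hom (mod_cat \<Lambda>) A B\<^esub> g"

lemma S_simps [simp]:
  "Hom S = Hom (arrow_cat M)" "Comp S = Comp (arrow_cat M)" "Ident S = Ident (arrow_cat M)"
  by (simp_all add: S_cat_def)

lemma S_preadditive: "preadditive_category S"
  unfolding S_cat_def
  by (rule preadditive_category.full_subcat_preadditive[OF C.arrow_cat_preadditive])

lemma S_ObjE:
  assumes "x \<in> Obj S"
  obtains A B f where "x = (A, B, f)" "(A, B, f) \<in> Obj S"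
  using assms by (metis prod_cases3)

lemma S_ObjD:
  assumes "(A, B, f) \<in> Obj S"
  shows "A \<in> \<XX>" "B \<in> \<XX>" "Cok (A, B, f) \<in> \<XX>" "short_exact M A f B (q (A, B, f)) (Cok (A, B, f))"
    "A \<in> Obj M" "B \<in> Obj M" "Cok (A, B, f) \<in> Obj M" "f \<in> Arr M A B" "q (A, B, f) \<in> Arr M B (Cok (A, B, f))"
    "cp A B (Cok (A, B, f)) (q (A, B, f)) f = Zero M A (Cok (A, B, f))"
proof -
  have m: "monic M A f B" and X: "A \<in> \<XX>" "B \<in> \<XX>" "Cok (A, B, f) \<in> \<XX>"
    using assms by (simp_all add: S_cat_def)
  note se = cok_short_exact[OF m]
  show "A \<in> \<XX>" "B \<in> \<XX>" "Cok (A, B, f) \<in> \<XX>" "short_exact M A f B (q (A, B, f)) (Cok (A, B, f))"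
    "A \<in> Obj M" "B \<in> Obj M" "Cok (A, B, f) \<in> Obj M" "f \<in> Arr M A B" "q (A, B, f) \<in> Arr M B (Cok (A, B, f))"
    "cp A B (Cok (A, B, f)) (q (A, B, f)) f = Zero M A (Cok (A, B, f))"
    using X se C.short_exactD[OF se] by simp_all
qed

lemma S_ObjI:
  assumes se: "short_exact M A f B p D" and X: "A \<in> \<XX>" "B \<in> \<XX>" "D \<in> \<XX>"
  shows "(A, B, f) \<in> Obj S"
    "\<exists>k. iso_arr M (Cok (A, B, f)) k D \<and> k \<in> Arr M (Cok (A, B, f)) D \<and> cp B (Cok (A, B, f)) D k (q (A, B, f)) = p"
proof -
  note O = C.short_exactD[OF se]
  have c: "is_cokernel M A f B p D" using se by (simp add: short_exact_def)
  note c' = C.cok_is_cokernel[OF c]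
  obtain l where l: "iso_arr M D l (Cok (A, B, f))" using C.cokernel_unique[OF c c'] by metis
  have "Cok (A, B, f) \<in> \<XX>" using X_iso[OF X(3) l] .
  then show "(A, B, f) \<in> Obj S" using O X C.se_is_monic[OF se] by (simp add: S_cat_def)
  obtain k where "iso_arr M (Cok (A, B, f)) k D" "cp B (Cok (A, B, f)) D k (q (A, B, f)) = p" "k \<in> Arr M (Cok (A, B, f)) D"
    using C.cokernel_unique[OF c' c] by metis
  then show "\<exists>k. iso_arr M (Cok (A, B, f)) k D \<and> k \<in> Arr M (Cok (A, B, f)) D \<and> cp B (Cok (A, B, f)) D k (q (A, B, f)) = p"
    by auto
qed

lemma induced:
  assumes x: "(A, B, f) \<in> Obj S" and y: "(A', B', f') \<in> Obj S"
    and ab: "(a, b) \<in> Arr S (A, B, f) (A', B', f')"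
  shows "ind (A, B, f) (A', B', f') (a, b) \<in> Arr M (Cok (A, B, f)) (Cok (A', B', f'))"
    "cp B (Cok (A, B, f)) (Cok (A', B', f')) (ind (A, B, f) (A', B', f') (a, b)) (q (A, B, f))
      = cp B B' (Cok (A', B', f')) (q (A', B', f')) b"
    "\<And>c. c \<in> Arr M (Cok (A, B, f)) (Cok (A', B', f')) \<Longrightarrow>
      cp B (Cok (A, B, f)) (Cok (A', B', f')) c (q (A, B, f)) = cp B B' (Cok (A', B', f')) (q (A', B', f')) b \<Longrightarrow>
      c = ind (A, B, f) (A', B', f') (a, b)"
proof -
  note X = S_ObjD[OF x] and Y = S_ObjD[OF y]
  let ?D = "Cok (A, B, f)" and ?D' = "Cok (A', B', f')" and ?q = "q (A, B, f)" and ?q' = "q (A', B', f')"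
  have H: "a \<in> Arr M A A'" "b \<in> Arr M B B'" "cp A A' B' f' a = cp A B B' b f" using ab by simp_all
  have "cp A B ?D' (cp B B' ?D' ?q' b) f = cp A A' ?D' (cp A' B' ?D' ?q' f') a"
    using X(5-9) Y(5-9) H(1,2) by (simp add: C.Comp_assoc' H(3))
  then have z: "cp A B ?D' (cp B B' ?D' ?q' b) f = Zero M A ?D'" using X Y H by simp
  have bc: "cp B B' ?D' ?q' b \<in> Arr M B ?D'" using X Y H by simp
  obtain c where c: "c \<in> Arr M ?D ?D'" "cp B ?D ?D' c ?q = cp B B' ?D' ?q' b"
    using C.se_colift[OF X(4) Y(7) bc z] by auto
  have uniq: "c' = c" if "c' \<in> Arr M ?D ?D'" "cp B ?D ?D' c' ?q = cp B B' ?D' ?q' b" for c'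
    by (rule C.se_epi[OF X(4) Y(7)]) (use that c in simp_all)
  have e: "ind (A, B, f) (A', B', f') (a, b) = c"
    unfolding induced_cok_map_def Let_def fst_conv snd_conv
    by (rule the_equality) (use c uniq in \<open>blast+\<close>)
  show "ind (A, B, f) (A', B', f') (a, b) \<in> Arr M ?D ?D'"
    "cp B ?D ?D' (ind (A, B, f) (A', B', f') (a, b)) ?q = cp B B' ?D' ?q' b"
    "\<And>c. c \<in> Arr M ?D ?D' \<Longrightarrow> cp B ?D ?D' c ?q = cp B B' ?D' ?q' b \<Longrightarrow> c = ind (A, B, f) (A', B', f') (a, b)"
    unfolding e by (rule c, rule c, rule uniq)
qed

text \<open>The component \<open>a\<close> is found by lifting \<open>b f\<close> along \<open>f'\<close>, which is a kernel of its cokernel map.\<close>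

lemma induced_lift:
  assumes x: "(A, B, f) \<in> Obj S" and y: "(A', B', f') \<in> Obj S"
    and c: "c \<in> Arr M (Cok (A, B, f)) (Cok (A', B', f'))" and b: "b \<in> Arr M B B'"
    and cb: "cp B (Cok (A, B, f)) (Cok (A', B', f')) c (q (A, B, f)) = cp B B' (Cok (A', B', f')) (q (A', B', f')) b"
  shows "\<exists>a. (a, b) \<in> Arr S (A, B, f) (A', B', f') \<and> ind (A, B, f) (A', B', f') (a, b) = c"
proof -
  note X = S_ObjD[OF x] and Y = S_ObjD[OF y]
  have "cp A B' (Cok (A', B', f')) (q (A', B', f')) (cp A B B' b f)
     = cp A (Cok (A, B, f)) (Cok (A', B', f')) c (cp A B (Cok (A, B, f)) (q (A, B, f)) f)"
    using X(5-9) Y(5-9) b c by (simp add: C.Comp_assoc cb)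
  then have z: "cp A B' (Cok (A', B', f')) (q (A', B', f')) (cp A B B' b f) = Zero M A (Cok (A', B', f'))"
    using X Y b c by simp
  have bf: "cp A B B' b f \<in> Arr M A B'" using X Y b by simp
  obtain a where a: "a \<in> Arr M A A'" "cp A A' B' f' a = cp A B B' b f"
    using C.se_lift[OF Y(4) X(5) bf z] by auto
  then have ab: "(a, b) \<in> Arr S (A, B, f) (A', B', f')" using b by simp
  then show ?thesis using induced(3)[OF x y ab c cb] by auto
qed

lemma induced_Comp:
  assumes x: "(A, B, f) \<in> Obj S" and y: "(A', B', f') \<in> Obj S" and z: "(A'', B'', f'') \<in> Obj S"
    and ab: "(a, b) \<in> Arr S (A, B, f) (A', B', f')" and ab': "(a', b') \<in> Arr S (A', B', f') (A'', B'', f'')"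
  shows "ind (A, B, f) (A'', B'', f'') (Comp S (A, B, f) (A', B', f') (A'', B'', f'') (a', b') (a, b))
    = cp (Cok (A, B, f)) (Cok (A', B', f')) (Cok (A'', B'', f''))
        (ind (A', B', f') (A'', B'', f'') (a', b')) (ind (A, B, f) (A', B', f') (a, b))"
proof -
  note X = S_ObjD[OF x] and Y = S_ObjD[OF y] and Z = S_ObjD[OF z]
  note i1 = induced(1,2)[OF x y ab] and i2 = induced(1,2)[OF y z ab']
  have H: "b \<in> Arr M B B'" "b' \<in> Arr M B' B''" using ab ab' by simp_all
  have cl: "Comp S (A, B, f) (A', B', f') (A'', B'', f'') (a', b') (a, b) \<in> Arr S (A, B, f) (A'', B'', f'')"
    by (rule preadditive_category.Comp_closed[OF S_preadditive x y z ab ab'])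
  let ?c = "ind (A, B, f) (A', B', f') (a, b)" and ?c' = "ind (A', B', f') (A'', B'', f'') (a', b')"
  have "cp B (Cok (A, B, f)) (Cok (A'', B'', f'')) (cp (Cok (A, B, f)) (Cok (A', B', f')) (Cok (A'', B'', f'')) ?c' ?c) (q (A, B, f))
      = cp B (Cok (A', B', f')) (Cok (A'', B'', f'')) ?c' (cp B B' (Cok (A', B', f')) (q (A', B', f')) b)"
    unfolding i1(2)[symmetric] using X Y Z i1(1) i2(1) by (simp add: C.Comp_assoc')
  also have "\<dots> = cp B B'' (Cok (A'', B'', f'')) (q (A'', B'', f'')) (cp B B' B'' b' b)"
    using X(5-9) Y(5-9) Z(5-9) H i1(1) i2(1) by (simp add: C.Comp_assoc i2(2))
  finally have "cp (Cok (A, B, f)) (Cok (A', B', f')) (Cok (A'', B'', f'')) ?c' ?c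
     = ind (A, B, f) (A'', B'', f'') (cp A A' A'' a' a, cp B B' B'' b' b)"
    using cl X Y Z i1(1) i2(1) by (intro induced(3)[OF x z]) simp_all
  then show ?thesis by simp
qed

lemma induced_add:
  assumes x: "(A, B, f) \<in> Obj S" and y: "(A', B', f') \<in> Obj S"
    and ab: "(a, b) \<in> Arr S (A, B, f) (A', B', f')" and ab': "(a', b') \<in> Arr S (A, B, f) (A', B', f')"
  shows "ind (A, B, f) (A', B', f') ((a, b) \<otimes>\<^bsub>Hom S (A, B, f) (A', B', f')\<^esub> (a', b'))
    = ind (A, B, f) (A', B', f') (a, b) \<otimes>\<^bsub>Hom M (Cok (A, B, f)) (Cok (A', B', f'))\<^esub>
      ind (A, B, f) (A', B', f') (a', b')"
proof -
  note X = S_ObjD[OF x] and Y = S_ObjD[OF y]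
  note i1 = induced(1,2)[OF x y ab] and i2 = induced(1,2)[OF x y ab']
  have H: "b \<in> Arr M B B'" "b' \<in> Arr M B B'" using ab ab' by simp_all
  have cl: "(a, b) \<otimes>\<^bsub>Hom S (A, B, f) (A', B', f')\<^esub> (a', b') \<in> Arr S (A, B, f) (A', B', f')"
    by (rule preadditive_category.add_closed[OF S_preadditive x y ab ab'])
  have "ind (A, B, f) (A', B', f') (a, b) \<otimes>\<^bsub>Hom M (Cok (A, B, f)) (Cok (A', B', f'))\<^esub>
      ind (A, B, f) (A', B', f') (a', b')
    = ind (A, B, f) (A', B', f') (a \<otimes>\<^bsub>Hom M A A'\<^esub> a', b \<otimes>\<^bsub>Hom M B B'\<^esub> b')"
    using cl X Y i1 i2 H by (intro induced(3)[OF x y]) (simp_all add: C.Comp_add_left C.Comp_add_right)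
  then show ?thesis by simp
qed

lemma induced_Ident:
  assumes x: "(A, B, f) \<in> Obj S"
  shows "ind (A, B, f) (A, B, f) (Ident S (A, B, f)) = Ident M (Cok (A, B, f))"
proof -
  have "Ident M (Cok (A, B, f)) = ind (A, B, f) (A, B, f) (Ident M A, Ident M B)"
    using S_ObjD[OF x] by (intro induced(3)[OF x x]) simp_all
  then show ?thesis by simp
qed

lemma cover_exact:
  assumes "D \<in> \<XX>"
  obtains K P i p where "projective_cover \<Lambda> P p D" "short_exact M K i P p D" "K \<in> \<XX>" "P \<in> \<XX>" "P \<in> prj \<Lambda>"
    "(K, P, i) \<in> \<V>"
proof -
  obtain P p where P: "projective_cover \<Lambda> P p D" using cover[OF assms] by auto
  then have P': "P \<in> prj \<Lambda>" "epi M P p D" by (simp_all add: projective_cover_def)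
  obtain K i where K: "K \<in> \<XX>" "short_exact M K i P p D" using X_kernel[OF P'(2) prj_X[OF P'(1)] assms] by auto
  have "is_kernel M K i P p D" using K by (simp add: short_exact_def)
  then have "(K, P, i) \<in> \<V>" unfolding V_objects_def using P assms by blast
  then show ?thesis using that P P' K prj_X by blast
qed

end

section \<open>Direct sums of monomorphisms\<close>

context preadditive_category
begin

lemma biproductD:
  assumes "biproduct C A B S i j p q"
  shows "A \<in> Obj C" "B \<in> Obj C" "S \<in> Obj C" "i \<in> Arr C A S" "j \<in> Arr C B S" "p \<in> Arr C S A" "q \<in> Arr C S B"
    "Comp C A S A p i = Ident C A" "Comp C B S B q j = Ident C B"
    "Comp C B S A p j = Zero C B A" "Comp C A S B q i = Zero C A B"
    "Comp C S A S i p \<otimes>\<^bsub>Hom C S S\<^esub> Comp C S B S j q = Ident C S"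
  using assms by (simp_all add: biproduct_def)

lemma biproduct_ext:
  assumes b: "biproduct C A B S i j p q" and T: "T \<in> Obj C" "s \<in> Arr C T S" "t \<in> Arr C T S"
    and "Comp C T S A p s = Comp C T S A p t" "Comp C T S B q s = Comp C T S B q t"
  shows "s = t"
proof -
  note O = biproductD(1-7)[OF b]
  have *: "u = Comp C T A S i (Comp C T S A p u) \<otimes>\<^bsub>Hom C T S\<^esub> Comp C T B S j (Comp C T S B q u)" if u: "u \<in> Arr C T S" for u
  proof -
    have "Comp C T A S i (Comp C T S A p u) \<otimes>\<^bsub>Hom C T S\<^esub> Comp C T B S j (Comp C T S B q u)
       = Comp C T S S (Comp C S A S i p \<otimes>\<^bsub>Hom C S S\<^esub> Comp C S B S j q) u"
      using O T u by (simp add: Comp_add_left Comp_assoc)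
    then show ?thesis using biproductD(12)[OF b] O T u by simp
  qed
  show ?thesis using *[OF T(2)] *[OF T(3)] assms by simp
qed

lemma biproduct_coext:
  assumes b: "biproduct C A B S i j p q" and T: "T \<in> Obj C" "s \<in> Arr C S T" "t \<in> Arr C S T"
    and "Comp C A S T s i = Comp C A S T t i" "Comp C B S T s j = Comp C B S T t j"
  shows "s = t"
proof -
  note O = biproductD(1-7)[OF b]
  have *: "u = Comp C S A T (Comp C A S T u i) p \<otimes>\<^bsub>Hom C S T\<^esub> Comp C S B T (Comp C B S T u j) q" if u: "u \<in> Arr C S T" for u
  proof -
    have "Comp C S A T (Comp C A S T u i) p \<otimes>\<^bsub>Hom C S T\<^esub> Comp C S B T (Comp C B S T u j) q
       = Comp C S S T u (Comp C S A S i p \<otimes>\<^bsub>Hom C S S\<^esub> Comp C S B S j q)"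
      using O T u by (simp add: Comp_add_right Comp_assoc')
    then show ?thesis using biproductD(12)[OF b] O T u by simp
  qed
  show ?thesis using *[OF T(2)] *[OF T(3)] assms by simp
qed

text \<open>The map \<open>f \<oplus> f'\<close> between two biproducts, characterised by its components.\<close>

lemma biproduct_map:
  assumes b: "biproduct C A A' S i j p q" and b': "biproduct C B B' T k l r s"
    and f: "f \<in> Arr C A B" "f' \<in> Arr C A' B'"
  shows "\<exists>h. h \<in> Arr C S T \<and> Comp C A S T h i = Comp C A B T k f \<and> Comp C A' S T h j = Comp C A' B' T l f' \<and>
    Comp C S T B r h = Comp C S A B f p \<and> Comp C S T B' s h = Comp C S A' B' f' q"
proof -
  note O = biproductD(1-7)[OF b] and E = biproductD(8-11)[OF b]
  note O' = biproductD(1-7)[OF b'] and E' = biproductD(8-11)[OF b']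
  let ?h = "Comp C S A T (Comp C A B T k f) p \<otimes>\<^bsub>Hom C S T\<^esub> Comp C S A' T (Comp C A' B' T l f') q"
  have 1: "Comp C A S T ?h i = Comp C A B T k f" "Comp C A' S T ?h j = Comp C A' B' T l f'"
    using O O' f by (simp_all add: Comp_add_left Comp_assoc' E)
  have 2: "Comp C S T B r (Comp C S B T k (Comp C S A B f p)) = Comp C S A B f p"
    "Comp C S T B r (Comp C S B' T l (Comp C S A' B' f' q)) = Zero C S B"
    "Comp C S T B' s (Comp C S B T k (Comp C S A B f p)) = Zero C S B'"
    "Comp C S T B' s (Comp C S B' T l (Comp C S A' B' f' q)) = Comp C S A' B' f' q"
  proof -
    have "Comp C S T B r (Comp C S B T k x) = x" "Comp C S T B' s (Comp C S B T k x) = Zero C S B'"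
      if "x \<in> Arr C S B" for x
      using O O' E' that by (simp_all add: Comp_assoc)
    moreover have "Comp C S T B r (Comp C S B' T l x) = Zero C S B" "Comp C S T B' s (Comp C S B' T l x) = x"
      if "x \<in> Arr C S B'" for x
      using O O' E' that by (simp_all add: Comp_assoc)
    moreover have "Comp C S A B f p \<in> Arr C S B" "Comp C S A' B' f' q \<in> Arr C S B'" using O O' f by simp_all
    ultimately show "Comp C S T B r (Comp C S B T k (Comp C S A B f p)) = Comp C S A B f p"
      "Comp C S T B r (Comp C S B' T l (Comp C S A' B' f' q)) = Zero C S B"
      "Comp C S T B' s (Comp C S B T k (Comp C S A B f p)) = Zero C S B'"
      "Comp C S T B' s (Comp C S B' T l (Comp C S A' B' f' q)) = Comp C S A' B' f' q"
      by blast+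
  qed
  have 3: "?h = Comp C S B T k (Comp C S A B f p) \<otimes>\<^bsub>Hom C S T\<^esub> Comp C S B' T l (Comp C S A' B' f' q)"
    using O O' f by (simp add: Comp_assoc)
  have "Comp C S T B r ?h = Comp C S A B f p" "Comp C S T B' s ?h = Comp C S A' B' f' q"
    unfolding 3 using O O' f 2 by (simp_all add: Comp_add_right)
  then show ?thesis using 1 O O' f by (intro exI[of _ ?h]) simp
qed

end

context resolving_setting
begin

text \<open>The biproducts of the sources, of the targets and of the cokernels again form a short exact sequence; so
  the componentwise biproduct has its cokernel in \<open>\<XX>\<close>.\<close>

lemma S_biproduct:
  assumes "x \<in> Obj S" "y \<in> Obj S"
  shows "\<exists>z\<in>Obj S. \<exists>i j p r. biproduct S x y z i j p r"
proof -
  obtain A B f where x: "x = (A, B, f)" "(A, B, f) \<in> Obj S" using S_ObjE[OF assms(1)] by metis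
  obtain A' B' f' where y: "y = (A', B', f')" "(A', B', f') \<in> Obj S" using S_ObjE[OF assms(2)] by metis
  note X = S_ObjD[OF x(2)] and Y = S_ObjD[OF y(2)]
  let ?D = "Cok (A, B, f)" and ?D' = "Cok (A', B', f')" and ?q = "q (A, B, f)" and ?q' = "q (A', B', f')"
  obtain A2 ia ja pa qa where a: "A2 \<in> \<XX>" "biproduct M A A' A2 ia ja pa qa" using X_biproduct[OF X(1) Y(1)] by auto
  obtain B2 ib jb pb qb where b: "B2 \<in> \<XX>" "biproduct M B B' B2 ib jb pb qb" using X_biproduct[OF X(2) Y(2)] by auto
  obtain D2 id jd pd qd where d: "D2 \<in> \<XX>" "biproduct M ?D ?D' D2 id jd pd qd" using X_biproduct[OF X(3) Y(3)] by auto
  note Oa = C.biproductD[OF a(2)] and Ob = C.biproductD[OF b(2)] and Od = C.biproductD[OF d(2)]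
  obtain h where h: "h \<in> Arr M A2 B2" "cp A A2 B2 h ia = cp A B B2 ib f" "cp A' A2 B2 h ja = cp A' B' B2 jb f'"
     "cp A2 B2 B pb h = cp A2 A B f pa" "cp A2 B2 B' qb h = cp A2 A' B' f' qa"
    using C.biproduct_map[OF a(2) b(2) X(8) Y(8)] by auto
  obtain u where u: "u \<in> Arr M B2 D2" "cp B B2 D2 u ib = cp B ?D D2 id ?q" "cp B' B2 D2 u jb = cp B' ?D' D2 jd ?q'"
     "cp B2 D2 ?D pd u = cp B2 B ?D ?q pb" "cp B2 D2 ?D' qd u = cp B2 B' ?D' ?q' qb"
    using C.biproduct_map[OF b(2) d(2) X(9) Y(9)] by auto
  have ue: "epi M B2 u D2" unfolding epi_def
  proof (intro conjI ballI impI)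
    fix T s t assume T: "T \<in> Obj M" "s \<in> Arr M D2 T" "t \<in> Arr M D2 T" "cp B2 D2 T s u = cp B2 D2 T t u"
    have 1: "cp B ?D T (cp ?D D2 T s id) ?q = cp B B2 T (cp B2 D2 T s u) ib" if "s \<in> Arr M D2 T" for s
      using X(5-9) Ob(1-7) Od(1-7) T(1) that u(1) by (simp add: C.Comp_assoc' u(2))
    have 2: "cp B' ?D' T (cp ?D' D2 T s jd) ?q' = cp B' B2 T (cp B2 D2 T s u) jb" if "s \<in> Arr M D2 T" for s
      using Y(5-9) Ob(1-7) Od(1-7) T(1) that u(1) by (simp add: C.Comp_assoc' u(3))
    have "cp ?D D2 T s id = cp ?D D2 T t id"
      by (rule C.se_epi[OF X(4) T(1)]) (use 1[OF T(2)] 1[OF T(3)] T Od in simp_all)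
    moreover have "cp ?D' D2 T s jd = cp ?D' D2 T t jd"
      by (rule C.se_epi[OF Y(4) T(1)]) (use 2[OF T(2)] 2[OF T(3)] T Od in simp_all)
    ultimately show "s = t" using C.biproduct_coext[OF d(2) T(1-3)] by simp
  qed (use Ob Od u in simp_all)
  have uh: "cp A2 B2 D2 u h = Zero M A2 D2"
  proof (rule C.biproduct_ext[OF d(2)])
    have "cp A2 D2 ?D pd (cp A2 B2 D2 u h) = cp A2 B ?D ?q (cp A2 B2 B pb h)"
      using X(5-9) Oa(1-7) Ob(1-7) Od(1-7) h(1) u(1) by (simp add: C.Comp_assoc u(4))
    also have "\<dots> = Zero M A2 ?D" unfolding h(4) using X(5-10) Oa(1-7) by (simp add: C.Comp_assoc)
    finally show "cp A2 D2 ?D pd (cp A2 B2 D2 u h) = cp A2 D2 ?D pd (Zero M A2 D2)" using Oa Od by simp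
    have "cp A2 D2 ?D' qd (cp A2 B2 D2 u h) = cp A2 B' ?D' ?q' (cp A2 B2 B' qb h)"
      using Y(5-9) Oa(1-7) Ob(1-7) Od(1-7) h(1) u(1) by (simp add: C.Comp_assoc u(5))
    also have "\<dots> = Zero M A2 ?D'" unfolding h(5) using Y(5-10) Oa(1-7) by (simp add: C.Comp_assoc)
    finally show "cp A2 D2 ?D' qd (cp A2 B2 D2 u h) = cp A2 D2 ?D' qd (Zero M A2 D2)" using Oa Od by simp
  qed (use Oa Ob Od h u in simp_all)
  have "is_kernel M A2 h B2 u D2"
    unfolding is_kernel_def
  proof (intro conjI ballI impI)
    fix T t assume T: "T \<in> Obj M" "t \<in> Arr M T B2" "cp T B2 D2 u t = Zero M T D2"
    have "cp T B ?D ?q (cp T B2 B pb t) = cp T D2 ?D pd (cp T B2 D2 u t)"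
      using X(5-9) Ob(1-7) Od(1-7) T(1,2) u(1) by (simp add: C.Comp_assoc u(4))
    then have z1: "cp T B ?D ?q (cp T B2 B pb t) = Zero M T ?D" using T Od X by simp
    have "cp T B' ?D' ?q' (cp T B2 B' qb t) = cp T D2 ?D' qd (cp T B2 D2 u t)"
      using Y(5-9) Ob(1-7) Od(1-7) T(1,2) u(1) by (simp add: C.Comp_assoc u(5))
    then have z2: "cp T B' ?D' ?q' (cp T B2 B' qb t) = Zero M T ?D'" using T Od Y by simp
    have t12: "cp T B2 B pb t \<in> Arr M T B" "cp T B2 B' qb t \<in> Arr M T B'" using T Ob by simp_all
    obtain s where s: "s \<in> Arr M T A" "cp T A B f s = cp T B2 B pb t" using C.se_lift[OF X(4) T(1) t12(1) z1] by auto
    obtain s' where s': "s' \<in> Arr M T A'" "cp T A' B' f' s' = cp T B2 B' qb t" using C.se_lift[OF Y(4) T(1) t12(2) z2] by auto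
    let ?s = "ad T A2 (cp T A A2 ia s) (cp T A' A2 ja s')"
    have sc: "?s \<in> Arr M T A2" using T s s' Oa by simp
    have ps: "cp T A2 A pa ?s = s" "cp T A2 A' qa ?s = s'"
      using T(1) s(1) s'(1) Oa by (simp_all add: C.Comp_add_right C.Comp_assoc)
    have key: "cp T B2 B pb (cp T A2 B2 h r) = cp T A B f (cp T A2 A pa r)"
        "cp T B2 B' qb (cp T A2 B2 h r) = cp T A' B' f' (cp T A2 A' qa r)" if "r \<in> Arr M T A2" for r
      using X(5-9) Y(5-9) Oa(1-7) Ob(1-7) T(1) h(1) that by (simp_all add: C.Comp_assoc h(4,5))
    show "\<exists>!s. s \<in> Arr M T A2 \<and> cp T A2 B2 h s = t"
    proof (rule ex1I[of _ ?s])
      have "cp T A2 B2 h ?s = t"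
        by (rule C.biproduct_ext[OF b(2) T(1)]) (use key[OF sc] ps s s' sc T h Oa Ob in simp_all)
      then show "?s \<in> Arr M T A2 \<and> cp T A2 B2 h ?s = t" using sc by simp
      fix r assume r: "r \<in> Arr M T A2 \<and> cp T A2 B2 h r = t"
      have rc: "r \<in> Arr M T A2" using r by simp
      have "cp T A2 A pa r = s"
        by (rule C.se_mono[OF X(4) T(1)]) (use key[OF rc] r s T Oa in simp_all)
      moreover have "cp T A2 A' qa r = s'"
        by (rule C.se_mono[OF Y(4) T(1)]) (use key[OF rc] r s' T Oa in simp_all)
      ultimately show "r = ?s" using C.biproduct_ext[OF a(2) T(1) rc sc] ps by simp
    qed
  qed (use Oa Ob Od h u uh in simp_all)
  then have se: "short_exact M A2 h B2 u D2" by (rule kernel_epi[OF ue])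
  have z: "(A2, B2, h) \<in> Obj S" by (rule S_ObjI(1)[OF se a(1) b(1) d(1)])
  have "biproduct S x y (A2, B2, h) (ia, ib) (ja, jb) (pa, pb) (qa, qb)"
    unfolding biproduct_def using x y z h Oa Ob by simp
  then show ?thesis using z by blast
qed

lemma X_id_object:
  assumes "A \<in> \<XX>" shows "(A, A, Ident M A) \<in> Obj S" "(A, A, Ident M A) \<in> \<V>"
proof -
  obtain Z where Z: "zero_object M Z" using zero_exists by auto
  have AO: "A \<in> Obj M" using assms X_Obj by simp
  have ZO: "Z \<in> Obj M" and Za: "\<And>T f. T \<in> Obj M \<Longrightarrow> f \<in> Arr M Z T \<Longrightarrow> f = Zero M Z T"
    using Z by (auto simp: zero_object_def)
  have e: "epi M A (Zero M A Z) Z" unfolding epi_def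
  proof (intro conjI ballI impI)
    fix T s t assume "T \<in> Obj M" "s \<in> Arr M Z T" "t \<in> Arr M Z T"
    then show "s = t" using Za by metis
  qed (use AO ZO in simp_all)
  have "is_kernel M A (Ident M A) A (Zero M A Z) Z"
    unfolding is_kernel_def
  proof (intro conjI ballI impI)
    fix T t assume T: "T \<in> Obj M" "t \<in> Arr M T A"
    show "\<exists>!s. s \<in> Arr M T A \<and> cp T A A (Ident M A) s = t"
      by (rule ex1I[of _ t]) (use T AO in auto)
  qed (use AO ZO in simp_all)
  then have "short_exact M A (Ident M A) A (Zero M A Z) Z" by (rule kernel_epi[OF e])
  then show "(A, A, Ident M A) \<in> Obj S" using S_ObjI(1) assms X_zero[OF Z] by blast
  show "(A, A, Ident M A) \<in> \<V>" unfolding V_objects_def using assms by blast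
qed

lemma X_zero_object:
  assumes "D \<in> \<XX>" "zero_object M Z"
  shows "short_exact M Z (Zero M Z D) D (Ident M D) D" "(Z, D, Zero M Z D) \<in> Obj S" "(Z, D, Zero M Z D) \<in> \<V>"
proof -
  have DO: "D \<in> Obj M" using assms X_Obj by simp
  have ZO: "Z \<in> Obj M" and Za: "\<And>T f. T \<in> Obj M \<Longrightarrow> f \<in> Arr M T Z \<Longrightarrow> f = Zero M T Z"
    using assms(2) by (auto simp: zero_object_def)
  have "is_kernel M Z (Zero M Z D) D (Ident M D) D"
    unfolding is_kernel_def
  proof (intro conjI ballI impI)
    fix T t assume T: "T \<in> Obj M" "t \<in> Arr M T D" "cp T D D (Ident M D) t = Zero M T D"
    show "\<exists>!s. s \<in> Arr M T Z \<and> cp T Z D (Zero M Z D) s = t"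
      by (rule ex1I[of _ "Zero M T Z"]) (use T DO ZO Za[OF T(1)] in simp_all)
  qed (use DO ZO in simp_all)
  then show 1: "short_exact M Z (Zero M Z D) D (Ident M D) D"
    by (rule kernel_epi[OF C.iso_epi[OF C.iso_Ident[OF DO]]])
  show "(Z, D, Zero M Z D) \<in> Obj S" using S_ObjI(1)[OF 1 X_zero[OF assms(2)] assms(1,1)] .
  show "(Z, D, Zero M Z D) \<in> \<V>" unfolding V_objects_def using assms by blast
qed

lemma S_zero_exists: "\<exists>z\<in>Obj S. zero_object S z"
proof -
  obtain Z where Z: "zero_object M Z" using zero_exists by auto
  have ZO: "Z \<in> Obj M" and Za: "\<And>T. T \<in> Obj M \<Longrightarrow> Arr M T Z = {Zero M T Z}" "\<And>T. T \<in> Obj M \<Longrightarrow> Arr M Z T = {Zero M Z T}"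
    using Z by (auto simp: zero_object_def)
  have z: "(Z, Z, Zero M Z Z) \<in> Obj S" by (rule X_zero_object(2)[OF X_zero[OF Z] Z])
  have "Arr S (Z, Z, Zero M Z Z) x = {Zero S (Z, Z, Zero M Z Z) x} \<and> Arr S x (Z, Z, Zero M Z Z) = {Zero S x (Z, Z, Zero M Z Z)}"
    if xo: "x \<in> Obj S" for x
  proof -
    obtain A B f where x: "x = (A, B, f)" "(A, B, f) \<in> Obj S" using S_ObjE[OF xo] by metis
    note X = S_ObjD[OF x(2)]
    have u1: "ab = Zero S (Z, Z, Zero M Z Z) x" if "ab \<in> Arr S (Z, Z, Zero M Z Z) x" for ab
      using that Za X by (cases ab) (simp add: x)
    have u2: "ab = Zero S x (Z, Z, Zero M Z Z)" if "ab \<in> Arr S x (Z, Z, Zero M Z Z)" for ab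
      using that Za X by (cases ab) (simp add: x)
    have zs: "Zero S (Z, Z, Zero M Z Z) x \<in> Arr S (Z, Z, Zero M Z Z) x" "Zero S x (Z, Z, Zero M Z Z) \<in> Arr S x (Z, Z, Zero M Z Z)"
      using z xo preadditive_category.zero_closed[OF S_preadditive] by blast+
    have single: "E = {e}" if "e \<in> E" "\<And>a. a \<in> E \<Longrightarrow> a = e" for E :: "'r harr set" and e
      using that by blast
    show ?thesis by (rule conjI[OF single[OF zs(1) u1] single[OF zs(2) u2]])
  qed
  then show ?thesis using z unfolding zero_object_def by blast
qed

lemma S_direct_sum_exists:
  assumes "\<And>k. k < n \<Longrightarrow> v k \<in> Obj S"
  shows "\<exists>z\<in>Obj S. is_direct_sum S n v z"
proof -
  obtain Z where Z: "Z \<in> Obj S" "zero_object S Z" using S_zero_exists by auto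
  show ?thesis
    by (rule preadditive_category.direct_sum_data_exists[OF S_preadditive Z(2,1) subset_refl]) (use S_biproduct assms in auto)
qed

section \<open>Projective monomorphisms\<close>

text \<open>A deflation of \<open>\<E>\<close> consists of maps \<open>p1\<close>, \<open>p2\<close> and an induced map \<open>d\<close> of cokernels with sections \<open>s1\<close>,
  \<open>s2\<close>, \<open>s3\<close>, which need not form commutative squares.\<close>

lemma S_projectiveI:
  assumes x: "(A, B, f) \<in> Obj S"
    and lift: "\<And>Z1 Z2 h Y1 Y2 g p1 p2 d s1 s2 s3 a b.
      \<lbrakk>(Z1, Z2, h) \<in> Obj S; (Y1, Y2, g) \<in> Obj S; p1 \<in> Arr M Z1 Y1; p2 \<in> Arr M Z2 Y2; cp Z1 Y1 Y2 g p1 = cp Z1 Z2 Y2 p2 h;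
       s1 \<in> Arr M Y1 Z1; cp Y1 Z1 Y1 p1 s1 = Ident M Y1; s2 \<in> Arr M Y2 Z2; cp Y2 Z2 Y2 p2 s2 = Ident M Y2;
       d \<in> Arr M (Cok (Z1, Z2, h)) (Cok (Y1, Y2, g));
       cp Z2 (Cok (Z1, Z2, h)) (Cok (Y1, Y2, g)) d (q (Z1, Z2, h)) = cp Z2 Y2 (Cok (Y1, Y2, g)) (q (Y1, Y2, g)) p2;
       s3 \<in> Arr M (Cok (Y1, Y2, g)) (Cok (Z1, Z2, h));
       cp (Cok (Y1, Y2, g)) (Cok (Z1, Z2, h)) (Cok (Y1, Y2, g)) d s3 = Ident M (Cok (Y1, Y2, g));
       a \<in> Arr M A Y1; b \<in> Arr M B Y2; cp A Y1 Y2 g a = cp A B Y2 b f\<rbrakk>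
      \<Longrightarrow> \<exists>a' b'. a' \<in> Arr M A Z1 \<and> b' \<in> Arr M B Z2 \<and> cp A Z1 Z2 h a' = cp A B Z2 b' f \<and>
        cp A Z1 Y1 p1 a' = a \<and> cp B Z2 Y2 p2 b' = b"
  shows "projective S \<E> (A, B, f)"
  unfolding projective_def
proof (intro conjI x ballI impI)
  fix x z y i p t assume H: "x \<in> Obj S" "z \<in> Obj S" "y \<in> Obj S" "p \<in> Arr S z y" "\<E> x i z p y"
    "t \<in> Arr S (A, B, f) y"
  obtain X1 X2 e where xx: "x = (X1, X2, e)" by (metis prod_cases3)
  obtain Z1 Z2 h where z: "z = (Z1, Z2, h)" by (metis prod_cases3)
  obtain Y1 Y2 g where y: "y = (Y1, Y2, g)" by (metis prod_cases3)
  obtain i1 i2 where i: "i = (i1, i2)" by (metis surj_pair)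
  obtain p1 p2 where p: "p = (p1, p2)" by (metis surj_pair)
  obtain a b where t: "t = (a, b)" by (metis surj_pair)
  have e1: "split_exact M X1 i1 Z1 p1 Y1" and e2: "split_exact M X2 i2 Z2 p2 Y2"
    using H(5) by (simp_all add: scw_def xx z y i p Let_def)
  obtain c d where e3: "d \<in> Arr M (Cok z) (Cok y)" "cp Z2 (Cok z) (Cok y) d (q z) = cp Z2 Y2 (Cok y) (q y) p2"
    "split_exact M (Cok x) c (Cok z) d (Cok y)"
    using H(5) by (auto simp: scw_def xx z y i p Let_def)
  obtain s1 where s1: "s1 \<in> Arr M Y1 Z1" "cp Y1 Z1 Y1 p1 s1 = Ident M Y1" using e1 by (auto simp: split_exact_def)
  obtain s2 where s2: "s2 \<in> Arr M Y2 Z2" "cp Y2 Z2 Y2 p2 s2 = Ident M Y2" using e2 by (auto simp: split_exact_def)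
  obtain s3 where s3: "s3 \<in> Arr M (Cok y) (Cok z)" "cp (Cok y) (Cok z) (Cok y) d s3 = Ident M (Cok y)"
    using e3 by (auto simp: split_exact_def)
  have pp: "p1 \<in> Arr M Z1 Y1" "p2 \<in> Arr M Z2 Y2" "cp Z1 Y1 Y2 g p1 = cp Z1 Z2 Y2 p2 h"
    using H(4) by (simp_all add: z y p)
  have tt: "a \<in> Arr M A Y1" "b \<in> Arr M B Y2" "cp A Y1 Y2 g a = cp A B Y2 b f" using H(6) by (simp_all add: y t)
  obtain a' b' where "a' \<in> Arr M A Z1" "b' \<in> Arr M B Z2" "cp A Z1 Z2 h a' = cp A B Z2 b' f"
    "cp A Z1 Y1 p1 a' = a" "cp B Z2 Y2 p2 b' = b"
    using lift[OF H(2)[unfolded z] H(3)[unfolded y] pp s1 s2 e3(1,2)[unfolded z y] s3[unfolded z y] tt] by auto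
  then show "\<exists>s\<in>Arr S (A, B, f) z. Comp S (A, B, f) z y p s = t"
    by (intro bexI[of _ "(a', b')"]) (simp_all add: z y p t)
qed

text \<open>The first component lifts along its section, and the second one is then forced.\<close>

lemma id_projective:
  assumes X: "X \<in> \<XX>" shows "projective S \<E> (X, X, Ident M X)"
proof (rule S_projectiveI[OF X_id_object(1)[OF X]], goal_cases)
  case (1 Z1 Z2 h Y1 Y2 g p1 p2 d s1 s2 s3 a b)
  note Z = S_ObjD[OF 1(1)] and Y = S_ObjD[OF 1(2)]
  have XO: "X \<in> Obj M" using X X_Obj by simp
  let ?a = "cp X Y1 Z1 s1 a"
  have 2: "cp X Z1 Y1 p1 ?a = a" using XO Z Y 1(3-14) by (simp add: C.Comp_assoc)
  have "cp X Z2 Y2 p2 (cp X Z1 Z2 h ?a) = cp X Y1 Y2 g (cp X Z1 Y1 p1 ?a)"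
    using XO Z(5-9) Y(5-9) 1(3,4,6,14) by (simp add: C.Comp_assoc 1(5))
  also have "\<dots> = b" unfolding 2 using 1(14-16) XO Y by simp
  finally have 3: "cp X Z2 Y2 p2 (cp X Z1 Z2 h ?a) = b" .
  show ?case using XO Z Y 1(3-14) 2 3 by (intro exI[of _ ?a] exI[of _ "cp X Z1 Z2 h ?a"]) simp
qed

lemma zero_projective:
  assumes X: "X \<in> \<XX>" and W: "zero_object M W" shows "projective S \<E> (W, X, Zero M W X)"
proof (rule S_projectiveI[OF X_zero_object(2)[OF X W]], goal_cases)
  case (1 Z1 Z2 h Y1 Y2 g p1 p2 d s1 s2 s3 a b)
  note Z = S_ObjD[OF 1(1)] and Y = S_ObjD[OF 1(2)]
  have O: "X \<in> Obj M" "W \<in> Obj M" using X X_Obj W by (auto simp: zero_object_def)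
  have a: "a = Zero M W Y1" using W 1(14) Y unfolding zero_object_def by blast
  have 2: "cp X Z2 Y2 p2 (cp X Y2 Z2 s2 b) = b" using O Z Y 1(3-15) by (simp add: C.Comp_assoc)
  show ?case using O Z Y 1(3-15) 2 a
    by (intro exI[of _ "Zero M W Z1"] exI[of _ "cp X Y2 Z2 s2 b"]) simp
qed

text \<open>For a lift \<open>b0\<close> of \<open>e\<close> to \<open>Z2\<close>, the difference between \<open>b\<close> and \<open>p2 b0\<close> is a map into \<open>Y1\<close>, the kernel of the cokernel map
  of \<open>g\<close>; it is corrected by means of the section \<open>s1\<close>.  This diagram chase is behind the projectivity of \<open>(\<Omega> X \<rightarrow> P)\<close>.\<close>

lemma correct_lift:
  assumes Z: "(Z1, Z2, h) \<in> Obj S" and Y: "(Y1, Y2, g) \<in> Obj S"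
    and p: "p1 \<in> Arr M Z1 Y1" "p2 \<in> Arr M Z2 Y2" "cp Z1 Y1 Y2 g p1 = cp Z1 Z2 Y2 p2 h"
    and s1: "s1 \<in> Arr M Y1 Z1" "cp Y1 Z1 Y1 p1 s1 = Ident M Y1"
    and d: "d \<in> Arr M (Cok (Z1, Z2, h)) (Cok (Y1, Y2, g))"
       "cp Z2 (Cok (Z1, Z2, h)) (Cok (Y1, Y2, g)) d (q (Z1, Z2, h)) = cp Z2 Y2 (Cok (Y1, Y2, g)) (q (Y1, Y2, g)) p2"
    and P: "P \<in> prj \<Lambda>" and b: "b \<in> Arr M P Y2" and e: "e \<in> Arr M P (Cok (Z1, Z2, h))"
    and de: "cp P (Cok (Z1, Z2, h)) (Cok (Y1, Y2, g)) d e = cp P Y2 (Cok (Y1, Y2, g)) (q (Y1, Y2, g)) b"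
  shows "\<exists>b'. b' \<in> Arr M P Z2 \<and> cp P Z2 (Cok (Z1, Z2, h)) (q (Z1, Z2, h)) b' = e \<and> cp P Z2 Y2 p2 b' = b"
proof -
  note Z = S_ObjD[OF Z] and Y = S_ObjD[OF Y]
  let ?DZ = "Cok (Z1, Z2, h)" and ?DY = "Cok (Y1, Y2, g)" and ?qZ = "q (Z1, Z2, h)" and ?qY = "q (Y1, Y2, g)"
  have PO: "P \<in> Obj M" using P prj_X X_Obj by simp
  obtain b0 where b0: "b0 \<in> Arr M P Z2" "cp P Z2 ?DZ ?qZ b0 = e" using prj_lift[OF P C.se_is_epi[OF Z(4)] e] by auto
  have pb: "cp P Z2 Y2 p2 b0 \<in> Arr M P Y2" using PO Z Y p b0 by simp
  obtain \<delta> where \<delta>: "\<delta> \<in> Arr M P Y2" "b = ad P Y2 (cp P Z2 Y2 p2 b0) \<delta>" using C.difference[OF PO Y(6) b pb] by auto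
  have "cp P Y2 ?DY ?qY (cp P Z2 Y2 p2 b0) = cp P ?DZ ?DY d (cp P Z2 ?DZ ?qZ b0)"
    using PO Z(5-9) Y(5-9) p(2) b0(1) d(1) by (simp add: C.Comp_assoc d(2))
  then have e1: "cp P Y2 ?DY ?qY (cp P Z2 Y2 p2 b0) = cp P Y2 ?DY ?qY b" using b0(2) de by simp
  have "ad P ?DY (cp P Y2 ?DY ?qY (cp P Z2 Y2 p2 b0)) (cp P Y2 ?DY ?qY \<delta>) = cp P Y2 ?DY ?qY b"
    unfolding \<delta>(2) using PO Y(5-9) pb \<delta>(1) by (simp add: C.Comp_add_right)
  then have z: "cp P Y2 ?DY ?qY \<delta> = Zero M P ?DY"
    using e1 PO Y(5-9) b \<delta>(1) by (intro C.add_eq_self[of P ?DY "cp P Y2 ?DY ?qY b"]) simp_all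
  obtain u where u: "u \<in> Arr M P Y1" "cp P Y1 Y2 g u = \<delta>" using C.se_lift[OF Y(4) PO \<delta>(1) z] by auto
  let ?v = "cp P Y1 Z1 s1 u"
  have v: "?v \<in> Arr M P Z1" using PO Z Y s1 u by simp
  have "cp P Z2 Y2 p2 (cp P Z1 Z2 h ?v) = cp P Y1 Y2 g (cp P Z1 Y1 p1 ?v)"
    using PO Z(5-9) Y(5-9) p(1,2) v by (simp add: C.Comp_assoc p(3))
  also have "cp P Z1 Y1 p1 ?v = u" using PO Z(5) Y(5) p(1) s1 u(1) by (simp add: C.Comp_assoc)
  finally have e2: "cp P Z2 Y2 p2 (cp P Z1 Z2 h ?v) = \<delta>" using u by simp
  have e3: "cp P Z2 ?DZ ?qZ (cp P Z1 Z2 h ?v) = Zero M P ?DZ" using PO Z(5-10) v by (simp add: C.Comp_assoc)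
  have hv: "cp P Z1 Z2 h ?v \<in> Arr M P Z2" using PO Z v by simp
  show ?thesis
  proof (intro exI[of _ "ad P Z2 b0 (cp P Z1 Z2 h ?v)"] conjI)
    show "cp P Z2 ?DZ ?qZ (ad P Z2 b0 (cp P Z1 Z2 h ?v)) = e"
      using PO Z(5-9) b0 hv e e3 by (simp add: C.Comp_add_right)
    show "cp P Z2 Y2 p2 (ad P Z2 b0 (cp P Z1 Z2 h ?v)) = b"
      using PO Z(5-9) Y(5-9) b0(1) hv e2 p(2) \<delta>(2) by (simp add: C.Comp_add_right)
  qed (use PO Z b0 hv in simp)
qed

text \<open>A morphism from \<open>(K \<rightarrow> P)\<close> induces a map of cokernels, which lifts along the section \<open>s3\<close>; as \<open>P\<close> is
  projective, this lift comes from a lift of the given morphism.\<close>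

lemma omega_projective:
  assumes se: "short_exact M K i P \<pi> X" and K: "K \<in> \<XX>" and P: "P \<in> prj \<Lambda>" and X: "X \<in> \<XX>"
  shows "projective S \<E> (K, P, i)"
proof (rule S_projectiveI[OF S_ObjI(1)[OF se K prj_X[OF P] X]], goal_cases)
  case (1 Z1 Z2 h Y1 Y2 g p1 p2 d s1 s2 s3 a b)
  note Z = S_ObjD[OF 1(1)] and Y = S_ObjD[OF 1(2)] and O = C.short_exactD[OF se]
  let ?DZ = "Cok (Z1, Z2, h)" and ?DY = "Cok (Y1, Y2, g)" and ?qZ = "q (Z1, Z2, h)" and ?qY = "q (Y1, Y2, g)"
  have "cp K P ?DY (cp P Y2 ?DY ?qY b) i = cp K Y1 ?DY (cp Y1 Y2 ?DY ?qY g) a"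
    using O(1-5) Y(5-9) 1(14,15) by (simp add: C.Comp_assoc' 1(16))
  then have z: "cp K P ?DY (cp P Y2 ?DY ?qY b) i = Zero M K ?DY" using O Y 1(14) by simp
  have qb: "cp P Y2 ?DY ?qY b \<in> Arr M P ?DY" using O Y 1(15) by simp
  obtain c where c: "c \<in> Arr M X ?DY" "cp P X ?DY c \<pi> = cp P Y2 ?DY ?qY b" using C.se_colift[OF se Y(7) qb z] by auto
  let ?e = "cp P X ?DZ (cp X ?DY ?DZ s3 c) \<pi>"
  have e: "?e \<in> Arr M P ?DZ" using O Z Y 1(12) c(1) by simp
  have "cp P ?DZ ?DY d ?e = cp P X ?DY (cp X ?DY ?DY (cp ?DY ?DZ ?DY d s3) c) \<pi>"
    using O(1-5) Z(7) Y(7) 1(10,12) c(1) by (simp add: C.Comp_assoc)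
  then have de: "cp P ?DZ ?DY d ?e = cp P Y2 ?DY ?qY b" using 1(13) c Y O by simp
  obtain b' where b': "b' \<in> Arr M P Z2" "cp P Z2 ?DZ ?qZ b' = ?e" "cp P Z2 Y2 p2 b' = b"
    using correct_lift[OF 1(1-7,10,11) P 1(15) e de] by auto
  have "cp K Z2 ?DZ ?qZ (cp K P Z2 b' i) = cp K X ?DZ (cp X ?DY ?DZ s3 c) (cp K P X \<pi> i)"
    using O(1-5) Z(5-9) Y(7) 1(12) c(1) b'(1) by (simp add: C.Comp_assoc b'(2))
  then have z': "cp K Z2 ?DZ ?qZ (cp K P Z2 b' i) = Zero M K ?DZ" using O Z Y 1(12) c by simp
  have bi: "cp K P Z2 b' i \<in> Arr M K Z2" using O Z b' by simp
  obtain a' where a': "a' \<in> Arr M K Z1" "cp K Z1 Z2 h a' = cp K P Z2 b' i" using C.se_lift[OF Z(4) O(1) bi z'] by auto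
  have "cp K Z1 Y1 p1 a' = a"
  proof (rule C.se_mono[OF Y(4) O(1)])
    have "cp K Y1 Y2 g (cp K Z1 Y1 p1 a') = cp K Z2 Y2 p2 (cp K Z1 Z2 h a')"
      using O(1-5) Z(5-9) Y(5-9) 1(3,4) a'(1) by (simp add: C.Comp_assoc 1(5))
    also have "\<dots> = cp K P Y2 (cp P Z2 Y2 p2 b') i"
      unfolding a'(2) using O(1-5) Z(5-9) Y(5-9) 1(4) b'(1) by (simp add: C.Comp_assoc)
    finally show "cp K Y1 Y2 g (cp K Z1 Y1 p1 a') = cp K Y1 Y2 g a" using b'(3) 1(16) by simp
  qed (use O Z Y 1(3,14) a' in simp_all)
  then show ?case using a' b' by auto
qed

end

section \<open>Deflations of monomorphisms\<close>

context resolving_setting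
begin

text \<open>A morphism that is a split epimorphism on all three terms is a deflation.  The kernels
  \<open>K\<^sub>1 \<rightarrow> K\<^sub>2 \<rightarrow> K\<^sub>3\<close> form a short exact sequence by a case of the \<open>3 \<times> 3\<close> lemma; that \<open>K\<^sub>2 \<rightarrow> K\<^sub>3\<close> is
  epic is seen by lifting a projective cover of \<open>K\<^sub>3\<close>.\<close>

lemma split_deflation:
  assumes Z: "(Z1, Z2, h) \<in> Obj S" and Y: "(Y1, Y2, g) \<in> Obj S"
    and p: "p1 \<in> Arr M Z1 Y1" "p2 \<in> Arr M Z2 Y2" "cp Z1 Y1 Y2 g p1 = cp Z1 Z2 Y2 p2 h"
    and s1: "s1 \<in> Arr M Y1 Z1" "cp Y1 Z1 Y1 p1 s1 = Ident M Y1"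
    and s2: "s2 \<in> Arr M Y2 Z2" "cp Y2 Z2 Y2 p2 s2 = Ident M Y2"
    and d: "d \<in> Arr M (Cok (Z1, Z2, h)) (Cok (Y1, Y2, g))"
       "cp Z2 (Cok (Z1, Z2, h)) (Cok (Y1, Y2, g)) d (q (Z1, Z2, h)) = cp Z2 Y2 (Cok (Y1, Y2, g)) (q (Y1, Y2, g)) p2"
    and s3: "s3 \<in> Arr M (Cok (Y1, Y2, g)) (Cok (Z1, Z2, h))"
       "cp (Cok (Y1, Y2, g)) (Cok (Z1, Z2, h)) (Cok (Y1, Y2, g)) d s3 = Ident M (Cok (Y1, Y2, g))"
  shows "\<exists>x i. x \<in> Obj S \<and> i \<in> Arr S x (Z1, Z2, h) \<and> \<E> x i (Z1, Z2, h) (p1, p2) (Y1, Y2, g)"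
proof -
  note ZO = Z and YO = Y
  note Z = S_ObjD[OF ZO] and Y = S_ObjD[OF YO]
  let ?DZ = "Cok (Z1, Z2, h)" and ?DY = "Cok (Y1, Y2, g)" and ?qZ = "q (Z1, Z2, h)" and ?qY = "q (Y1, Y2, g)"
  obtain K1 i1 where K1: "K1 \<in> \<XX>" "short_exact M K1 i1 Z1 p1 Y1"
    using X_kernel[OF C.split_epi[OF Z(5) Y(5) p(1) s1] Z(1) Y(1)] by auto
  obtain K2 i2 where K2: "K2 \<in> \<XX>" "short_exact M K2 i2 Z2 p2 Y2"
    using X_kernel[OF C.split_epi[OF Z(6) Y(6) p(2) s2] Z(2) Y(2)] by auto
  obtain K3 i3 where K3: "K3 \<in> \<XX>" "short_exact M K3 i3 ?DZ d ?DY"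
    using X_kernel[OF C.split_epi[OF Z(7) Y(7) d(1) s3] Z(3) Y(3)] by auto
  note O1 = C.short_exactD[OF K1(2)] and O2 = C.short_exactD[OF K2(2)] and O3 = C.short_exactD[OF K3(2)]
  have "cp K1 Z2 Y2 p2 (cp K1 Z1 Z2 h i1) = cp K1 Y1 Y2 g (cp K1 Z1 Y1 p1 i1)"
    using O1(1-5) O2(1-5) Z(8) Y(8) by (simp add: C.Comp_assoc p(3))
  then have z: "cp K1 Z2 Y2 p2 (cp K1 Z1 Z2 h i1) = Zero M K1 Y2" using O1 Y by simp
  have hi: "cp K1 Z1 Z2 h i1 \<in> Arr M K1 Z2" using O1 Z by simp
  obtain f where f: "f \<in> Arr M K1 K2" "cp K1 K2 Z2 i2 f = cp K1 Z1 Z2 h i1" using C.se_lift[OF K2(2) O1(1) hi z] by auto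
  have "cp K2 ?DZ ?DY d (cp K2 Z2 ?DZ ?qZ i2) = cp K2 Y2 ?DY ?qY (cp K2 Z2 Y2 p2 i2)"
    using O2(1-5) Z(5-9) Y(5-9) d(1) by (simp add: C.Comp_assoc d(2))
  then have z: "cp K2 ?DZ ?DY d (cp K2 Z2 ?DZ ?qZ i2) = Zero M K2 ?DY" using O2 Y by simp
  have qi: "cp K2 Z2 ?DZ ?qZ i2 \<in> Arr M K2 ?DZ" using O2 Z by simp
  obtain u where u: "u \<in> Arr M K2 K3" "cp K2 K3 ?DZ i3 u = cp K2 Z2 ?DZ ?qZ i2" using C.se_lift[OF K3(2) O2(1) qi z] by auto
  have uf: "cp K1 K2 K3 u f = Zero M K1 K3"
  proof (rule C.se_mono[OF K3(2) O1(1)])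
    have "cp K1 K3 ?DZ i3 (cp K1 K2 K3 u f) = cp K1 Z2 ?DZ ?qZ (cp K1 K2 Z2 i2 f)"
      using O1(1-5) O2(1-5) O3(1-5) Z(5-9) f(1) u(1) by (simp add: C.Comp_assoc u(2))
    also have "\<dots> = Zero M K1 ?DZ" unfolding f(2) using O1(1-5) Z(5-10) by (simp add: C.Comp_assoc)
    finally show "cp K1 K3 ?DZ i3 (cp K1 K2 K3 u f) = cp K1 K3 ?DZ i3 (Zero M K1 K3)" using O1 O3 by simp
  qed (use O1 O2 O3 f u in simp_all)
  have fm: "s = t" if "T \<in> Obj M" "s \<in> Arr M T K1" "t \<in> Arr M T K1" "cp T K1 K2 f s = cp T K1 K2 f t" for T s t
  proof (rule C.se_mono[OF K1(2) that(1-3)], rule C.se_mono[OF Z(4) that(1)])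
    have "cp T Z1 Z2 h (cp T K1 Z1 i1 r) = cp T K2 Z2 i2 (cp T K1 K2 f r)" if "r \<in> Arr M T K1" for r
      using O1(1-5) O2(1-5) Z(5-9) f(1) that \<open>T \<in> Obj M\<close> by (simp add: C.Comp_assoc f(2))
    then show "cp T Z1 Z2 h (cp T K1 Z1 i1 s) = cp T Z1 Z2 h (cp T K1 Z1 i1 t)" using that by simp
  qed (use that O1 in simp_all)
  have ker: "is_kernel M K1 f K2 u K3"
    unfolding is_kernel_def
  proof (intro conjI ballI impI)
    fix T t assume T: "T \<in> Obj M" "t \<in> Arr M T K2" "cp T K2 K3 u t = Zero M T K3"
    have it: "cp T K2 Z2 i2 t \<in> Arr M T Z2" using T O2 by simp
    have "cp T Z2 ?DZ ?qZ (cp T K2 Z2 i2 t) = cp T K3 ?DZ i3 (cp T K2 K3 u t)"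
      using O2(1-5) O3(1-5) Z(5-9) T(1,2) u(1) by (simp add: C.Comp_assoc u(2))
    then have z: "cp T Z2 ?DZ ?qZ (cp T K2 Z2 i2 t) = Zero M T ?DZ" using T O3 by simp
    obtain \<alpha> where \<alpha>: "\<alpha> \<in> Arr M T Z1" "cp T Z1 Z2 h \<alpha> = cp T K2 Z2 i2 t" using C.se_lift[OF Z(4) T(1) it z] by auto
    have "cp T Z1 Y1 p1 \<alpha> = Zero M T Y1"
    proof (rule C.se_mono[OF Y(4) T(1)])
      have "cp T Y1 Y2 g (cp T Z1 Y1 p1 \<alpha>) = cp T Z2 Y2 p2 (cp T Z1 Z2 h \<alpha>)"
        using Z(5-9) Y(5-9) p(1,2) \<alpha>(1) T(1) by (simp add: C.Comp_assoc p(3))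
      also have "\<dots> = Zero M T Y2" unfolding \<alpha>(2) using O2 T(1,2) by (simp add: C.Comp_assoc)
      finally show "cp T Y1 Y2 g (cp T Z1 Y1 p1 \<alpha>) = cp T Y1 Y2 g (Zero M T Y1)" using T Y by simp
    qed (use T Y Z p \<alpha> in simp_all)
    then obtain \<beta> where \<beta>: "\<beta> \<in> Arr M T K1" "cp T K1 Z1 i1 \<beta> = \<alpha>" using C.se_lift[OF K1(2) T(1) \<alpha>(1)] by auto
    have f\<beta>: "cp T K1 K2 f \<beta> = t"
    proof (rule C.se_mono[OF K2(2) T(1)])
      have "cp T K2 Z2 i2 (cp T K1 K2 f \<beta>) = cp T Z1 Z2 h (cp T K1 Z1 i1 \<beta>)"
        using O1(1-5) O2(1-5) Z(5-9) T(1) \<beta>(1) f(1) by (simp add: C.Comp_assoc f(2))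
      then show "cp T K2 Z2 i2 (cp T K1 K2 f \<beta>) = cp T K2 Z2 i2 t" using \<beta> \<alpha> by simp
    qed (use T O1 O2 f \<beta> in simp_all)
    show "\<exists>!s. s \<in> Arr M T K1 \<and> cp T K1 K2 f s = t"
    proof (rule ex1I[of _ \<beta>])
      show "s = \<beta>" if "s \<in> Arr M T K1 \<and> cp T K1 K2 f s = t" for s
        using fm[OF T(1), of s \<beta>] that \<beta> f\<beta> by simp
    qed (use \<beta> f\<beta> in simp)
  qed (use O1 O2 O3 f u uf in simp_all)
  have ue: "epi M K2 u K3"
  proof (rule cover_exact[OF K3(1)])
    fix W P w e assume P0: "projective_cover \<Lambda> P e K3" and P: "P \<in> prj \<Lambda>"
    have e: "epi M P e K3" using P0 by (simp add: projective_cover_def)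
    then have eO: "P \<in> Obj M" "e \<in> Arr M P K3" by (simp_all add: epi_def)
    have ie: "cp P K3 ?DZ i3 e \<in> Arr M P ?DZ" using eO O3 by simp
    have "cp P ?DZ ?DY d (cp P K3 ?DZ i3 e) = cp P Y2 ?DY ?qY (Zero M P Y2)"
      using eO O3 Y by (simp add: C.Comp_assoc)
    then obtain b where b: "b \<in> Arr M P Z2" "cp P Z2 ?DZ ?qZ b = cp P K3 ?DZ i3 e" "cp P Z2 Y2 p2 b = Zero M P Y2"
      using correct_lift[OF ZO YO p s1 d P C.zero_closed[OF eO(1) Y(6)] ie] by auto
    obtain b' where b': "b' \<in> Arr M P K2" "cp P K2 Z2 i2 b' = b" using C.se_lift[OF K2(2) eO(1) b(1,3)] by auto
    have "cp P K2 K3 u b' = e"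
    proof (rule C.se_mono[OF K3(2) eO(1)])
      have "cp P K3 ?DZ i3 (cp P K2 K3 u b') = cp P Z2 ?DZ ?qZ (cp P K2 Z2 i2 b')"
        using O2(1-5) O3(1-5) Z(5-9) eO b'(1) u(1) by (simp add: C.Comp_assoc u(2))
      then show "cp P K3 ?DZ i3 (cp P K2 K3 u b') = cp P K3 ?DZ i3 e" using b' b by simp
    qed (use O2 O3 eO b' u in simp_all)
    then show ?thesis using C.epi_factor[of P K2 K3 u b'] e b'(1) u(1) O2(1) by simp
  qed
  have se: "short_exact M K1 f K2 u K3" by (rule kernel_epi[OF ue ker])
  have XO: "(K1, K2, f) \<in> Obj S" by (rule S_ObjI(1)[OF se K1(1) K2(1) K3(1)])
  note X = S_ObjD[OF XO]
  let ?DX = "Cok (K1, K2, f)" and ?qX = "q (K1, K2, f)"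
  obtain k where k: "iso_arr M ?DX k K3" "k \<in> Arr M ?DX K3" "cp K2 ?DX K3 k ?qX = u"
    using S_ObjI(2)[OF se K1(1) K2(1) K3(1)] by auto
  let ?c = "cp ?DX K3 ?DZ i3 k"
  have c: "?c \<in> Arr M ?DX ?DZ" using k X O3 by simp
  have cq: "cp K2 ?DX ?DZ ?c ?qX = cp K2 Z2 ?DZ ?qZ i2"
    using k(2) X(5-9) O3 by (simp add: C.Comp_assoc' k(3) u(2))
  have "\<E> (K1, K2, f) (i1, i2) (Z1, Z2, h) (p1, p2) (Y1, Y2, g)"
    unfolding scw_def Let_def prod.case
  proof (intro conjI XO ZO YO)
    show "short_exact (arrow_cat M) (K1, K2, f) (i1, i2) (Z1, Z2, h) (p1, p2) (Y1, Y2, g)"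
      using C.arrow_short_exact[OF K1(2) K2(2) f(1) Z(8) Y(8)] f(2) p(3) by simp
    show "split_exact M K1 i1 Z1 p1 Y1" "split_exact M K2 i2 Z2 p2 Y2"
      unfolding split_exact_def using K1 K2 s1 s2 by blast+
    have "split_exact M ?DX ?c ?DZ d ?DY"
      unfolding split_exact_def using C.short_exact_iso_left[OF K3(2) k(1)] s3 by blast
    then show "\<exists>c\<in>Arr M ?DX ?DZ. \<exists>d\<in>Arr M ?DZ ?DY. cp K2 ?DX ?DZ c ?qX = cp K2 Z2 ?DZ ?qZ i2 \<and>
      cp Z2 ?DZ ?DY d ?qZ = cp Z2 Y2 ?DY ?qY p2 \<and> split_exact M ?DX c ?DZ d ?DY"
      using c cq d by blast
  qed
  moreover have "(i1, i2) \<in> Arr S (K1, K2, f) (Z1, Z2, h)" using O1 O2 f by simp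
  ultimately show ?thesis using XO by blast
qed

section \<open>The ideal of morphisms with stably trivial cokernel map\<close>

definition N where "N = factoring_through M (prj \<Lambda>)"

lemma N_ideal: "category_ideal M N"
  unfolding N_def
proof (rule C.factoring_through_ideal)
  obtain Z where Z: "zero_object M Z" using zero_exists by auto
  obtain P p where "projective_cover \<Lambda> P p Z" using cover[OF X_zero[OF Z]] by auto
  then have "P \<in> prj \<Lambda>" by (simp add: projective_cover_def)
  then show "prj \<Lambda> \<inter> Obj M \<noteq> {}" using prj_X X_Obj by blast
  fix A B f g assume H: "A \<in> Obj M" "B \<in> Obj M" "f \<in> factoring_through M (prj \<Lambda>) A B" "g \<in> factoring_through M (prj \<Lambda>) A B"
  show "ad A B f g \<in> factoring_through M (prj \<Lambda>) A B"
  proof (rule C.factoring_through_add[OF H])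
    fix P Q assume PQ: "P \<in> prj \<Lambda> \<inter> Obj M" "Q \<in> prj \<Lambda> \<inter> Obj M"
    then obtain T i j p r where T: "biproduct M P Q T i j p r" using X_biproduct[of P Q] prj_X by blast
    have "projective M (short_exact M) T"
      using C.projective_biproduct[OF T] PQ by (simp add: prj_def)
    then show "\<exists>B\<in>prj \<Lambda>. \<exists>i j p r. biproduct M P Q B i j p r" using T unfolding prj_def by blast
  qed
qed

end

sublocale resolving_setting \<subseteq> N: category_ideal "mod_cat \<Lambda>" N
  by (rule N_ideal)

context resolving_setting
begin

lemma NI: "\<lbrakk>P \<in> prj \<Lambda>; f \<in> Arr M A P; g \<in> Arr M P B\<rbrakk> \<Longrightarrow> cp A P B g f \<in> N A B"
  unfolding N_def using C.factoring_throughI prj_X X_Obj by blast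

lemma N_lift:
  assumes "epi M B p D" "t \<in> N T D" "T \<in> Obj M"
  shows "\<exists>s. s \<in> Arr M T B \<and> cp T B D p s = t"
proof -
  obtain P f g where P: "P \<in> prj \<Lambda>" "P \<in> Obj M" "f \<in> Arr M T P" "g \<in> Arr M P D" "t = cp T P D g f"
    using assms(2) unfolding N_def by (rule C.factoring_throughE)
  obtain s where s: "s \<in> Arr M P B" "cp P B D p s = g" using prj_lift[OF P(1) assms(1) P(4)] by auto
  have "cp T B D p (cp T P B s f) = t"
    using assms P(2-5) s by (simp add: epi_def C.Comp_assoc)
  then show ?thesis using assms P s by (intro exI[of _ "cp T P B s f"]) (simp add: epi_def)
qed

text \<open>The morphisms whose image under \<open>\<Psi>\<close> factors through a projective functor, in terms of modules.  The part
  \<open>q y \<circ> s\<close> of the cokernel map is invisible to \<open>\<Psi>\<close>; the part \<open>c\<close> gives a morphism that factors through a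
  functor presented by a monomorphism with projective target.\<close>

definition stably_trivial :: "'r hobj \<Rightarrow> 'r hobj \<Rightarrow> 'r harr set" where
  "stably_trivial x y = {ab \<in> Arr S x y. \<exists>c s. c \<in> Arr M (Cok x) (Cok y) \<and> s \<in> Arr M (Cok x) (fst (snd y)) \<and>
    cp (fst (snd x)) (Cok x) (Cok y) c (q x) \<in> N (fst (snd x)) (Cok y) \<and>
    ind x y ab = ad (Cok x) (Cok y) c (cp (Cok x) (fst (snd y)) (Cok y) (q y) s)}"

text \<open>For the identity of \<open>(X = X)\<close> the cokernel is zero, for \<open>(0 \<rightarrow> X)\<close> the map onto the cokernel is invertible,
  and for \<open>(\<Omega> X \<rightarrow> P)\<close> it starts at a projective module.\<close>

lemma V_cases:
  assumes "v \<in> \<V>"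
  shows "v \<in> Obj S \<and> projective S \<E> v \<and> Ident S v \<in> stably_trivial v v"
proof -
  consider (id) X where "X \<in> \<XX>" "v = (X, X, Ident M X)"
    | (zero) Z X where "zero_object M Z" "X \<in> \<XX>" "v = (Z, X, Zero M Z X)"
    | (omega) K P i X p where "X \<in> \<XX>" "projective_cover \<Lambda> P p X" "is_kernel M K i P p X" "v = (K, P, i)"
    using assms unfolding V_objects_def by blast
  then show ?thesis
  proof cases
    case id
    note O = X_id_object(1)[OF id(1)]
    note X = S_ObjD[OF O]
    have "q v = Zero M X (Cok v)" using X id by simp
    moreover have "cp X (Cok v) (Cok v) (Ident M (Cok v)) (q v) = q v" using X id(2) by simp
    ultimately have "cp X (Cok v) (Cok v) (Ident M (Cok v)) (q v) \<in> N X (Cok v)" using N.I_zero X id(2) by simp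
    then have "Ident S v \<in> stably_trivial v v"
      unfolding stably_trivial_def
      using preadditive_category.Ident_closed[OF S_preadditive, of v] O X id(2) induced_Ident[OF O]
      by (intro CollectI conjI exI[of _ "Ident M (Cok v)"] exI[of _ "Zero M (Cok v) X"]) simp_all
    then show ?thesis using O id_projective[OF id(1)] id(2) by simp
  next
    case zero
    note O = X_zero_object(2)[OF zero(2,1)]
    note X = S_ObjD[OF O]
    obtain k where k: "iso_arr M (Cok v) k X" "k \<in> Arr M (Cok v) X" "cp X (Cok v) X k (q v) = Ident M X"
      using S_ObjI(2)[OF X_zero_object(1)[OF zero(2,1)] X_zero[OF zero(1)] zero(2,2)] zero(3) by auto
    note X' = X[folded zero(3)]
    have "cp X (Cok v) (Cok v) (cp (Cok v) X (Cok v) (q v) k) (q v) = cp X (Cok v) (Cok v) (Ident M (Cok v)) (q v)"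
      using X'(5-9) k by (simp add: C.Comp_assoc')
    then have qk: "cp (Cok v) X (Cok v) (q v) k = Ident M (Cok v)"
      by (rule C.se_epi[OF X'(4) X'(7), rotated 2]) (use X' k in simp_all)
    have "cp X (Cok v) (Cok v) (Zero M (Cok v) (Cok v)) (q v) \<in> N X (Cok v)" using N.I_zero X zero(3) by simp
    then have "Ident S v \<in> stably_trivial v v"
      unfolding stably_trivial_def
      using preadditive_category.Ident_closed[OF S_preadditive, of v] O X zero(3) induced_Ident[OF O] k qk
      by (intro CollectI conjI exI[of _ "Zero M (Cok v) (Cok v)"] exI[of _ k]) simp_all
    then show ?thesis using O zero_projective[OF zero(2,1)] zero(3) by simp
  next
    case omega
    have P: "P \<in> prj \<Lambda>" "epi M P p X" using omega(2) by (simp_all add: projective_cover_def)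
    have se: "short_exact M K i P p X" by (rule kernel_epi[OF P(2) omega(3)])
    obtain K' i' where K': "K' \<in> \<XX>" "short_exact M K' i' P p X" using X_kernel[OF P(2) prj_X[OF P(1)] omega(1)] by auto
    note D = C.short_exactD[OF se] and D' = C.short_exactD[OF K'(2)]
    obtain a where a: "a \<in> Arr M K' K" "cp K' K P i a = i'" using C.se_lift[OF se D'(1,4,6)] by auto
    obtain b where b: "b \<in> Arr M K K'" "cp K K' P i' b = i" using C.se_lift[OF K'(2) D(1,4,6)] by auto
    have "cp K K' K a b = Ident M K"
      by (rule C.se_mono[OF se D(1)]) (use a b D D' in \<open>simp_all add: C.Comp_assoc\<close>)
    moreover have "cp K' K K' b a = Ident M K'"
      by (rule C.se_mono[OF K'(2) D'(1)]) (use a b D D' in \<open>simp_all add: C.Comp_assoc\<close>)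
    ultimately have "iso_arr M K' a K" using a b D D' by (auto simp: iso_arr_def)
    then have K: "K \<in> \<XX>" using X_iso K'(1) by blast
    note O = S_ObjI(1)[OF se K prj_X[OF P(1)] omega(1)]
    note X = S_ObjD[OF O]
    have "cp P P (Cok v) (q v) (Ident M P) \<in> N P (Cok v)" using X omega(4) by (intro NI P) simp_all
    then have "cp P (Cok v) (Cok v) (Ident M (Cok v)) (q v) \<in> N P (Cok v)" using X omega(4) by simp
    then have "Ident S v \<in> stably_trivial v v"
      unfolding stably_trivial_def
      using preadditive_category.Ident_closed[OF S_preadditive, of v] O X omega(4) induced_Ident[OF O]
      by (intro CollectI conjI exI[of _ "Ident M (Cok v)"] exI[of _ "Zero M (Cok v) P"]) simp_all
    then show ?thesis using O omega_projective[OF se K P(1) omega(1)] omega(4) by simp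
  qed
qed

text \<open>A stably trivial morphism \<open>x \<rightarrow> y\<close> factors through the direct sum of \<open>(\<Omega> D' \<rightarrow> P)\<close>, \<open>(0 \<rightarrow> D)\<close> and
  \<open>(B = B)\<close>, where \<open>D\<close> and \<open>D'\<close> are the cokernels and \<open>B\<close> is the middle term of \<open>x\<close>.  The first summand takes
  care of the part of the cokernel map that factors through a projective module, the second of the
  part that factors through \<open>B' \<rightarrow> D'\<close>, and the third of what is then left.\<close>

lemma stably_trivial_decomposition:
  assumes x: "x \<in> Obj S" and y: "y \<in> Obj S" and ab: "ab \<in> stably_trivial x y"
  shows "\<exists>v g h. (\<forall>k<3. v k \<in> \<V> \<and> h k \<in> Arr S x (v k) \<and> g k \<in> Arr S (v k) y) \<and>
    ab = finprod (Hom S x y) (\<lambda>k. Comp S x (v k) y (g k) (h k)) {..<3::nat}"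
proof -
  obtain A B f where xx: "x = (A, B, f)" "(A, B, f) \<in> Obj S" using S_ObjE[OF x] by metis
  obtain A' B' f' where yy: "y = (A', B', f')" "(A', B', f') \<in> Obj S" using S_ObjE[OF y] by metis
  obtain a b where abp: "ab = (a, b)" by (metis surj_pair)
  note X = S_ObjD[OF xx(2)] and Y = S_ObjD[OF yy(2)]
  let ?D = "Cok (A, B, f)" and ?D' = "Cok (A', B', f')" and ?p = "q (A, B, f)" and ?p' = "q (A', B', f')"
  have abA: "(a, b) \<in> Arr S (A, B, f) (A', B', f')" using ab by (simp add: stably_trivial_def xx yy abp)
  then have H: "a \<in> Arr M A A'" "b \<in> Arr M B B'" "cp A A' B' f' a = cp A B B' b f" by simp_all
  obtain c s where c: "c \<in> Arr M ?D ?D'" "s \<in> Arr M ?D B'" "cp B ?D ?D' c ?p \<in> N B ?D'"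
    "ind (A, B, f) (A', B', f') (a, b) = ad ?D ?D' c (cp ?D B' ?D' ?p' s)"
    using ab by (auto simp: stably_trivial_def xx yy abp)
  obtain K P i \<pi> where om: "projective_cover \<Lambda> P \<pi> ?D'" "short_exact M K i P \<pi> ?D'" "K \<in> \<XX>" "P \<in> \<XX>" "P \<in> prj \<Lambda>"
    "(K, P, i) \<in> \<V>" using cover_exact[OF Y(3)] .
  note W = C.short_exactD[OF om(2)]
  obtain k where k: "k \<in> Arr M B P" "cp B P ?D' \<pi> k = cp B ?D ?D' c ?p"
    using N_lift[OF C.se_is_epi[OF om(2)] c(3) X(6)] by auto
  obtain l where l: "l \<in> Arr M P B'" "cp P B' ?D' ?p' l = \<pi>" using prj_lift[OF om(5) C.se_is_epi[OF Y(4)] W(5)] by auto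
  have "cp A P ?D' \<pi> (cp A B P k f) = cp A ?D ?D' c (cp A B ?D ?p f)"
    using X(5-9) Y(5-9) W(1-5) k(1) c(1) by (simp add: C.Comp_assoc k(2))
  then have z: "cp A P ?D' \<pi> (cp A B P k f) = Zero M A ?D'" using X Y c by simp
  have kf: "cp A B P k f \<in> Arr M A P" using X W k by simp
  obtain a1 where a1: "a1 \<in> Arr M A K" "cp A K P i a1 = cp A B P k f" using C.se_lift[OF om(2) X(5) kf z] by auto
  have "cp K B' ?D' ?p' (cp K P B' l i) = cp K P ?D' \<pi> i" using Y(5-9) W(1-5) l(1) by (simp add: C.Comp_assoc l(2))
  then have z: "cp K B' ?D' ?p' (cp K P B' l i) = Zero M K ?D'" using W by simp
  have li: "cp K P B' l i \<in> Arr M K B'" using W Y l by simp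
  obtain w where w: "w \<in> Arr M K A'" "cp K A' B' f' w = cp K P B' l i" using C.se_lift[OF Y(4) W(1) li z] by auto
  let ?lk = "cp B P B' l k" and ?sp = "cp B ?D B' s ?p"
  have b1: "ad B B' ?lk ?sp \<in> Arr M B B'" using X Y W k l c by simp
  obtain \<delta> where \<delta>: "\<delta> \<in> Arr M B B'" "b = ad B B' (ad B B' ?lk ?sp) \<delta>" using C.difference[OF X(6) Y(6) H(2) b1] by auto
  have e1: "cp B B' ?D' ?p' (ad B B' ?lk ?sp) = ad B ?D' (cp B ?D ?D' c ?p) (cp B B' ?D' ?p' ?sp)"
  proof -
    have "cp B B' ?D' ?p' ?lk = cp B P ?D' \<pi> k" using X(5-9) Y(5-9) W(1-5) k(1) l(1) by (simp add: C.Comp_assoc l(2))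
    then show ?thesis using X(5-9) Y(5-9) W(1-5) k l(1) c(1,2) by (simp add: C.Comp_add_right)
  qed
  have e2: "cp B B' ?D' ?p' b = ad B ?D' (cp B ?D ?D' c ?p) (cp B B' ?D' ?p' ?sp)"
    using induced(2)[OF xx(2) yy(2) abA] X(5-9) Y(5-9) c(1,2) by (simp add: c(4) C.Comp_add_left C.Comp_assoc)
  have s1: "ad B ?D' (cp B B' ?D' ?p' (ad B B' ?lk ?sp)) (cp B B' ?D' ?p' \<delta>) = cp B B' ?D' ?p' b"
    using \<delta> b1 X(6) Y(5-9) by (simp add: C.Comp_add_right)
  have z: "cp B B' ?D' ?p' \<delta> = Zero M B ?D'"
  proof (intro C.add_eq_self[of B ?D' "cp B B' ?D' ?p' b"])
    have "cp B B' ?D' ?p' (ad B B' ?lk ?sp) = cp B B' ?D' ?p' b" using e1 e2 by simp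
    then show "ad B ?D' (cp B B' ?D' ?p' b) (cp B B' ?D' ?p' \<delta>) = cp B B' ?D' ?p' b" using s1 by simp
  qed (use X(6) Y(5-9) H(2) \<delta>(1) in simp_all)
  obtain t where t: "t \<in> Arr M B A'" "cp B A' B' f' t = \<delta>" using C.se_lift[OF Y(4) X(6) \<delta>(1) z] by auto
  obtain Z where Z: "zero_object M Z" using zero_exists by auto
  then have ZO: "Z \<in> Obj M" by (simp add: zero_object_def)
  have aeq: "a = ad A A' (ad A A' (cp A K A' w a1) (Zero M A A')) (cp A B A' t f)"
  proof (rule C.se_mono[OF Y(4) X(5)])
    have 1: "cp A A' B' f' (cp A K A' w a1) = cp A B B' ?lk f"
    proof -
      have "cp A A' B' f' (cp A K A' w a1) = cp A P B' l (cp A K P i a1)"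
        using X(5-9) Y(5-9) W(1-5) w(1) a1(1) l(1) by (simp add: C.Comp_assoc w(2))
      then show ?thesis unfolding a1(2) using X(5-9) Y(5-9) W(1-5) k(1) l(1) by (simp add: C.Comp_assoc)
    qed
    have 2: "cp A B B' ?sp f = Zero M A B'" using X(5-10) Y(5-9) c(2) by (simp add: C.Comp_assoc')
    have 3: "cp A A' B' f' (cp A B A' t f) = cp A B B' \<delta> f" using X(5-9) Y(5-9) t by (simp add: C.Comp_assoc)
    have "cp A A' B' f' a = ad A B' (ad A B' (cp A B B' ?lk f) (cp A B B' ?sp f)) (cp A B B' \<delta> f)"
      unfolding H(3) \<delta>(2) using X(5-9) Y(5-9) W(1-5) k(1) l(1) c(2) \<delta>(1) by (simp add: C.Comp_add_left)
    also have "\<dots> = cp A A' B' f' (ad A A' (ad A A' (cp A K A' w a1) (Zero M A A')) (cp A B A' t f))"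
      unfolding 2 1[symmetric] 3[symmetric] using X(5-9) Y(5-9) W(1-5) w(1) a1(1) t(1) by (simp add: C.Comp_add_right)
    finally show "cp A A' B' f' a = cp A A' B' f' (ad A A' (ad A A' (cp A K A' w a1) (Zero M A A')) (cp A B A' t f))" .
  qed (use X Y W w a1 t H in simp_all)
  define v where "v n = (if n = 0 then (K, P, i) else if n = 1 then (Z, ?D, Zero M Z ?D) else (B, B, Ident M B))" for n :: nat
  define h where "h n = (if n = 0 then (a1, k) else if n = 1 then (Zero M A Z, ?p) else (f, Ident M B))" for n :: nat
  define g where "g n = (if n = 0 then (w, l) else if n = 1 then (Zero M Z A', s) else (t, cp B A' B' f' t))" for n :: nat
  have vV: "v n \<in> \<V>" for n
    using om(6) X_zero_object(3)[OF X(3) Z] X_id_object(2)[OF X(2)] by (simp add: v_def)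
  have hA: "h n \<in> Arr S x (v n)" for n
    using X a1 k ZO by (simp add: h_def v_def xx)
  have gA: "g n \<in> Arr S (v n) y" for n
    using Y X W w l c ZO t \<delta>(1) by (simp add: g_def v_def yy)
  interpret S: preadditive_category S by (rule S_preadditive)
  have vS: "v n \<in> Obj S" for n using V_cases[OF vV[of n]] by simp
  have cl: "Comp S x (v n) y (g n) (h n) \<in> Arr S x y" for n
    by (rule S.Comp_closed[OF x vS y hA gA])
  have three: "{..<3::nat} = {..<Suc (Suc (Suc 0))}" by (simp add: numeral_3_eq_3)
  have "finprod (Hom S x y) (\<lambda>k. Comp S x (v k) y (g k) (h k)) {..<3::nat}
     = Comp S x (v 0) y (g 0) (h 0) \<otimes>\<^bsub>Hom S x y\<^esub> Comp S x (v 1) y (g 1) (h 1) \<otimes>\<^bsub>Hom S x y\<^esub> Comp S x (v 2) y (g 2) (h 2)"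
    unfolding three using cl x y
    by (simp only: S.finprod_Arr_Suc comm_monoid.finprod_empty[OF S.Hom_comm_monoid[OF x y]] lessThan_0 S.zero_add One_nat_def numeral_2_eq_2)
  also have "\<dots> = (a, b)"
    using aeq \<delta> t(2) ZO X(5,6) Y(5,6) by (simp add: g_def h_def v_def xx yy)
  finally show ?thesis using vV hA gA abp by (intro exI[of _ v] exI[of _ g] exI[of _ h]) simp
qed

end

section \<open>The functors presented by monomorphisms\<close>

text \<open>The images of the elements of a coset all lie in one coset, so the union collapses.\<close>

lemma coset_union:
  assumes G: "comm_group G" and H: "comm_group H" and f: "f \<in> hom G H"
    and K: "subgroup K G" and L: "subgroup L H" and KL: "\<And>k. k \<in> K \<Longrightarrow> f k \<in> L" and x: "x \<in> carrier G"
  shows "(\<Union>s\<in>K #>\<^bsub>G\<^esub> x. L #>\<^bsub>H\<^esub> f s) = L #>\<^bsub>H\<^esub> f x"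
proof -
  interpret G: comm_group G by fact
  interpret H: comm_group H by fact
  have "L #>\<^bsub>H\<^esub> f s = L #>\<^bsub>H\<^esub> f x" if s: "s \<in> K #>\<^bsub>G\<^esub> x" for s
  proof -
    have sG: "s \<in> carrier G" and sx: "K #>\<^bsub>G\<^esub> s = K #>\<^bsub>G\<^esub> x" using G.coset_mem_iff[OF K x s] by simp_all
    then obtain k where k: "k \<in> K" "s = x \<otimes>\<^bsub>G\<^esub> k" using G.coset_eq_iff[OF K sG x] by auto
    then have "f s = f x \<otimes>\<^bsub>H\<^esub> f k" using f x subgroup.mem_carrier[OF K k(1)] by (simp add: hom_def)
    then have "\<exists>h\<in>L. f s = f x \<otimes>\<^bsub>H\<^esub> h" using KL[OF k(1)] by blast
    then show ?thesis using H.coset_eq_iff[OF L, of "f s" "f x"] f sG x by (auto simp: hom_def)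
  qed
  moreover have "x \<in> K #>\<^bsub>G\<^esub> x" using G.rcos_self[OF x K] .
  ultimately show ?thesis by blast
qed

text \<open>The inverses of the components are natural again.\<close>

lemma fp_cat_iso:
  assumes F: "finitely_presented C F" and G: "finitely_presented C G"
    and e: "\<eta> \<in> Arr (fp_cat C) F G"
    and bij: "\<And>T. T \<in> Obj C \<Longrightarrow> bij_betw (\<eta> T) (carrier (FObj F T)) (carrier (FObj G T))"
  shows "iso_arr (fp_cat C) F \<eta> G"
proof -
  let ?i = "\<lambda>T. inv_into (carrier (FObj F T)) (\<eta> T)"
  let ?\<theta> = "\<lambda>T\<in>Obj C. \<lambda>x\<in>carrier (FObj G T). ?i T x"
  have gF: "comm_group (FObj F T)" and gG: "comm_group (FObj G T)" if "T \<in> Obj C" for T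
    using additive_functor.FObj_closed[OF finitely_presented_functor[OF F], of T]
      additive_functor.FObj_closed[OF finitely_presented_functor[OF G], of T] that by simp_all
  have aF: "FArr F T T' u \<in> hom (FObj F T) (FObj F T') \<inter> extensional (carrier (FObj F T))"
    and aG: "FArr G T T' u \<in> hom (FObj G T) (FObj G T') \<inter> extensional (carrier (FObj G T))"
    if "T \<in> Obj C" "T' \<in> Obj C" "u \<in> Arr C T' T" for T T' u
    using additive_functor.FArr_closed[OF finitely_presented_functor[OF F], of T T' u]
      additive_functor.FArr_closed[OF finitely_presented_functor[OF G], of T T' u] that by simp_all
  have h: "\<eta> T \<in> hom (FObj F T) (FObj G T)" if "T \<in> Obj C" for T
    using e that by (auto simp: fp_cat_Arr)
  have nat: "\<eta> T' (FArr F T T' u x) = FArr G T T' u (\<eta> T x)"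
    if "T \<in> Obj C" "T' \<in> Obj C" "u \<in> Arr C T' T" "x \<in> carrier (FObj F T)" for T T' u x
  proof -
    have "compose (carrier (FObj F T)) (\<eta> T') (FArr F T T' u) = compose (carrier (FObj F T)) (FArr G T T' u) (\<eta> T)"
      using e that by (simp add: fp_cat_Arr)
    from fun_cong[OF this, of x] show ?thesis using that by (simp add: compose_def)
  qed
  have i: "?i T y \<in> carrier (FObj F T)" "\<eta> T (?i T y) = y" if "T \<in> Obj C" "y \<in> carrier (FObj G T)" for T y
    using bij[OF that(1)] that(2) by (simp_all add: bij_betw_def inv_into_into f_inv_into_f)
  have i': "?i T (\<eta> T x) = x" if "T \<in> Obj C" "x \<in> carrier (FObj F T)" for T x
    using bij[OF that(1)] that(2) by (simp add: bij_betw_def)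
  have ih: "?i T (x \<otimes>\<^bsub>FObj G T\<^esub> y) = ?i T x \<otimes>\<^bsub>FObj F T\<^esub> ?i T y"
    if T: "T \<in> Obj C" and xy: "x \<in> carrier (FObj G T)" "y \<in> carrier (FObj G T)" for T x y
  proof -
    have "x \<otimes>\<^bsub>FObj G T\<^esub> y = \<eta> T (?i T x \<otimes>\<^bsub>FObj F T\<^esub> ?i T y)"
      using h[OF T] i[OF T xy(1)] i[OF T xy(2)] by (simp add: hom_def)
    moreover have "?i T x \<otimes>\<^bsub>FObj F T\<^esub> ?i T y \<in> carrier (FObj F T)"
      using gF[OF T] i[OF T xy(1)] i[OF T xy(2)] by (simp add: comm_group_def comm_monoid_def monoid.m_closed)
    ultimately show ?thesis using i'[OF T] by simp
  qed
  have ia: "?i T' (FArr G T T' u y) = FArr F T T' u (?i T y)"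
    if T: "T \<in> Obj C" "T' \<in> Obj C" "u \<in> Arr C T' T" and y: "y \<in> carrier (FObj G T)" for T T' u y
  proof -
    have "FArr G T T' u y = \<eta> T' (FArr F T T' u (?i T y))" using nat[OF T i(1)[OF T(1) y]] i(2)[OF T(1) y] by simp
    moreover have "FArr F T T' u (?i T y) \<in> carrier (FObj F T')" using aF[OF T] i(1)[OF T(1) y] by (auto simp: hom_def)
    ultimately show ?thesis using i'[OF T(2)] by simp
  qed
  have aGc: "FArr G T T' u y \<in> carrier (FObj G T')" if "T \<in> Obj C" "T' \<in> Obj C" "u \<in> Arr C T' T" "y \<in> carrier (FObj G T)" for T T' u y
    using aG[OF that(1-3)] that(4) by (auto simp: hom_def)
  have gGm: "x \<otimes>\<^bsub>FObj G T\<^esub> y \<in> carrier (FObj G T)" if "T \<in> Obj C" "x \<in> carrier (FObj G T)" "y \<in> carrier (FObj G T)" for T x y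
    using gG[OF that(1)] that(2,3) by (simp add: comm_group_def comm_monoid_def monoid.m_closed)
  have "?\<theta> \<in> Arr (fp_cat C) G F"
    unfolding fp_cat_Arr
  proof (intro CollectI conjI ballI)
    show "?\<theta> T \<in> Arr ab_cat (FObj G T) (FObj F T)" if "T \<in> Obj C" for T
      using that i(1)[OF that] ih[OF that] gGm[OF that] by (simp add: hom_def)
    show "Comp ab_cat (FObj G T) (FObj G T') (FObj F T') (?\<theta> T') (FArr G T T' u) =
        Comp ab_cat (FObj G T) (FObj F T) (FObj F T') (FArr F T T' u) (?\<theta> T)"
      if T: "T \<in> Obj C" "T' \<in> Obj C" "u \<in> Arr C T' T" for T T' u
      using T ia[OF T] aGc[OF T] by (simp add: compose_def cong: restrict_cong)
  qed simp
  moreover have "Comp (fp_cat C) F G F ?\<theta> \<eta> = Ident (fp_cat C) F"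
  proof -
    have "\<eta> T x \<in> carrier (FObj G T)" if "T \<in> Obj C" "x \<in> carrier (FObj F T)" for T x
      using h[OF that(1)] that(2) by (auto simp: hom_def)
    then show ?thesis using i' by (simp add: compose_def cong: restrict_cong)
  qed
  moreover have "Comp (fp_cat C) G F G \<eta> ?\<theta> = Ident (fp_cat C) G"
    using i by (simp add: compose_def cong: restrict_cong)
  ultimately show ?thesis
    unfolding iso_arr_def by (intro conjI bexI[of _ ?\<theta>]) (use F G e in \<open>simp_all only: fp_cat_simps mem_Collect_eq\<close>)
qed

context resolving_setting
begin

abbreviation St where "St \<equiv> stable_X_cat \<Lambda> \<XX>"
abbreviation FP where "FP \<equiv> fp_cat (stable_X_cat \<Lambda> \<XX>)"
abbreviation Mid where "Mid x \<equiv> fst (snd x)"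

lemma X_cat_Obj [simp]: "Obj (X_cat \<Lambda> \<XX>) = \<XX>"
  using X_Obj by (auto simp: X_cat_def)

lemma St_eq: "St = full_subcat (factor_cat M N) \<XX>"
  by (simp add: stable_X_cat_def X_cat_def N_def factor_cat_def full_subcat_def)

lemma St_simps [simp]:
  "Obj St = \<XX>" "Hom St = Hom (factor_cat M N)" "Comp St = Comp (factor_cat M N)" "Ident St = Ident (factor_cat M N)"
  using X_Obj by (auto simp: St_eq)

lemma St_preadditive: "preadditive_category St"
  unfolding St_eq by (rule preadditive_category.full_subcat_preadditive[OF N.factor_preadditive])

lemma SD:
  assumes "x \<in> Obj S"
  shows "Mid x \<in> \<XX>" "Cok x \<in> \<XX>" "Mid x \<in> Obj M" "Cok x \<in> Obj M" "q x \<in> Arr M (Mid x) (Cok x)" "epi M (Mid x) (q x) (Cok x)"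
proof -
  obtain A B f where xx: "x = (A, B, f)" "(A, B, f) \<in> Obj S" using S_ObjE[OF assms] by metis
  show "Mid x \<in> \<XX>" "Cok x \<in> \<XX>" "Mid x \<in> Obj M" "Cok x \<in> Obj M" "q x \<in> Arr M (Mid x) (Cok x)" "epi M (Mid x) (q x) (Cok x)"
    using S_ObjD[OF xx(2)] C.se_is_epi[OF S_ObjD(4)[OF xx(2)]] by (simp_all add: xx(1))
qed

lemma psi_image_eq: "psi_image \<Lambda> x T = cp T (Mid x) (Cok x) (q x) ` Arr M T (Mid x)"
  by (simp add: psi_image_def Let_def)

lemma psi_sub:
  assumes "x \<in> Obj S" "T \<in> Obj M" shows "subgroup (psi_image \<Lambda> x T) (Hom M T (Cok x))"
proof -
  note X = SD[OF assms(1)]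
  have "group_hom (Hom M T (Mid x)) (Hom M T (Cok x)) (cp T (Mid x) (Cok x) (q x))"
    using C.hom_group[OF assms(2)] C.Comp_hom_right[OF assms(2) X(3,4,5)] X
    by (simp add: group_hom_def group_hom_axioms_def)
  from group_hom.img_is_subgroup[OF this] show ?thesis by (simp add: psi_image_eq)
qed

abbreviation pc where "pc x T s \<equiv> psi_image \<Lambda> x T #>\<^bsub>Hom (mod_cat \<Lambda>) T (cok_obj (mod_cat \<Lambda>) x)\<^esub> s"

lemma pc_eq_iff:
  assumes "x \<in> Obj S" "T \<in> Obj M" "s \<in> Arr M T (Cok x)" "s' \<in> Arr M T (Cok x)"
  shows "pc x T s = pc x T s' \<longleftrightarrow> (\<exists>b. b \<in> Arr M T (Mid x) \<and> s = ad T (Cok x) s' (cp T (Mid x) (Cok x) (q x) b))"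
  using comm_group.coset_eq_iff[OF C.Hom_comm_group[OF assms(2) SD(4)[OF assms(1)]] psi_sub[OF assms(1,2)] assms(3,4)]
  by (auto simp: psi_image_eq)

lemma pc_zero_iff:
  assumes "x \<in> Obj S" "T \<in> Obj M" "s \<in> Arr M T (Cok x)"
  shows "pc x T s = psi_image \<Lambda> x T \<longleftrightarrow> (\<exists>b. b \<in> Arr M T (Mid x) \<and> cp T (Mid x) (Cok x) (q x) b = s)"
  using comm_group.coset_zero[OF C.Hom_comm_group[OF assms(2) SD(4)[OF assms(1)]] psi_sub[OF assms(1,2)] assms(3)]
  by (auto simp: psi_image_eq)

lemma psi_group_simps:
  "carrier (pg x T) = pc x T ` Arr M T (Cok x)" "\<one>\<^bsub>pg x T\<^esub> = psi_image \<Lambda> x T"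
  by (simp_all add: psi_group_def carrier_Mod Let_def)

lemma psi_group_mult:
  assumes "x \<in> Obj S" "T \<in> Obj M" "s \<in> Arr M T (Cok x)" "s' \<in> Arr M T (Cok x)"
  shows "pc x T s \<otimes>\<^bsub>pg x T\<^esub> pc x T s' = pc x T (ad T (Cok x) s s')"
  using comm_group.Mod_mult[OF C.Hom_comm_group[OF assms(2) SD(4)[OF assms(1)]] psi_sub[OF assms(1,2)] assms(3,4)]
  by (simp add: psi_group_def)

lemma psi_group_comm: "x \<in> Obj S \<Longrightarrow> T \<in> Obj M \<Longrightarrow> comm_group (pg x T)"
  unfolding psi_group_def by (intro comm_group.abelian_Mod C.Hom_comm_group psi_sub SD(4))

lemma psi_FObj [simp]: "FObj (descend (psi_obj \<Lambda> x)) T = pg x T"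
  by (simp add: descend_def psi_obj_def Let_def)

text \<open>As maps in \<open>N\<close> lift along the epimorphism \<open>q x\<close>, they act as zero on the functor, which is therefore
  defined on stable morphisms.\<close>

lemma pc_N:
  assumes x: "x \<in> Obj S" and T: "T \<in> Obj M" and s: "s \<in> Arr M T (Cok x)" and n: "n \<in> N T (Cok x)"
  shows "pc x T (ad T (Cok x) s n) = pc x T s"
proof -
  note X = SD[OF x]
  obtain b where b: "b \<in> Arr M T (Mid x)" "cp T (Mid x) (Cok x) (q x) b = n" using N_lift[OF X(6) n T] by auto
  have "n \<in> Arr M T (Cok x)" by (rule N.I_Arr[OF T X(4) n])
  then show ?thesis using pc_eq_iff[OF x T, of "ad T (Cok x) s n" s] s b T X by auto
qed

lemma psi_FArr:
  assumes x: "x \<in> Obj S" and T: "T \<in> \<XX>" "T' \<in> \<XX>" and u: "u \<in> Arr M T' T" and s: "s \<in> Arr M T (Cok x)"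
  shows "FArr (descend (psi_obj \<Lambda> x)) T T' (N.cls T' T u) (pc x T s) = pc x T' (cp T' T (Cok x) s u)"
proof -
  note X = SD[OF x]
  have O: "T \<in> Obj M" "T' \<in> Obj M" using T X_Obj by simp_all
  define u0 where "u0 = (SOME v. v \<in> N.cls T' T u)"
  have u0: "u0 \<in> Arr M T' T" "N.cls T' T u0 = N.cls T' T u" using N.cls_some[OF O(2,1) u] by (simp_all add: u0_def)
  then obtain n where n: "n \<in> N T' T" "u0 = ad T' T u n" using N.cls_eq_iff[OF O(2,1) u0(1) u] by auto
  have "FArr (descend (psi_obj \<Lambda> x)) T T' (N.cls T' T u) (pc x T s) = (\<Union>s'\<in>pc x T s. pc x T' (cp T' T (Cok x) s' u0))"
    using s by (simp add: descend_def psi_obj_def Let_def u0_def psi_group_simps)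
  also have "\<dots> = pc x T' (cp T' T (Cok x) s u0)"
  proof (rule coset_union[OF C.Hom_comm_group[OF O(1) X(4)] C.Hom_comm_group[OF O(2) X(4)]
        C.Comp_hom_left[OF O(2,1) X(4) u0(1)] psi_sub[OF x O(1)] psi_sub[OF x O(2)] _ s])
    fix k assume "k \<in> psi_image \<Lambda> x T"
    then obtain b where b: "b \<in> Arr M T (Mid x)" "k = cp T (Mid x) (Cok x) (q x) b" by (auto simp: psi_image_eq)
    have "cp T' T (Cok x) k u0 = cp T' (Mid x) (Cok x) (q x) (cp T' T (Mid x) b u0)"
      unfolding b(2) using O X b u0 by (simp add: C.Comp_assoc)
    then show "cp T' T (Cok x) k u0 \<in> psi_image \<Lambda> x T'" using O X b u0 by (simp add: psi_image_eq)
  qed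
  also have "cp T' T (Cok x) s u0 = ad T' (Cok x) (cp T' T (Cok x) s u) (cp T' T (Cok x) s n)"
    unfolding n(2) using O X s u N.I_Arr[OF O(2,1) n(1)] by (simp add: C.Comp_add_right)
  also have "pc x T' \<dots> = pc x T' (cp T' T (Cok x) s u)"
    using O X s u N.I_Comp_left[OF O(2,1) X(4) n(1) s] by (intro pc_N[OF x O(2)]) simp_all
  finally show ?thesis .
qed

lemma psi_FArr_ext: "FArr (descend (psi_obj \<Lambda> x)) T T' U \<in> extensional (carrier (pg x T))"
  by (simp add: descend_def psi_obj_def Let_def)

lemma psi_FArr_hom:
  assumes x: "x \<in> Obj S" and T: "T \<in> \<XX>" "T' \<in> \<XX>" and u: "u \<in> Arr M T' T"
  shows "FArr (descend (psi_obj \<Lambda> x)) T T' (N.cls T' T u) \<in> hom (pg x T) (pg x T')"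
proof -
  note X = SD[OF x]
  have O: "T \<in> Obj M" "T' \<in> Obj M" using T X_Obj by simp_all
  show ?thesis
  proof (rule homI)
    fix c assume "c \<in> carrier (pg x T)"
    then obtain s where s: "s \<in> Arr M T (Cok x)" "c = pc x T s" by (auto simp: psi_group_simps)
    show "FArr (descend (psi_obj \<Lambda> x)) T T' (N.cls T' T u) c \<in> carrier (pg x T')"
      unfolding s(2) psi_FArr[OF x T u s(1)] using s u O X by (simp add: psi_group_simps)
    fix c' assume "c' \<in> carrier (pg x T)"
    then obtain s' where s': "s' \<in> Arr M T (Cok x)" "c' = pc x T s'" by (auto simp: psi_group_simps)
    have ss: "ad T (Cok x) s s' \<in> Arr M T (Cok x)" using s s' O X by simp
    show "FArr (descend (psi_obj \<Lambda> x)) T T' (N.cls T' T u) (c \<otimes>\<^bsub>pg x T\<^esub> c') =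
      FArr (descend (psi_obj \<Lambda> x)) T T' (N.cls T' T u) c \<otimes>\<^bsub>pg x T'\<^esub> FArr (descend (psi_obj \<Lambda> x)) T T' (N.cls T' T u) c'"
      unfolding s(2) s'(2) psi_group_mult[OF x O(1) s(1) s'(1)] psi_FArr[OF x T u s(1)] psi_FArr[OF x T u s'(1)] psi_FArr[OF x T u ss]
      using O X u s(1) s'(1) by (simp add: psi_group_mult[OF x O(2)] C.Comp_add_left)
  qed
qed

lemma psi_functor:
  assumes x: "x \<in> Obj S"
  shows "additive_functor (op_cat St) ab_cat (descend (psi_obj \<Lambda> x))"
proof (intro additive_functor.intro additive_functor_axioms.intro
    preadditive_category.op_cat_preadditive[OF St_preadditive] ab_cat_preadditive)
  let ?F = "descend (psi_obj \<Lambda> x)"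
  note X = SD[OF x]
  fix T assume "T \<in> Obj (op_cat St)"
  then have T: "T \<in> \<XX>" "T \<in> Obj M" using X_Obj by simp_all
  show "FObj ?F T \<in> Obj ab_cat" using psi_group_comm[OF x T(2)] by simp
  have "FArr ?F T T (N.cls T T (Ident M T)) = (\<lambda>c\<in>carrier (pg x T). c)"
  proof (rule extensionalityI[OF psi_FArr_ext restrict_extensional])
    fix c assume "c \<in> carrier (pg x T)"
    then obtain s where s: "s \<in> Arr M T (Cok x)" "c = pc x T s" by (auto simp: psi_group_simps)
    show "FArr ?F T T (N.cls T T (Ident M T)) c = (\<lambda>c\<in>carrier (pg x T). c) c"
      using psi_FArr[OF x T(1,1) C.Ident_closed[OF T(2)] s(1)] s T X by (simp add: psi_group_simps)
  qed
  then show "FArr ?F T T (Ident (op_cat St) T) = Ident ab_cat (FObj ?F T)" by simp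
  fix T' assume "T' \<in> Obj (op_cat St)"
  then have T': "T' \<in> \<XX>" "T' \<in> Obj M" using X_Obj by simp_all
  show "FArr ?F T T' \<in> hom (Hom (op_cat St) T T') (Hom ab_cat (FObj ?F T) (FObj ?F T'))"
  proof (rule homI)
    fix U assume "U \<in> Arr (op_cat St) T T'"
    then obtain u where u: "u \<in> Arr M T' T" "U = N.cls T' T u" by auto
    show "FArr ?F T T' U \<in> Arr ab_cat (FObj ?F T) (FObj ?F T')"
      using psi_FArr_hom[OF x T(1) T'(1) u(1)] psi_FArr_ext by (simp add: u(2))
    fix V assume "V \<in> Arr (op_cat St) T T'"
    then obtain v where v: "v \<in> Arr M T' T" "V = N.cls T' T v" by auto
    have uv: "ad T' T u v \<in> Arr M T' T" using u v T T' by simp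
    have "FArr ?F T T' (N.cls T' T (ad T' T u v)) = (\<lambda>c\<in>carrier (pg x T). FArr ?F T T' U c \<otimes>\<^bsub>pg x T'\<^esub> FArr ?F T T' V c)"
    proof (rule extensionalityI[OF psi_FArr_ext restrict_extensional])
      fix c assume c: "c \<in> carrier (pg x T)"
      then obtain s where s: "s \<in> Arr M T (Cok x)" "c = pc x T s" by (auto simp: psi_group_simps)
      have "FArr ?F T T' (N.cls T' T (ad T' T u v)) c = FArr ?F T T' U c \<otimes>\<^bsub>pg x T'\<^esub> FArr ?F T T' V c"
        unfolding u(2) v(2) s(2) psi_FArr[OF x T(1) T'(1) u(1) s(1)] psi_FArr[OF x T(1) T'(1) v(1) s(1)] psi_FArr[OF x T(1) T'(1) uv s(1)]
        using T T' X u(1) v(1) s(1) by (simp add: psi_group_mult[OF x T'(2)] C.Comp_add_right)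
      then show "FArr ?F T T' (N.cls T' T (ad T' T u v)) c = (\<lambda>c\<in>carrier (pg x T). FArr ?F T T' U c \<otimes>\<^bsub>pg x T'\<^esub> FArr ?F T T' V c) c"
        using c by simp
    qed
    then show "FArr ?F T T' (U \<otimes>\<^bsub>Hom (op_cat St) T T'\<^esub> V) = FArr ?F T T' U \<otimes>\<^bsub>Hom ab_cat (FObj ?F T) (FObj ?F T')\<^esub> FArr ?F T T' V"
      using u v T T' by simp
  qed
  fix T'' U V assume "T'' \<in> Obj (op_cat St)" "U \<in> Arr (op_cat St) T T'" "V \<in> Arr (op_cat St) T' T''"
  then obtain u v where T'': "T'' \<in> \<XX>" "T'' \<in> Obj M" and u: "u \<in> Arr M T' T" "U = N.cls T' T u" and v: "v \<in> Arr M T'' T'" "V = N.cls T'' T' v"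
    using X_Obj by auto
  have uv: "cp T'' T' T u v \<in> Arr M T'' T" using u v T T' T'' by simp
  have "FArr ?F T T'' (N.cls T'' T (cp T'' T' T u v)) = compose (carrier (pg x T)) (FArr ?F T' T'' V) (FArr ?F T T' U)"
  proof (rule extensionalityI[OF psi_FArr_ext compose_extensional])
    fix c assume c: "c \<in> carrier (pg x T)"
    then obtain s where s: "s \<in> Arr M T (Cok x)" "c = pc x T s" by (auto simp: psi_group_simps)
    have su: "cp T' T (Cok x) s u \<in> Arr M T' (Cok x)" using s u T T' X by simp
    have "FArr ?F T T'' (N.cls T'' T (cp T'' T' T u v)) c = FArr ?F T' T'' V (FArr ?F T T' U c)"
      unfolding u(2) v(2) s(2) psi_FArr[OF x T(1) T'(1) u(1) s(1)] psi_FArr[OF x T'(1) T''(1) v(1) su] psi_FArr[OF x T(1) T''(1) uv s(1)]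
      using T T' T'' X u(1) v(1) s(1) by (simp add: C.Comp_assoc)
    then show "FArr ?F T T'' (N.cls T'' T (cp T'' T' T u v)) c = compose (carrier (pg x T)) (FArr ?F T' T'' V) (FArr ?F T T' U) c"
      using c by (simp add: compose_def)
  qed
  then show "FArr ?F T T'' (Comp (op_cat St) T T' T'' V U) = Comp ab_cat (FObj ?F T) (FObj ?F T') (FObj ?F T'') (FArr ?F T' T'' V) (FArr ?F T T' U)"
    using u v T T' T'' by simp
qed

text \<open>Over the stable category \<open>(-, B) \<rightarrow> (-, Cok x)\<close> still presents the functor: the maps in \<open>N\<close>
  that are divided out lift along \<open>q x\<close>.\<close>

lemma psi_finitely_presented:
  assumes x: "x \<in> Obj S"
  shows "finitely_presented St (descend (psi_obj \<Lambda> x))"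
  unfolding finitely_presented_def
proof (intro conjI psi_functor[OF x])
  let ?F = "descend (psi_obj \<Lambda> x)"
  note X = SD[OF x]
  let ?D = "Cok x" and ?B = "Mid x" and ?f = "N.cls (Mid x) (Cok x) (q x)"
  define \<pi> where "\<pi> T U = pc x T (SOME u. u \<in> U)" for T U
  have \<pi>: "\<pi> T (N.cls T ?D s) = pc x T s" if T: "T \<in> \<XX>" and s: "s \<in> Arr M T ?D" for T s
  proof -
    have O: "T \<in> Obj M" using T X_Obj by simp
    let ?u = "SOME v. v \<in> N.cls T ?D s"
    have u: "?u \<in> Arr M T ?D" "N.cls T ?D ?u = N.cls T ?D s" using N.cls_some[OF O X(4) s] by simp_all
    obtain n where "n \<in> N T ?D" "?u = ad T ?D s n" using N.cls_eq_iff[OF O X(4) u(1) s] u(2) by auto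
    then show ?thesis using pc_N[OF x O s] by (simp add: \<pi>_def)
  qed
  have "?f \<in> Arr St ?B ?D" using X by simp
  moreover have "(\<forall>T\<in>Obj St. \<pi> T \<in> hom (Hom St T ?D) (FObj ?F T) \<and> \<pi> T ` Arr St T ?D = carrier (FObj ?F T) \<and>
        kernel (Hom St T ?D) (FObj ?F T) (\<pi> T) = (\<lambda>s. Comp St T ?B ?D ?f s) ` Arr St T ?B)"
  proof (intro ballI conjI)
    fix T assume "T \<in> Obj St"
    then have T: "T \<in> \<XX>" "T \<in> Obj M" using X_Obj by simp_all
    show "\<pi> T \<in> hom (Hom St T ?D) (FObj ?F T)"
    proof (rule homI)
      fix U assume "U \<in> Arr St T ?D"
      then obtain u where u: "u \<in> Arr M T ?D" "U = N.cls T ?D u" by auto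
      show "\<pi> T U \<in> carrier (FObj ?F T)" using u \<pi>[OF T(1) u(1)] by (simp add: psi_group_simps)
      fix V assume "V \<in> Arr St T ?D"
      then obtain v where v: "v \<in> Arr M T ?D" "V = N.cls T ?D v" by auto
      have uv: "ad T ?D u v \<in> Arr M T ?D" using u v T X by simp
      show "\<pi> T (U \<otimes>\<^bsub>Hom St T ?D\<^esub> V) = \<pi> T U \<otimes>\<^bsub>FObj ?F T\<^esub> \<pi> T V"
        using u v T X \<pi>[OF T(1) u(1)] \<pi>[OF T(1) v(1)] \<pi>[OF T(1) uv] by (simp add: psi_group_mult[OF x T(2) u(1) v(1)])
    qed
    show "\<pi> T ` Arr St T ?D = carrier (FObj ?F T)"
      using \<pi>[OF T(1)] by (simp add: psi_group_simps image_image)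
    show "kernel (Hom St T ?D) (FObj ?F T) (\<pi> T) = (\<lambda>s. Comp St T ?B ?D ?f s) ` Arr St T ?B"
    proof (rule Set.set_eqI)
      fix U
      have "U \<in> kernel (Hom St T ?D) (FObj ?F T) (\<pi> T) \<longleftrightarrow> (\<exists>u. u \<in> Arr M T ?D \<and> U = N.cls T ?D u \<and> pc x T u = psi_image \<Lambda> x T)"
        using \<pi>[OF T(1)] by (auto simp: kernel_def psi_group_simps)
      also have "\<dots> \<longleftrightarrow> (\<exists>b. b \<in> Arr M T ?B \<and> U = N.cls T ?D (cp T ?B ?D (q x) b))"
        using pc_zero_iff[OF x T(2)] T X by (metis C.Comp_closed)
      also have "\<dots> \<longleftrightarrow> U \<in> (\<lambda>s. Comp St T ?B ?D ?f s) ` Arr St T ?B"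
        using T X by (auto simp: image_image)
      finally show "U \<in> kernel (Hom St T ?D) (FObj ?F T) (\<pi> T) \<longleftrightarrow> U \<in> (\<lambda>s. Comp St T ?B ?D ?f s) ` Arr St T ?B" .
    qed
  qed
  moreover have "(\<forall>T\<in>Obj St. \<forall>T'\<in>Obj St. \<forall>u\<in>Arr St T' T. \<forall>s\<in>Arr St T ?D.
        \<pi> T' (Comp St T' T ?D s u) = FArr ?F T T' u (\<pi> T s))"
  proof (intro ballI)
    fix T T' U V assume "T \<in> Obj St" "T' \<in> Obj St" "U \<in> Arr St T' T" "V \<in> Arr St T ?D"
    then obtain u s where T: "T \<in> \<XX>" "T \<in> Obj M" "T' \<in> \<XX>" "T' \<in> Obj M" and u: "u \<in> Arr M T' T" "U = N.cls T' T u"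
      and s: "s \<in> Arr M T ?D" "V = N.cls T ?D s" using X_Obj by auto
    have su: "cp T' T ?D s u \<in> Arr M T' ?D" using s u T X by simp
    show "\<pi> T' (Comp St T' T ?D V U) = FArr ?F T T' U (\<pi> T V)"
      using \<pi>[OF T(1) s(1)] \<pi>[OF T(3) su] psi_FArr[OF x T(1,3) u(1) s(1)] T X u s by simp
  qed
  ultimately show "\<exists>A\<in>Obj St. \<exists>B\<in>Obj St. \<exists>f\<in>Arr St A B. \<exists>\<pi>.
      (\<forall>T\<in>Obj St. \<pi> T \<in> hom (Hom St T B) (FObj ?F T) \<and> \<pi> T ` Arr St T B = carrier (FObj ?F T) \<and>
        kernel (Hom St T B) (FObj ?F T) (\<pi> T) = (\<lambda>s. Comp St T A B f s) ` Arr St T A) \<and>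
      (\<forall>T\<in>Obj St. \<forall>T'\<in>Obj St. \<forall>u\<in>Arr St T' T. \<forall>s\<in>Arr St T B. \<pi> T' (Comp St T' T B s u) = FArr ?F T T' u (\<pi> T s))"
    using X(1,2) St_simps(1) by (intro bexI[of _ ?B] bexI[of _ ?D] bexI[of _ ?f] exI[of _ \<pi>] conjI) simp_all
qed

end

section \<open>Natural transformations between presented functors\<close>

declare fp_cat_simps [simp del]

sublocale resolving_setting \<subseteq> FP: preadditive_category "fp_cat (stable_X_cat \<Lambda> \<XX>) :: ('r sfun, 'r snat) precat"
  by (rule fp_cat_preadditive)

context resolving_setting
begin

definition psi_map :: "'r hobj \<Rightarrow> 'r hobj \<Rightarrow> 'r fmap \<Rightarrow> 'r snat" where
  "psi_map x y c = (\<lambda>T\<in>\<XX>. \<lambda>K\<in>carrier (pg x T). \<Union>s\<in>K. pc y T (cp T (Cok x) (Cok y) c s))"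

text \<open>The maps of cokernels that are induced by morphisms of monomorphisms; only these induce natural
  transformations.\<close>

definition liftable :: "'r hobj \<Rightarrow> 'r hobj \<Rightarrow> 'r fmap \<Rightarrow> bool" where
  "liftable x y c \<longleftrightarrow> c \<in> Arr M (Cok x) (Cok y) \<and>
    (\<exists>b. b \<in> Arr M (Mid x) (Mid y) \<and> cp (Mid x) (Cok x) (Cok y) c (q x) = cp (Mid x) (Mid y) (Cok y) (q y) b)"

abbreviation Fun :: "'r hobj \<Rightarrow> 'r sfun" where "Fun x \<equiv> descend (psi_obj \<Lambda> x)"

lemma Psi_simps: "FObj \<Psi> x = Fun x" "FArr \<Psi> x y ab = psi_map x y (ind x y ab)"
  by (simp_all add: Psi_def psi_map_def Let_def)

lemma Fun_Obj [simp]: "x \<in> Obj S \<Longrightarrow> Fun x \<in> Obj FP"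
  by (simp add: fp_cat_simps psi_finitely_presented)

lemma psi_map_eval:
  assumes x: "x \<in> Obj S" and y: "y \<in> Obj S" and c: "liftable x y c" and T: "T \<in> \<XX>" and s: "s \<in> Arr M T (Cok x)"
  shows "psi_map x y c T (pc x T s) = pc y T (cp T (Cok x) (Cok y) c s)"
proof -
  note X = SD[OF x] and Y = SD[OF y]
  have O: "T \<in> Obj M" using T X_Obj by simp
  obtain b where b: "c \<in> Arr M (Cok x) (Cok y)" "b \<in> Arr M (Mid x) (Mid y)"
    "cp (Mid x) (Cok x) (Cok y) c (q x) = cp (Mid x) (Mid y) (Cok y) (q y) b" using c by (auto simp: liftable_def)
  have "psi_map x y c T (pc x T s) = (\<Union>s'\<in>pc x T s. pc y T (cp T (Cok x) (Cok y) c s'))"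
    using T s by (simp add: psi_map_def psi_group_simps)
  also have "\<dots> = pc y T (cp T (Cok x) (Cok y) c s)"
  proof (rule coset_union[OF C.Hom_comm_group[OF O X(4)] C.Hom_comm_group[OF O Y(4)]
        C.Comp_hom_right[OF O X(4) Y(4) b(1)] psi_sub[OF x O] psi_sub[OF y O] _ s])
    fix k assume "k \<in> psi_image \<Lambda> x T"
    then obtain a where a: "a \<in> Arr M T (Mid x)" "k = cp T (Mid x) (Cok x) (q x) a" by (auto simp: psi_image_eq)
    have "cp T (Cok x) (Cok y) c k = cp T (Mid y) (Cok y) (q y) (cp T (Mid x) (Mid y) b a)"
      unfolding a(2) using O X Y a(1) b(1,2) by (simp add: C.Comp_assoc b(3))
    then show "cp T (Cok x) (Cok y) c k \<in> psi_image \<Lambda> y T" using O X Y a b by (simp add: psi_image_eq)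
  qed
  finally show ?thesis .
qed

lemma FP_D:
  assumes "\<theta> \<in> Arr FP F G"
  shows "\<theta> \<in> extensional \<XX>" "T \<in> \<XX> \<Longrightarrow> \<theta> T \<in> hom (FObj F T) (FObj G T)" "T \<in> \<XX> \<Longrightarrow> \<theta> T \<in> extensional (carrier (FObj F T))"
  using assms by (simp_all add: fp_cat_Arr)

lemma FP_nat:
  assumes "\<theta> \<in> Arr FP F G" "T \<in> \<XX>" "T' \<in> \<XX>" "u \<in> Arr M T' T" "k \<in> carrier (FObj F T)"
  shows "\<theta> T' (FArr F T T' (N.cls T' T u) k) = FArr G T T' (N.cls T' T u) (\<theta> T k)"
proof -
  have "N.cls T' T u \<in> Arr St T' T" using assms(4) by simp
  then have "compose (carrier (FObj F T)) (\<theta> T') (FArr F T T' (N.cls T' T u)) = compose (carrier (FObj F T)) (FArr G T T' (N.cls T' T u)) (\<theta> T)"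
    using assms(1-3) unfolding fp_cat_Arr by (simp del: St_simps(2) add: ball_simps)
  from fun_cong[OF this, of k] show ?thesis using assms(5) by (simp add: compose_def)
qed

lemma Fun_ext:
  assumes "\<theta> \<in> Arr FP (Fun x) G" "\<theta>' \<in> Arr FP (Fun x) G'"
    and eq: "\<And>T s. T \<in> \<XX> \<Longrightarrow> s \<in> Arr M T (Cok x) \<Longrightarrow> \<theta> T (pc x T s) = \<theta>' T (pc x T s)"
  shows "\<theta> = \<theta>'"
proof (rule extensionalityI[OF FP_D(1)[OF assms(1)] FP_D(1)[OF assms(2)]])
  fix T assume T: "T \<in> \<XX>"
  show "\<theta> T = \<theta>' T"
  proof (rule extensionalityI[of _ "carrier (pg x T)"])
    show "\<theta> T \<in> extensional (carrier (pg x T))" "\<theta>' T \<in> extensional (carrier (pg x T))"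
      using FP_D(3)[OF assms(1) T] FP_D(3)[OF assms(2) T] by simp_all
    fix k assume "k \<in> carrier (pg x T)"
    then show "\<theta> T k = \<theta>' T k" using eq[OF T] by (auto simp: psi_group_simps)
  qed
qed

lemma psi_map_Arr:
  assumes x: "x \<in> Obj S" and y: "y \<in> Obj S" and c: "liftable x y c"
  shows "psi_map x y c \<in> Arr FP (Fun x) (Fun y)"
  unfolding fp_cat_Arr
proof (intro CollectI conjI ballI)
  note X = SD[OF x] and Y = SD[OF y] and ev = psi_map_eval[OF x y c]
  have cA: "c \<in> Arr M (Cok x) (Cok y)" using c by (simp add: liftable_def)
  show "psi_map x y c \<in> extensional (Obj St)" by (simp add: psi_map_def)
  fix T assume "T \<in> Obj St"
  then have T: "T \<in> \<XX>" "T \<in> Obj M" using X_Obj by simp_all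
  have ext: "psi_map x y c T \<in> extensional (carrier (pg x T))" using T by (simp add: psi_map_def)
  have "psi_map x y c T \<in> hom (pg x T) (pg y T)"
  proof (rule homI)
    fix k assume "k \<in> carrier (pg x T)"
    then obtain s where s: "s \<in> Arr M T (Cok x)" "k = pc x T s" by (auto simp: psi_group_simps)
    show "psi_map x y c T k \<in> carrier (pg y T)" unfolding s(2) ev[OF T(1) s(1)] using T X Y cA s by (simp add: psi_group_simps)
    fix k' assume "k' \<in> carrier (pg x T)"
    then obtain s' where s': "s' \<in> Arr M T (Cok x)" "k' = pc x T s'" by (auto simp: psi_group_simps)
    have ss: "ad T (Cok x) s s' \<in> Arr M T (Cok x)" using s s' T X by simp
    show "psi_map x y c T (k \<otimes>\<^bsub>pg x T\<^esub> k') = psi_map x y c T k \<otimes>\<^bsub>pg y T\<^esub> psi_map x y c T k'"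
      unfolding s(2) s'(2) psi_group_mult[OF x T(2) s(1) s'(1)] ev[OF T(1) s(1)] ev[OF T(1) s'(1)] ev[OF T(1) ss]
      using T X Y cA s(1) s'(1) by (simp add: psi_group_mult[OF y T(2)] C.Comp_add_right)
  qed
  then show "psi_map x y c T \<in> Arr ab_cat (FObj (Fun x) T) (FObj (Fun y) T)" using ext by simp
  fix T' U assume "T' \<in> Obj St" "U \<in> Arr St T' T"
  then obtain u where T': "T' \<in> \<XX>" "T' \<in> Obj M" and u: "u \<in> Arr M T' T" "U = N.cls T' T u" using X_Obj by auto
  have "compose (carrier (pg x T)) (psi_map x y c T') (FArr (Fun x) T T' U)
      = compose (carrier (pg x T)) (FArr (Fun y) T T' U) (psi_map x y c T)"
  proof (rule extensionalityI[OF compose_extensional compose_extensional])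
    fix k assume k: "k \<in> carrier (pg x T)"
    then obtain s where s: "s \<in> Arr M T (Cok x)" "k = pc x T s" by (auto simp: psi_group_simps)
    have su: "cp T' T (Cok x) s u \<in> Arr M T' (Cok x)" and cs: "cp T (Cok x) (Cok y) c s \<in> Arr M T (Cok y)"
      using s u cA T T' X Y by simp_all
    have "psi_map x y c T' (FArr (Fun x) T T' U k) = FArr (Fun y) T T' U (psi_map x y c T k)"
      unfolding u(2) s(2) psi_FArr[OF x T(1) T'(1) u(1) s(1)] ev[OF T(1) s(1)] ev[OF T'(1) su] psi_FArr[OF y T(1) T'(1) u(1) cs]
      using T T' X Y s(1) u(1) cA by (simp add: C.Comp_assoc)
    then show "compose (carrier (pg x T)) (psi_map x y c T') (FArr (Fun x) T T' U) k
      = compose (carrier (pg x T)) (FArr (Fun y) T T' U) (psi_map x y c T) k"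
      using k by (simp add: compose_def)
  qed
  then show "Comp ab_cat (FObj (Fun x) T) (FObj (Fun x) T') (FObj (Fun y) T') (psi_map x y c T') (FArr (Fun x) T T' U)
      = Comp ab_cat (FObj (Fun x) T) (FObj (Fun y) T) (FObj (Fun y) T') (FArr (Fun y) T T' U) (psi_map x y c T)" by simp
qed

text \<open>Yoneda: a natural transformation is determined by a representative \<open>c\<close> of the image of the class of the
  identity of \<open>Cok x\<close>, and \<open>c\<close> is liftable because the class of \<open>q x\<close> is zero.\<close>

lemma psi_map_full:
  assumes x: "x \<in> Obj S" and y: "y \<in> Obj S" and th: "\<theta> \<in> Arr FP (Fun x) (Fun y)"
  shows "\<exists>c. liftable x y c \<and> \<theta> = psi_map x y c"
proof -
  note X = SD[OF x] and Y = SD[OF y]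
  let ?D = "Cok x" and ?e = "pc x (Cok x) (Ident M (Cok x))"
  have e: "?e \<in> carrier (pg x ?D)" using X by (simp add: psi_group_simps)
  have "\<theta> ?D ?e \<in> carrier (pg y ?D)" using FP_D(2)[OF th X(2)] e by (auto simp: hom_def)
  then obtain c where c: "c \<in> Arr M ?D (Cok y)" "\<theta> ?D ?e = pc y ?D c" by (auto simp: psi_group_simps)
  have ev: "\<theta> T (pc x T s) = pc y T (cp T ?D (Cok y) c s)" if T: "T \<in> \<XX>" and s: "s \<in> Arr M T ?D" for T s
  proof -
    have TO: "T \<in> Obj M" using T X_Obj by simp
    have "pc x T s = FArr (Fun x) ?D T (N.cls T ?D s) ?e"
      using psi_FArr[OF x X(2) T s C.Ident_closed[OF X(4)]] s TO X by simp
    then have "\<theta> T (pc x T s) = FArr (Fun y) ?D T (N.cls T ?D s) (\<theta> ?D ?e)"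
      using FP_nat[OF th X(2) T s, of ?e] e by simp
    then show ?thesis unfolding c(2) using psi_FArr[OF y X(2) T s c(1)] by simp
  qed
  have "pc x (Mid x) (q x) = psi_image \<Lambda> x (Mid x)"
    using pc_zero_iff[OF x X(3,5)] X by (auto intro!: exI[of _ "Ident M (Mid x)"])
  moreover have "\<theta> (Mid x) \<one>\<^bsub>pg x (Mid x)\<^esub> = \<one>\<^bsub>pg y (Mid x)\<^esub>"
    using hom_one[OF FP_D(2)[OF th X(1)]] psi_group_comm[OF x X(3)] psi_group_comm[OF y X(3)] by (simp add: comm_group_def)
  ultimately have "pc y (Mid x) (cp (Mid x) ?D (Cok y) c (q x)) = psi_image \<Lambda> y (Mid x)"
    using ev[OF X(1,5)] by (simp add: psi_group_simps)
  then obtain b where "b \<in> Arr M (Mid x) (Mid y)" "cp (Mid x) (Mid y) (Cok y) (q y) b = cp (Mid x) ?D (Cok y) c (q x)"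
    using pc_zero_iff[OF y X(3), of "cp (Mid x) ?D (Cok y) c (q x)"] c(1) X Y by auto
  then have ad: "liftable x y c" using c(1) by (auto simp: liftable_def)
  have "\<theta> = psi_map x y c"
    by (rule Fun_ext[OF th psi_map_Arr[OF x y ad]]) (simp add: ev psi_map_eval[OF x y ad])
  then show ?thesis using ad by blast
qed

text \<open>The forward direction evaluates both transformations at the identity of \<open>Cok x\<close>.\<close>

lemma psi_map_eq_iff:
  assumes x: "x \<in> Obj S" and y: "y \<in> Obj S" and c: "liftable x y c" and c': "liftable x y c'"
  shows "psi_map x y c = psi_map x y c' \<longleftrightarrow>
    (\<exists>s. s \<in> Arr M (Cok x) (Mid y) \<and> c = ad (Cok x) (Cok y) c' (cp (Cok x) (Mid y) (Cok y) (q y) s))"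
proof -
  note X = SD[OF x] and Y = SD[OF y]
  have cA: "c \<in> Arr M (Cok x) (Cok y)" "c' \<in> Arr M (Cok x) (Cok y)" using c c' by (simp_all add: liftable_def)
  show ?thesis
  proof
    assume "psi_map x y c = psi_map x y c'"
    then have "pc y (Cok x) c = pc y (Cok x) c'"
      using psi_map_eval[OF x y c X(2) C.Ident_closed[OF X(4)]] psi_map_eval[OF x y c' X(2) C.Ident_closed[OF X(4)]] cA X Y by simp
    then show "\<exists>s. s \<in> Arr M (Cok x) (Mid y) \<and> c = ad (Cok x) (Cok y) c' (cp (Cok x) (Mid y) (Cok y) (q y) s)"
      using pc_eq_iff[OF y X(4) cA] by simp
  next
    assume "\<exists>s. s \<in> Arr M (Cok x) (Mid y) \<and> c = ad (Cok x) (Cok y) c' (cp (Cok x) (Mid y) (Cok y) (q y) s)"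
    then obtain s where s: "s \<in> Arr M (Cok x) (Mid y)" "c = ad (Cok x) (Cok y) c' (cp (Cok x) (Mid y) (Cok y) (q y) s)" by auto
    show "psi_map x y c = psi_map x y c'"
    proof (rule Fun_ext[OF psi_map_Arr[OF x y c] psi_map_Arr[OF x y c']])
      fix T t assume T: "T \<in> \<XX>" and t: "t \<in> Arr M T (Cok x)"
      have TO: "T \<in> Obj M" using T X_Obj by simp
      have "cp T (Cok x) (Cok y) c t = ad T (Cok y) (cp T (Cok x) (Cok y) c' t) (cp T (Mid y) (Cok y) (q y) (cp T (Cok x) (Mid y) s t))"
        unfolding s(2) using TO X Y t s(1) cA(2) by (simp add: C.Comp_add_left C.Comp_assoc)
      then have "pc y T (cp T (Cok x) (Cok y) c t) = pc y T (cp T (Cok x) (Cok y) c' t)"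
        by (intro iffD2[OF pc_eq_iff[OF y TO]] exI[of _ "cp T (Cok x) (Mid y) s t"] conjI)
          (use TO X Y t s(1) cA in simp_all)
      then show "psi_map x y c T (pc x T t) = psi_map x y c' T (pc x T t)"
        by (simp add: psi_map_eval[OF x y c T t] psi_map_eval[OF x y c' T t])
    qed
  qed
qed

lemma liftable_comp:
  assumes x: "x \<in> Obj S" and y: "y \<in> Obj S" and z: "z \<in> Obj S" and c: "liftable x y c" and d: "liftable y z d"
  shows "liftable x z (cp (Cok x) (Cok y) (Cok z) d c)"
proof -
  note X = SD[OF x] and Y = SD[OF y] and Z = SD[OF z]
  obtain b where b: "c \<in> Arr M (Cok x) (Cok y)" "b \<in> Arr M (Mid x) (Mid y)"
    "cp (Mid x) (Cok x) (Cok y) c (q x) = cp (Mid x) (Mid y) (Cok y) (q y) b" using c by (auto simp: liftable_def)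
  obtain a where a: "d \<in> Arr M (Cok y) (Cok z)" "a \<in> Arr M (Mid y) (Mid z)"
    "cp (Mid y) (Cok y) (Cok z) d (q y) = cp (Mid y) (Mid z) (Cok z) (q z) a" using d by (auto simp: liftable_def)
  have "cp (Mid x) (Cok x) (Cok z) (cp (Cok x) (Cok y) (Cok z) d c) (q x) = cp (Mid x) (Cok y) (Cok z) d (cp (Mid x) (Mid y) (Cok y) (q y) b)"
    unfolding b(3)[symmetric] using X Y Z a(1) b(1) by (simp add: C.Comp_assoc)
  also have "\<dots> = cp (Mid x) (Mid z) (Cok z) (q z) (cp (Mid x) (Mid y) (Mid z) a b)"
    using X Y Z a(1,2) b(1,2) by (simp add: C.Comp_assoc a(3))
  finally show ?thesis unfolding liftable_def using X Y Z a b by (auto intro!: exI[of _ "cp (Mid x) (Mid y) (Mid z) a b"])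
qed

lemma liftable_add:
  assumes x: "x \<in> Obj S" and y: "y \<in> Obj S" and c: "liftable x y c" and d: "liftable x y d"
  shows "liftable x y (ad (Cok x) (Cok y) c d)"
proof -
  note X = SD[OF x] and Y = SD[OF y]
  obtain b where b: "c \<in> Arr M (Cok x) (Cok y)" "b \<in> Arr M (Mid x) (Mid y)"
    "cp (Mid x) (Cok x) (Cok y) c (q x) = cp (Mid x) (Mid y) (Cok y) (q y) b" using c by (auto simp: liftable_def)
  obtain a where a: "d \<in> Arr M (Cok x) (Cok y)" "a \<in> Arr M (Mid x) (Mid y)"
    "cp (Mid x) (Cok x) (Cok y) d (q x) = cp (Mid x) (Mid y) (Cok y) (q y) a" using d by (auto simp: liftable_def)
  show ?thesis unfolding liftable_def using X Y a b
    by (intro conjI exI[of _ "ad (Mid x) (Mid y) b a"]) (simp_all add: C.Comp_add_left C.Comp_add_right)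
qed

lemma liftable_Ident: "x \<in> Obj S \<Longrightarrow> liftable x x (Ident M (Cok x))"
  unfolding liftable_def by (intro conjI exI[of _ "Ident M (Mid x)"]) (use SD[of x] in simp_all)

lemma liftable_N:
  assumes x: "x \<in> Obj S" and y: "y \<in> Obj S" and c: "c \<in> Arr M (Cok x) (Cok y)"
    and n: "cp (Mid x) (Cok x) (Cok y) c (q x) \<in> N (Mid x) (Cok y)"
  shows "liftable x y c"
  using N_lift[OF SD(6)[OF y] n SD(3)[OF x]] c unfolding liftable_def by metis

lemma liftable_zero:
  assumes "x \<in> Obj S" "y \<in> Obj S" shows "liftable x y (Zero M (Cok x) (Cok y))"
  by (rule liftable_N[OF assms]) (use SD[OF assms(1)] SD[OF assms(2)] N.I_zero in simp_all)

lemma psi_map_Comp: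
  assumes x: "x \<in> Obj S" and y: "y \<in> Obj S" and z: "z \<in> Obj S" and c: "liftable x y c" and d: "liftable y z d"
  shows "Comp FP (Fun x) (Fun y) (Fun z) (psi_map y z d) (psi_map x y c) = psi_map x z (cp (Cok x) (Cok y) (Cok z) d c)"
proof (rule Fun_ext[OF FP.Comp_closed[OF Fun_Obj[OF x] Fun_Obj[OF y] Fun_Obj[OF z] psi_map_Arr[OF x y c] psi_map_Arr[OF y z d]]
      psi_map_Arr[OF x z liftable_comp[OF x y z c d]]])
  fix T s assume T: "T \<in> \<XX>" and s: "s \<in> Arr M T (Cok x)"
  have cA: "c \<in> Arr M (Cok x) (Cok y)" "d \<in> Arr M (Cok y) (Cok z)" using c d by (simp_all add: liftable_def)
  have TO: "T \<in> Obj M" using T X_Obj by simp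
  have cs: "cp T (Cok x) (Cok y) c s \<in> Arr M T (Cok y)" using TO s cA SD[OF x] SD[OF y] by simp
  have k: "pc x T s \<in> carrier (pg x T)" using s by (simp add: psi_group_simps)
  show "Comp FP (Fun x) (Fun y) (Fun z) (psi_map y z d) (psi_map x y c) T (pc x T s) = psi_map x z (cp (Cok x) (Cok y) (Cok z) d c) T (pc x T s)"
    using T TO k s cA SD[OF x] SD[OF y] SD[OF z]
    by (simp add: fp_cat_simps compose_def psi_map_eval[OF x y c T s] psi_map_eval[OF y z d T cs]
        psi_map_eval[OF x z liftable_comp[OF x y z c d] T s] C.Comp_assoc)
qed

lemma psi_map_Ident:
  assumes x: "x \<in> Obj S" shows "psi_map x x (Ident M (Cok x)) = Ident FP (Fun x)"
proof (rule Fun_ext[OF psi_map_Arr[OF x x liftable_Ident[OF x]] FP.Ident_closed[OF Fun_Obj[OF x]]])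
  fix T s assume T: "T \<in> \<XX>" and s: "s \<in> Arr M T (Cok x)"
  have TO: "T \<in> Obj M" using T X_Obj by simp
  have k: "pc x T s \<in> carrier (pg x T)" using s by (simp add: psi_group_simps)
  show "psi_map x x (Ident M (Cok x)) T (pc x T s) = Ident FP (Fun x) T (pc x T s)"
    using T k s TO SD[OF x] by (simp add: fp_cat_simps psi_map_eval[OF x x liftable_Ident[OF x] T s])
qed

lemma psi_map_add:
  assumes x: "x \<in> Obj S" and y: "y \<in> Obj S" and c: "liftable x y c" and d: "liftable x y d"
  shows "psi_map x y (ad (Cok x) (Cok y) c d) = psi_map x y c \<otimes>\<^bsub>Hom FP (Fun x) (Fun y)\<^esub> psi_map x y d"
proof (rule Fun_ext[OF psi_map_Arr[OF x y liftable_add[OF x y c d]]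
      FP.add_closed[OF Fun_Obj[OF x] Fun_Obj[OF y] psi_map_Arr[OF x y c] psi_map_Arr[OF x y d]]])
  fix T s assume T: "T \<in> \<XX>" and s: "s \<in> Arr M T (Cok x)"
  have cA: "c \<in> Arr M (Cok x) (Cok y)" "d \<in> Arr M (Cok x) (Cok y)" using c d by (simp_all add: liftable_def)
  have TO: "T \<in> Obj M" using T X_Obj by simp
  have k: "pc x T s \<in> carrier (pg x T)" using s by (simp add: psi_group_simps)
  show "psi_map x y (ad (Cok x) (Cok y) c d) T (pc x T s) = (psi_map x y c \<otimes>\<^bsub>Hom FP (Fun x) (Fun y)\<^esub> psi_map x y d) T (pc x T s)"
    using T k s TO cA SD[OF x] SD[OF y]
    by (simp add: fp_cat_simps psi_map_eval[OF x y liftable_add[OF x y c d] T s] psi_map_eval[OF x y c T s] psi_map_eval[OF x y d T s]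
        psi_group_mult[OF y TO] C.Comp_add_left)
qed

lemma psi_map_zero:
  assumes x: "x \<in> Obj S" and y: "y \<in> Obj S"
  shows "psi_map x y (Zero M (Cok x) (Cok y)) = Zero FP (Fun x) (Fun y)"
proof (rule FP.add_eq_self[OF Fun_Obj[OF x] Fun_Obj[OF y]])
  let ?z = "psi_map x y (Zero M (Cok x) (Cok y))"
  show "?z \<in> Arr FP (Fun x) (Fun y)" "?z \<in> Arr FP (Fun x) (Fun y)" by (rule psi_map_Arr[OF x y liftable_zero[OF x y]])+
  show "?z \<otimes>\<^bsub>Hom FP (Fun x) (Fun y)\<^esub> ?z = ?z"
    using psi_map_add[OF x y liftable_zero[OF x y] liftable_zero[OF x y]] SD[OF x] SD[OF y] by simp
qed

lemma psi_map_eq_zero_iff: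
  assumes x: "x \<in> Obj S" and y: "y \<in> Obj S" and c: "liftable x y c"
  shows "psi_map x y c = Zero FP (Fun x) (Fun y) \<longleftrightarrow>
    (\<exists>s. s \<in> Arr M (Cok x) (Mid y) \<and> c = cp (Cok x) (Mid y) (Cok y) (q y) s)"
  using psi_map_eq_iff[OF x y c liftable_zero[OF x y]] psi_map_zero[OF x y] SD[OF x] SD[OF y]
  by (metis C.Comp_closed C.zero_add)

lemma induced_liftable:
  assumes x: "x \<in> Obj S" and y: "y \<in> Obj S" and ab: "ab \<in> Arr S x y"
  shows "liftable x y (ind x y ab)"
proof -
  obtain A B f where xx: "x = (A, B, f)" "(A, B, f) \<in> Obj S" using S_ObjE[OF x] by metis
  obtain A' B' f' where yy: "y = (A', B', f')" "(A', B', f') \<in> Obj S" using S_ObjE[OF y] by metis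
  obtain a b where abp: "ab = (a, b)" by (metis surj_pair)
  have "(a, b) \<in> Arr S (A, B, f) (A', B', f')" using ab by (simp only: xx yy abp)
  from induced(1,2)[OF xx(2) yy(2) this] this show ?thesis unfolding liftable_def xx(1) yy(1) abp by auto
qed

lemma liftable_induced:
  assumes x: "x \<in> Obj S" and y: "y \<in> Obj S" and c: "liftable x y c"
  shows "\<exists>ab\<in>Arr S x y. ind x y ab = c"
proof -
  obtain A B f where xx: "x = (A, B, f)" "(A, B, f) \<in> Obj S" using S_ObjE[OF x] by metis
  obtain A' B' f' where yy: "y = (A', B', f')" "(A', B', f') \<in> Obj S" using S_ObjE[OF y] by metis
  show ?thesis using induced_lift[OF xx(2) yy(2)] c unfolding liftable_def xx(1) yy(1) fst_conv snd_conv by metis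
qed

lemma Psi_functor: "additive_functor S FP \<Psi>"
proof (intro additive_functor.intro additive_functor_axioms.intro S_preadditive FP.preadditive_category_axioms)
  fix x assume x: "x \<in> Obj S"
  obtain A B f where xx: "x = (A, B, f)" "(A, B, f) \<in> Obj S" using S_ObjE[OF x] by metis
  show "FObj \<Psi> x \<in> Obj FP" using x by (simp add: Psi_simps)
  have i: "ind x x (Ident S x) = Ident M (Cok x)" unfolding xx(1) by (rule induced_Ident[OF xx(2)])
  show "FArr \<Psi> x x (Ident S x) = Ident FP (FObj \<Psi> x)"
    unfolding Psi_simps i by (rule psi_map_Ident[OF x])
  fix y assume y: "y \<in> Obj S"
  obtain A' B' f' where yy: "y = (A', B', f')" "(A', B', f') \<in> Obj S" using S_ObjE[OF y] by metis
  show "FArr \<Psi> x y \<in> hom (Hom S x y) (Hom FP (FObj \<Psi> x) (FObj \<Psi> y))"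
  proof (rule homI)
    fix u assume u: "u \<in> Arr S x y"
    show "FArr \<Psi> x y u \<in> Arr FP (FObj \<Psi> x) (FObj \<Psi> y)"
      unfolding Psi_simps by (rule psi_map_Arr[OF x y induced_liftable[OF x y u]])
    fix v assume v: "v \<in> Arr S x y"
    obtain a b a' b' where uv: "u = (a, b)" "v = (a', b')" by (metis surj_pair)
    have "ind x y (u \<otimes>\<^bsub>Hom S x y\<^esub> v) = ad (Cok x) (Cok y) (ind x y u) (ind x y v)"
      using induced_add[OF xx(2) yy(2)] u v unfolding xx(1) yy(1) uv by blast
    then show "FArr \<Psi> x y (u \<otimes>\<^bsub>Hom S x y\<^esub> v)
      = FArr \<Psi> x y u \<otimes>\<^bsub>Hom FP (FObj \<Psi> x) (FObj \<Psi> y)\<^esub> FArr \<Psi> x y v"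
      unfolding Psi_simps using psi_map_add[OF x y induced_liftable[OF x y u] induced_liftable[OF x y v]] by simp
  qed
  fix z u v assume z: "z \<in> Obj S" and u: "u \<in> Arr S x y" and v: "v \<in> Arr S y z"
  obtain A'' B'' f'' where zz: "z = (A'', B'', f'')" "(A'', B'', f'') \<in> Obj S" using S_ObjE[OF z] by metis
  obtain a b a' b' where uv: "u = (a, b)" "v = (a', b')" by (metis surj_pair)
  have "ind x z (Comp S x y z v u) = cp (Cok x) (Cok y) (Cok z) (ind y z v) (ind x y u)"
    using induced_Comp[OF xx(2) yy(2) zz(2)] u v unfolding xx(1) yy(1) zz(1) uv by blast
  then show "FArr \<Psi> x z (Comp S x y z v u)
     = Comp FP (FObj \<Psi> x) (FObj \<Psi> y) (FObj \<Psi> z) (FArr \<Psi> y z v) (FArr \<Psi> x y u)"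
    unfolding Psi_simps using psi_map_Comp[OF x y z induced_liftable[OF x y u] induced_liftable[OF y z v]] by simp
qed

lemma Psi_full:
  assumes x: "x \<in> Obj S" and y: "y \<in> Obj S"
  shows "FArr \<Psi> x y ` Arr S x y = Arr FP (FObj \<Psi> x) (FObj \<Psi> y)"
proof (intro equalityI subsetI)
  fix t assume "t \<in> FArr \<Psi> x y ` Arr S x y"
  then obtain ab where ab: "ab \<in> Arr S x y" "t = psi_map x y (ind x y ab)" unfolding Psi_simps by blast
  show "t \<in> Arr FP (FObj \<Psi> x) (FObj \<Psi> y)"
    unfolding ab(2) Psi_simps by (rule psi_map_Arr[OF x y induced_liftable[OF x y ab(1)]])
next
  fix t assume "t \<in> Arr FP (FObj \<Psi> x) (FObj \<Psi> y)"
  then have t: "t \<in> Arr FP (Fun x) (Fun y)" by (simp only: Psi_simps)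
  obtain c where c: "liftable x y c" "t = psi_map x y c" using psi_map_full[OF x y t] by auto
  obtain ab where "ab \<in> Arr S x y" "ind x y ab = c" using liftable_induced[OF x y c(1)] by blast
  then show "t \<in> FArr \<Psi> x y ` Arr S x y" using c(2) unfolding Psi_simps by blast
qed

text \<open>A presentation \<open>(-, A) \<rightarrow> (-, B) \<rightarrow> F \<rightarrow> 0\<close> over the stable category becomes, after adding a
  projective cover of \<open>B\<close> to \<open>A\<close>, one by an epimorphism \<open>A \<oplus> P \<rightarrow> B\<close>; its kernel is the monomorphism
  that presents \<open>F\<close>.\<close>

lemma Fun_dense:
  assumes F: "F \<in> Obj FP"
  shows "\<exists>x\<in>Obj S. \<exists>\<eta>. iso_arr FP (Fun x) \<eta> F"
proof -
  have fp: "finitely_presented St F" using F by (simp add: fp_cat_simps)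
  then have funF: "additive_functor (op_cat St) ab_cat F" by (rule finitely_presented_functor)
  obtain A B g \<pi> where AB: "A \<in> Obj St" "B \<in> Obj St" "g \<in> Arr St A B"
    and \<pi>: "\<forall>T\<in>Obj St. \<pi> T \<in> hom (Hom St T B) (FObj F T) \<and> \<pi> T ` Arr St T B = carrier (FObj F T) \<and>
        kernel (Hom St T B) (FObj F T) (\<pi> T) = (\<lambda>s. Comp St T A B g s) ` Arr St T A"
    and \<pi>n: "\<forall>T\<in>Obj St. \<forall>T'\<in>Obj St. \<forall>u\<in>Arr St T' T. \<forall>s\<in>Arr St T B. \<pi> T' (Comp St T' T B s u) = FArr F T T' u (\<pi> T s)"
    using conjunct2[OF fp[unfolded finitely_presented_def]] by (elim bexE exE conjE) (rule that; assumption)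
  have A: "A \<in> \<XX>" "A \<in> Obj M" and B: "B \<in> \<XX>" "B \<in> Obj M" using AB X_Obj by simp_all
  obtain u where u: "u \<in> Arr M A B" "g = N.cls A B u" using AB(3) by auto
  obtain K0 P i0 \<rho> where P: "short_exact M K0 i0 P \<rho> B" "P \<in> \<XX>" "P \<in> prj \<Lambda>" using cover_exact[OF B(1)] by metis
  note PO = C.short_exactD[OF P(1)]
  obtain E i j p r where E: "E \<in> \<XX>" "biproduct M A P E i j p r" using X_biproduct[OF A(1) P(2)] by auto
  note EO = C.biproductD[OF E(2)]
  let ?q = "ad E B (cp E A B u p) (cp E P B \<rho> r)"
  have qA: "?q \<in> Arr M E B" using EO u PO B by simp
  have qi: "cp A E B ?q i = u" "cp P E B ?q j = \<rho>"
    using EO u(1) PO B by (simp_all add: C.Comp_add_left C.Comp_assoc')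
  have "epi M E ?q B" by (rule C.epi_factor[of P E B ?q j]) (use qi(2) C.se_is_epi[OF P(1)] EO qA in simp_all)
  then obtain K k0 where K: "K \<in> \<XX>" "short_exact M K k0 E ?q B" using X_kernel[OF _ E(1) B(1)] by blast
  define x where "x = (K, E, k0)"
  have x: "x \<in> Obj S" unfolding x_def by (rule S_ObjI(1)[OF K(2,1) E(1) B(1)])
  note X = SD[OF x]
  have Mid: "Mid x = E" by (simp add: x_def)
  obtain k where k: "iso_arr M (Cok x) k B" "k \<in> Arr M (Cok x) B" "cp E (Cok x) B k (q x) = ?q"
    using S_ObjI(2)[OF K(2,1) E(1) B(1)] unfolding x_def by auto
  obtain k' where k': "k' \<in> Arr M B (Cok x)" "cp (Cok x) B (Cok x) k' k = Ident M (Cok x)" "cp B (Cok x) B k k' = Ident M B"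
    using k(1) by (auto simp: iso_arr_def)
  \<comment> \<open>the given presentation of \<open>F\<close>, transported to \<open>Cok x \<cong> B\<close>; it has the kernel of the one by \<open>x\<close>\<close>
  define h where "h T s = \<pi> T (N.cls T B (cp T (Cok x) B k s))" for T s
  have gF: "comm_group (FObj F T)" if "T \<in> \<XX>" for T
    using additive_functor.FObj_closed[OF funF, of T] that by simp
  have hclosed: "h T s \<in> carrier (FObj F T)" if "T \<in> \<XX>" "s \<in> Arr M T (Cok x)" for T s
  proof -
    have "N.cls T B (cp T (Cok x) B k s) \<in> Arr St T B" using that X_Obj k X B by simp
    then show ?thesis using \<pi> that(1) unfolding h_def hom_def by (auto simp del: St_simps(2))
  qed
  have hadd: "h T (ad T (Cok x) s s') = h T s \<otimes>\<^bsub>FObj F T\<^esub> h T s'"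
    if T: "T \<in> \<XX>" and s: "s \<in> Arr M T (Cok x)" "s' \<in> Arr M T (Cok x)" for T s s'
  proof -
    have TO: "T \<in> Obj M" using T X_Obj by simp
    have c: "cp T (Cok x) B k s \<in> Arr M T B" "cp T (Cok x) B k s' \<in> Arr M T B" using TO s k X B by simp_all
    have hm: "\<pi> T \<in> hom (Hom St T B) (FObj F T)" using \<pi> T by simp
    have "\<pi> T (N.cls T B (cp T (Cok x) B k s) \<otimes>\<^bsub>Hom St T B\<^esub> N.cls T B (cp T (Cok x) B k s')) = h T s \<otimes>\<^bsub>FObj F T\<^esub> h T s'"
      unfolding h_def by (rule hom_mult[OF hm]) (use c in simp_all)
    then show ?thesis unfolding h_def using TO s k(2) X B c by (simp add: C.Comp_add_right)
  qed
  have hker: "h T d = \<one>\<^bsub>FObj F T\<^esub> \<longleftrightarrow> (\<exists>b. b \<in> Arr M T E \<and> cp T E (Cok x) (q x) b = d)"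
    if T: "T \<in> \<XX>" and d: "d \<in> Arr M T (Cok x)" for T d
  proof -
    have TO: "T \<in> Obj M" using T X_Obj by simp
    have kd: "cp T (Cok x) B k d \<in> Arr M T B" using TO d k X B by simp
    have "h T d = \<one>\<^bsub>FObj F T\<^esub> \<longleftrightarrow> N.cls T B (cp T (Cok x) B k d) \<in> kernel (Hom St T B) (FObj F T) (\<pi> T)"
      using kd by (simp add: kernel_def h_def)
    also have "\<dots> \<longleftrightarrow> (\<exists>a\<in>Arr M T A. N.cls T B (cp T (Cok x) B k d) = N.cls T B (cp T A B u a))"
    proof -
      have "kernel (Hom St T B) (FObj F T) (\<pi> T) = (\<lambda>s. Comp St T A B g s) ` Arr St T A" using \<pi> T by simp
      also have "\<dots> = (\<lambda>a. N.cls T B (cp T A B u a)) ` Arr M T A"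
        using TO A B u by (simp add: image_image cong: image_cong_simp)
      finally show ?thesis by auto
    qed
    also have "\<dots> \<longleftrightarrow> (\<exists>b. b \<in> Arr M T E \<and> cp T E (Cok x) (q x) b = d)"
    proof
      assume "\<exists>a\<in>Arr M T A. N.cls T B (cp T (Cok x) B k d) = N.cls T B (cp T A B u a)"
      then obtain a where a: "a \<in> Arr M T A" "N.cls T B (cp T (Cok x) B k d) = N.cls T B (cp T A B u a)" by auto
      have ua: "cp T A B u a \<in> Arr M T B" using TO a A B u by simp
      obtain n where n: "n \<in> N T B" "cp T (Cok x) B k d = ad T B (cp T A B u a) n"
        using N.cls_eq_iff[OF TO B(2) kd ua] a(2) by auto
      obtain e where e: "e \<in> Arr M T P" "cp T P B \<rho> e = n" using N_lift[OF C.se_is_epi[OF P(1)] n(1) TO] by auto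
      let ?b = "ad T E (cp T A E i a) (cp T P E j e)"
      have bE: "?b \<in> Arr M T E" using TO a e EO by simp
      have "cp T E B ?q ?b = ad T B (cp T A B (cp A E B ?q i) a) (cp T P B (cp P E B ?q j) e)"
        using TO EO(1-7) qA a(1) e(1) B(2) by (simp add: C.Comp_add_right C.Comp_assoc)
      then have qb: "cp T E B ?q ?b = cp T (Cok x) B k d" unfolding qi using e n by simp
      have "cp T E (Cok x) (q x) ?b = cp T B (Cok x) k' (cp T E B (cp E (Cok x) B k (q x)) ?b)"
      proof -
        have "cp E B (Cok x) k' (cp E (Cok x) B k (q x)) = q x"
          using X B k(2) k'(1,2) Mid by (simp add: C.Comp_assoc)
        then show ?thesis using TO X B k(2) k'(1) Mid bE EO(3) qA k(3) by (simp add: C.Comp_assoc)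
      qed
      also have "\<dots> = d" unfolding k(3) qb using TO X B k(2) k' d by (simp add: C.Comp_assoc)
      finally show "\<exists>b. b \<in> Arr M T E \<and> cp T E (Cok x) (q x) b = d" using bE by blast
    next
      assume "\<exists>b. b \<in> Arr M T E \<and> cp T E (Cok x) (q x) b = d"
      then obtain b where b: "b \<in> Arr M T E" "cp T E (Cok x) (q x) b = d" by auto
      have pb: "cp T E A p b \<in> Arr M T A" "cp T E P r b \<in> Arr M T P" using TO b EO by simp_all
      have "cp T (Cok x) B k d = cp T E B ?q b"
        unfolding b(2)[symmetric] k(3)[symmetric] using TO X B k(2) Mid b(1) EO(3) by (simp add: C.Comp_assoc)
      also have "\<dots> = ad T B (cp T A B u (cp T E A p b)) (cp T P B \<rho> (cp T E P r b))"
        using TO EO(1-7) u(1) PO B(2) b(1) by (simp add: C.Comp_add_left C.Comp_assoc)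
      finally have e: "cp T (Cok x) B k d = ad T B (cp T A B u (cp T E A p b)) (cp T P B \<rho> (cp T E P r b))" .
      have "cp T P B \<rho> (cp T E P r b) \<in> N T B" using NI[OF P(3) pb(2) PO(5)] .
      then have "N.cls T B (cp T (Cok x) B k d) = N.cls T B (cp T A B u (cp T E A p b))"
        using N.cls_eq_iff[OF TO B(2) kd, of "cp T A B u (cp T E A p b)"] e pb TO A B u by auto
      then show "\<exists>a\<in>Arr M T A. N.cls T B (cp T (Cok x) B k d) = N.cls T B (cp T A B u a)" using pb by blast
    qed
    finally show ?thesis .
  qed
  have heq: "h T s = h T s' \<longleftrightarrow> pc x T s = pc x T s'"
    if T: "T \<in> \<XX>" and s: "s \<in> Arr M T (Cok x)" "s' \<in> Arr M T (Cok x)" for T s s'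
  proof -
    have TO: "T \<in> Obj M" using T X_Obj by simp
    obtain d where d: "d \<in> Arr M T (Cok x)" "s = ad T (Cok x) s' d" using C.difference[OF TO X(4) s] by auto
    interpret G: comm_group "FObj F T" by (rule gF[OF T])
    have "h T s = h T s' \<longleftrightarrow> h T s' \<otimes>\<^bsub>FObj F T\<^esub> h T d = h T s'" using hadd[OF T s(2) d(1)] d(2) by simp
    also have "\<dots> \<longleftrightarrow> h T d = \<one>\<^bsub>FObj F T\<^esub>" using hclosed[OF T s(2)] hclosed[OF T d(1)] by simp
    also have "\<dots> \<longleftrightarrow> (\<exists>b. b \<in> Arr M T E \<and> cp T E (Cok x) (q x) b = d)" by (rule hker[OF T d(1)])
    also have "\<dots> \<longleftrightarrow> (\<exists>b. b \<in> Arr M T E \<and> s = ad T (Cok x) s' (cp T E (Cok x) (q x) b))"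
    proof -
      have "cp T E (Cok x) (q x) b = d \<longleftrightarrow> s = ad T (Cok x) s' (cp T E (Cok x) (q x) b)" if "b \<in> Arr M T E" for b
      proof -
        have "cp T E (Cok x) (q x) b \<in> Arr M T (Cok x)" using TO X Mid that EO(3) by simp
        then show ?thesis unfolding d(2) using TO X(4) s(2) d(1) by auto
      qed
      then show ?thesis by blast
    qed
    finally show ?thesis using pc_eq_iff[OF x TO s] Mid by simp
  qed
  define \<eta> where "\<eta> = (\<lambda>T\<in>\<XX>. \<lambda>K\<in>carrier (pg x T). h T (SOME s. s \<in> Arr M T (Cok x) \<and> pc x T s = K))"
  have \<eta>: "\<eta> T (pc x T s) = h T s" if T: "T \<in> \<XX>" and s: "s \<in> Arr M T (Cok x)" for T s
  proof -
    let ?s = "SOME s'. s' \<in> Arr M T (Cok x) \<and> pc x T s' = pc x T s"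
    have "?s \<in> Arr M T (Cok x) \<and> pc x T ?s = pc x T s"
      by (rule someI[of "\<lambda>s'. s' \<in> Arr M T (Cok x) \<and> pc x T s' = pc x T s" s]) (use s in simp)
    then have "h T ?s = h T s" using heq[OF T _ s, of ?s] by blast
    then show ?thesis using T s by (simp add: \<eta>_def psi_group_simps)
  qed
  have \<eta>A: "\<eta> \<in> Arr FP (Fun x) F"
    unfolding fp_cat_Arr
  proof (intro CollectI conjI ballI)
    show "\<eta> \<in> extensional (Obj St)" by (simp add: \<eta>_def)
    fix T assume "T \<in> Obj St"
    then have T: "T \<in> \<XX>" "T \<in> Obj M" using X_Obj by simp_all
    have ext: "\<eta> T \<in> extensional (carrier (pg x T))" using T by (simp add: \<eta>_def)
    have "\<eta> T \<in> hom (pg x T) (FObj F T)"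
    proof (rule homI)
      fix a assume "a \<in> carrier (pg x T)"
      then obtain s where s: "s \<in> Arr M T (Cok x)" "a = pc x T s" by (auto simp: psi_group_simps)
      show "\<eta> T a \<in> carrier (FObj F T)" unfolding s(2) \<eta>[OF T(1) s(1)] by (rule hclosed[OF T(1) s(1)])
      fix a' assume "a' \<in> carrier (pg x T)"
      then obtain s' where s': "s' \<in> Arr M T (Cok x)" "a' = pc x T s'" by (auto simp: psi_group_simps)
      have ss: "ad T (Cok x) s s' \<in> Arr M T (Cok x)" using s s' T X by simp
      show "\<eta> T (a \<otimes>\<^bsub>pg x T\<^esub> a') = \<eta> T a \<otimes>\<^bsub>FObj F T\<^esub> \<eta> T a'"
        unfolding s(2) s'(2) psi_group_mult[OF x T(2) s(1) s'(1)] \<eta>[OF T(1) s(1)] \<eta>[OF T(1) s'(1)] \<eta>[OF T(1) ss]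
        by (rule hadd[OF T(1) s(1) s'(1)])
    qed
    then show "\<eta> T \<in> Arr ab_cat (FObj (Fun x) T) (FObj F T)" using ext by simp
    fix T' U assume "T' \<in> Obj St" "U \<in> Arr St T' T"
    then obtain w where T': "T' \<in> \<XX>" "T' \<in> Obj M" and w: "w \<in> Arr M T' T" "U = N.cls T' T w" using X_Obj by auto
    have "compose (carrier (pg x T)) (\<eta> T') (FArr (Fun x) T T' U) = compose (carrier (pg x T)) (FArr F T T' U) (\<eta> T)"
    proof (rule extensionalityI[OF compose_extensional compose_extensional])
      fix a assume a: "a \<in> carrier (pg x T)"
      then obtain s where s: "s \<in> Arr M T (Cok x)" "a = pc x T s" by (auto simp: psi_group_simps)
      have sw: "cp T' T (Cok x) s w \<in> Arr M T' (Cok x)" and ks: "cp T (Cok x) B k s \<in> Arr M T B" using s w k T T' X B by simp_all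
      have "\<pi> T' (Comp St T' T B (N.cls T B (cp T (Cok x) B k s)) U) = FArr F T T' U (\<pi> T (N.cls T B (cp T (Cok x) B k s)))"
      proof -
        have "U \<in> Arr St T' T" "N.cls T B (cp T (Cok x) B k s) \<in> Arr St T B" using w ks by simp_all
        then show ?thesis using \<pi>n T T' by (simp del: St_simps(2,3))
      qed
      then have "h T' (cp T' T (Cok x) s w) = FArr F T T' U (h T s)"
        unfolding h_def w(2) using T T' X B k(2) s(1) w(1) ks by (simp add: C.Comp_assoc)
      then have "\<eta> T' (FArr (Fun x) T T' U a) = FArr F T T' U (\<eta> T a)"
        unfolding w(2) s(2) psi_FArr[OF x T(1) T'(1) w(1) s(1)] \<eta>[OF T(1) s(1)] \<eta>[OF T'(1) sw] .
      then show "compose (carrier (pg x T)) (\<eta> T') (FArr (Fun x) T T' U) a = compose (carrier (pg x T)) (FArr F T T' U) (\<eta> T) a"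
        using a by (simp add: compose_def)
    qed
    then show "Comp ab_cat (FObj (Fun x) T) (FObj (Fun x) T') (FObj F T') (\<eta> T') (FArr (Fun x) T T' U)
        = Comp ab_cat (FObj (Fun x) T) (FObj F T) (FObj F T') (FArr F T T' U) (\<eta> T)" by simp
  qed
  have bij: "bij_betw (\<eta> T) (carrier (FObj (Fun x) T)) (carrier (FObj F T))" if "T \<in> Obj St" for T
  proof -
    have T: "T \<in> \<XX>" "T \<in> Obj M" using that X_Obj by simp_all
    have "inj_on (\<eta> T) (carrier (pg x T))"
    proof (rule inj_onI)
      fix a a' assume "a \<in> carrier (pg x T)" "a' \<in> carrier (pg x T)" and e: "\<eta> T a = \<eta> T a'"
      then obtain s s' where s: "s \<in> Arr M T (Cok x)" "a = pc x T s" "s' \<in> Arr M T (Cok x)" "a' = pc x T s'"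
        by (auto simp: psi_group_simps)
      show "a = a'" using e unfolding s(2,4) \<eta>[OF T(1) s(1)] \<eta>[OF T(1) s(3)] heq[OF T(1) s(1,3)] .
    qed
    moreover have "\<eta> T ` carrier (pg x T) = carrier (FObj F T)"
    proof (intro equalityI subsetI)
      fix f assume "f \<in> \<eta> T ` carrier (pg x T)"
      then show "f \<in> carrier (FObj F T)" using FP_D(2)[OF \<eta>A T(1)] by (auto simp: hom_def)
    next
      fix f assume "f \<in> carrier (FObj F T)"
      then have "f \<in> \<pi> T ` Arr St T B" using \<pi> that by blast
      then obtain t where t: "t \<in> Arr M T B" "f = \<pi> T (N.cls T B t)" by auto
      have k't: "cp T B (Cok x) k' t \<in> Arr M T (Cok x)" using t k' T X B by simp
      have "cp T (Cok x) B k (cp T B (Cok x) k' t) = t" using t k'(1,3) k(2) T X B by (simp add: C.Comp_assoc)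
      then have "f = \<eta> T (pc x T (cp T B (Cok x) k' t))" unfolding \<eta>[OF T(1) k't] h_def t(2) by simp
      then show "f \<in> \<eta> T ` carrier (pg x T)" using k't by (auto simp: psi_group_simps)
    qed
    ultimately show ?thesis by (simp add: bij_betw_def)
  qed
  show ?thesis using fp_cat_iso[OF psi_finitely_presented[OF x] fp \<eta>A bij] x by blast
qed

end

section \<open>Projective functors\<close>

context preadditive_category
begin

lemma transport_lift:
  assumes "A \<in> Obj C" "B \<in> Obj C" "v \<in> Obj C" "T \<in> Obj C" "m \<in> Arr C A B" "a \<in> Arr C v T" "a' \<in> Arr C T v"
    "Comp C T v T a a' = Ident C T" "t \<in> Arr C T B" "s \<in> Arr C v A" "Comp C v A B m s = Comp C v T B t a"
  shows "Comp C T A B m (Comp C T v A s a') = t"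
proof -
  have "Comp C T A B m (Comp C T v A s a') = Comp C T v B (Comp C v A B m s) a'"
    using assms by (simp add: Comp_assoc)
  also have "\<dots> = Comp C T T B t (Comp C T v T a a')"
    using assms(1-7,9,10) by (simp add: assms(11) Comp_assoc)
  finally show ?thesis using assms by simp
qed

lemma transport_colift:
  assumes "D \<in> Obj C" "B \<in> Obj C" "v \<in> Obj C" "T \<in> Obj C" "n \<in> Arr C B D" "a \<in> Arr C v T" "a' \<in> Arr C T v"
    "Comp C T v T a a' = Ident C T" "t \<in> Arr C B T" "s \<in> Arr C D v" "Comp C B D v s n = Comp C B T v a' t"
  shows "Comp C B D T (Comp C D v T a s) n = t"
proof -
  have "Comp C B D T (Comp C D v T a s) n = Comp C B v T a (Comp C B D v s n)"
    using assms(1-6,10) by (simp add: Comp_assoc)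
  also have "\<dots> = Comp C B T T (Comp C T v T a a') t"
    using assms(1-7,9,10) by (simp add: assms(11) Comp_assoc)
  finally show ?thesis using assms by simp
qed

text \<open>The universal properties of a kernel and a cokernel need to be tested only against one object
  from each isomorphism class.\<close>

lemma short_exact_test:
  assumes O: "A \<in> Obj C" "B \<in> Obj C" "D \<in> Obj C" and m: "m \<in> Arr C A B" and n: "n \<in> Arr C B D"
    and nm: "Comp C A B D n m = Zero C A D"
    and W: "W \<subseteq> Obj C" "\<And>T. T \<in> Obj C \<Longrightarrow> \<exists>v\<in>W. \<exists>a. iso_arr C v a T"
    and lift: "\<And>v t. \<lbrakk>v \<in> W; t \<in> Arr C v B; Comp C v B D n t = Zero C v D\<rbrakk> \<Longrightarrow> \<exists>s. s \<in> Arr C v A \<and> Comp C v A B m s = t"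
    and mono: "\<And>v t. \<lbrakk>v \<in> W; t \<in> Arr C v A; Comp C v A B m t = Zero C v B\<rbrakk> \<Longrightarrow> t = Zero C v A"
    and colift: "\<And>v t. \<lbrakk>v \<in> W; t \<in> Arr C B v; Comp C A B v t m = Zero C A v\<rbrakk> \<Longrightarrow> \<exists>s. s \<in> Arr C D v \<and> Comp C B D v s n = t"
    and epi: "\<And>v t. \<lbrakk>v \<in> W; t \<in> Arr C D v; Comp C B D v t n = Zero C B v\<rbrakk> \<Longrightarrow> t = Zero C D v"
  shows "short_exact C A m B n D"
  unfolding short_exact_def is_kernel_def is_cokernel_def
proof (intro conjI ballI impI O m n nm)
  fix T t assume T: "T \<in> Obj C"
  obtain v a where v: "v \<in> W" "iso_arr C v a T" using W(2)[OF T] by blast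
  have vO: "v \<in> Obj C" using v(1) W(1) by auto
  obtain a' where a: "a \<in> Arr C v T" "a' \<in> Arr C T v" "Comp C T v T a a' = Ident C T" "Comp C v T v a' a = Ident C v"
    using v(2) by (auto simp: iso_arr_def)
  {
    assume t: "t \<in> Arr C T B" "Comp C T B D n t = Zero C T D"
    have "Comp C v B D n (Comp C v T B t a) = Zero C v D"
      using O T vO t a n by (simp add: Comp_assoc)
    then obtain s where s: "s \<in> Arr C v A" "Comp C v A B m s = Comp C v T B t a"
      using lift[OF v(1), of "Comp C v T B t a"] O T vO t a by auto
    show "\<exists>!s. s \<in> Arr C T A \<and> Comp C T A B m s = t"
    proof (rule ex1I[of _ "Comp C T v A s a'"])
      show "Comp C T v A s a' \<in> Arr C T A \<and> Comp C T A B m (Comp C T v A s a') = t"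
        using transport_lift[OF O(1,2) vO T m a(1,2,3) t(1) s] O T vO s(1) a(2) by simp
      fix s' assume s': "s' \<in> Arr C T A \<and> Comp C T A B m s' = t"
      have s1: "Comp C T v A s a' \<in> Arr C T A" using O T vO s(1) a(2) by simp
      obtain d where d: "d \<in> Arr C T A" "s' = Comp C T v A s a' \<otimes>\<^bsub>Hom C T A\<^esub> d"
        using difference[OF T O(1) conjunct1[OF s'] s1] by auto
      have "t \<otimes>\<^bsub>Hom C T B\<^esub> Comp C T A B m d = t"
        using s' transport_lift[OF O(1,2) vO T m a(1,2,3) t(1) s] s1 d O T m by (simp add: Comp_add_right)
      then have md: "Comp C T A B m d = Zero C T B" using add_eq_self[OF T O(2) t(1)] O T m d by simp
      then have "Comp C v A B m (Comp C v T A d a) = Zero C v B" using O T vO m d(1) a by (simp add: Comp_assoc)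
      then have da: "Comp C v T A d a = Zero C v A" using mono[OF v(1), of "Comp C v T A d a"] O T vO d(1) a by simp
      have "d = Comp C T T A d (Comp C T v T a a')" using d(1) O T a by simp
      also have "\<dots> = Zero C T A" using d(1) O T vO a(1,2) by (simp add: Comp_assoc da)
      finally show "s' = Comp C T v A s a'" using d s1 O T by simp
    qed
  }
  {
    assume t: "t \<in> Arr C B T" "Comp C A B T t m = Zero C A T"
    have "Comp C A B v (Comp C B T v a' t) m = Zero C A v"
      using O T vO t a m by (simp add: Comp_assoc')
    then obtain s where s: "s \<in> Arr C D v" "Comp C B D v s n = Comp C B T v a' t"
      using colift[OF v(1), of "Comp C B T v a' t"] O T vO t a by auto
    show "\<exists>!s. s \<in> Arr C D T \<and> Comp C B D T s n = t"
    proof (rule ex1I[of _ "Comp C D v T a s"])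
      show "Comp C D v T a s \<in> Arr C D T \<and> Comp C B D T (Comp C D v T a s) n = t"
        using transport_colift[OF O(3,2) vO T n a(1,2,3) t(1) s] O T vO s(1) a(1) by simp
      fix s' assume s': "s' \<in> Arr C D T \<and> Comp C B D T s' n = t"
      have s1: "Comp C D v T a s \<in> Arr C D T" using O T vO s(1) a(1) by simp
      obtain d where d: "d \<in> Arr C D T" "s' = Comp C D v T a s \<otimes>\<^bsub>Hom C D T\<^esub> d"
        using difference[OF O(3) T conjunct1[OF s'] s1] by auto
      have "t \<otimes>\<^bsub>Hom C B T\<^esub> Comp C B D T d n = t"
        using s' transport_colift[OF O(3,2) vO T n a(1,2,3) t(1) s] s1 d O T n by (simp add: Comp_add_left)
      then have "Comp C B D T d n = Zero C B T" using add_eq_self[OF O(2) T t(1)] O T n d by simp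
      then have "Comp C B D v (Comp C D T v a' d) n = Zero C B v" using O T vO n d(1) a by (simp add: Comp_assoc')
      then have da: "Comp C D T v a' d = Zero C D v" using epi[OF v(1), of "Comp C D T v a' d"] O T vO d(1) a by simp
      have "d = Comp C D T T (Comp C T v T a a') d" using d(1) O T a by simp
      also have "\<dots> = Zero C D T" using d(1) O T vO a(1,2) by (simp add: Comp_assoc' da)
      finally show "s' = Comp C D v T a s" using d s1 O T by simp
    qed
  }
qed

end

context resolving_setting
begin

text \<open>As kernels of epimorphisms in \<open>\<XX>\<close> stay in \<open>\<XX>\<close>, every such epimorphism is up to isomorphism the cokernel map of an
  object of \<open>S\<close>.\<close>

lemma epi_object:
  assumes p: "epi M B p D" and X: "B \<in> \<XX>" "D \<in> \<XX>"
  obtains x k k' where "x \<in> Obj S" "Mid x = B" "k \<in> Arr M (Cok x) D" "k' \<in> Arr M D (Cok x)"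
    "cp (Cok x) D (Cok x) k' k = Ident M (Cok x)" "cp D (Cok x) D k k' = Ident M D"
    "cp B (Cok x) D k (q x) = p" "cp B D (Cok x) k' p = q x"
proof -
  obtain K i where K: "K \<in> \<XX>" "short_exact M K i B p D" using X_kernel[OF p X] by auto
  have x: "(K, B, i) \<in> Obj S" by (rule S_ObjI(1)[OF K(2,1) X])
  note SO = SD[OF x, unfolded fst_conv snd_conv]
  obtain k where k: "iso_arr M (Cok (K, B, i)) k D" "k \<in> Arr M (Cok (K, B, i)) D" "cp B (Cok (K, B, i)) D k (q (K, B, i)) = p"
    using S_ObjI(2)[OF K(2,1) X] by auto
  obtain k' where k': "k' \<in> Arr M D (Cok (K, B, i))" "cp (Cok (K, B, i)) D (Cok (K, B, i)) k' k = Ident M (Cok (K, B, i))"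
    "cp D (Cok (K, B, i)) D k k' = Ident M D" using k(1) by (auto simp: iso_arr_def)
  have "cp B D (Cok (K, B, i)) k' p = q (K, B, i)"
    unfolding k(3)[symmetric] using SO X_Obj[OF X(2)] k(2) k'(1,2) by (simp add: C.Comp_assoc)
  then show thesis using that[OF x _ k(2) k'(1,2,3) k(3)] by simp
qed

text \<open>The functors presented by a monomorphism with projective target turn out to be enough
  projectives.\<close>

lemma cover_object:
  assumes x: "x \<in> Obj S"
  obtains w k k' where "w \<in> Obj S" "Mid w \<in> prj \<Lambda>" "k \<in> Arr M (Cok w) (Cok x)" "k' \<in> Arr M (Cok x) (Cok w)"
    "cp (Cok w) (Cok x) (Cok w) k' k = Ident M (Cok w)" "cp (Cok x) (Cok w) (Cok x) k k' = Ident M (Cok x)"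
    "liftable w x k"
proof -
  note X = SD[OF x]
  obtain K P i p where P: "short_exact M K i P p (Cok x)" "P \<in> \<XX>" "P \<in> prj \<Lambda>" using cover_exact[OF X(2)] by metis
  have p: "p \<in> Arr M P (Cok x)" using C.short_exactD[OF P(1)] by simp
  obtain w k k' where w: "w \<in> Obj S" "Mid w = P" "k \<in> Arr M (Cok w) (Cok x)" "k' \<in> Arr M (Cok x) (Cok w)"
    "cp (Cok w) (Cok x) (Cok w) k' k = Ident M (Cok w)" "cp (Cok x) (Cok w) (Cok x) k k' = Ident M (Cok x)"
    "cp P (Cok w) (Cok x) k (q w) = p" using epi_object[OF C.se_is_epi[OF P(1)] P(2) X(2)] by metis
  obtain b where "b \<in> Arr M P (Mid x)" "cp P (Mid x) (Cok x) (q x) b = p" using prj_lift[OF P(3) X(6) p] by auto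
  then have "liftable w x k" unfolding liftable_def using w(2,3,7) by auto
  then show thesis using that[OF w(1) _ w(3-6)] w(2) P(3) by simp
qed

text \<open>The pullback is the kernel of \<open>(f, -g)\<close> on \<open>B \<oplus> P\<close>.  The map to \<open>B\<close> is epic because a projective cover of \<open>B\<close>
  lifts to the pullback.\<close>

lemma X_pullback:
  assumes f: "epi M B f D" and g: "epi M P g D" and X: "B \<in> \<XX>" "P \<in> \<XX>" "D \<in> \<XX>"
  obtains E u v where "E \<in> \<XX>" "epi M E u B" "v \<in> Arr M E P" "cp E B D f u = cp E P D g v"
    "\<forall>T\<in>Obj M. \<forall>s\<in>Arr M T B. \<forall>t\<in>Arr M T P. cp T B D f s = cp T P D g t \<longrightarrow>
      (\<exists>h. h \<in> Arr M T E \<and> cp T E B u h = s \<and> cp T E P v h = t)"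
proof -
  have O: "B \<in> Obj M" "P \<in> Obj M" "D \<in> Obj M" using X X_Obj by simp_all
  have fg: "f \<in> Arr M B D" "g \<in> Arr M P D" using f g by (simp_all add: epi_def)
  obtain W i j p r where W: "W \<in> \<XX>" "biproduct M B P W i j p r" using X_biproduct[OF X(1,2)] by auto
  note WO = C.biproductD[OF W(2)]
  let ?g = "inv\<^bsub>Hom M P D\<^esub> g"
  let ?F = "ad W D (cp W B D f p) (cp W P D ?g r)"
  have gi: "?g \<in> Arr M P D" using O fg by simp
  have F: "?F \<in> Arr M W D" using O WO fg gi by simp
  have Fi: "cp B W D ?F i = f" using O WO fg gi by (simp add: C.Comp_add_left C.Comp_assoc')
  have "epi M W ?F D" by (rule C.epi_factor[of B W D ?F i]) (use Fi f WO F in simp_all)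
  then obtain E e where E: "E \<in> \<XX>" "short_exact M E e W ?F D" using X_kernel[OF _ W(1) X(3)] by blast
  note EO = C.short_exactD[OF E(2)]
  let ?u = "cp E W B p e" and ?v = "cp E W P r e"
  have uv: "?u \<in> Arr M E B" "?v \<in> Arr M E P" using EO WO by simp_all
  have F_eq: "cp T W D ?F a = Zero M T D \<longleftrightarrow> cp T B D f (cp T W B p a) = cp T P D g (cp T W P r a)"
    if T: "T \<in> Obj M" and a: "a \<in> Arr M T W" for T a
  proof -
    have pr: "cp T W B p a \<in> Arr M T B" "cp T W P r a \<in> Arr M T P" using T a WO by simp_all
    have gn: "ad T D (cp T P D g (cp T W P r a)) (cp T P D ?g (cp T W P r a)) = Zero M T D"
      using C.Comp_add_left[OF T O(2,3) pr(2) fg(2) gi] T O fg pr by simp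
    have "cp T W D ?F a = ad T D (cp T B D f (cp T W B p a)) (cp T P D ?g (cp T W P r a))"
      using T a WO(1-7) O fg gi by (simp add: C.Comp_add_left C.Comp_assoc)
    then have "cp T W D ?F a = Zero M T D \<longleftrightarrow>
      ad T D (cp T P D ?g (cp T W P r a)) (cp T B D f (cp T W B p a)) = ad T D (cp T P D ?g (cp T W P r a)) (cp T P D g (cp T W P r a))"
      using gn T O fg gi pr by (metis C.add_comm C.Comp_closed)
    then show ?thesis using T O fg gi pr by simp
  qed
  have uvD: "cp E B D f ?u = cp E P D g ?v" using F_eq[OF EO(1,4)] EO(6) by simp
  have univ: "\<exists>h. h \<in> Arr M T E \<and> cp T E B ?u h = s \<and> cp T E P ?v h = t"
    if T: "T \<in> Obj M" and s: "s \<in> Arr M T B" and t: "t \<in> Arr M T P" and st: "cp T B D f s = cp T P D g t" for T s t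
  proof -
    let ?a = "ad T W (cp T B W i s) (cp T P W j t)"
    have a: "?a \<in> Arr M T W" using T s t WO by simp
    have pa: "cp T W B p ?a = s" "cp T W P r ?a = t" using T s t WO by (simp_all add: C.Comp_add_right C.Comp_assoc)
    obtain h where h: "h \<in> Arr M T E" "cp T E W e h = ?a" using C.se_lift[OF E(2) T a] F_eq[OF T a] pa st by auto
    have "cp T E B ?u h = s" "cp T E P ?v h = t"
      using h T WO EO(1,4) pa by (simp_all add: C.Comp_assoc')
    then show ?thesis using h(1) by auto
  qed
  obtain K0 P0 i0 c where P0: "short_exact M K0 i0 P0 c B" "P0 \<in> prj \<Lambda>" using cover_exact[OF X(1)] by metis
  note PO = C.short_exactD[OF P0(1)]
  obtain t where t: "t \<in> Arr M P0 P" "cp P0 P D g t = cp P0 B D f c" using prj_lift[OF P0(2) g, of "cp P0 B D f c"] PO O fg by auto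
  obtain h where h: "h \<in> Arr M P0 E" "cp P0 E B ?u h = c" using univ[OF PO(2,5) t(1)] t(2) by auto
  have "epi M E ?u B" by (rule C.epi_factor[of P0 E B ?u h]) (use h C.se_is_epi[OF P0(1)] uv EO(1) in simp_all)
  then show thesis using that[OF E(1) _ uv(2) uvD] univ by blast
qed

text \<open>The cokernel of \<open>Fun x \<rightarrow> Fun y\<close> is presented by the epimorphism \<open>(q y, c) : B \<oplus> Cok x \<rightarrow> Cok y\<close>.  It vanishes as
  the given morphism is epic, which means that this epimorphism splits.\<close>

lemma psi_map_epi:
  assumes x: "x \<in> Obj S" and y: "y \<in> Obj S" and c: "liftable x y c" and e: "epi FP (Fun x) (psi_map x y c) (Fun y)"
  obtains s1 s2 where "s1 \<in> Arr M (Cok y) (Mid y)" "s2 \<in> Arr M (Cok y) (Cok x)"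
    "Ident M (Cok y) = ad (Cok y) (Cok y) (cp (Cok y) (Mid y) (Cok y) (q y) s1) (cp (Cok y) (Cok x) (Cok y) c s2)"
proof -
  note X = SD[OF x] and Y = SD[OF y]
  have cA: "c \<in> Arr M (Cok x) (Cok y)" using c by (simp add: liftable_def)
  obtain E i j p r where E: "E \<in> \<XX>" "biproduct M (Mid y) (Cok x) E i j p r" using X_biproduct[OF Y(1) X(2)] by auto
  note EO = C.biproductD[OF E(2)]
  let ?q = "ad E (Cok y) (cp E (Mid y) (Cok y) (q y) p) (cp E (Cok x) (Cok y) c r)"
  have qA: "?q \<in> Arr M E (Cok y)" using EO X Y cA by simp
  have qi: "cp (Mid y) E (Cok y) ?q i = q y" "cp (Cok x) E (Cok y) ?q j = c"
    using EO X Y cA by (simp_all add: C.Comp_add_left C.Comp_assoc')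
  have "epi M E ?q (Cok y)" by (rule C.epi_factor[of "Mid y" E "Cok y" ?q i]) (use qi(1) Y EO qA in simp_all)
  then obtain z k k' where z: "z \<in> Obj S" "Mid z = E" "k \<in> Arr M (Cok z) (Cok y)" "k' \<in> Arr M (Cok y) (Cok z)"
    "cp (Cok z) (Cok y) (Cok z) k' k = Ident M (Cok z)" "cp (Cok y) (Cok z) (Cok y) k k' = Ident M (Cok y)"
    "cp E (Cok z) (Cok y) k (q z) = ?q" "cp E (Cok y) (Cok z) k' ?q = q z"
    using epi_object[OF _ E(1) Y(2)] by metis
  note Z = SD[OF z(1)]
  have ki: "cp (Mid y) (Cok y) (Cok z) k' (q y) = cp (Mid y) E (Cok z) (q z) i"
    unfolding z(8)[symmetric] by (subst qi(1)[symmetric]) (use EO(1,3,4) Y Z z(4) qA in \<open>simp add: C.Comp_assoc\<close>)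
  have kj: "cp (Cok x) (Cok y) (Cok z) k' c = cp (Cok x) E (Cok z) (q z) j"
    unfolding z(8)[symmetric] by (subst qi(2)[symmetric]) (use EO(2,3,5) X Y Z z(4) qA in \<open>simp add: C.Comp_assoc\<close>)
  have lk: "liftable y z k'" unfolding liftable_def using z(2,4) ki EO(4) by auto
  have "psi_map x z (cp (Cok x) (Cok y) (Cok z) k' c) = Zero FP (Fun x) (Fun z)"
    using psi_map_eq_zero_iff[OF x z(1) liftable_comp[OF x y z(1) c lk]] kj EO(5) z(2) by auto
  then have eq: "Comp FP (Fun x) (Fun y) (Fun z) (psi_map y z k') (psi_map x y c)
    = Comp FP (Fun x) (Fun y) (Fun z) (Zero FP (Fun y) (Fun z)) (psi_map x y c)"
    using psi_map_Comp[OF x y z(1) c lk] x y z(1) psi_map_Arr[OF x y c] by simp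
  have "psi_map y z k' = Zero FP (Fun y) (Fun z)"
    using e eq psi_map_Arr[OF y z(1) lk] Fun_Obj[OF z(1)] FP.zero_closed[OF Fun_Obj[OF y] Fun_Obj[OF z(1)]]
    unfolding epi_def by blast
  then obtain s where s: "s \<in> Arr M (Cok y) E" "k' = cp (Cok y) E (Cok z) (q z) s"
    using psi_map_eq_zero_iff[OF y z(1) lk] z(2) by auto
  have "Ident M (Cok y) = cp (Cok y) E (Cok y) (cp E (Cok z) (Cok y) k (q z)) s"
    unfolding z(6)[symmetric] s(2) using Y Z z(2,3) s(1) EO(3) by (simp add: C.Comp_assoc)
  also have "\<dots> = ad (Cok y) (Cok y) (cp (Cok y) (Mid y) (Cok y) (q y) (cp (Cok y) E (Mid y) p s))
      (cp (Cok y) (Cok x) (Cok y) c (cp (Cok y) E (Cok x) r s))"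
    unfolding z(7) using X Y EO(1-7) cA s(1) by (simp add: C.Comp_add_left C.Comp_assoc)
  finally show thesis using that[of "cp (Cok y) E (Mid y) p s" "cp (Cok y) E (Cok x) r s"] X Y EO s(1) by simp
qed

text \<open>By the splitting above, a map \<open>e : Cok w \<rightarrow> Cok y\<close> agrees with \<open>c\<close> after \<open>s2 e\<close>, up to a map through \<open>q y\<close>.  The map
  \<open>s2 e\<close> is liftable since the projective module \<open>Mid w\<close> allows lifts along \<open>q x\<close>.\<close>

lemma Fun_projective:
  assumes w: "w \<in> Obj S" and P: "Mid w \<in> prj \<Lambda>"
  shows "projective FP (short_exact FP) (Fun w)"
  unfolding projective_def
proof (intro conjI ballI impI Fun_Obj[OF w])
  fix A B D i p t assume H: "A \<in> Obj FP" "B \<in> Obj FP" "D \<in> Obj FP" "short_exact FP A i B p D" and t: "t \<in> Arr FP (Fun w) D"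
  note W = SD[OF w]
  have p: "epi FP B p D" "p \<in> Arr FP B D" using FP.se_is_epi[OF H(4)] FP.short_exactD[OF H(4)] by simp_all
  obtain x \<beta> where x: "x \<in> Obj S" and \<beta>: "iso_arr FP (Fun x) \<beta> B" using Fun_dense[OF H(2)] by blast
  obtain y \<gamma> where y: "y \<in> Obj S" and \<gamma>: "iso_arr FP (Fun y) \<gamma> D" using Fun_dense[OF H(3)] by blast
  note X = SD[OF x] and Y = SD[OF y] and F = Fun_Obj[OF w] Fun_Obj[OF x] Fun_Obj[OF y]
  have bA: "\<beta> \<in> Arr FP (Fun x) B" using \<beta> by (simp add: iso_arr_def)
  obtain \<gamma>' where g: "iso_arr FP D \<gamma>' (Fun y)" "\<gamma>' \<in> Arr FP D (Fun y)" "Comp FP D (Fun y) D \<gamma> \<gamma>' = Ident FP D" "\<gamma> \<in> Arr FP (Fun y) D"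
    using FP.iso_sym[OF \<gamma>] \<gamma> unfolding iso_arr_def by metis
  let ?p = "Comp FP (Fun x) D (Fun y) \<gamma>' (Comp FP (Fun x) B D p \<beta>)"
  have pe: "epi FP (Fun x) ?p (Fun y)" by (intro FP.epi_comp[OF FP.epi_comp] FP.iso_epi \<beta> p(1) g(1))
  have pA: "?p \<in> Arr FP (Fun x) (Fun y)" using pe by (simp add: epi_def)
  obtain c where c: "liftable x y c" "?p = psi_map x y c" using psi_map_full[OF x y pA] by blast
  have tA: "Comp FP (Fun w) D (Fun y) \<gamma>' t \<in> Arr FP (Fun w) (Fun y)" using F H(3) t g(2) by simp
  obtain e where e: "liftable w y e" "Comp FP (Fun w) D (Fun y) \<gamma>' t = psi_map w y e" using psi_map_full[OF w y tA] by blast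
  have cA: "c \<in> Arr M (Cok x) (Cok y)" "e \<in> Arr M (Cok w) (Cok y)" using c e by (simp_all add: liftable_def)
  obtain s1 s2 where s: "s1 \<in> Arr M (Cok y) (Mid y)" "s2 \<in> Arr M (Cok y) (Cok x)"
    "Ident M (Cok y) = ad (Cok y) (Cok y) (cp (Cok y) (Mid y) (Cok y) (q y) s1) (cp (Cok y) (Cok x) (Cok y) c s2)"
    using psi_map_epi[OF x y c(1)] pe c(2) by metis
  let ?g = "cp (Cok w) (Cok y) (Cok x) s2 e" and ?s = "cp (Cok w) (Cok y) (Mid y) s1 e"
  have gs: "?g \<in> Arr M (Cok w) (Cok x)" "?s \<in> Arr M (Cok w) (Mid y)" using W X Y s cA by simp_all
  have gq: "cp (Mid w) (Cok w) (Cok x) ?g (q w) \<in> Arr M (Mid w) (Cok x)" using gs W X by simp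
  obtain b where "b \<in> Arr M (Mid w) (Mid x)" "cp (Mid w) (Mid x) (Cok x) (q x) b = cp (Mid w) (Cok w) (Cok x) ?g (q w)"
    using prj_lift[OF P X(6) gq] by auto
  then have lg: "liftable w x ?g" unfolding liftable_def using gs by metis
  have "e = cp (Cok w) (Cok y) (Cok y) (Ident M (Cok y)) e" using W Y cA by simp
  also have "\<dots> = ad (Cok w) (Cok y) (cp (Cok w) (Mid y) (Cok y) (q y) ?s) (cp (Cok w) (Cok x) (Cok y) c ?g)"
    unfolding s(3) using W X Y s(1,2) cA by (simp add: C.Comp_add_left C.Comp_assoc)
  also have "\<dots> = ad (Cok w) (Cok y) (cp (Cok w) (Cok x) (Cok y) c ?g) (cp (Cok w) (Mid y) (Cok y) (q y) ?s)"
    by (rule C.add_comm) (use W X Y gs cA in simp_all)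
  finally have "psi_map w y e = psi_map w y (cp (Cok w) (Cok x) (Cok y) c ?g)"
    using psi_map_eq_iff[OF w y e(1) liftable_comp[OF w x y lg c(1)]] gs(2) by blast
  then have *: "Comp FP (Fun w) D (Fun y) \<gamma>' t = Comp FP (Fun w) (Fun x) (Fun y) ?p (psi_map w x ?g)"
    unfolding e(2) c(2) using psi_map_Comp[OF w x y lg c(1)] by simp
  let ?l = "Comp FP (Fun w) (Fun x) B \<beta> (psi_map w x ?g)"
  note ga = psi_map_Arr[OF w x lg]
  have l: "?l \<in> Arr FP (Fun w) B" using F H ga bA by simp
  have "Comp FP (Fun w) D (Fun y) \<gamma>' (Comp FP (Fun w) B D p ?l) = Comp FP (Fun w) D (Fun y) \<gamma>' t"
    unfolding * using F H ga bA p(2) g(2) by (simp add: FP.Comp_assoc)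
  then have "Comp FP (Fun w) D D (Comp FP D (Fun y) D \<gamma> \<gamma>') (Comp FP (Fun w) B D p ?l) = Comp FP (Fun w) D D (Comp FP D (Fun y) D \<gamma> \<gamma>') t"
    using F H(1-3) l p(2) g(2,4) t FP.Comp_assoc' FP.Comp_closed by metis
  then have "Comp FP (Fun w) B D p ?l = t" unfolding g(3) using F H l p(2) t by simp
  then show "\<exists>s\<in>Arr FP (Fun w) B. Comp FP (Fun w) B D p s = t" using l by blast
qed

end

context resolving_setting
begin

text \<open>With \<open>w\<close> covering \<open>Cok x\<close>, the kernel of \<open>Fun w \<rightarrow> Fun x\<close> is presented by the pullback of \<open>q x\<close>
  along the projective cover.\<close>

lemma Fun_cover_exact:
  assumes x: "x \<in> Obj S"
  obtains w z m n where "w \<in> Obj S" "Mid w \<in> prj \<Lambda>" "z \<in> Obj S" "short_exact FP (Fun z) m (Fun w) n (Fun x)"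
proof -
  obtain w k k' where w: "w \<in> Obj S" "Mid w \<in> prj \<Lambda>" and k: "k \<in> Arr M (Cok w) (Cok x)" "k' \<in> Arr M (Cok x) (Cok w)"
    "cp (Cok w) (Cok x) (Cok w) k' k = Ident M (Cok w)" "cp (Cok x) (Cok w) (Cok x) k k' = Ident M (Cok x)"
    and lk: "liftable w x k" using cover_object[OF x] by metis
  note X = SD[OF x] and W = SD[OF w(1)]
  let ?p = "cp (Mid w) (Cok w) (Cok x) k (q w)"
  have ki: "iso_arr M (Cok w) k (Cok x)" using k W X unfolding iso_arr_def by auto
  have p: "epi M (Mid w) ?p (Cok x)" by (rule C.epi_comp[OF W(6) C.iso_epi[OF ki]])
  have pA: "?p \<in> Arr M (Mid w) (Cok x)" using p by (simp add: epi_def)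
  have kp: "cp (Mid w) (Cok x) (Cok w) k' ?p = q w" using W X k by (simp add: C.Comp_assoc)
  obtain E u v where E: "E \<in> \<XX>" "epi M E u (Mid x)" "v \<in> Arr M E (Mid w)"
    "cp E (Mid x) (Cok x) (q x) u = cp E (Mid w) (Cok x) ?p v"
    and univ: "\<forall>T\<in>Obj M. \<forall>s\<in>Arr M T (Mid x). \<forall>t\<in>Arr M T (Mid w). cp T (Mid x) (Cok x) (q x) s = cp T (Mid w) (Cok x) ?p t \<longrightarrow>
      (\<exists>h. h \<in> Arr M T E \<and> cp T E (Mid x) u h = s \<and> cp T E (Mid w) v h = t)"
    using X_pullback[OF X(6) p X(1) W(1) X(2)] by metis
  have EO: "E \<in> Obj M" "u \<in> Arr M E (Mid x)" using E(2) by (simp_all add: epi_def)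
  obtain z l l' where z: "z \<in> Obj S" "Mid z = E" "l \<in> Arr M (Cok z) (Mid x)" "l' \<in> Arr M (Mid x) (Cok z)"
    "cp (Cok z) (Mid x) (Cok z) l' l = Ident M (Cok z)" "cp (Mid x) (Cok z) (Mid x) l l' = Ident M (Mid x)"
    "cp E (Cok z) (Mid x) l (q z) = u" "cp E (Mid x) (Cok z) l' u = q z"
    using epi_object[OF E(2,1) X(1)] by metis
  note Z = SD[OF z(1)]
  let ?ql = "cp (Cok z) (Mid x) (Cok x) (q x) l"
  \<comment> \<open>\<open>Cok z \<cong> Mid x \<rightarrow> Cok x \<cong> Cok w\<close>\<close>
  define m where "m = cp (Cok z) (Cok x) (Cok w) k' ?ql"
  have mA: "m \<in> Arr M (Cok z) (Cok w)" unfolding m_def using Z X W k z(3) by simp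
  have km: "cp (Cok z) (Cok w) (Cok x) k m = ?ql"
    unfolding m_def using Z X W k z(3) by (simp add: C.Comp_assoc)
  have ml': "cp (Mid x) (Cok z) (Cok w) m l' = cp (Mid x) (Cok x) (Cok w) k' (q x)"
  proof -
    have "cp (Mid x) (Cok z) (Cok w) m l' = cp (Mid x) (Cok x) (Cok w) k' (cp (Mid x) (Mid x) (Cok x) (q x) (cp (Mid x) (Cok z) (Mid x) l l'))"
      unfolding m_def using Z X W k(2) z(3,4) by (simp add: C.Comp_assoc del: z(6))
    then show ?thesis unfolding z(6) using X by simp
  qed
  have mq: "cp E (Cok z) (Cok w) m (q z) = cp E (Mid w) (Cok w) (q w) v"
  proof -
    have "cp E (Cok z) (Cok w) m (q z) = cp E (Cok x) (Cok w) k' (cp E (Mid x) (Cok x) (q x) (cp E (Cok z) (Mid x) l (q z)))"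
      unfolding m_def using Z(3-5)[unfolded z(2)] X(3-5) W(3-5) k(2) z(3) by (simp add: C.Comp_assoc)
    also have "\<dots> = cp E (Mid w) (Cok w) (cp (Mid w) (Cok x) (Cok w) k' ?p) v"
      unfolding z(7) E(4) using EO(1) X W pA k(2) E(3) by (simp add: C.Comp_assoc)
    finally show ?thesis unfolding kp .
  qed
  have lm: "liftable z w m" unfolding liftable_def using mA mq E(3) z(2) by auto
  note F = Fun_Obj[OF z(1)] Fun_Obj[OF w(1)] Fun_Obj[OF x]
  have "short_exact FP (Fun z) (psi_map z w m) (Fun w) (psi_map w x k) (Fun x)"
  proof (rule FP.short_exact_test[OF F psi_map_Arr[OF z(1) w(1) lm] psi_map_Arr[OF w(1) x lk], where W = "Fun ` Obj S"])
    have "psi_map z x (cp (Cok z) (Cok w) (Cok x) k m) = Zero FP (Fun z) (Fun x)"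
      using psi_map_eq_zero_iff[OF z(1) x liftable_comp[OF z(1) w(1) x lm lk]] km z(3) by blast
    then show "Comp FP (Fun z) (Fun w) (Fun x) (psi_map w x k) (psi_map z w m) = Zero FP (Fun z) (Fun x)"
      unfolding psi_map_Comp[OF z(1) w(1) x lm lk] .
    show "Fun ` Obj S \<subseteq> Obj FP" using Fun_Obj by blast
    show "\<exists>v\<in>Fun ` Obj S. \<exists>a. iso_arr FP v a T" if "T \<in> Obj FP" for T using Fun_dense[OF that] by blast
  next
    fix V t assume "V \<in> Fun ` Obj S" and t: "t \<in> Arr FP V (Fun w)" "Comp FP V (Fun w) (Fun x) (psi_map w x k) t = Zero FP V (Fun x)"
    then obtain y where y: "y \<in> Obj S" "V = Fun y" by blast
    note Y = SD[OF y(1)]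
    obtain c where c: "liftable y w c" "t = psi_map y w c" using psi_map_full[OF y(1) w(1)] t(1) y(2) by blast
    obtain b where b: "c \<in> Arr M (Cok y) (Cok w)" "b \<in> Arr M (Mid y) (Mid w)"
      "cp (Mid y) (Cok y) (Cok w) c (q y) = cp (Mid y) (Mid w) (Cok w) (q w) b" using c(1) by (auto simp: liftable_def)
    have "psi_map y x (cp (Cok y) (Cok w) (Cok x) k c) = Zero FP (Fun y) (Fun x)"
      using t(2) unfolding y(2) c(2) psi_map_Comp[OF y(1) w(1) x c(1) lk] .
    then obtain s where s: "s \<in> Arr M (Cok y) (Mid x)" "cp (Cok y) (Cok w) (Cok x) k c = cp (Cok y) (Mid x) (Cok x) (q x) s"
      using psi_map_eq_zero_iff[OF y(1) x liftable_comp[OF y(1) w(1) x c(1) lk]] by blast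
    have "cp (Mid y) (Mid x) (Cok x) (q x) (cp (Mid y) (Cok y) (Mid x) s (q y)) = cp (Mid y) (Cok y) (Cok x) (cp (Cok y) (Cok w) (Cok x) k c) (q y)"
      unfolding s(2) using Y X s(1) by (simp add: C.Comp_assoc)
    also have "\<dots> = cp (Mid y) (Cok w) (Cok x) k (cp (Mid y) (Cok y) (Cok w) c (q y))"
      using Y X W k(1) b(1) by (simp add: C.Comp_assoc del: b(3))
    also have "\<dots> = cp (Mid y) (Mid w) (Cok x) ?p b" unfolding b(3) using Y X W k(1) b(2) by (simp add: C.Comp_assoc)
    \<comment> \<open>the pullback property makes the map induced by \<open>s\<close> liftable\<close>
    finally obtain h where h: "h \<in> Arr M (Mid y) E" "cp (Mid y) E (Mid x) u h = cp (Mid y) (Cok y) (Mid x) s (q y)"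
      using univ[rule_format, OF Y(3) _ b(2)] Y X s(1) by (metis C.Comp_closed)
    let ?g = "cp (Cok y) (Mid x) (Cok z) l' s"
    have g: "?g \<in> Arr M (Cok y) (Cok z)" using Y X Z z(4) s(1) by simp
    have "cp (Mid y) (Cok y) (Cok z) ?g (q y) = cp (Mid y) (Mid x) (Cok z) l' (cp (Mid y) E (Mid x) u h)"
      unfolding h(2) using Y X Z z(4) s(1) by (simp add: C.Comp_assoc)
    also have "\<dots> = cp (Mid y) E (Cok z) (q z) h"
      unfolding z(8)[symmetric] using Y X Z z(4) EO h(1) by (simp add: C.Comp_assoc)
    finally have lg: "liftable y z ?g" unfolding liftable_def using g h(1) z(2) by auto
    have "cp (Cok y) (Cok z) (Cok w) m ?g = cp (Cok y) (Mid x) (Cok w) (cp (Mid x) (Cok z) (Cok w) m l') s"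
      using Y Z X W mA z(4) s(1) by (simp add: C.Comp_assoc)
    also have "\<dots> = cp (Cok y) (Cok x) (Cok w) k' (cp (Cok y) (Cok w) (Cok x) k c)"
      unfolding ml' s(2) using Y X W k(2) s(1) by (simp add: C.Comp_assoc)
    also have "\<dots> = c" using Y X W k b(1) by (simp add: C.Comp_assoc)
    finally have "Comp FP (Fun y) (Fun z) (Fun w) (psi_map z w m) (psi_map y z ?g) = t"
      unfolding psi_map_Comp[OF y(1) z(1) w(1) lg lm] c(2) by simp
    then show "\<exists>s. s \<in> Arr FP V (Fun z) \<and> Comp FP V (Fun z) (Fun w) (psi_map z w m) s = t"
      unfolding y(2) using psi_map_Arr[OF y(1) z(1) lg] by blast
  next
    fix V t assume "V \<in> Fun ` Obj S" and t: "t \<in> Arr FP V (Fun z)" "Comp FP V (Fun z) (Fun w) (psi_map z w m) t = Zero FP V (Fun w)"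
    then obtain y where y: "y \<in> Obj S" "V = Fun y" by blast
    note Y = SD[OF y(1)]
    obtain g where g: "liftable y z g" "t = psi_map y z g" using psi_map_full[OF y(1) z(1)] t(1) y(2) by blast
    have gA: "g \<in> Arr M (Cok y) (Cok z)" using g(1) by (simp add: liftable_def)
    have "psi_map y w (cp (Cok y) (Cok z) (Cok w) m g) = Zero FP (Fun y) (Fun w)"
      using t(2) unfolding y(2) g(2) psi_map_Comp[OF y(1) z(1) w(1) g(1) lm] .
    then obtain s where s: "s \<in> Arr M (Cok y) (Mid w)" "cp (Cok y) (Cok z) (Cok w) m g = cp (Cok y) (Mid w) (Cok w) (q w) s"
      using psi_map_eq_zero_iff[OF y(1) w(1) liftable_comp[OF y(1) z(1) w(1) g(1) lm]] by blast
    have lgA: "cp (Cok y) (Cok z) (Mid x) l g \<in> Arr M (Cok y) (Mid x)" using Y Z X z(3) gA by simp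
    have "cp (Cok y) (Mid x) (Cok x) (q x) (cp (Cok y) (Cok z) (Mid x) l g) = cp (Cok y) (Cok w) (Cok x) k (cp (Cok y) (Cok z) (Cok w) m g)"
    proof -
      have "cp (Cok y) (Cok w) (Cok x) k (cp (Cok y) (Cok z) (Cok w) m g) = cp (Cok y) (Cok z) (Cok x) (cp (Cok z) (Cok w) (Cok x) k m) g"
        using Y Z W X k(1) mA gA by (simp add: C.Comp_assoc)
      then show ?thesis unfolding km using Y Z X z(3) gA by (simp add: C.Comp_assoc)
    qed
    also have "\<dots> = cp (Cok y) (Mid w) (Cok x) ?p s"
      unfolding s(2) using Y W X k(1) s(1) by (simp add: C.Comp_assoc)
    finally obtain h where h: "h \<in> Arr M (Cok y) E" "cp (Cok y) E (Mid x) u h = cp (Cok y) (Cok z) (Mid x) l g"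
      using univ[rule_format, OF Y(4) lgA s(1)] by blast
    have "g = cp (Cok y) (Mid x) (Cok z) l' (cp (Cok y) (Cok z) (Mid x) l g)"
      using Y Z X z(3,4,5) gA by (simp add: C.Comp_assoc)
    also have "\<dots> = cp (Cok y) E (Cok z) (q z) h"
      unfolding h(2)[symmetric] z(8)[symmetric] using Y X Z z(4) EO h(1) by (simp add: C.Comp_assoc)
    finally show "t = Zero FP V (Fun z)"
      unfolding y(2) g(2) using psi_map_eq_zero_iff[OF y(1) z(1) g(1)] h(1) z(2) by auto
  next
    fix V t assume "V \<in> Fun ` Obj S" and t: "t \<in> Arr FP (Fun w) V" "Comp FP (Fun z) (Fun w) V t (psi_map z w m) = Zero FP (Fun z) V"
    then obtain y where y: "y \<in> Obj S" "V = Fun y" by blast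
    note Y = SD[OF y(1)]
    obtain c where c: "liftable w y c" "t = psi_map w y c" using psi_map_full[OF w(1) y(1)] t(1) y(2) by blast
    have cA: "c \<in> Arr M (Cok w) (Cok y)" using c(1) by (simp add: liftable_def)
    have "psi_map z y (cp (Cok z) (Cok w) (Cok y) c m) = Zero FP (Fun z) (Fun y)"
      using t(2) unfolding y(2) c(2) psi_map_Comp[OF z(1) w(1) y(1) lm c(1)] .
    then obtain s where s: "s \<in> Arr M (Cok z) (Mid y)" "cp (Cok z) (Cok w) (Cok y) c m = cp (Cok z) (Mid y) (Cok y) (q y) s"
      using psi_map_eq_zero_iff[OF z(1) y(1) liftable_comp[OF z(1) w(1) y(1) lm c(1)]] by blast
    let ?g = "cp (Cok x) (Cok w) (Cok y) c k'" and ?b = "cp (Mid x) (Cok z) (Mid y) s l'"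
    have g: "?g \<in> Arr M (Cok x) (Cok y)" "?b \<in> Arr M (Mid x) (Mid y)" using Y X W Z k(2) cA s(1) z(4) by simp_all
    have "cp (Mid x) (Cok x) (Cok y) ?g (q x) = cp (Mid x) (Cok w) (Cok y) c (cp (Mid x) (Cok z) (Cok w) m l')"
      unfolding ml' using Y X W k(2) cA by (simp add: C.Comp_assoc)
    also have "\<dots> = cp (Mid x) (Cok z) (Cok y) (cp (Cok z) (Cok w) (Cok y) c m) l'"
      using Y X W Z mA cA z(4) by (simp add: C.Comp_assoc)
    also have "\<dots> = cp (Mid x) (Mid y) (Cok y) (q y) ?b" unfolding s(2) using Y X Z z(4) s(1) by (simp add: C.Comp_assoc)
    finally have lg: "liftable x y ?g" unfolding liftable_def using g by blast
    have "cp (Cok w) (Cok x) (Cok y) ?g k = cp (Cok w) (Cok w) (Cok y) c (cp (Cok w) (Cok x) (Cok w) k' k)"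
      using Y X W k(1,2) cA by (simp add: C.Comp_assoc)
    then have "cp (Cok w) (Cok x) (Cok y) ?g k = c" unfolding k(3) using Y W cA by simp
    then have "Comp FP (Fun w) (Fun x) (Fun y) (psi_map x y ?g) (psi_map w x k) = t"
      unfolding psi_map_Comp[OF w(1) x y(1) lk lg] c(2) by simp
    then show "\<exists>s. s \<in> Arr FP (Fun x) V \<and> Comp FP (Fun w) (Fun x) V s (psi_map w x k) = t"
      unfolding y(2) using psi_map_Arr[OF x y(1) lg] by blast
  next
    fix V t assume "V \<in> Fun ` Obj S" and t: "t \<in> Arr FP (Fun x) V" "Comp FP (Fun w) (Fun x) V t (psi_map w x k) = Zero FP (Fun w) V"
    then obtain y where y: "y \<in> Obj S" "V = Fun y" by blast
    note Y = SD[OF y(1)]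
    obtain g where g: "liftable x y g" "t = psi_map x y g" using psi_map_full[OF x y(1)] t(1) y(2) by blast
    have gA: "g \<in> Arr M (Cok x) (Cok y)" using g(1) by (simp add: liftable_def)
    have "psi_map w y (cp (Cok w) (Cok x) (Cok y) g k) = Zero FP (Fun w) (Fun y)"
      using t(2) unfolding y(2) g(2) psi_map_Comp[OF w(1) x y(1) lk g(1)] .
    then obtain s where s: "s \<in> Arr M (Cok w) (Mid y)" "cp (Cok w) (Cok x) (Cok y) g k = cp (Cok w) (Mid y) (Cok y) (q y) s"
      using psi_map_eq_zero_iff[OF w(1) y(1) liftable_comp[OF w(1) x y(1) lk g(1)]] by blast
    have "g = cp (Cok x) (Cok x) (Cok y) g (cp (Cok x) (Cok w) (Cok x) k k')" using X Y gA k(4) by simp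
    also have "\<dots> = cp (Cok x) (Cok w) (Cok y) (cp (Cok w) (Cok x) (Cok y) g k) k'" using X Y W gA k(1,2) by (simp add: C.Comp_assoc)
    also have "\<dots> = cp (Cok x) (Mid y) (Cok y) (q y) (cp (Cok x) (Cok w) (Mid y) s k')"
      unfolding s(2) using X Y W s(1) k(2) by (simp add: C.Comp_assoc)
    finally show "t = Zero FP (Fun x) V"
      unfolding y(2) g(2) using psi_map_eq_zero_iff[OF x y(1) g(1)] X Y W s(1) k(2) C.Comp_closed by metis
  qed
  then show thesis using that[OF w z(1)] by blast
qed

abbreviation J where "J \<equiv> stable_ideal (fp_cat (stable_X_cat \<Lambda> \<XX>) :: ('r sfun, 'r snat) precat) (short_exact (fp_cat (stable_X_cat \<Lambda> \<XX>)))"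

text \<open>A projective functor is a retract of \<open>Fun w\<close> for some \<open>w\<close> with projective \<open>Mid w\<close>.  So a morphism in \<open>J\<close>
  is induced by a map through \<open>Cok w\<close>, which becomes a map through \<open>Mid w\<close> when restricted along \<open>q x\<close>.\<close>

lemma J_Fun_D:
  assumes x: "x \<in> Obj S" and y: "y \<in> Obj S" and th: "\<theta> \<in> J (Fun x) (Fun y)"
  shows "\<exists>c. c \<in> Arr M (Cok x) (Cok y) \<and> cp (Mid x) (Cok x) (Cok y) c (q x) \<in> N (Mid x) (Cok y) \<and> \<theta> = psi_map x y c"
proof -
  obtain F f g where F: "projective FP (short_exact FP) F" "F \<in> Obj FP" "f \<in> Arr FP (Fun x) F" "g \<in> Arr FP F (Fun y)"
    "\<theta> = Comp FP (Fun x) F (Fun y) g f"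
    using th unfolding stable_ideal_def factoring_through_def by blast
  obtain v a where v: "v \<in> Obj S" "iso_arr FP (Fun v) a F" using Fun_dense[OF F(2)] by blast
  obtain a' where a: "a \<in> Arr FP (Fun v) F" "a' \<in> Arr FP F (Fun v)" "Comp FP F (Fun v) F a a' = Ident FP F"
    using v(2) by (auto simp: iso_arr_def)
  obtain w z m n where w: "w \<in> Obj S" "Mid w \<in> prj \<Lambda>" and z: "z \<in> Obj S" "short_exact FP (Fun z) m (Fun w) n (Fun v)"
    using Fun_cover_exact[OF v(1)] by metis
  note O = Fun_Obj[OF x] Fun_Obj[OF y] Fun_Obj[OF v(1)] Fun_Obj[OF w(1)] F(2)
  note se = FP.short_exactD[OF z(2)]
  obtain \<sigma> where s: "\<sigma> \<in> Arr FP F (Fun w)" "Comp FP F (Fun w) (Fun v) n \<sigma> = a'"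
    using F(1) z(2) se a(2) unfolding projective_def by blast
  let ?s = "Comp FP (Fun x) F (Fun w) \<sigma> f" and ?t = "Comp FP (Fun w) F (Fun y) g (Comp FP (Fun w) (Fun v) F a n)"
  have st: "?s \<in> Arr FP (Fun x) (Fun w)" "?t \<in> Arr FP (Fun w) (Fun y)" using O F s(1) a(1) se(5) by simp_all
  have "Comp FP (Fun x) (Fun w) (Fun y) ?t ?s
      = Comp FP (Fun x) F (Fun y) g (Comp FP (Fun x) F F (Comp FP F (Fun v) F a (Comp FP F (Fun w) (Fun v) n \<sigma>)) f)"
    using O F(3,4) s(1) a(1) se(5) by (simp add: FP.Comp_assoc)
  then have th': "\<theta> = Comp FP (Fun x) (Fun w) (Fun y) ?t ?s" unfolding s(2) a(3) F(5) using O F(3,4) by simp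
  obtain d where d: "liftable x w d" "?s = psi_map x w d" using psi_map_full[OF x w(1) st(1)] by blast
  obtain e where e: "liftable w y e" "?t = psi_map w y e" using psi_map_full[OF w(1) y st(2)] by blast
  obtain b where b: "d \<in> Arr M (Cok x) (Cok w)" "b \<in> Arr M (Mid x) (Mid w)"
    "cp (Mid x) (Cok x) (Cok w) d (q x) = cp (Mid x) (Mid w) (Cok w) (q w) b" using d(1) by (auto simp: liftable_def)
  have eA: "e \<in> Arr M (Cok w) (Cok y)" using e(1) by (simp add: liftable_def)
  note X = SD[OF x] and Y = SD[OF y] and W = SD[OF w(1)]
  let ?c = "cp (Cok x) (Cok w) (Cok y) e d"
  have "cp (Mid x) (Cok x) (Cok y) ?c (q x) = cp (Mid x) (Cok w) (Cok y) e (cp (Mid x) (Cok x) (Cok w) d (q x))"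
    using X Y W b(1) eA by (simp add: C.Comp_assoc del: b(3))
  also have "\<dots> = cp (Mid x) (Mid w) (Cok y) (cp (Mid w) (Cok w) (Cok y) e (q w)) b"
    unfolding b(3) using X Y W b(2) eA by (simp add: C.Comp_assoc)
  also have "\<dots> \<in> N (Mid x) (Cok y)" by (rule NI[OF w(2) b(2)]) (use W Y eA in simp)
  finally have "cp (Mid x) (Cok x) (Cok y) ?c (q x) \<in> N (Mid x) (Cok y)" .
  then show ?thesis
    using th' psi_map_Comp[OF x w(1) y d(1) e(1)] d(2) e(2) X Y W b(1) eA by (intro exI[of _ ?c]) simp
qed

text \<open>The map \<open>c\<close> factors through the functor that belongs to a projective cover of \<open>Cok y\<close>: the hypothesis makes
  its composite with \<open>Cok y \<cong> Cok w\<close> liftable.\<close>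

lemma J_Fun_I:
  assumes x: "x \<in> Obj S" and y: "y \<in> Obj S" and c: "c \<in> Arr M (Cok x) (Cok y)"
    and n: "cp (Mid x) (Cok x) (Cok y) c (q x) \<in> N (Mid x) (Cok y)"
  shows "psi_map x y c \<in> J (Fun x) (Fun y)"
proof -
  obtain w k k' where w: "w \<in> Obj S" "Mid w \<in> prj \<Lambda>" and k: "k \<in> Arr M (Cok w) (Cok y)" "k' \<in> Arr M (Cok y) (Cok w)"
    "cp (Cok w) (Cok y) (Cok w) k' k = Ident M (Cok w)" "cp (Cok y) (Cok w) (Cok y) k k' = Ident M (Cok y)"
    and lk: "liftable w y k" using cover_object[OF y] by metis
  note X = SD[OF x] and Y = SD[OF y] and W = SD[OF w(1)]
  let ?d = "cp (Cok x) (Cok y) (Cok w) k' c"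
  have "cp (Mid x) (Cok y) (Cok w) k' (cp (Mid x) (Cok x) (Cok y) c (q x)) \<in> N (Mid x) (Cok w)"
    by (rule N.I_Comp_left) (use X Y W k n in simp_all)
  then have ld: "liftable x w ?d"
    by (intro liftable_N x w(1)) (use X Y W k(2) c in \<open>simp_all add: C.Comp_assoc\<close>)
  have "cp (Cok x) (Cok w) (Cok y) k ?d = c" using X Y W k c by (simp add: C.Comp_assoc)
  then have "psi_map x y c = Comp FP (Fun x) (Fun w) (Fun y) (psi_map w y k) (psi_map x w ?d)"
    using psi_map_Comp[OF x w(1) y ld lk] by simp
  then show ?thesis
    unfolding stable_ideal_def
    using FP.factoring_throughI[of "Fun w" "{P. projective FP (short_exact FP) P}", OF _ Fun_Obj[OF w(1)]
        psi_map_Arr[OF x w(1) ld] psi_map_Arr[OF w(1) y lk]] Fun_projective[OF w] by simp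
qed

text \<open>Closure under addition is checked between functors of the form \<open>Fun x\<close>, where the description of \<open>J\<close> is
  additive, and transported along isomorphisms.\<close>

lemma J_ideal: "category_ideal FP J"
  unfolding stable_ideal_def
proof (rule FP.factoring_through_ideal)
  obtain x where "x \<in> Obj S" using S_zero_exists by blast
  then obtain w where w: "w \<in> Obj S" "Mid w \<in> prj \<Lambda>" using cover_object by metis
  then show "{P. projective (FP :: ('r sfun, 'r snat) precat) (short_exact FP) P} \<inter> Obj FP \<noteq> {}" using Fun_projective[OF w] Fun_Obj[OF w(1)] by blast
next
  let ?Q = "factoring_through (FP :: ('r sfun, 'r snat) precat) {P. projective FP (short_exact FP) P}"
  have Q: "?Q = J" by (simp add: stable_ideal_def)
  fix A B f g assume A: "A \<in> Obj FP" and B: "B \<in> Obj FP" and f: "f \<in> ?Q A B" and g: "g \<in> ?Q A B"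
  note fA = FP.factoring_through_Arr[OF A B f] and gA = FP.factoring_through_Arr[OF A B g]
  obtain x a where x: "x \<in> Obj S" "iso_arr FP (Fun x) a A" using Fun_dense[OF A] by blast
  obtain y b where y: "y \<in> Obj S" "iso_arr FP (Fun y) b B" using Fun_dense[OF B] by blast
  obtain a' where a: "a \<in> Arr FP (Fun x) A" "a' \<in> Arr FP A (Fun x)" "Comp FP A (Fun x) A a a' = Ident FP A"
    using x(2) by (auto simp: iso_arr_def)
  obtain b' where b: "b \<in> Arr FP (Fun y) B" "b' \<in> Arr FP B (Fun y)" "Comp FP B (Fun y) B b b' = Ident FP B"
    using y(2) by (auto simp: iso_arr_def)
  note F = Fun_Obj[OF x(1)] Fun_Obj[OF y(1)]
  let ?t = "\<lambda>f. Comp FP (Fun x) B (Fun y) b' (Comp FP (Fun x) A B f a)"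
  let ?u = "\<lambda>f. Comp FP A (Fun y) B b (Comp FP A (Fun x) (Fun y) f a')"
  have ut: "?u (?t h) = h" if h: "h \<in> Arr FP A B" for h
  proof -
    have "?u (?t h) = Comp FP A B B (Comp FP B (Fun y) B b b') (Comp FP A A B h (Comp FP A (Fun x) A a a'))"
      using A B F h a(1,2) b(1,2) by (simp add: FP.Comp_assoc)
    then show ?thesis unfolding a(3) b(3) using A B h by simp
  qed
  have t: "?t h \<in> J (Fun x) (Fun y)" if "h \<in> ?Q A B" for h
    unfolding Q[symmetric]
    by (rule FP.factoring_through_left[OF F(1) B F(2) FP.factoring_through_right[OF F(1) A B a(1) that] b(2)])
  obtain c where c: "c \<in> Arr M (Cok x) (Cok y)" "cp (Mid x) (Cok x) (Cok y) c (q x) \<in> N (Mid x) (Cok y)" "?t f = psi_map x y c"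
    using J_Fun_D[OF x(1) y(1) t[OF f]] by blast
  obtain d where d: "d \<in> Arr M (Cok x) (Cok y)" "cp (Mid x) (Cok x) (Cok y) d (q x) \<in> N (Mid x) (Cok y)" "?t g = psi_map x y d"
    using J_Fun_D[OF x(1) y(1) t[OF g]] by blast
  note X = SD[OF x(1)] and Y = SD[OF y(1)]
  let ?e = "ad (Cok x) (Cok y) c d"
  have lc: "liftable x y c" and ld: "liftable x y d" using liftable_N[OF x(1) y(1)] c d by simp_all
  have "ad (Mid x) (Cok y) (cp (Mid x) (Cok x) (Cok y) c (q x)) (cp (Mid x) (Cok x) (Cok y) d (q x)) \<in> N (Mid x) (Cok y)"
    by (rule N.I_add[OF X(3) Y(4) c(2) d(2)])
  then have "psi_map x y ?e \<in> J (Fun x) (Fun y)"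
    by (intro J_Fun_I x(1) y(1)) (use X Y c(1) d(1) in \<open>simp_all add: C.Comp_add_left\<close>)
  then have "?u (psi_map x y ?e) \<in> ?Q A B"
    unfolding Q[symmetric] using FP.factoring_through_left[OF A F(2) B FP.factoring_through_right[OF A F a(2)] b(1)] by blast
  moreover have "?u (psi_map x y ?e) = f \<otimes>\<^bsub>Hom FP A B\<^esub> g"
  proof -
    note tA = psi_map_Arr[OF x(1) y(1) lc] psi_map_Arr[OF x(1) y(1) ld]
    have "?u (psi_map x y ?e) = ?u (psi_map x y c) \<otimes>\<^bsub>Hom FP A B\<^esub> ?u (psi_map x y d)"
      unfolding psi_map_add[OF x(1) y(1) lc ld] using A B F tA a(2) b(1) by (simp add: FP.Comp_add_left FP.Comp_add_right)
    also have "\<dots> = f \<otimes>\<^bsub>Hom FP A B\<^esub> g" unfolding c(3)[symmetric] d(3)[symmetric] ut[OF fA] ut[OF gA] ..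
    finally show ?thesis .
  qed
  ultimately show "f \<otimes>\<^bsub>Hom FP A B\<^esub> g \<in> ?Q A B" by simp
qed

lemma stably_trivial_iff:
  assumes x: "x \<in> Obj S" and y: "y \<in> Obj S"
  shows "stably_trivial x y = {ab \<in> Arr S x y. FArr \<Psi> x y ab \<in> J (FObj \<Psi> x) (FObj \<Psi> y)}"
proof -
  have "(\<exists>c s. c \<in> Arr M (Cok x) (Cok y) \<and> s \<in> Arr M (Cok x) (Mid y) \<and>
    cp (Mid x) (Cok x) (Cok y) c (q x) \<in> N (Mid x) (Cok y) \<and>
    ind x y ab = ad (Cok x) (Cok y) c (cp (Cok x) (Mid y) (Cok y) (q y) s))
    \<longleftrightarrow> psi_map x y (ind x y ab) \<in> J (Fun x) (Fun y)" (is "?L \<longleftrightarrow> ?R") if ab: "ab \<in> Arr S x y" for ab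
  proof
    assume ?L
    then obtain c s where cs: "c \<in> Arr M (Cok x) (Cok y)" "s \<in> Arr M (Cok x) (Mid y)"
      "cp (Mid x) (Cok x) (Cok y) c (q x) \<in> N (Mid x) (Cok y)"
      "ind x y ab = ad (Cok x) (Cok y) c (cp (Cok x) (Mid y) (Cok y) (q y) s)" by blast
    have "psi_map x y (ind x y ab) = psi_map x y c"
      using psi_map_eq_iff[OF x y induced_liftable[OF x y ab] liftable_N[OF x y cs(1,3)]] cs(2,4) by blast
    then show ?R using J_Fun_I[OF x y cs(1,3)] by simp
  next
    assume ?R
    then obtain c where c: "c \<in> Arr M (Cok x) (Cok y)" "cp (Mid x) (Cok x) (Cok y) c (q x) \<in> N (Mid x) (Cok y)"
      "psi_map x y (ind x y ab) = psi_map x y c" using J_Fun_D[OF x y] by blast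
    then show ?L using psi_map_eq_iff[OF x y induced_liftable[OF x y ab] liftable_N[OF x y c(1,2)]] by blast
  qed
  then show ?thesis unfolding stably_trivial_def Psi_simps by blast
qed

end

section \<open>The three descriptions of the ideal\<close>

lemma (in category_ideal) Ident_direct_sum:
  assumes ds: "is_direct_sum C n A P" and A: "\<And>k. k < n \<Longrightarrow> Ident C (A k) \<in> I (A k) (A k)"
  shows "Ident C P \<in> I P P"
proof -
  obtain i p where ip: "\<And>k. k < n \<Longrightarrow> i k \<in> Arr C (A k) P" "\<And>k. k < n \<Longrightarrow> p k \<in> Arr C P (A k)"
    "finprod (Hom C P P) (\<lambda>k. Comp C P (A k) P (i k) (p k)) {..<n} = Ident C P"
    and O: "\<And>k. k < n \<Longrightarrow> A k \<in> Obj C" "P \<in> Obj C"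
    using ds unfolding is_direct_sum_def by blast
  have summand: "Comp C P (A k) P (i k) (p k) \<in> I P P" if k: "k < n" for k
  proof -
    have "Comp C P (A k) (A k) (Ident C (A k)) (p k) \<in> I P (A k)" by (rule I_Comp_right[OF O(2) O(1)[OF k] O(1)[OF k] ip(2)[OF k] A[OF k]])
    then have "p k \<in> I P (A k)" using O k ip by simp
    then show ?thesis by (rule I_Comp_left[OF O(2) O(1)[OF k] O(2) _ ip(1)[OF k]])
  qed
  have "finprod (Hom C P P) (\<lambda>k. Comp C P (A k) P (i k) (p k)) {..<m} \<in> I P P" if "m \<le> n" for m
    using that
  proof (induction m)
    case 0
    interpret comm_group "Hom C P P" by (rule Hom_comm_group[OF O(2,2)])
    show ?case using I_zero[OF O(2,2)] by simp
  next
    case (Suc m)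
    have "finprod (Hom C P P) (\<lambda>k. Comp C P (A k) P (i k) (p k)) {..<Suc m}
        = finprod (Hom C P P) (\<lambda>k. Comp C P (A k) P (i k) (p k)) {..<m} \<otimes>\<^bsub>Hom C P P\<^esub> Comp C P (A m) P (i m) (p m)"
      by (rule finprod_Arr_Suc[OF O(2,2)]) (use Suc.prems O ip in simp)
    then show ?case using I_add[OF O(2,2) Suc.IH summand[of m]] Suc.prems by simp
  qed
  from this[of n] show ?thesis using ip(3) by simp
qed

context resolving_setting
begin

text \<open>An object \<open>(A \<rightarrow> B)\<close> with cokernel \<open>D\<close> is the target of the conflation whose middle term is
  \<open>(A = A) \<oplus> (0 \<rightarrow> B) \<oplus> (\<Omega> D \<rightarrow> P\<^sub>D)\<close>: the first summand splits the map onto \<open>A\<close>, the second the map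
  onto \<open>B\<close> and the third the map onto \<open>D\<close>.  So these summands are enough projectives.\<close>

lemma projective_Ident_generated:
  assumes px: "projective S \<E> x"
  shows "Ident S x \<in> generated_ideal S \<V> x x"
proof -
  interpret S: preadditive_category S by (rule S_preadditive)
  have x: "x \<in> Obj S" using px by (simp add: projective_def)
  obtain A B f where xx: "x = (A, B, f)" "(A, B, f) \<in> Obj S" using S_ObjE[OF x] by metis
  note X = S_ObjD[OF xx(2)]
  let ?D = "Cok (A, B, f)"
  obtain Z0 where Z0: "zero_object M Z0" using zero_exists by auto
  obtain K P i p where P: "short_exact M K i P p ?D" "K \<in> \<XX>" "P \<in> \<XX>" "P \<in> prj \<Lambda>" "(K, P, i) \<in> \<V>"
    using cover_exact[OF X(3)] by metis
  note PO = C.short_exactD[OF P(1)]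
  have w: "(K, P, i) \<in> Obj S" by (rule S_ObjI(1)[OF P(1,2,3) X(3)])
  note W = S_ObjD[OF w]
  note a = X_id_object[OF X(1)] and b = X_zero_object(2,3)[OF X(2) Z0]
  obtain k where k: "iso_arr M (Cok (K, P, i)) k ?D" "k \<in> Arr M (Cok (K, P, i)) ?D" "cp P (Cok (K, P, i)) ?D k (q (K, P, i)) = p"
    using S_ObjI(2)[OF P(1,2,3) X(3)] by auto
  obtain k' where k': "k' \<in> Arr M ?D (Cok (K, P, i))" "cp ?D (Cok (K, P, i)) ?D k k' = Ident M ?D" using k(1) by (auto simp: iso_arr_def)
  obtain l where l: "l \<in> Arr M P B" "cp P B ?D (q (A, B, f)) l = p" using prj_lift[OF P(4) C.se_is_epi[OF X(4)] PO(5)] by auto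
  have lk: "cp P (Cok (K, P, i)) ?D k (q (K, P, i)) = cp P B ?D (q (A, B, f)) l" using k(3) l(2) by simp
  obtain t where t: "(t, l) \<in> Arr S (K, P, i) (A, B, f)" "ind (K, P, i) (A, B, f) (t, l) = k"
    using induced_lift[OF w xx(2) k(2) l(1) lk] by auto
  define V where "V = (\<lambda>n::nat. if n = 0 then (A, A, Ident M A) else if n = 1 then (Z0, B, Zero M Z0 B) else (K, P, i))"
  define g where "g = (\<lambda>n::nat. if n = 0 then (Ident M A, f) else if n = 1 then (Zero M Z0 A, Ident M B) else (t, l))"
  have VO: "V n \<in> Obj S" "V n \<in> \<V>" for n using a b w P(5) by (simp_all add: V_def)
  have Z0O: "Z0 \<in> Obj M" using Z0 by (simp add: zero_object_def)
  have gA: "g n \<in> Arr S (V n) x" for n using X t(1) Z0O by (simp add: g_def V_def xx(1))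
  obtain Z where Z: "Z \<in> Obj S" "is_direct_sum S 3 V Z" using S_direct_sum_exists[of 3 V] VO(1) by blast
  obtain j v where jv: "\<And>n. n < 3 \<Longrightarrow> j n \<in> Arr S (V n) Z" "v \<in> Arr S Z x" "\<And>n. n < 3 \<Longrightarrow> Comp S (V n) Z x v (j n) = g n"
    using S.direct_sum_copair[OF Z(2) x gA] by metis
  obtain Z1 Z2 h where ZZ: "Z = (Z1, Z2, h)" "(Z1, Z2, h) \<in> Obj S" using S_ObjE[OF Z(1)] by metis
  note ZO = S_ObjD[OF ZZ(2)]
  obtain v1 v2 where v: "v = (v1, v2)" by (metis surj_pair)
  obtain a1 a2 where j0: "j 0 = (a1, a2)" by (metis surj_pair)
  obtain b1 b2 where j1: "j 1 = (b1, b2)" by (metis surj_pair)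
  obtain c1 c2 where j2: "j 2 = (c1, c2)" by (metis surj_pair)
  have vA: "(v1, v2) \<in> Arr S (Z1, Z2, h) (A, B, f)" using jv(2) by (simp only: v ZZ(1) xx(1))
  have vD: "v1 \<in> Arr M Z1 A" "v2 \<in> Arr M Z2 B" "cp Z1 A B f v1 = cp Z1 Z2 B v2 h" using vA by simp_all
  have s1: "a1 \<in> Arr M A Z1" "cp A Z1 A v1 a1 = Ident M A"
    using jv(1)[of 0] jv(3)[of 0] by (simp_all add: j0 v g_def V_def ZZ(1) xx(1))
  have s2: "b2 \<in> Arr M B Z2" "cp B Z2 B v2 b2 = Ident M B"
    using jv(1)[of 1] jv(3)[of 1] unfolding j1 by (simp_all add: v g_def V_def ZZ(1) xx(1))
  have cA: "(c1, c2) \<in> Arr S (K, P, i) (Z1, Z2, h)" using jv(1)[of 2] unfolding j2 by (simp add: V_def ZZ(1))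
  have vc: "Comp S (K, P, i) (Z1, Z2, h) (A, B, f) (v1, v2) (c1, c2) = (t, l)"
    using jv(3)[of 2] unfolding j2 by (simp add: v g_def V_def ZZ(1) xx(1))
  let ?d = "ind (Z1, Z2, h) (A, B, f) (v1, v2)" and ?c = "ind (K, P, i) (Z1, Z2, h) (c1, c2)"
  note dA = induced(1,2)[OF ZZ(2) xx(2) vA] and ci = induced(1)[OF w ZZ(2) cA]
  have dc: "cp (Cok (K, P, i)) (Cok (Z1, Z2, h)) ?D ?d ?c = k" using induced_Comp[OF w ZZ(2) xx(2) cA vA] vc t(2) by simp
  let ?s = "cp ?D (Cok (K, P, i)) (Cok (Z1, Z2, h)) ?c k'"
  have s3: "?s \<in> Arr M ?D (Cok (Z1, Z2, h))" "cp ?D (Cok (Z1, Z2, h)) ?D ?d ?s = Ident M ?D"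
    using X W ZO dA(1) ci k' dc by (simp_all add: C.Comp_assoc)
  obtain y u where y: "y \<in> Obj S" "u \<in> Arr S y (Z1, Z2, h)" "\<E> y u (Z1, Z2, h) (v1, v2) (A, B, f)"
    using split_deflation[OF ZZ(2) xx(2) vD s1 s2 dA s3] by blast
  have "\<exists>s\<in>Arr S x Z. Comp S x Z x v s = Ident S x"
    using px y Z(1) x jv(2) S.Ident_closed[OF x] unfolding projective_def ZZ(1)[symmetric] xx(1)[symmetric] v[symmetric] by blast
  then obtain s where s: "s \<in> Arr S x Z" "Comp S x Z x v s = Ident S x" by blast
  have "Comp S x Z x v s \<in> factoring_through S {P. \<exists>n A. (\<forall>k<n. A k \<in> \<V>) \<and> is_direct_sum S n A P} x x"
    by (rule S.factoring_throughI[OF _ Z(1) s(1) jv(2)]) (use Z(2) VO(2) in blast)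
  then show ?thesis unfolding s(2) generated_ideal_def .
qed

lemma stably_trivial_ideal: "category_ideal S stably_trivial"
  by (rule preimage_ideal[OF Psi_functor J_ideal stably_trivial_iff])

text \<open>A cycle of inclusions.  A morphism through a projective object lies in the generated ideal since the
  identity of that object does.  The generated ideal consists of stably trivial morphisms since the identities of its generators
  are stably trivial.  A stably trivial morphism decomposes into three morphisms through generators, and these are
  projective.\<close>

lemma ideals_agree:
  assumes x: "x \<in> Obj S" and y: "y \<in> Obj S"
  shows "stable_ideal S \<E> x y = stably_trivial x y"
    and "generated_ideal S \<V> x y = stably_trivial x y"
proof -
  interpret S: category_ideal S stably_trivial by (rule stably_trivial_ideal)
  let ?V = "\<V>"
  have 1: "stable_ideal S \<E> x y \<subseteq> generated_ideal S ?V x y"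
  proof
    fix h assume "h \<in> stable_ideal S \<E> x y"
    then obtain P f g where P: "projective S \<E> P" "P \<in> Obj S" "f \<in> Arr S x P" "g \<in> Arr S P y" "h = Comp S x P y g f"
      unfolding stable_ideal_def factoring_through_def by blast
    have "Ident S P \<in> generated_ideal S ?V P P" by (rule projective_Ident_generated[OF P(1)])
    then have "Comp S x P P (Ident S P) f \<in> generated_ideal S ?V x P"
      unfolding generated_ideal_def by (rule S.factoring_through_right[OF x P(2,2,3)])
    then have "f \<in> generated_ideal S ?V x P" unfolding S.Comp_Ident_left[OF x P(2,3)] .
    then show "h \<in> generated_ideal S ?V x y"
      unfolding P(5) generated_ideal_def by (rule S.factoring_through_left[OF x P(2) y _ P(4)])
  qed
  have 2: "generated_ideal S ?V x y \<subseteq> stably_trivial x y"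
  proof
    fix h assume "h \<in> generated_ideal S ?V x y"
    then obtain P n A f g where P: "\<forall>k<n. A k \<in> ?V" "is_direct_sum S n A P" "P \<in> Obj S" "f \<in> Arr S x P" "g \<in> Arr S P y" "h = Comp S x P y g f"
      unfolding generated_ideal_def factoring_through_def by blast
    have "Ident S P \<in> stably_trivial P P" by (rule S.Ident_direct_sum[OF P(2)]) (use P(1) V_cases in blast)
    then have "Comp S x P P (Ident S P) f \<in> stably_trivial x P" by (rule S.I_Comp_right[OF x P(3,3,4)])
    then have "f \<in> stably_trivial x P" unfolding S.Comp_Ident_left[OF x P(3,4)] .
    then show "h \<in> stably_trivial x y" unfolding P(6) by (rule S.I_Comp_left[OF x P(3) y _ P(5)])
  qed
  have 3: "stably_trivial x y \<subseteq> stable_ideal S \<E> x y"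
  proof
    fix h assume "h \<in> stably_trivial x y"
    then obtain v g k where v: "\<forall>n<3. v n \<in> ?V \<and> k n \<in> Arr S x (v n) \<and> g n \<in> Arr S (v n) y"
      "h = finprod (Hom S x y) (\<lambda>n. Comp S x (v n) y (g n) (k n)) {..<3::nat}"
      using stably_trivial_decomposition[OF x y] by blast
    have vO: "v n \<in> Obj S" "projective S \<E> (v n)" "k n \<in> Arr S x (v n)" "g n \<in> Arr S (v n) y" if "n < 3" for n
      using v(1) V_cases that by blast+
    obtain P where P: "P \<in> Obj S" "is_direct_sum S 3 v P" using S_direct_sum_exists[of 3 v] vO(1) by blast
    obtain a b where ab: "a \<in> Arr S x P" "b \<in> Arr S P y" "h = Comp S x P y b a"
      using S.sum_factors_through_direct_sum[OF P(2) x y, of k g] vO(3,4) unfolding v(2) by blast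
    have "projective S \<E> P" by (rule S.projective_direct_sum[OF P(2) vO(2)])
    then show "h \<in> stable_ideal S \<E> x y"
      unfolding ab(3) stable_ideal_def by (intro S.factoring_throughI[OF _ P(1) ab(1,2)]) simp
  qed
  show "stable_ideal S \<E> x y = stably_trivial x y" "generated_ideal S ?V x y = stably_trivial x y"
    using 1 2 3 by blast+
qed

theorem Psi_induces_equivalences:
  "(\<exists>G. induces_on_factors S (stable_ideal S \<E>) FP J \<Psi> G \<and>
      equivalence_of_categories (factor_cat S (stable_ideal S \<E>)) (factor_cat FP J) G)"
  "(\<exists>H. equivalence_of_categories (factor_cat S (generated_ideal S \<V>)) (factor_cat FP J) H)"
proof -
  have dense: "\<exists>x\<in>Obj S. \<exists>f. iso_arr FP (FObj \<Psi> x) f Y" if "Y \<in> Obj FP" for Y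
    unfolding Psi_simps by (rule Fun_dense[OF that])
  show "\<exists>G. induces_on_factors S (stable_ideal S \<E>) FP J \<Psi> G \<and>
      equivalence_of_categories (factor_cat S (stable_ideal S \<E>)) (factor_cat FP J) G"
    by (rule full_dense_factor_equivalence[OF Psi_functor Psi_full dense J_ideal])
      (simp_all only: ideals_agree(1) stably_trivial_iff)
  show "\<exists>H. equivalence_of_categories (factor_cat S (generated_ideal S \<V>)) (factor_cat FP J) H"
    using full_dense_factor_equivalence[OF Psi_functor Psi_full dense J_ideal, of "generated_ideal S \<V>"]
    by (simp only: ideals_agree(2) stably_trivial_iff) blast
qed

end

section \<open>Resolving subcategories over an Artin algebra\<close>

text \<open>Zero objects are the empty direct sums, so a resolving subcategory contains them.\<close>

lemma resolving_imp_setting: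
  assumes art: "artin_algebra R \<Lambda> \<phi>" and res: "resolving \<Lambda> \<XX>"
  shows "resolving_setting \<Lambda> \<XX>"
proof -
  have ring: "ring \<Lambda>" using art by (simp add: artin_algebra_def)
  note mc = module_category.intro[OF ring]
  note amc = artin_module_category.intro[OF mc artin_module_category_axioms.intro[OF art]]
  let ?M = "mod_cat \<Lambda>"
  interpret C: preadditive_category ?M by (rule module_category.mod_cat_preadditive[OF mc])
  have O: "X \<in> Obj ?M" if "X \<in> \<XX>" for X using res that by (auto simp: resolving_def subcategory_def)
  have iso: "\<forall>X\<in>\<XX>. \<forall>B f. iso_arr ?M X f B \<longrightarrow> B \<in> \<XX>" using res unfolding resolving_def subcategory_def by (elim conjE)
  have sum: "B \<in> \<XX>" if "is_direct_sum ?M n X B" "\<forall>k<n. X k \<in> \<XX>" for n X B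
    using res that unfolding resolving_def by blast
  have ker: "K \<in> \<XX>" if "epi ?M B p D" "is_kernel ?M K i B p D" "B \<in> \<XX>" "D \<in> \<XX>" for K i B p D
    using res that unfolding resolving_def by blast
  obtain Z0 where Z0: "zero_object ?M Z0" using module_category.zero_module_exists[OF mc] by blast
  show ?thesis
  proof (unfold_locales)
    show "B \<in> \<XX>" if "X \<in> \<XX>" "iso_arr ?M X f B" for X f B using iso[rule_format, OF that] .
    show "\<exists>Z. zero_object ?M Z" using Z0 by blast
    show "Z \<in> \<XX>" if Z: "zero_object ?M Z" for Z
    proof (rule sum[of 0 "\<lambda>_. Z"])
      have ZO: "Z \<in> Obj ?M" using Z by (simp add: zero_object_def)
      interpret comm_group "Hom ?M Z Z" by (rule C.Hom_comm_group[OF ZO ZO])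
      have "Zero ?M Z Z = Ident ?M Z" using Z C.Ident_closed[OF ZO] by (auto simp: zero_object_def)
      then show "is_direct_sum ?M 0 (\<lambda>_. Z) Z" using ZO by (simp add: is_direct_sum_def)
    qed simp
    show "\<exists>S\<in>\<XX>. \<exists>i j p q. biproduct ?M X Y S i j p q" if "X \<in> \<XX>" "Y \<in> \<XX>" for X Y
    proof -
      have "\<exists>B\<in>Obj ?M. is_direct_sum ?M 2 (\<lambda>k. if k = 0 then X else Y) B"
        by (rule C.direct_sum_data_exists[OF Z0 _ subset_refl])
          (use Z0 module_category.biproduct_exists[OF mc] O that in \<open>auto simp: zero_object_def\<close>)
      then obtain B where B: "is_direct_sum ?M 2 (\<lambda>k. if k = 0 then X else Y) B" by blast
      have "B \<in> \<XX>" by (rule sum[OF B]) (use that in simp)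
      then show ?thesis using C.biproduct_of_direct_sum[OF B] by blast
    qed
    show "\<exists>K\<in>\<XX>. \<exists>i. short_exact ?M K i B p D" if e: "epi ?M B p D" and X: "B \<in> \<XX>" "D \<in> \<XX>" for B p D
    proof -
      have "p \<in> Arr ?M B D" using e by (simp add: epi_def)
      then obtain K i where K: "is_kernel ?M K i B p D" using artin_module_category.kernel_exists[OF amc O[OF X(1)] O[OF X(2)]] by blast
      show ?thesis using ker[OF e K X] module_category.epi_kernel_short_exact[OF mc e K] by blast
    qed
    show "short_exact ?M X f B (cok_map ?M (X, B, f)) (cok_obj ?M (X, B, f))" if m: "monic ?M X f B" for X f B
    proof -
      have XB: "X \<in> Obj ?M" "B \<in> Obj ?M" "f \<in> Arr ?M X B" using m by (simp_all add: monic_def)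
      obtain D p where D: "is_cokernel ?M X f B p D" by (rule module_category.cokernel_exists[OF mc XB])
      show ?thesis by (rule module_category.monic_cokernel_short_exact[OF mc m C.cok_is_cokernel[OF D]])
    qed
    show "\<exists>P p. projective_cover \<Lambda> P p D" if "D \<in> \<XX>" for D using artin_module_category.projective_cover_exists[OF amc O[OF that]] .
    show "P \<in> \<XX>" if "P \<in> prj \<Lambda>" for P using res that unfolding resolving_def by blast
    show "\<exists>s. s \<in> Arr ?M P B \<and> Comp ?M P B D p s = t" if "P \<in> prj \<Lambda>" "epi ?M B p D" "t \<in> Arr ?M P D" for P B p D t
      using artin_module_category.projective_lift[OF amc _ that(2,3)] that(1) unfolding prj_def by blast
  qed (use module_category.epi_kernel_short_exact[OF mc] O in blast)+
qed

theorem theorem4p2: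
  fixes R :: "('k, 'c) ring_scheme" and \<Lambda> :: "('r, 'd) ring_scheme" and \<phi> :: "'k \<Rightarrow> 'r"
    and \<XX> :: "'r fmod set"
  assumes "artin_algebra R \<Lambda> \<phi>"
    and "resolving \<Lambda> \<XX>"
    and "contravariantly_finite \<Lambda> \<XX>"
  shows "(additive_functor (S_cat \<Lambda> \<XX>) (mod_stable_X \<Lambda> \<XX>) (Psi \<Lambda> \<XX>) \<and>
      (\<exists>G. induces_on_factors
            (S_cat \<Lambda> \<XX>) (stable_ideal (S_cat \<Lambda> \<XX>) (scw \<Lambda> \<XX>))
            (mod_stable_X \<Lambda> \<XX>) (stable_ideal (mod_stable_X \<Lambda> \<XX>) (short_exact (mod_stable_X \<Lambda> \<XX>)))
            (Psi \<Lambda> \<XX>) G \<and>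
          equivalence_of_categories
            (stable_cat (S_cat \<Lambda> \<XX>) (scw \<Lambda> \<XX>))
            (stable_cat (mod_stable_X \<Lambda> \<XX>) (short_exact (mod_stable_X \<Lambda> \<XX>))) G)) \<and>
    (\<exists>H. equivalence_of_categories
            (factor_cat (S_cat \<Lambda> \<XX>) (generated_ideal (S_cat \<Lambda> \<XX>) (V_objects \<Lambda> \<XX>)))
            (stable_cat (mod_stable_X \<Lambda> \<XX>) (short_exact (mod_stable_X \<Lambda> \<XX>))) H)"
proof -
  interpret resolving_setting \<Lambda> \<XX> by (rule resolving_imp_setting[OF assms(1,2)])
  show ?thesis
    unfolding stable_cat_def mod_stable_X_def
    using Psi_functor Psi_induces_equivalences by blast
qed

end
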